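(* There are infinitely many virtual knots $K$ such that the eight virtual knots $K,\ -K,\ K^\#,\ K^*,\ -K^\#,\ -K^*,\ K^{\#*},\ -K^{\#*}$ are mutually distinct.
   Context: Virtual knots. $\Sigma$ denotes a closed, connected, oriented surface. A diagram $(\Sigma,D)$ is an oriented closed curve $D$ on $\Sigma$, generically immersed with finitely many transverse double points, each equipped with over/under-information (a crossing). Two diagrams present the same (oriented) virtual knot iff they are related by a finite sequence of: orientation-preserving homeomorphisms of the surface; Reidemeister moves I, II, III on the surface; stabilizations/destabilizations, i.e. 1- or 2-handle surgeries on the surface away from the diagram, changing the genus by $\pm1$ and keeping the surface connected. A virtual knot is an equivalence class of diagrams. Symmetries. For a diagram $D$ on $\Sigma$ of a virtual knot $K$: $-D$ is $D$ with reversed orientation of the curve; $D^\#$ is $D$ with over/under-information changed at every crossing; $D^*$ is the image of $D$ under an orientation-reversing homeomorphism of $\Sigma$. The virtual knots they present are denoted $-K$ (reverse), $K^\#$ (vertical mirror image), and $K^*$ (horizontal mirror image); compositions are written $-K^\#$, $-K^*$, $K^{\#*}=(K^\#)^*$, $-K^{\#*}$. *)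

theory Defs
  imports "HOL-Complex_Analysis.Complex_Analysis"
begin

section \<open>Closed oriented surfaces\<close>

text \<open>The surface is a topological manifold, and an orientation is a maximal oriented atlas: the set
  of all positively oriented charts. Every chart is parametrised by the whole plane, which loses
  nothing, since a point of a surface has arbitrarily small neighbourhoods homeomorphic to the
  plane.\<close>

definition plane_chart :: "'a topology \<Rightarrow> (complex \<Rightarrow> 'a) \<Rightarrow> bool" where
  "plane_chart X e \<longleftrightarrow> embedding_map euclidean X e \<and> openin X (range e)"

text \<open>The transition map from the first chart to the second has local degree one at every point:
  a small positively oriented circle about z is sent to a loop of winding number one about the
  image w of z. By homotopy invariance the choice of the radius r is immaterial.\<close>

definition compatible_charts :: "(complex \<Rightarrow> 'a) \<Rightarrow> (complex \<Rightarrow> 'a) \<Rightarrow> bool" where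
  "compatible_charts e e' \<longleftrightarrow> (\<forall>z w. e z = e' w \<longrightarrow>
     (\<exists>r>0. e ` cball z r \<subseteq> range e' \<and>
            winding_number (inv e' \<circ> e \<circ> circlepath z r) w = 1))"

definition orientation :: "'a topology \<Rightarrow> (complex \<Rightarrow> 'a) set \<Rightarrow> bool" where
  "orientation X C \<longleftrightarrow>
     (\<forall>e\<in>C. plane_chart X e) \<and> (\<Union>e\<in>C. range e) = topspace X \<and>
     (\<forall>e\<in>C. \<forall>e'\<in>C. compatible_charts e e') \<and>
     (\<forall>e. plane_chart X e \<and> (\<forall>e'\<in>C. compatible_charts e e') \<longrightarrow> e \<in> C)"

definition closed_oriented_surface :: "'a topology \<Rightarrow> (complex \<Rightarrow> 'a) set \<Rightarrow> bool" where
  "closed_oriented_surface X C \<longleftrightarrow>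
     compact_space X \<and> connected_space X \<and> Hausdorff_space X \<and> orientation X C"

definition orientation_preserving_homeo ::
  "'a topology \<Rightarrow> (complex \<Rightarrow> 'a) set \<Rightarrow> 'a topology \<Rightarrow> (complex \<Rightarrow> 'a) set \<Rightarrow> ('a \<Rightarrow> 'a) \<Rightarrow> bool" where
  "orientation_preserving_homeo X C Y D f \<longleftrightarrow>
     homeomorphic_map X Y f \<and> (\<forall>e\<in>C. f \<circ> e \<in> D)"

definition orientation_reversing_homeo ::
  "'a topology \<Rightarrow> (complex \<Rightarrow> 'a) set \<Rightarrow> 'a topology \<Rightarrow> (complex \<Rightarrow> 'a) set \<Rightarrow> ('a \<Rightarrow> 'a) \<Rightarrow> bool" where
  "orientation_reversing_homeo X C Y D f \<longleftrightarrow>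
     homeomorphic_map X Y f \<and> (\<forall>e\<in>C. f \<circ> e \<circ> cnj \<in> D)"


section \<open>Diagrams\<close>

text \<open>The oriented closed curve is given by a parametrisation of period 1, and the over/under
  information by the set \<open>over\<close> of those parameters at which the curve runs through a crossing
  on the over-strand. Diagrams that differ by an orientation-preserving change of parameter are
  identified below.\<close>

record 'a diagram =
  surface :: "'a topology"
  charts :: "(complex \<Rightarrow> 'a) set"
  curve :: "real \<Rightarrow> 'a"
  over :: "real set"

definition double_params :: "(real \<Rightarrow> 'a) \<Rightarrow> real \<Rightarrow> real \<Rightarrow> bool" where
  "double_params c s t \<longleftrightarrow> c s = c t \<and> s - t \<notin> \<int>"

text \<open>Two branches cross transversely if some chart turns them into the two coordinate axes. Since
  the category is topological, the chart can be chosen to match the parametrisations as well.\<close>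

definition transverse_at :: "(complex \<Rightarrow> 'a) set \<Rightarrow> (real \<Rightarrow> 'a) \<Rightarrow> real \<Rightarrow> real \<Rightarrow> bool" where
  "transverse_at C c s t \<longleftrightarrow>
     (\<exists>e\<in>C. \<exists>\<sigma>\<in>{1, -1}. \<exists>\<epsilon>>0. \<forall>x. \<bar>x\<bar> < \<epsilon> \<longrightarrow>
        c (s + x) = e (Complex x 0) \<and> c (t + x) = e (Complex 0 (\<sigma> * x)))"

definition closed_curve :: "'a topology \<Rightarrow> (real \<Rightarrow> 'a) \<Rightarrow> bool" where
  "closed_curve X c \<longleftrightarrow> continuous_map euclideanreal X c \<and> (\<forall>t. c (t + 1) = c t)"

text \<open>Immersed means locally injective, the notion appropriate to the topological category.\<close>

definition generic_immersion :: "(complex \<Rightarrow> 'a) set \<Rightarrow> (real \<Rightarrow> 'a) \<Rightarrow> bool" where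
  "generic_immersion C c \<longleftrightarrow>
     (\<forall>t. \<exists>\<epsilon>>0. inj_on c {t - \<epsilon><..<t + \<epsilon>}) \<and>
     finite {c s |s. \<exists>t. double_params c s t} \<and>
     (\<forall>r s t. c r = c s \<and> c s = c t \<longrightarrow> r - s \<in> \<int> \<or> s - t \<in> \<int> \<or> r - t \<in> \<int>) \<and>
     (\<forall>s t. double_params c s t \<longrightarrow> transverse_at C c s t)"

definition crossing_information :: "(real \<Rightarrow> 'a) \<Rightarrow> real set \<Rightarrow> bool" where
  "crossing_information c V \<longleftrightarrow>
     V \<subseteq> {s. \<exists>t. double_params c s t} \<and> (\<forall>t. t + 1 \<in> V \<longleftrightarrow> t \<in> V) \<and>
     (\<forall>s t. double_params c s t \<longrightarrow> (s \<in> V \<longleftrightarrow> t \<notin> V))"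

definition diagrams :: "'a diagram set" where
  "diagrams = {D. closed_oriented_surface (surface D) (charts D) \<and>
     closed_curve (surface D) (curve D) \<and> generic_immersion (charts D) (curve D) \<and>
     crossing_information (curve D) (over D)}"


section \<open>Moves\<close>

definition reparametrization :: "'a diagram \<Rightarrow> 'a diagram \<Rightarrow> bool" where
  "reparametrization D E \<longleftrightarrow> surface E = surface D \<and> charts E = charts D \<and>
     (\<exists>h. continuous_on UNIV h \<and> strict_mono h \<and> (\<forall>t::real. h (t + 1) = h t + 1) \<and>
          curve E = curve D \<circ> h \<and> over E = h -` over D)"

definition surface_homeo :: "'a diagram \<Rightarrow> 'a diagram \<Rightarrow> bool" where
  "surface_homeo D E \<longleftrightarrow>
     (\<exists>f. orientation_preserving_homeo (surface D) (charts D) (surface E) (charts E) f \<and>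
          curve E = f \<circ> curve D \<and> over E = over D)"

text \<open>A Reidemeister move replaces one tangle by another inside the image of the square
  \<open>[-1,1]\<times>[-1,1]\<close> under a positively oriented chart. The tangles are lists of paths; strand \<open>i\<close> of
  the tangle occupies the parameters \<open>a i + b i * u\<close> of the curve, for \<open>u\<close> in \<open>[0,1]\<close>, and is
  traversed backwards if \<open>b i\<close> is negative. The injective function \<open>h\<close> assigns heights to the strands;
  it decides which of two different strands is the upper one where they cross. At a
  self-crossing of a strand the over/under information is arbitrary.\<close>

definition unit_square :: "complex set" where
  "unit_square = cbox (Complex (-1) (-1)) (Complex 1 1)"

definition shows_tangle ::
  "(real \<Rightarrow> complex) list \<Rightarrow> (complex \<Rightarrow> 'a) \<Rightarrow> (nat \<Rightarrow> real) \<Rightarrow> (nat \<Rightarrow> real) \<Rightarrow> (nat \<Rightarrow> nat)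
     \<Rightarrow> 'a diagram \<Rightarrow> bool" where
  "shows_tangle ps e a b h D \<longleftrightarrow>
     (\<forall>i<length ps. \<forall>u\<in>{0..1}. curve D (a i + b i * u) = e ((ps ! i) u)) \<and>
     (\<forall>i<length ps. \<forall>j<length ps. \<forall>u\<in>{0..1}. \<forall>v\<in>{0..1}.
        i \<noteq> j \<and> (ps ! i) u = (ps ! j) v \<longrightarrow> (a i + b i * u \<in> over D \<longleftrightarrow> h j < h i)) \<and>
     (\<forall>t. (\<forall>i<length ps. \<forall>u\<in>{0..1}. t - (a i + b i * u) \<notin> \<int>)
        \<longrightarrow> curve D t \<notin> e ` unit_square)"

definition tangle_replacement ::
  "(real \<Rightarrow> complex) list \<Rightarrow> (real \<Rightarrow> complex) list \<Rightarrow> 'a diagram \<Rightarrow> 'a diagram \<Rightarrow> bool" where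
  "tangle_replacement ps qs D E \<longleftrightarrow> surface E = surface D \<and> charts E = charts D \<and>
     length qs = length ps \<and>
     (\<exists>e\<in>charts D. \<exists>a b h. (\<forall>i<length ps. b i \<noteq> 0) \<and> inj_on h {..<length ps} \<and>
        shows_tangle ps e a b h D \<and> shows_tangle qs e a b h E \<and>
        (\<forall>t. (\<forall>i<length ps. \<forall>u\<in>{0..1}. t - (a i + b i * u) \<notin> \<int>)
           \<longrightarrow> curve E t = curve D t \<and> (t \<in> over E \<longleftrightarrow> t \<in> over D)))"

text \<open>The mirror images of the following pictures need no separate treatment, although only
  positively oriented charts are used: in the first move reflection amounts to reversing the
  strand, and the other pictures are symmetric about the vertical axis.\<close>

definition reidemeister1 :: "'a diagram \<Rightarrow> 'a diagram \<Rightarrow> bool" where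
  "reidemeister1 = tangle_replacement
     [linepath (Complex (-1) 0) (Complex 1 0)]
     [(linepath (Complex (-1) 0) (Complex (1/2) (1/2)) +++
       linepath (Complex (1/2) (1/2)) (Complex (-1/2) (1/2))) +++
       linepath (Complex (-1/2) (1/2)) (Complex 1 0)]"

definition reidemeister2 :: "'a diagram \<Rightarrow> 'a diagram \<Rightarrow> bool" where
  "reidemeister2 = tangle_replacement
     [linepath (Complex (-1) 0) (Complex 1 0),
      linepath (Complex (-1) (1/2)) (Complex 1 (1/2))]
     [linepath (Complex (-1) 0) (Complex 1 0),
      linepath (Complex (-1) (1/2)) (Complex 0 (-1/2)) +++
      linepath (Complex 0 (-1/2)) (Complex 1 (1/2))]"

definition reidemeister3 :: "'a diagram \<Rightarrow> 'a diagram \<Rightarrow> bool" where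
  "reidemeister3 = tangle_replacement
     [linepath (Complex (-1) (-1)) (Complex 1 1),
      linepath (Complex (-1) 1) (Complex 1 (-1)),
      linepath (Complex (-1) 0) (Complex 0 (1/2)) +++
      linepath (Complex 0 (1/2)) (Complex 1 0)]
     [linepath (Complex (-1) (-1)) (Complex 1 1),
      linepath (Complex (-1) 1) (Complex 1 (-1)),
      linepath (Complex (-1) 0) (Complex 0 (-1/2)) +++
      linepath (Complex 0 (-1/2)) (Complex 1 0)]"

text \<open>Surgery along a 1-handle: the interiors of two disjoint closed discs are removed and a closed
  annulus is glued in. The result is again a closed connected oriented surface, hence of genus one
  more. The inverse is surgery along a 2-handle whose result is still connected.\<close>

definition stabilization :: "'a diagram \<Rightarrow> 'a diagram \<Rightarrow> bool" where
  "stabilization D E \<longleftrightarrow>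
     (\<exists>\<delta>\<^sub>1 \<delta>\<^sub>2 \<alpha> f.
        embedding_map (top_of_set (cball (0::complex) 1)) (surface D) \<delta>\<^sub>1 \<and>
        embedding_map (top_of_set (cball (0::complex) 1)) (surface D) \<delta>\<^sub>2 \<and>
        embedding_map (top_of_set (cball (0::complex) 2 - ball 0 1)) (surface E) \<alpha> \<and>
        \<delta>\<^sub>1 ` cball 0 1 \<inter> \<delta>\<^sub>2 ` cball 0 1 = {} \<and>
        range (curve D) \<inter> (\<delta>\<^sub>1 ` cball 0 1 \<union> \<delta>\<^sub>2 ` cball 0 1) = {} \<and>
        range (curve E) \<inter> \<alpha> ` (cball 0 2 - ball 0 1) = {} \<and>
        homeomorphic_map
          (subtopology (surface D) (topspace (surface D) - (\<delta>\<^sub>1 ` ball 0 1 \<union> \<delta>\<^sub>2 ` ball 0 1)))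
          (subtopology (surface E) (topspace (surface E) - \<alpha> ` (ball 0 2 - cball 0 1))) f \<and>
        (\<forall>e\<in>charts D. range e \<inter> (\<delta>\<^sub>1 ` cball 0 1 \<union> \<delta>\<^sub>2 ` cball 0 1) = {} \<longrightarrow> f \<circ> e \<in> charts E) \<and>
        curve E = f \<circ> curve D \<and> over E = over D)"

definition move :: "'a diagram \<Rightarrow> 'a diagram \<Rightarrow> bool" where
  "move D E \<longleftrightarrow> D \<in> diagrams \<and> E \<in> diagrams \<and>
     (reparametrization D E \<or> surface_homeo D E \<or>
      reidemeister1 D E \<or> reidemeister2 D E \<or> reidemeister3 D E \<or> stabilization D E)"


section \<open>Virtual knots and their symmetries\<close>

definition virtual_equivalence :: "('a diagram \<times> 'a diagram) set" where
  "virtual_equivalence = {(D, E). D \<in> diagrams \<and> E \<in> diagrams \<and> equivclp move D E}"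

lemma equiv_virtual_equivalence: "equiv diagrams virtual_equivalence"
  unfolding virtual_equivalence_def
  by (intro equivI refl_onI symI transI)
     (auto intro: equivclp_sym equivclp_trans equivclp_refl)

text \<open>Points are taken from a fixed type, so that virtual knots form a set. Only the cardinality
  of this type matters: the topology of a surface is not related to that of the ambient
  type, and a closed surface has exactly as many points as \<open>complex \<times> complex\<close>.\<close>

type_synonym point = "complex \<times> complex"

definition virtual_knots :: "point diagram set set" where
  "virtual_knots = diagrams // virtual_equivalence"

definition reverse_diagram :: "'a diagram \<Rightarrow> 'a diagram" where
  "reverse_diagram D = D\<lparr>curve := (\<lambda>t. curve D (- t)), over := {t. - t \<in> over D}\<rparr>"

definition switch_diagram :: "'a diagram \<Rightarrow> 'a diagram" where
  "switch_diagram D = D\<lparr>over := {s. \<exists>t. double_params (curve D) s t} - over D\<rparr>"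

definition mirror_diagram :: "'a diagram \<Rightarrow> 'a diagram \<Rightarrow> bool" where
  "mirror_diagram D E \<longleftrightarrow> surface E = surface D \<and> charts E = charts D \<and>
     (\<exists>f. orientation_reversing_homeo (surface D) (charts D) (surface D) (charts D) f \<and>
          curve E = f \<circ> curve D \<and> over E = over D)"

text \<open>The virtual knot presented by the transforms of the diagrams of K, as a class of diagrams. For
  the horizontal mirror image, the transform of a diagram depends on the choice of an
  orientation-reversing homeomorphism of its surface, but its class does not.\<close>

definition reverse_knot :: "'a diagram set \<Rightarrow> 'a diagram set" where
  "reverse_knot K = virtual_equivalence `` (reverse_diagram ` K)"

definition vertical_mirror :: "'a diagram set \<Rightarrow> 'a diagram set" where
  "vertical_mirror K = virtual_equivalence `` (switch_diagram ` K)"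

definition horizontal_mirror :: "'a diagram set \<Rightarrow> 'a diagram set" where
  "horizontal_mirror K = virtual_equivalence `` {E. \<exists>D\<in>K. mirror_diagram D E}"

end

theory Submission
  imports Defs
begin

text \<open>The arc of a crossing is the part of the curve from the over- to the under-passage, and its index
  is the signed number of crossings of this arc with the rest of the curve. The signed number of
  crossings of any given nonzero index is an invariant of the virtual knot, and so is the signed
  number of pairs of crossings of indices m and n (nonzero and distinct) such that the arc of the
  first lies inside the arc of the second, provided that disjoint and covering pairs of arcs are
  counted with suitable weights. Reversal and the two mirror images act on these invariants by
  permuting and negating the indices.

  It remains to realise, on some surface, Gauss diagrams whose invariants are moved by every
  symmetry. Take a torus with a small hole about the lattice point and double it along the boundary
  of the hole. The knot runs from the hole to the hole on one sheet, along a broken line with two long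
  edges, and back along the same line on the other sheet. Its crossings are the intersections of the
  two edges modulo the lattice, on both sheets; if the first edge is the upper strand at all of them
  but one, no symmetry is left.\<close>
section \<open>Invariants of Gauss diagrams\<close>

text \<open>Index writhes alone cannot separate the vertical from the horizontal mirror image, since
  both send the writhe of index n to minus that of index - n. Nested pairs are ordered, and this
  breaks the tie: reversal and the vertical mirror image exchange inner and outer arc and turn the
  indices (m, n) into (- n, - m), while the horizontal mirror image only negates them. In the
  examples one of four pairs of indices that these maps permute has nesting number 0 and the other
  three have - 1. The only nontrivial symmetry that fixes all four is reversal combined with the
  vertical mirror image, and it negates the index writhes, which are 1 at N and - N. Surfaces are
  only topological, so there are no tangent vectors: a crossing is seen through straight rays in a
  chart, and local degrees show that its sign does not depend on the chart. Doubling makes the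
  writhes of the two sheets cancel except where the altered crossing interferes, and the exchange of
  the sheets is an explicit orientation-reversing homeomorphism, as the horizontal mirror image
  requires.\<close>

record 'c gauss =
  chords :: "'c set"
  sign :: "'c \<Rightarrow> int"
  over_in :: "'c \<Rightarrow> 'c \<Rightarrow> bool"
  under_in :: "'c \<Rightarrow> 'c \<Rightarrow> bool"

text \<open>A chord y with exactly one passage on the arc of x is an intersection of this arc,
  closed up at x, with the rest of the curve. Counted in the order arc, rest, its sign is
  \<open>sign G y\<close> if the over-passage is the one inside and the opposite otherwise. Chords
  with both passages inside, or none, drop out.\<close>

definition chord_index :: "'c gauss \<Rightarrow> 'c \<Rightarrow> int" where
  "chord_index G x = (\<Sum>y\<in>chords G - {x}. sign G y * (of_bool (over_in G x y) - of_bool (under_in G x y)))"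

definition index_writhe :: "'c gauss \<Rightarrow> int \<Rightarrow> int" where
  "index_writhe G n = (\<Sum>x\<in>chords G. if chord_index G x = n then sign G x else 0)"

text \<open>The first case is a pair of nested arcs. The weights of disjoint arcs and of arcs that cover the
  curve are those that make the sum over all pairs invariant under the third Reidemeister move.\<close>

definition pair_weight :: "(int \<Rightarrow> int \<Rightarrow> int) \<Rightarrow> int \<Rightarrow> int \<Rightarrow> bool \<Rightarrow> bool \<Rightarrow> bool \<Rightarrow> bool \<Rightarrow> int" where
  "pair_weight S m n i j k l =
     (if \<not> i \<and> \<not> j \<and> k \<and> l then S m n
      else if \<not> i \<and> \<not> j \<and> \<not> k \<and> \<not> l then S m (m + n)
      else if i \<and> j \<and> k \<and> l then S (m + n) n else 0)"

text \<open>Complementing both arcs makes the inner arc the outer one and exchanges disjoint with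
  covering pairs. The weights \<open>S m (m + n)\<close> and \<open>S (m + n) n\<close> of these two
  cases are exchanged as well once the arguments of S are swapped and negated, so the weights
  dictated by the third move are compatible with the symmetries.\<close>

lemma pair_weight_flip:
  "pair_weight S (- m) (- n) (\<not> i) (\<not> j) (\<not> k) (\<not> l) = pair_weight (\<lambda>m n. S (- n) (- m)) n m k l i j"
  by (cases i; cases j; cases k; cases l; simp add: pair_weight_def add.commute)

lemma pair_weight_negate:
  "pair_weight S (- m) (- n) i j k l = pair_weight (\<lambda>m n. S (- m) (- n)) m n i j k l"
  by (auto simp: pair_weight_def)

lemma pair_weight_swap: "pair_weight S m n j i l k = pair_weight S m n i j k l"
  by (cases i; cases j; cases k; cases l; simp add: pair_weight_def)

definition pair_term :: "(int \<Rightarrow> int \<Rightarrow> int) \<Rightarrow> 'c gauss \<Rightarrow> 'c \<Rightarrow> 'c \<Rightarrow> int" where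
  "pair_term S G x y = sign G x * sign G y *
     pair_weight S (chord_index G x) (chord_index G y)
       (over_in G x y) (under_in G x y) (over_in G y x) (under_in G y x)"

definition nesting :: "(int \<Rightarrow> int \<Rightarrow> int) \<Rightarrow> 'c gauss \<Rightarrow> int" where
  "nesting S G = (\<Sum>x\<in>chords G. \<Sum>y\<in>chords G - {x}. pair_term S G x y)"

text \<open>Crossings created by the first move have index 0, and the pair created by the second has equal
  indices.\<close>

definition reduced :: "(int \<Rightarrow> int \<Rightarrow> int) \<Rightarrow> bool" where
  "reduced S \<longleftrightarrow> (\<forall>n. S 0 n = 0 \<and> S n 0 = 0 \<and> S n n = 0)"

text \<open>The index 0 is left out of the writhes because the first move changes the number of
  crossings of index 0; restricting S to \<open>reduced\<close> weights does the same for
  pairs.\<close>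

definition gauss_equal :: "'c gauss \<Rightarrow> 'd gauss \<Rightarrow> bool" where
  "gauss_equal G H \<longleftrightarrow> (\<forall>n. n \<noteq> 0 \<longrightarrow> index_writhe G n = index_writhe H n) \<and>
     (\<forall>S. reduced S \<longrightarrow> nesting S G = nesting S H)"

lemma gauss_equal_refl: "gauss_equal G G"
  by (simp add: gauss_equal_def)

lemma gauss_equal_sym: "gauss_equal G H \<Longrightarrow> gauss_equal H G"
  by (simp add: gauss_equal_def)

lemma gauss_equal_trans: "gauss_equal G H \<Longrightarrow> gauss_equal H K \<Longrightarrow> gauss_equal G K"
  by (simp add: gauss_equal_def)

section \<open>Isomorphisms, symmetries and Reidemeister moves of abstract Gauss diagrams\<close>

definition gauss_iso :: "('c \<Rightarrow> 'd) \<Rightarrow> 'c gauss \<Rightarrow> 'd gauss \<Rightarrow> bool" where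
  "gauss_iso f G H \<longleftrightarrow> bij_betw f (chords G) (chords H) \<and>
     (\<forall>x\<in>chords G. sign H (f x) = sign G x) \<and>
     (\<forall>x\<in>chords G. \<forall>y\<in>chords G. x \<noteq> y \<longrightarrow>
        over_in H (f x) (f y) = over_in G x y \<and> under_in H (f x) (f y) = under_in G x y)"

lemma sum_bij_minus:
  assumes "bij_betw f X Y" "x \<in> X"
  shows "(\<Sum>y\<in>Y - {f x}. g y) = (\<Sum>y\<in>X - {x}. g (f y))"
proof (rule sum.reindex_cong)
  show "inj_on f (X - {x})" using assms by (auto simp: bij_betw_def inj_on_def)
  show "Y - {f x} = f ` (X - {x})" using assms by (auto simp: bij_betw_def inj_on_def)
qed simp

lemma gauss_iso_index:
  assumes "gauss_iso f G H" "x \<in> chords G"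
  shows "chord_index H (f x) = chord_index G x"
proof -
  have b: "bij_betw f (chords G) (chords H)" using assms by (simp add: gauss_iso_def)
  show ?thesis unfolding chord_index_def sum_bij_minus[OF b assms(2)]
    using assms by (intro sum.cong) (auto simp: gauss_iso_def)
qed

lemma gauss_iso_index_writhe:
  assumes "gauss_iso f G H"
  shows "index_writhe H n = index_writhe G n"
proof -
  have b: "bij_betw f (chords G) (chords H)" using assms by (simp add: gauss_iso_def)
  show ?thesis unfolding index_writhe_def sum.reindex_bij_betw[OF b, symmetric]
    using assms gauss_iso_index[OF assms] by (intro sum.cong) (auto simp: gauss_iso_def)
qed

lemma gauss_iso_nesting:
  assumes "gauss_iso f G H"
  shows "nesting S H = nesting S G"
proof -
  have b: "bij_betw f (chords G) (chords H)" using assms by (simp add: gauss_iso_def)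
  have "pair_term S H (f x) (f y) = pair_term S G x y" if "x \<in> chords G" "y \<in> chords G - {x}" for x y
    using that assms gauss_iso_index[OF assms] by (auto simp: gauss_iso_def pair_term_def)
  then show ?thesis unfolding nesting_def sum.reindex_bij_betw[OF b, symmetric]
    by (intro sum.cong refl) (simp add: sum_bij_minus[OF b])
qed

lemma gauss_iso_equal: "gauss_iso f G H \<Longrightarrow> gauss_equal G H"
  by (simp add: gauss_equal_def gauss_iso_index_writhe gauss_iso_nesting)

text \<open>Serves the two symmetries that replace every arc by its complement. For \<delta> = 1
  (reversal) signs and passages persist; for \<delta> = - 1 (all crossings switched) signs are
  negated and the over- and under-passages of the other chord are exchanged too. Either way the
  index is negated, and no sign appears in the nesting sum because crossing signs enter it in
  pairs.\<close>

lemma gauss_flip: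
  assumes fin: "finite (chords G)" and ch: "chords H = chords G" and \<delta>: "\<delta> \<in> {1, -1}"
    and sg: "\<And>x. x \<in> chords G \<Longrightarrow> sign H x = \<delta> * sign G x"
    and arcs: "\<And>x y. x \<in> chords G \<Longrightarrow> y \<in> chords G \<Longrightarrow> x \<noteq> y \<Longrightarrow>
       (if \<delta> = 1 then over_in H x y = (\<not> over_in G x y) \<and> under_in H x y = (\<not> under_in G x y)
        else over_in H x y = (\<not> under_in G x y) \<and> under_in H x y = (\<not> over_in G x y))"
  shows "index_writhe H n = \<delta> * index_writhe G (- n)"
    and "nesting S H = nesting (\<lambda>m n. S (- n) (- m)) G"
proof -
  have ind: "chord_index H x = - chord_index G x" if "x \<in> chords G" for x
    unfolding chord_index_def ch sum_negf[symmetric]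
    using that \<delta> by (intro sum.cong refl) (auto simp: sg dest: arcs split: if_splits)
  show "index_writhe H n = \<delta> * index_writhe G (- n)"
    unfolding index_writhe_def ch sum_distrib_left
    by (intro sum.cong refl) (auto simp: ind sg)
  have "pair_term S H x y = pair_term (\<lambda>m n. S (- n) (- m)) G y x"
    if xy: "x \<in> chords G" "y \<in> chords G" "x \<noteq> y" for x y
  proof (cases "\<delta> = 1")
    case True
    then show ?thesis using xy arcs[OF xy] arcs[OF xy(2,1)]
      by (simp add: pair_term_def ind sg pair_weight_flip mult.commute)
  next
    case False
    then show ?thesis using xy arcs[OF xy] arcs[OF xy(2,1)] \<delta>
      by (simp add: pair_term_def ind sg pair_weight_flip mult.commute) (simp add: pair_weight_swap)
  qed
  then have "nesting S H = (\<Sum>x\<in>chords G. \<Sum>y\<in>chords G - {x}. pair_term (\<lambda>m n. S (- n) (- m)) G y x)"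
    unfolding nesting_def ch by (intro sum.cong refl) auto
  \<comment> \<open>The flip exchanges inner and outer arc, so the order of summation has to be
    exchanged; zero terms on the diagonal turn the index set into a product.\<close>
  also have "\<dots> = (\<Sum>x\<in>chords G. \<Sum>y\<in>chords G. if x = y then 0 else pair_term (\<lambda>m n. S (- n) (- m)) G y x)"
    using fin by (intro sum.cong refl sum.mono_neutral_cong_left) auto
  also have "\<dots> = (\<Sum>y\<in>chords G. \<Sum>x\<in>chords G. if x = y then 0 else pair_term (\<lambda>m n. S (- n) (- m)) G y x)"
    by (rule sum.swap)
  also have "\<dots> = nesting (\<lambda>m n. S (- n) (- m)) G"
    unfolding nesting_def using fin by (intro sum.cong refl sum.mono_neutral_cong_right) auto
  finally show "nesting S H = nesting (\<lambda>m n. S (- n) (- m)) G" .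
qed

lemma gauss_negate:
  assumes ch: "chords H = chords G"
    and sg: "\<And>x. x \<in> chords G \<Longrightarrow> sign H x = - sign G x"
    and arcs: "\<And>x y. x \<in> chords G \<Longrightarrow> y \<in> chords G \<Longrightarrow> x \<noteq> y \<Longrightarrow>
        over_in H x y = over_in G x y \<and> under_in H x y = under_in G x y"
  shows "index_writhe H n = - index_writhe G (- n)"
    and "nesting S H = nesting (\<lambda>m n. S (- m) (- n)) G"
proof -
  have ind: "chord_index H x = - chord_index G x" if "x \<in> chords G" for x
    unfolding chord_index_def ch sum_negf[symmetric]
    using that by (intro sum.cong refl) (auto simp: sg arcs)
  show "index_writhe H n = - index_writhe G (- n)"
    unfolding index_writhe_def ch sum_negf[symmetric]
    by (intro sum.cong refl) (auto simp: ind sg)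
  show "nesting S H = nesting (\<lambda>m n. S (- m) (- n)) G"
    unfolding nesting_def ch
  proof (intro sum.cong refl)
    fix x y assume "x \<in> chords G" "y \<in> chords G - {x}"
    then show "pair_term S H x y = pair_term (\<lambda>m n. S (- m) (- n)) G x y"
      using arcs[of x y] arcs[of y x] by (auto simp: pair_term_def pair_weight_negate ind sg)
  qed
qed

text \<open>The two passages of the kink q are adjacent. Every other arc therefore contains both or
  neither of them, and the arc of q contains all other passages or none, as k tells.\<close>

lemma gauss_R1:
  assumes fin: "finite (chords G)" and q: "q \<notin> chords G" and ch: "chords H = insert q (chords G)"
    and sg: "\<And>x. x \<in> chords G \<Longrightarrow> sign H x = sign G x"
    and arcs: "\<And>x y. x \<in> chords G \<Longrightarrow> y \<in> chords G \<Longrightarrow> x \<noteq> y \<Longrightarrow>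
        over_in H x y = over_in G x y \<and> under_in H x y = under_in G x y"
    and q1: "\<And>x. x \<in> chords G \<Longrightarrow> over_in H x q = under_in H x q"
    and q2: "\<And>x. x \<in> chords G \<Longrightarrow> over_in H q x = k \<and> under_in H q x = k"
  shows "gauss_equal G H"
proof -
  have ind: "chord_index H x = chord_index G x" if "x \<in> chords G" for x
  proof -
    have "chords H - {x} = insert q (chords G - {x})" using that q ch by auto
    then have "chord_index H x = (\<Sum>y\<in>chords G - {x}.
        sign H y * (of_bool (over_in H x y) - of_bool (under_in H x y)))"
      unfolding chord_index_def using fin q q1[OF that] by simp
    also have "\<dots> = chord_index G x" unfolding chord_index_def
      using that by (intro sum.cong refl) (auto simp: sg arcs)
    finally show ?thesis .
  qed
  have "chords H - {q} = chords G" using q ch by auto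
  then have indq: "chord_index H q = 0" unfolding chord_index_def by (simp add: q2)
  have "index_writhe H n = index_writhe G n" if "n \<noteq> 0" for n
    unfolding index_writhe_def ch using fin q that by (simp add: indq ind sg cong: if_cong)
  moreover have "nesting S H = nesting S G" if S: "reduced S" for S
  proof -
    \<comment> \<open>Since q has index 0, every weight that occurs is a value of S with an argument
      0 or on the diagonal; the diagonal values come from disjoint and covering pairs.\<close>
    have 0: "pair_term S H x q = 0" "pair_term S H q x = 0" if "x \<in> chords G" for x
      using S that q1[OF that] q2[OF that]
      by (auto simp: pair_term_def pair_weight_def indq ind reduced_def)
    have 1: "pair_term S H x y = pair_term S G x y" if "x \<in> chords G" "y \<in> chords G - {x}" for x y
      using that by (auto simp: pair_term_def ind sg arcs)
    have "(\<Sum>y\<in>chords H - {x}. pair_term S H x y) = (\<Sum>y\<in>chords G - {x}. pair_term S G x y)"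
      if "x \<in> chords G" for x
    proof -
      have "chords H - {x} = insert q (chords G - {x})" using that q ch by auto
      then show ?thesis using fin q that by (simp add: 0 1)
    qed
    then show ?thesis unfolding nesting_def ch using fin q by (simp add: 0 ch)
  qed
  ultimately show ?thesis by (simp add: gauss_equal_def)
qed

text \<open>The chords q and r of the bigon look the same from every other chord and have opposite
  signs, so their contributions cancel. In the first two patterns of \<open>qr\<close> the strands
  run in the same direction and neither arc contains the other; in the last two they run in opposite
  directions and one arc is nested in the other.\<close>

lemma gauss_R2:
  assumes fin: "finite (chords G)" and q: "q \<notin> chords G" "r \<notin> chords G" "q \<noteq> r"
    and ch: "chords H = insert q (insert r (chords G))"
    and sg: "\<And>x. x \<in> chords G \<Longrightarrow> sign H x = sign G x" and sqr: "sign H r = - sign H q"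
    and arcs: "\<And>x y. x \<in> chords G \<Longrightarrow> y \<in> chords G \<Longrightarrow> x \<noteq> y \<Longrightarrow>
        over_in H x y = over_in G x y \<and> under_in H x y = under_in G x y"
    and q1: "\<And>x. x \<in> chords G \<Longrightarrow> over_in H x q = over_in H x r \<and> under_in H x q = under_in H x r"
    and q2: "\<And>x. x \<in> chords G \<Longrightarrow> over_in H q x = over_in H r x \<and> under_in H q x = under_in H r x"
    and qr: "(over_in H q r, under_in H q r, over_in H r q, under_in H r q) \<in>
       {(True, False, False, True), (False, True, True, False),
        (False, False, True, True), (True, True, False, False)}"
  shows "gauss_equal G H"
proof -
  have ind: "chord_index H x = chord_index G x" if "x \<in> chords G" for x
  proof -
    have "chords H - {x} = insert q (insert r (chords G - {x}))" using that q ch by auto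
    then have "chord_index H x = (\<Sum>y\<in>chords G - {x}.
        sign H y * (of_bool (over_in H x y) - of_bool (under_in H x y)))"
      unfolding chord_index_def using fin q that q1[OF that] by (simp add: sqr)
    also have "\<dots> = chord_index G x" unfolding chord_index_def
      using that by (intro sum.cong refl) (auto simp: sg arcs)
    finally show ?thesis .
  qed
  define k where "k = (\<Sum>y\<in>chords G. sign H y * (of_bool (over_in H q y) - of_bool (under_in H q y)))"
  have "chords H - {q} = insert r (chords G)" "chords H - {r} = insert q (chords G)" using q ch by auto
  moreover have "k = (\<Sum>y\<in>chords G. sign H y * (of_bool (over_in H r y) - of_bool (under_in H r y)))"
    unfolding k_def by (intro sum.cong refl) (simp add: q2)
  \<comment> \<open>The chords q and r meet each other's arcs with opposite incidence and have
    opposite signs, so each contributes the same amount to the index of the other.\<close>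
  moreover have "(of_bool (over_in H q r) - of_bool (under_in H q r) :: int) =
      - (of_bool (over_in H r q) - of_bool (under_in H r q))" using qr by auto
  ultimately have indqr: "chord_index H r = chord_index H q"
    unfolding chord_index_def using fin q by (simp add: sqr k_def[symmetric])
  have "index_writhe H n = index_writhe G n" for n
    unfolding index_writhe_def ch using fin q by (simp add: indqr ind sg sqr cong: if_cong)
  moreover have "nesting S H = nesting S G" if S: "reduced S" for S
  proof -
    have 0: "pair_term S H q r = 0" "pair_term S H r q = 0"
      using S qr by (auto simp: pair_term_def pair_weight_def indqr reduced_def)
    have 2: "pair_term S H r x = - pair_term S H q x" "pair_term S H x r = - pair_term S H x q"
      if "x \<in> chords G" for x
      using q1[OF that] q2[OF that] by (auto simp: pair_term_def indqr sqr)
    have 1: "pair_term S H x y = pair_term S G x y" if "x \<in> chords G" "y \<in> chords G - {x}" for x y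
      using that by (auto simp: pair_term_def ind sg arcs)
    have "(\<Sum>y\<in>chords H - {x}. pair_term S H x y) = (\<Sum>y\<in>chords G - {x}. pair_term S G x y)"
      if "x \<in> chords G" for x
    proof -
      have "chords H - {x} = insert q (insert r (chords G - {x}))" using that q ch by auto
      then show ?thesis using fin q that by (simp add: 1 2)
    qed
    moreover have "chords H - {q} = insert r (chords G)" "chords H - {r} = insert q (chords G)"
      using q ch by auto
    ultimately show ?thesis unfolding nesting_def using fin q
      by (simp add: 0 2 ch sum_negf)
  qed
  ultimately show ?thesis by (simp add: gauss_equal_def)
qed

text \<open>For the top, middle and bottom strands T, M, B of a third move, a is the crossing of T
  and M, b that of T and B, c that of M and B. The flag \<kappa> says that the strands follow each
  other in the cyclic order T, M, B. The other flags give the order of the two crossings on each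
  strand: a before b on T, a before c on M, b before c on B.\<close>

definition triangle :: "'c gauss \<Rightarrow> 'c \<Rightarrow> 'c \<Rightarrow> 'c \<Rightarrow> bool \<Rightarrow> bool \<Rightarrow> bool \<Rightarrow> bool \<Rightarrow> bool" where
  "triangle G a b c \<kappa> tT tM tB \<longleftrightarrow>
     over_in G a b = tT \<and> under_in G a b = (\<not> \<kappa>) \<and> over_in G b a = (\<not> tT) \<and> under_in G b a = \<kappa> \<and>
     over_in G a c = (\<not> tM) \<and> under_in G a c = (\<not> \<kappa>) \<and> over_in G c a = (\<not> \<kappa>) \<and> under_in G c a = (\<not> tM) \<and>
     over_in G b c = \<kappa> \<and> under_in G b c = (\<not> tB) \<and> over_in G c b = (\<not> \<kappa>) \<and> under_in G c b = tB"

text \<open>The move reverses the order of the two crossings on each of the three strands and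
  changes nothing else. By \<open>add\<close>, the arc of b is composed of those of a and c as far
  as other chords can see; together with a finite check inside the triangle this makes the index of
  b the sum of the indices of a and c, before and after the move.\<close>

lemma gauss_R3_aux:
  assumes fin: "finite Y" and abc: "a \<notin> Y" "b \<notin> Y" "c \<notin> Y" "a \<noteq> b" "a \<noteq> c" "b \<noteq> c"
    and ch: "chords G = insert a (insert b (insert c Y))" "chords H = chords G"
    and sg: "\<And>x. x \<in> chords G \<Longrightarrow> sign H x = sign G x"
    and arcs: "\<And>x y. x \<in> chords G \<Longrightarrow> y \<in> chords G \<Longrightarrow> x \<noteq> y \<Longrightarrow> x \<in> Y \<or> y \<in> Y \<Longrightarrow>
        over_in H x y = over_in G x y \<and> under_in H x y = under_in G x y"
    and TG: "triangle G a b c \<kappa> tT tM tB" and TH: "triangle H a b c \<kappa> (\<not> tT) (\<not> tM) (\<not> tB)"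
    and s: "sign G a \<in> {1, -1}" "sign G b \<in> {1, -1}" "sign G c \<in> {1, -1}"
    and eab: "sign G a = sign G b \<longleftrightarrow> tM = tB" and eac: "sign G a = sign G c \<longleftrightarrow> tT = tB"
    and add: "\<And>y. y \<in> Y \<Longrightarrow>
       (of_bool (over_in G b y) :: int) = of_bool (over_in G a y) + of_bool (over_in G c y) + d \<and>
       (of_bool (under_in G b y) :: int) = of_bool (under_in G a y) + of_bool (under_in G c y) + d"
  shows "gauss_equal G H"
proof -
  note tg = TG[unfolded triangle_def] and th = TH[unfolded triangle_def]
  define Z where "Z x = (\<Sum>y\<in>Y. sign G y * (of_bool (over_in G x y) - of_bool (under_in G x y)))" for x
  have Zb: "Z b = Z a + Z c"
    unfolding Z_def sum.distrib[symmetric]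
  proof (rule sum.cong[OF refl])
    fix y assume "y \<in> Y"
    from add[OF this] show "sign G y * (of_bool (over_in G b y) - of_bool (under_in G b y)) =
        sign G y * (of_bool (over_in G a y) - of_bool (under_in G a y)) +
        sign G y * (of_bool (over_in G c y) - of_bool (under_in G c y))"
      by (simp add: distrib_left[symmetric])
  qed
  have ZH: "(\<Sum>y\<in>Y. sign H y * (of_bool (over_in H x y) - of_bool (under_in H x y))) = Z x"
    if "x \<in> {a, b, c}" for x
    unfolding Z_def
  proof (intro sum.cong refl)
    fix y assume y: "y \<in> Y"
    have "over_in H x y = over_in G x y \<and> under_in H x y = under_in G x y"
      using y that abc ch by (intro arcs) auto
    then show "sign H y * (of_bool (over_in H x y) - of_bool (under_in H x y)) =
        sign G y * (of_bool (over_in G x y) - of_bool (under_in G x y))"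
      using sg[of y] y ch by simp
  qed
  have rem: "chords G - {a} = insert b (insert c Y)" "chords G - {b} = insert a (insert c Y)"
    "chords G - {c} = insert a (insert b Y)" using abc ch by auto
  have iG: "chord_index G a = sign G b * (of_bool tT - of_bool (\<not> \<kappa>)) + sign G c * (of_bool (\<not> tM) - of_bool (\<not> \<kappa>)) + Z a"
     "chord_index G b = sign G a * (of_bool (\<not> tT) - of_bool \<kappa>) + sign G c * (of_bool \<kappa> - of_bool (\<not> tB)) + Z b"
     "chord_index G c = sign G a * (of_bool (\<not> \<kappa>) - of_bool (\<not> tM)) + sign G b * (of_bool (\<not> \<kappa>) - of_bool tB) + Z c"
    unfolding chord_index_def rem by (simp_all add: Z_def tg fin abc not_sym[OF abc(4)] not_sym[OF abc(5)] not_sym[OF abc(6)])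
  have sH: "sign H a = sign G a" "sign H b = sign G b" "sign H c = sign G c" using sg ch by auto
  have iH: "chord_index H a = sign G b * (of_bool (\<not> tT) - of_bool (\<not> \<kappa>)) + sign G c * (of_bool tM - of_bool (\<not> \<kappa>)) + Z a"
     "chord_index H b = sign G a * (of_bool tT - of_bool \<kappa>) + sign G c * (of_bool \<kappa> - of_bool tB) + Z b"
     "chord_index H c = sign G a * (of_bool (\<not> \<kappa>) - of_bool tM) + sign G b * (of_bool (\<not> \<kappa>) - of_bool (\<not> tB)) + Z c"
    unfolding chord_index_def ch(2) rem by (simp_all add: ZH th sH fin abc not_sym[OF abc(4)] not_sym[OF abc(5)] not_sym[OF abc(6)])
  define \<epsilon> where "\<epsilon> = sign G a"
  \<comment> \<open>The sign conditions express all three signs through one of them, so that the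
    rest is a case analysis over the four flags.\<close>
  have e: "sign G a = \<epsilon>" "sign G b = (if tM = tB then \<epsilon> else - \<epsilon>)" "sign G c = (if tT = tB then \<epsilon> else - \<epsilon>)"
    using s eab eac unfolding \<epsilon>_def by auto
  have "\<epsilon> = 1 \<or> \<epsilon> = -1" using s by (auto simp: \<epsilon>_def)
  then have e2: "\<epsilon> * \<epsilon> = 1" by auto
  have inda: "chord_index H a = chord_index G a" "chord_index H b = chord_index G b"
    "chord_index H c = chord_index G c" "chord_index G b = chord_index G a + chord_index G c"
    unfolding iG iH Zb e by (cases \<kappa>; cases tT; cases tM; cases tB; simp)+
  have indY: "chord_index H x = chord_index G x" if "x \<in> Y" for x
    unfolding chord_index_def ch(2)
  proof (intro sum.cong refl)
    fix y assume y: "y \<in> chords G - {x}"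
    have "over_in H x y = over_in G x y \<and> under_in H x y = under_in G x y"
      using y that ch by (intro arcs) auto
    then show "sign H y * (of_bool (over_in H x y) - of_bool (under_in H x y)) =
        sign G y * (of_bool (over_in G x y) - of_bool (under_in G x y))"
      using sg[of y] y by simp
  qed
  have ind: "chord_index H x = chord_index G x" if "x \<in> chords G" for x
    using that inda indY ch by auto
  have "index_writhe H n = index_writhe G n" for n
    unfolding index_writhe_def ch(2) by (intro sum.cong refl) (auto simp: ind sg)
  moreover have "nesting S H = nesting S G" if S: "reduced S" for S
  proof -
    have 1: "pair_term S H x y = pair_term S G x y"
      if "x \<in> chords G" "y \<in> chords G" "x \<noteq> y" "x \<in> Y \<or> y \<in> Y" for x y
      using that arcs[of x y] arcs[of y x] by (auto simp: pair_term_def ind sg)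
    have 2: "(\<Sum>y\<in>chords H - {x}. pair_term S H x y) = (\<Sum>y\<in>chords G - {x}. pair_term S G x y)" if "x \<in> Y" for x
      unfolding ch(2) using that ch abc by (intro sum.cong refl 1) auto
    have 3: "(\<Sum>y\<in>Y. pair_term S H x y) = (\<Sum>y\<in>Y. pair_term S G x y)" if "x \<in> {a, b, c}" for x
      using that ch abc by (intro sum.cong refl 1) auto
    \<comment> \<open>The arcs of a and c are never nested in each other. For \<kappa> they can be
      disjoint, with the weights that a and c have when nested in b; otherwise they can cover the
      curve, with the weights of b nested in a and in c. The sign conditions make gains and losses
      equal.\<close>
    have p: "pair_term S G a b + pair_term S G a c + pair_term S G b a + pair_term S G b c +
        pair_term S G c a + pair_term S G c b =
        pair_term S H a b + pair_term S H a c + pair_term S H b a + pair_term S H b c +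
        pair_term S H c a + pair_term S H c b"
      unfolding pair_term_def inda sH
      by (cases \<kappa>; cases tT; cases tM; cases tB;
          simp add: pair_weight_def e e2 tg th add.commute)
    have 4: "(\<Sum>x\<in>Y. \<Sum>y\<in>chords H - {x}. pair_term S H x y) = (\<Sum>x\<in>Y. \<Sum>y\<in>chords G - {x}. pair_term S G x y)"
      by (intro sum.cong refl 2)
    have 5: "(\<Sum>x\<in>chords K. \<Sum>y\<in>chords K - {x}. pair_term S K x y) =
        (\<Sum>x\<in>Y. \<Sum>y\<in>chords K - {x}. pair_term S K x y) +
        (\<Sum>y\<in>Y. pair_term S K a y) + (\<Sum>y\<in>Y. pair_term S K b y) + (\<Sum>y\<in>Y. pair_term S K c y) +
        (pair_term S K a b + pair_term S K a c + pair_term S K b a + pair_term S K b c +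
        pair_term S K c a + pair_term S K c b)" if K: "chords K = insert a (insert b (insert c Y))" for K
    proof -
      have r: "chords K - {a} = insert b (insert c Y)" "chords K - {b} = insert a (insert c Y)"
        "chords K - {c} = insert a (insert b Y)" using K abc by auto
      have "(\<Sum>x\<in>chords K. g x) = g a + g b + g c + (\<Sum>x\<in>Y. g x)" for g :: "'a \<Rightarrow> int"
        unfolding K using fin abc by simp
      then show ?thesis using fin abc by (simp add: r)
    qed
    show ?thesis
      unfolding nesting_def 5[OF ch(1)] 5[OF ch(2)[unfolded ch(1)]] 4 p using 3 by simp
  qed
  ultimately show ?thesis by (simp add: gauss_equal_def)
qed


section \<open>Local degree of planar maps\<close>

text \<open>Asking the formula of all loops in the punctured ball, instead of one circle, makes
  degrees multiply under composition without any homotopy argument.\<close>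

definition degree_on :: "(complex \<Rightarrow> complex) \<Rightarrow> complex \<Rightarrow> real \<Rightarrow> int \<Rightarrow> bool" where
  "degree_on g z R d \<longleftrightarrow> R > 0 \<and> (\<forall>p. path p \<and> pathfinish p = pathstart p \<and> path_image p \<subseteq> ball z R - {z} \<longrightarrow>
     path (g \<circ> p) \<and> g z \<notin> path_image (g \<circ> p) \<and>
     winding_number (g \<circ> p) (g z) = of_int d * winding_number p z)"

definition local_degree :: "(complex \<Rightarrow> complex) \<Rightarrow> complex \<Rightarrow> int \<Rightarrow> bool" where
  "local_degree g z d \<longleftrightarrow> (\<exists>R. degree_on g z R d)"

lemma path_image_mem: "path_image p \<subseteq> S \<Longrightarrow> t \<in> {0..1} \<Longrightarrow> p t \<in> S"
  by (auto simp: path_image_def)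

lemma ball_min: "ball z (min R r) \<subseteq> ball (z::complex) R" "ball z (min R r) \<subseteq> ball z r"
  by auto

lemma degree_onD:
  assumes "degree_on g z R d" "path p" "pathfinish p = pathstart p" "path_image p \<subseteq> ball z R - {z}"
  shows "path (g \<circ> p)" "g z \<notin> path_image (g \<circ> p)"
    "winding_number (g \<circ> p) (g z) = of_int d * winding_number p z"
  using assms by (auto simp: degree_on_def)

lemma degree_on_mono: "degree_on g z R d \<Longrightarrow> 0 < R' \<Longrightarrow> R' \<le> R \<Longrightarrow> degree_on g z R' d"
  unfolding degree_on_def by (meson Diff_mono order_refl subset_ball subset_trans)

lemma degree_on_cong:
  assumes "degree_on g z R d" "\<And>w. w \<in> ball z R \<Longrightarrow> g' w = g w"
  shows "degree_on g' z R d"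
  unfolding degree_on_def
proof (intro conjI allI impI)
  show R: "R > 0" using assms(1) by (simp add: degree_on_def)
  fix p assume p: "path p \<and> pathfinish p = pathstart p \<and> path_image p \<subseteq> ball z R - {z}"
  have *: "(g' \<circ> p) t = (g \<circ> p) t" if "t \<in> {0..1}" for t
    using assms(2)[of "p t"] path_image_mem[of p "ball z R - {z}" t] p that by auto
  have z: "g' z = g z" using assms(2)[of z] R by simp
  note D = degree_onD[OF assms(1), of p]
  have pa: "path (g \<circ> p)" using D p by blast
  show pa': "path (g' \<circ> p)" by (rule path_eq[OF pa]) (metis * atLeastAtMost_iff)
  have im: "path_image (g' \<circ> p) = path_image (g \<circ> p)"
    using * by (auto simp: path_image_def)
  show "g' z \<notin> path_image (g' \<circ> p)" using D p im z by simp
  have "winding_number (g' \<circ> p) (g z) = winding_number (g \<circ> p) (g z)"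
  proof (rule winding_number_loops_linear_eq[OF pa pa'])
    show "pathfinish (g \<circ> p) = pathstart (g \<circ> p)" "pathfinish (g' \<circ> p) = pathstart (g' \<circ> p)"
      using p by (auto simp: pathfinish_def pathstart_def)
    fix t :: real assume t: "t \<in> {0..1}"
    show "g z \<notin> closed_segment ((g \<circ> p) t) ((g' \<circ> p) t)"
      unfolding *[OF t] using D(2) p t by (auto simp: path_image_def)
  qed
  then show "winding_number (g' \<circ> p) (g' z) = of_int d * winding_number p z"
    using D p z by simp
qed

lemma local_degree_cong:
  assumes "local_degree g z d" "R > 0" "\<And>w. w \<in> ball z R \<Longrightarrow> g' w = g w"
  shows "local_degree g' z d"
proof -
  obtain R' where "degree_on g z R' d" using assms by (auto simp: local_degree_def)
  moreover from this have "R' > 0" by (simp add: degree_on_def)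
  ultimately have "degree_on g z (min R R') d"
    using degree_on_mono[of g z R' d "min R R'"] assms(2) by simp
  then have "degree_on g' z (min R R') d" by (rule degree_on_cong) (use assms(3) in auto)
  then show ?thesis by (auto simp: local_degree_def)
qed

text \<open>In logarithmic coordinates at the two points, the map commutes with the translation by
  \<open>2\<pi>\<i>\<close> up to a multiple of \<open>2\<pi>\<i>\<close>, which does not depend on the point.\<close>

lemma degree_on_exists:
  assumes "R > 0" and cont: "continuous_on (ball z R) g"
    and ne: "\<And>w. w \<in> ball z R \<Longrightarrow> w \<noteq> z \<Longrightarrow> g w \<noteq> g z"
  obtains d where "degree_on g z R d"
proof -
  define S where "S = {\<zeta>. Re \<zeta> < ln R}"
  define c where "c = 2 * complex_of_real pi * \<i>"
  have c0: "c \<noteq> 0" by (simp add: c_def)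
  have S: "convex S" unfolding S_def by (rule convex_halfspace_Re_lt)
  have cS: "\<zeta> + of_int k * c \<in> S" if "\<zeta> \<in> S" for \<zeta> and k :: int using that by (simp add: S_def c_def)
  have cS1: "\<zeta> + c \<in> S" if "\<zeta> \<in> S" for \<zeta> using cS[OF that, of 1] by simp
  have S_iff: "z + exp \<zeta> \<in> ball z R \<longleftrightarrow> \<zeta> \<in> S" for \<zeta>
  proof -
    have "exp (Re \<zeta>) < R \<longleftrightarrow> Re \<zeta> < ln R" using \<open>R > 0\<close> by (metis exp_less_cancel_iff exp_ln)
    then show ?thesis by (simp add: S_def dist_norm)
  qed
  have contH: "continuous_on S (\<lambda>\<zeta>. g (z + exp \<zeta>) - g z)"
    by (intro continuous_on_diff continuous_on_const continuous_on_compose2[OF cont] continuous_intros)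
       (use S_iff in auto)
  obtain L where contL: "continuous_on S L" and L: "\<And>\<zeta>. \<zeta> \<in> S \<Longrightarrow> g (z + exp \<zeta>) - g z = exp (L \<zeta>)"
  proof (rule continuous_logarithm_on_contractible[OF contH convex_imp_contractible[OF S]])
    show "g (z + exp \<zeta>) - g z \<noteq> 0" if "\<zeta> \<in> S" for \<zeta>
      using ne[of "z + exp \<zeta>"] S_iff that by auto
  qed blast
  have expc: "exp (\<zeta> + c) = exp \<zeta>" for \<zeta> unfolding c_def exp_add by simp
  define f where "f \<zeta> = (L (\<zeta> + c) - L \<zeta>) / c" for \<zeta>
  have fint: "f \<zeta> \<in> \<int>" if "\<zeta> \<in> S" for \<zeta>
  proof -
    have "exp (L (\<zeta> + c)) = exp (L \<zeta>)" using L[OF that] L[OF cS1[OF that]] expc[of \<zeta>] by simp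
    then obtain n :: int where "L (\<zeta> + c) = L \<zeta> + of_int (2 * n) * pi * \<i>" unfolding exp_eq by auto
    then have "f \<zeta> = of_int n" using c0 by (simp add: f_def c_def field_simps)
    then show ?thesis by simp
  qed
  \<comment> \<open>A continuous integer-valued function on a connected half-plane.\<close>
  have "f constant_on S"
  proof (rule continuous_discrete_range_constant)
    show "connected S" using S convex_connected by blast
    show "continuous_on S f" unfolding f_def
      by (intro continuous_intros contL continuous_on_compose2[OF contL]) (use cS1 c0 in auto)
    show "\<exists>e>0. \<forall>y. y \<in> S \<and> f y \<noteq> f x \<longrightarrow> e \<le> norm (f y - f x)" if "x \<in> S" for x
    proof (intro exI[of _ 1] conjI allI impI; simp?)
      fix y assume "y \<in> S \<and> f y \<noteq> f x"
      then show "1 \<le> norm (f y - f x)" using fint[of y] fint[OF that]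
        by (auto elim!: Ints_cases simp: of_int_diff[symmetric] norm_of_int simp del: of_int_diff)
    qed
  qed
  then obtain f0 where f0: "\<And>\<zeta>. \<zeta> \<in> S \<Longrightarrow> f \<zeta> = f0" by (auto simp: constant_on_def)
  have "complex_of_real (ln R - 1) \<in> S" by (simp add: S_def)
  then obtain d where d: "f0 = of_int d" using fint f0 by (metis Ints_cases)
  have L1: "L (\<zeta> + c) = L \<zeta> + of_int d * c" if "\<zeta> \<in> S" for \<zeta>
    using f0[OF that] d c0 by (simp add: f_def field_simps)
  have Ln: "L (\<zeta> + of_nat n * c) = L \<zeta> + of_nat n * of_int d * c" if "\<zeta> \<in> S" for \<zeta> n
  proof (induction n)
    case (Suc n)
    have "\<zeta> + of_nat n * c \<in> S" using cS[OF that, of "int n"] by simp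
    from L1[OF this] show ?case using Suc by (simp add: algebra_simps)
  qed simp
  have Lk: "L (\<zeta> + of_int k * c) = L \<zeta> + of_int k * of_int d * c" if "\<zeta> \<in> S" for \<zeta> k
  proof (cases "k \<ge> 0")
    case True then show ?thesis using Ln[OF that, of "nat k"] by simp
  next
    case False
    then show ?thesis using Ln[OF cS[OF that, of k], of "nat (-k)"] by (simp add: algebra_simps)
  qed
  have "degree_on g z R d"
    unfolding degree_on_def
  proof (intro conjI allI impI)
    show "R > 0" by fact
    fix p assume p: "path p \<and> pathfinish p = pathstart p \<and> path_image p \<subseteq> ball z R - {z}"
    then have zp: "z \<notin> path_image p" by auto
    show pg: "path (g \<circ> p)" using p by (intro path_continuous_image continuous_on_subset[OF cont]) auto
    show zg: "g z \<notin> path_image (g \<circ> p)" using p ne by (force simp: path_image_compose)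
    \<comment> \<open>A loop in the punctured ball lifts to a path in the half-plane whose ends
      differ by its winding number times \<open>c\<close>; by \<open>Lk\<close>, the logarithm
      \<open>L\<close> of the image then changes by \<open>d\<close> times as much.\<close>
    obtain q where q: "path q" "pathfinish q - pathstart q = 2 * of_real pi * \<i> * winding_number p z"
      "\<And>t. t \<in> {0..1} \<Longrightarrow> p t = z + exp (q t)"
      using winding_number_as_continuous_log[of p z] p zp by blast
    obtain k :: int where k: "winding_number p z = of_int k"
      using integer_winding_number[of p z] p zp by (auto elim: Ints_cases)
    have qS: "q t \<in> S" if "t \<in> {0..1}" for t
      using q(3)[OF that] S_iff[of "q t"] p that by (force simp: path_image_def)
    have pLq: "path (L \<circ> q)"
      by (intro path_continuous_image q continuous_on_subset[OF contL]) (use qS in \<open>auto simp: path_image_def\<close>)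
    have Lq: "(g \<circ> p) t - g z = exp (L (q t))" if "t \<in> {0..1}" for t
      using L[OF qS[OF that]] q(3)[OF that] by simp
    have "winding_number (g \<circ> p) (g z) = winding_number (\<lambda>t. (g \<circ> p) t - g z) 0"
      by (rule winding_number_offset)
    also have "\<dots> = winding_number (exp \<circ> (L \<circ> q)) 0"
    proof (rule winding_number_loops_linear_eq)
      show pe: "path (exp \<circ> (L \<circ> q))" by (intro path_continuous_image pLq continuous_intros)
      show "path (\<lambda>t. (g \<circ> p) t - g z)" using pg unfolding path_def by (intro continuous_on_diff continuous_on_const)
      have 01: "(0::real) \<in> {0..1}" "(1::real) \<in> {0..1}" by auto
      show "pathfinish (\<lambda>t. (g \<circ> p) t - g z) = pathstart (\<lambda>t. (g \<circ> p) t - g z)"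
        using p by (simp add: pathfinish_def pathstart_def)
      then show "pathfinish (exp \<circ> (L \<circ> q)) = pathstart (exp \<circ> (L \<circ> q))"
        using Lq[OF 01(1)] Lq[OF 01(2)] by (simp add: pathfinish_def pathstart_def)
      show "0 \<notin> closed_segment ((exp \<circ> (L \<circ> q)) t) ((g \<circ> p) t - g z)" if "t \<in> {0..1}" for t
        unfolding Lq[OF that] by simp
    qed
    also have "\<dots> = (L (pathfinish q) - L (pathstart q)) / (2 * of_real pi * \<i>)"
      using winding_number_compose_exp[OF pLq] by (simp add: pathfinish_def pathstart_def)
    also have "pathfinish q = pathstart q + of_int k * c" using q(2) k by (simp add: c_def algebra_simps)
    also have "L (pathstart q + of_int k * c) = L (pathstart q) + of_int k * of_int d * c"
      using Lk qS[of 0] by (simp add: pathstart_def)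
    finally show "winding_number (g \<circ> p) (g z) = of_int d * winding_number p z"
      using c0 by (simp add: k c_def o_def)
  qed
  then show ?thesis by (rule that)
qed

lemma circlepath_loop:
  assumes "0 < r" "r < R"
  shows "path (circlepath z r)" "pathfinish (circlepath z r) = pathstart (circlepath z r)"
    "path_image (circlepath z r) \<subseteq> ball z R - {z}"
  using assms by auto

lemma degree_on_circle:
  assumes "degree_on g z R d" "0 < r" "r < R"
  shows "winding_number (g \<circ> circlepath z r) (g z) = of_int d"
  using degree_onD(3)[OF assms(1) circlepath_loop[OF assms(2,3)]] assms(2)
  by (simp add: winding_number_circlepath_centre)

lemma local_degree_unique:
  assumes "local_degree g z d" "local_degree g z d'"
  shows "d = d'"
proof -
  obtain R R' where "degree_on g z R d" "degree_on g z R' d'" using assms by (auto simp: local_degree_def)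
  moreover then have "R > 0" "R' > 0" by (auto simp: degree_on_def)
  ultimately show ?thesis
    using degree_on_circle[of g z R d "min R R' / 2"] degree_on_circle[of g z R' d' "min R R' / 2"] by simp
qed

lemma local_degree_exists:
  assumes "open S" "z \<in> S" "continuous_on S g" "inj_on g S"
  obtains d where "local_degree g z d"
proof -
  obtain R where "R > 0" "ball z R \<subseteq> S" using assms open_contains_ball by blast
  then show ?thesis using that degree_on_exists[of R z g] assms
    by (metis continuous_on_subset inj_onD local_degree_def subset_iff)
qed

lemma local_degree_id: "local_degree (\<lambda>w. w) z 1"
  unfolding local_degree_def degree_on_def by (intro exI[of _ 1]) (auto simp: o_def)

lemma local_degree_cnj: "local_degree cnj z (- 1)"
  unfolding local_degree_def degree_on_def
proof (intro exI[of _ 1] conjI allI impI)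
  fix p assume p: "path p \<and> pathfinish p = pathstart p \<and> path_image p \<subseteq> ball z 1 - {z}"
  then have z: "z \<notin> path_image p" by auto
  show "path (cnj \<circ> p)" using p by (intro path_continuous_image continuous_intros) auto
  show "cnj z \<notin> path_image (cnj \<circ> p)" using z by (auto simp: path_image_compose)
  show "winding_number (cnj \<circ> p) (cnj z) = of_int (- 1) * winding_number p z"
    using winding_number_cnj[of p z] integer_winding_number[of p z] p z by (auto elim!: Ints_cases)
qed simp

lemma local_degree_compose:
  assumes g: "local_degree g z d" and k: "local_degree k (g z) d'" and c: "isCont g z"
  shows "local_degree (k \<circ> g) z (d' * d)"
proof -
  obtain R R' where R: "degree_on g z R d" "degree_on k (g z) R' d'" using g k by (auto simp: local_degree_def)
  then have pos: "R > 0" "R' > 0" by (auto simp: degree_on_def)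
  obtain r where r: "r > 0" "\<And>w. dist w z < r \<Longrightarrow> dist (g w) (g z) < R'"
    using c pos by (auto simp: continuous_at_eps_delta)
  have "degree_on (k \<circ> g) z (min R r) (d' * d)"
    unfolding degree_on_def
  proof (intro conjI allI impI)
    show "min R r > 0" using pos r by simp
    fix p assume p: "path p \<and> pathfinish p = pathstart p \<and> path_image p \<subseteq> ball z (min R r) - {z}"
    have D: "path (g \<circ> p)" "g z \<notin> path_image (g \<circ> p)"
      "winding_number (g \<circ> p) (g z) = of_int d * winding_number p z"
      using degree_onD[OF R(1), of p] p ball_min[of z R r] by blast+
    have "g y \<in> ball (g z) R'" if "y \<in> path_image p" for y
      using subsetD[of "path_image p" "ball z (min R r) - {z}" y] p r(2)[of y] that by (simp add: dist_commute)
    then have "path_image (g \<circ> p) \<subseteq> ball (g z) R'" by (auto simp: path_image_compose)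
    moreover have 1: "path (g \<circ> p)" "g z \<notin> path_image (g \<circ> p)"
      "winding_number (g \<circ> p) (g z) = of_int d * winding_number p z" using D p by auto
    moreover have "pathfinish (g \<circ> p) = pathstart (g \<circ> p)" using p by (simp add: pathfinish_def pathstart_def)
    ultimately have "path (k \<circ> (g \<circ> p))" "k (g z) \<notin> path_image (k \<circ> (g \<circ> p))"
       "winding_number (k \<circ> (g \<circ> p)) (k (g z)) = of_int d' * winding_number (g \<circ> p) (g z)"
      using degree_onD[OF R(2), of "g \<circ> p"] by auto
    then show "path (k \<circ> g \<circ> p)" "(k \<circ> g) z \<notin> path_image (k \<circ> g \<circ> p)"
      "winding_number (k \<circ> g \<circ> p) ((k \<circ> g) z) = of_int (d' * d) * winding_number p z"
      using 1 by (simp_all add: o_assoc)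
  qed
  then show ?thesis by (auto simp: local_degree_def)
qed

text \<open>One circle computes the degree at its centre and at all points close to the centre: the
  image of a small concentric ball is connected and, by injectivity, misses the image of the circle,
  so the winding number about image points of that ball is constant. Connectedness of S does the
  rest.\<close>

lemma local_degree_constant:
  assumes S: "open S" "connected S" and g: "continuous_on S g" "inj_on g S"
    and z: "z \<in> S" "local_degree g z d" and z': "z' \<in> S"
  shows "local_degree g z' d"
proof -
  have loc: "\<exists>r>0. \<forall>w\<in>ball x r. \<forall>d. local_degree g x d \<longrightarrow> local_degree g w d" if x: "x \<in> S" for x
  proof -
    obtain R where R: "R > 0" "ball x R \<subseteq> S" using S x open_contains_ball by blast
    \<comment> \<open>The circle of radius R/3 about x encloses every w at distance below R/4. It
      lies in the ball of radius 3/4 R about w because R/3 + R/4 < 3/4 R, and this ball lies in S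
      because R/4 + 3/4 R = R.\<close>
    show ?thesis
    proof (intro exI[of _ "R/4"] conjI ballI allI impI)
      fix w d assume w: "w \<in> ball x (R/4)" and d: "local_degree g x d"
      obtain d1 where d1: "degree_on g x R d1"
        using degree_on_exists[of R x g] R g x
        by (metis continuous_on_subset inj_onD subset_iff)
      have "ball w (3/4 * R) \<subseteq> S" using R w
      proof -
        have "y \<in> ball x R" if "y \<in> ball w (3/4 * R)" for y
          using w that dist_triangle[of x y w] by simp
        then show ?thesis using R by auto
      qed
      moreover have "w \<in> S" using w R by (auto simp: dist_norm)
      ultimately obtain d2 where d2: "degree_on g w (3/4 * R) d2"
        using degree_on_exists[of "3/4 * R" w g] R g
        by (metis continuous_on_subset inj_onD subset_iff mult_pos_pos zero_less_divide_iff zero_less_numeral)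
      let ?p = "circlepath x (R/3)"
      have pi: "path_image ?p = sphere x (R/3)" using R by simp
      have w_in: "path_image ?p \<subseteq> ball w (3/4 * R) - {w}"
      proof
        fix y assume "y \<in> path_image ?p"
        then have "dist x y = R/3" unfolding pi by simp
        moreover have "dist x w < R/4" using w by simp
        ultimately show "y \<in> ball w (3/4 * R) - {w}" using R dist_triangle[of w y x]
          by (auto simp: dist_commute)
      qed
      have x_in: "path_image ?p \<subseteq> ball x R - {x}" using pi R by auto
      have lp: "path ?p" "pathfinish ?p = pathstart ?p" by auto
      note D1 = degree_onD[OF d1 lp x_in] and D2 = degree_onD[OF d2 lp w_in]
      have "winding_number (g \<circ> ?p) (g w) = winding_number (g \<circ> ?p) (g x)"
      proof (rule winding_number_eq[of _ _ "g ` ball x (R/4)"])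
        show "g w \<in> g ` ball x (R / 4)" "g x \<in> g ` ball x (R / 4)" using w R by auto
        have sub: "ball x (R/4) \<subseteq> S" using R by (auto intro: subset_ball[THEN subsetD, of "R/4" R])
        show "connected (g ` ball x (R / 4))"
          using sub by (intro connected_continuous_image continuous_on_subset[OF g(1)]) auto
        show "g ` ball x (R / 4) \<inter> path_image (g \<circ> ?p) = {}"
        proof (rule ccontr)
          assume "\<not> ?thesis"
          then obtain u v where uv: "u \<in> ball x (R/4)" "v \<in> sphere x (R/3)" "g u = g v"
            unfolding path_image_compose pi by blast
          then have "u \<in> S" "v \<in> S" using sub x_in pi R(2) by auto
          then have "u = v" using uv g(2) by (auto dest: inj_onD)
          then show False using uv R by auto
        qed
      qed (use D1 lp in \<open>auto simp: pathfinish_def pathstart_def\<close>)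
      moreover have "winding_number ?p w = 1" "winding_number ?p x = 1"
        using w R by (auto intro!: winding_number_circlepath simp: dist_norm norm_minus_commute)
      ultimately have "d1 = d2" using D1 D2 by simp
      moreover have "d = d1" using local_degree_unique[OF d] d1 by (auto simp: local_degree_def)
      ultimately show "local_degree g w d" using d2 by (auto simp: local_degree_def)
    qed (use R in simp)
  qed
  show ?thesis
  proof (rule connected_induction_simple[where P = "\<lambda>x. local_degree g x d", OF S(2) z(1) z' z(2)])
    fix a assume "a \<in> S"
    from loc[OF this] obtain r where r: "r > 0" "\<And>w d. w \<in> ball a r \<Longrightarrow> local_degree g a d \<Longrightarrow> local_degree g w d" by blast
    obtain d0 where d0: "local_degree g a d0" using local_degree_exists[OF S(1) \<open>a \<in> S\<close> g] .
    have "local_degree g y d" if "x \<in> ball a r" "y \<in> ball a r" "local_degree g x d" for x y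
      using r(2)[OF that(1) d0] r(2)[OF that(2) d0] that(3) local_degree_unique by blast
    then show "\<exists>T. openin (top_of_set S) T \<and> a \<in> T \<and> (\<forall>x\<in>T. \<forall>y\<in>T. local_degree g x d \<longrightarrow> local_degree g y d)"
      using r(1) \<open>a \<in> S\<close> by (intro exI[of _ "S \<inter> ball a r"]) (blast intro: openin_open_Int centre_in_ball[THEN iffD2])
  qed
qed

text \<open>The straight homotopy between the increments of k and of g avoids 0 off z, so the images
  of a loop have equal winding numbers. This is the means by which all concrete degrees below are
  reduced to linear maps.\<close>

lemma local_degree_compare:
  assumes k: "local_degree k z d" and "R > 0" and cont: "continuous_on (ball z R) g"
    and seg: "\<And>w. w \<in> ball z R \<Longrightarrow> w \<noteq> z \<Longrightarrow> 0 \<notin> closed_segment (k w - k z) (g w - g z)"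
  shows "local_degree g z d"
proof -
  obtain R' where R': "degree_on k z R' d" using k by (auto simp: local_degree_def)
  have "degree_on g z (min R R') d" unfolding degree_on_def
  proof (intro conjI allI impI)
    show "min R R' > 0" using R' \<open>R > 0\<close> by (simp add: degree_on_def)
    fix p assume p: "path p \<and> pathfinish p = pathstart p \<and> path_image p \<subseteq> ball z (min R R') - {z}"
    have pt: "p t \<in> ball z R \<and> p t \<noteq> z" if "t \<in> {0..1}" for t
      using path_image_mem[of p "ball z (min R R') - {z}" t] p that by auto
    show pg: "path (g \<circ> p)" using p by (intro path_continuous_image continuous_on_subset[OF cont]) auto
    show "g z \<notin> path_image (g \<circ> p)"
    proof
      assume "g z \<in> path_image (g \<circ> p)"
      then obtain t where "t \<in> {0..1}" "g (p t) = g z" by (auto simp: path_image_def)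
      then show False using seg[of "p t"] pt[of t] by auto
    qed
    have D: "path (k \<circ> p)" "winding_number (k \<circ> p) (k z) = of_int d * winding_number p z"
      using degree_onD[OF R', of p] p ball_min[of z R R'] by blast+
    have "winding_number (g \<circ> p) (g z) = winding_number (\<lambda>t. (g \<circ> p) t - g z) 0"
      by (rule winding_number_offset)
    also have "\<dots> = winding_number (\<lambda>t. (k \<circ> p) t - k z) 0"
    proof (rule winding_number_loops_linear_eq)
      show "path (\<lambda>t. (k \<circ> p) t - k z)" "path (\<lambda>t. (g \<circ> p) t - g z)"
        using pg D(1) unfolding path_def by (auto intro!: continuous_on_diff)
      show "pathfinish (\<lambda>t. (k \<circ> p) t - k z) = pathstart (\<lambda>t. (k \<circ> p) t - k z)"
        "pathfinish (\<lambda>t. (g \<circ> p) t - g z) = pathstart (\<lambda>t. (g \<circ> p) t - g z)"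
        using p by (auto simp: pathfinish_def pathstart_def)
      show "0 \<notin> closed_segment ((k \<circ> p) t - k z) ((g \<circ> p) t - g z)" if "t \<in> {0..1}" for t
        using seg pt[OF that] by simp
    qed
    also have "\<dots> = winding_number (k \<circ> p) (k z)" by (rule winding_number_offset[symmetric])
    finally show "winding_number (g \<circ> p) (g z) = of_int d * winding_number p z" using D by simp
  qed
  then show ?thesis by (auto simp: local_degree_def)
qed

text \<open>Multiplication by c = exp q merely translates the logarithm of a loop by q.\<close>

lemma local_degree_linear:
  assumes "c \<noteq> 0"
  shows "local_degree (\<lambda>w. c * w) z 1"
proof -
  obtain q where q: "c = exp q" using assms by (metis exp_Ln)
  have "local_degree (\<lambda>w. c * w) z 1"
    unfolding local_degree_def degree_on_def
  proof (intro exI[of _ 1] conjI allI impI)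
    fix p assume p: "path p \<and> pathfinish p = pathstart p \<and> path_image p \<subseteq> ball z 1 - {z}"
    then have z: "z \<notin> path_image p" by auto
    show pp: "path ((*) c \<circ> p)" using p by (intro path_continuous_image continuous_intros) auto
    show "c * z \<notin> path_image ((*) c \<circ> p)" using z assms by (auto simp: path_image_compose)
    obtain r where r: "path r" "pathfinish r - pathstart r = 2 * of_real pi * \<i> * winding_number p z"
      "\<And>t. t \<in> {0..1} \<Longrightarrow> p t = z + exp (r t)"
      using winding_number_as_continuous_log[of p z] p z by blast
    have pqr: "path (\<lambda>t. q + r t)" using r(1) unfolding path_def by (intro continuous_on_add continuous_on_const)
    have eq: "((*) c \<circ> p) t - c * z = exp (q + r t)" if "t \<in> {0..1}" for t
      unfolding exp_add q[symmetric] using r(3)[OF that] by (simp add: algebra_simps)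
    have "winding_number ((*) c \<circ> p) (c * z) = winding_number (\<lambda>t. ((*) c \<circ> p) t - c * z) 0"
      by (rule winding_number_offset)
    also have "\<dots> = winding_number (exp \<circ> (\<lambda>t. q + r t)) 0"
    proof (rule winding_number_loops_linear_eq)
      show "path (exp \<circ> (\<lambda>t. q + r t))" by (intro path_continuous_image pqr continuous_intros)
      show "path (\<lambda>t. ((*) c \<circ> p) t - c * z)"
        using pp unfolding path_def by (intro continuous_on_diff continuous_on_const)
      have 01: "(0::real) \<in> {0..1}" "(1::real) \<in> {0..1}" by auto
      show 1: "pathfinish (\<lambda>t. ((*) c \<circ> p) t - c * z) = pathstart (\<lambda>t. ((*) c \<circ> p) t - c * z)"
        using p by (simp add: pathfinish_def pathstart_def)
      show "pathfinish (exp \<circ> (\<lambda>t. q + r t)) = pathstart (exp \<circ> (\<lambda>t. q + r t))"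
        using 1 eq[OF 01(1)] eq[OF 01(2)] unfolding pathfinish_def pathstart_def o_def by metis
      show "0 \<notin> closed_segment ((exp \<circ> (\<lambda>t. q + r t)) t) (((*) c \<circ> p) t - c * z)" if "t \<in> {0..1}" for t
        unfolding eq[OF that] by simp
    qed
    also have "\<dots> = winding_number p z"
      using winding_number_compose_exp[OF pqr] r(2) by (simp add: pathfinish_def pathstart_def)
    finally show "winding_number ((*) c \<circ> p) (c * z) = of_int 1 * winding_number p z" by simp
  qed simp
  then show ?thesis .
qed

lemma local_degree_deriv:
  assumes "(g has_field_derivative c) (at z)" "c \<noteq> 0" "R > 0" "continuous_on (ball z R) g"
  shows "local_degree g z 1"
proof -
  obtain r where r: "r > 0" "\<And>w. norm (w - z) < r \<Longrightarrow> norm (g w - g z - c * (w - z)) \<le> norm c / 2 * norm (w - z)"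
    using assms(1,2) unfolding has_field_derivative_def has_derivative_at_alt
    by (metis half_gt_zero zero_less_norm_iff)
  show ?thesis
  proof (rule local_degree_compare[OF local_degree_linear[OF assms(2)]])
    show "min R r > 0" using r assms by simp
    show "continuous_on (ball z (min R r)) g" using assms(4) by (rule continuous_on_subset) auto
    fix w assume w: "w \<in> ball z (min R r)" "w \<noteq> z"
    show "0 \<notin> closed_segment (c * w - c * z) (g w - g z)"
    proof
      assume "0 \<in> closed_segment (c * w - c * z) (g w - g z)"
      then have "norm (c * w - c * z) \<le> norm ((c * w - c * z) - (g w - g z))"
        using segment_bound1[of 0 "c * w - c * z" "g w - g z"] by (simp add: norm_minus_commute)
      also have "\<dots> = norm (g w - g z - c * (w - z))" by (simp add: algebra_simps norm_minus_commute)
      also have "\<dots> \<le> norm c / 2 * norm (w - z)" using r w by (auto simp: dist_norm norm_minus_commute)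
      also have "\<dots> < norm c * norm (w - z)" using assms(2) w by simp
      finally show False by (simp add: norm_mult[symmetric] right_diff_distrib)
    qed
  qed
qed

text \<open>Corresponding coordinates of \<open>w - z\<close> and of the increment of the map have
  the same sign, so the segment between the two cannot contain 0.\<close>

lemma local_degree_box:
  assumes k: "strict_mono k" "continuous_on UNIV k" and l: "strict_mono l" "continuous_on UNIV l"
  shows "local_degree (\<lambda>w. Complex (k (Re w)) (l (Im w))) z 1"
proof (rule local_degree_compare[OF local_degree_id zero_less_one])
  show "continuous_on (ball z 1) (\<lambda>w. Complex (k (Re w)) (l (Im w)))"
    by (intro continuous_on_Complex continuous_on_compose2[OF k(2)] continuous_on_compose2[OF l(2)] continuous_intros) auto
  fix w assume "w \<noteq> z"
  show "0 \<notin> closed_segment (w - z) (Complex (k (Re w)) (l (Im w)) - Complex (k (Re z)) (l (Im z)))"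
  proof
    assume "0 \<in> closed_segment (w - z) (Complex (k (Re w)) (l (Im w)) - Complex (k (Re z)) (l (Im z)))"
    then obtain u where u: "0 \<le> u" "u \<le> 1"
       "(1 - u) * (Re w - Re z) + u * (k (Re w) - k (Re z)) = 0"
       "(1 - u) * (Im w - Im z) + u * (l (Im w) - l (Im z)) = 0"
      by (auto simp: closed_segment_def complex_eq_iff)

    have key: "x = y" if "(1 - u) * (x - y) + u * (m x - m y) = 0" "strict_mono m" for x y and m :: "real \<Rightarrow> real"
    proof (rule ccontr)
      assume "x \<noteq> y"
      then consider "x < y" | "y < x" by linarith
      then show False
      proof cases
        case 1
        then have m: "m x < m y" using that(2) by (rule strict_monoD[rotated])
        have "(1 - u) * (x - y) \<le> 0" "u * (m x - m y) \<le> 0" using u 1 m by (auto intro: mult_nonneg_nonpos)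
        then have "(1 - u) * (x - y) = 0" "u * (m x - m y) = 0" using that(1) by linarith+
        then show False using 1 m by auto
      next
        case 2
        then have m: "m y < m x" using that(2) by (rule strict_monoD[rotated])
        have "(1 - u) * (x - y) \<ge> 0" "u * (m x - m y) \<ge> 0" using u 2 m by auto
        then have "(1 - u) * (x - y) = 0" "u * (m x - m y) = 0" using that(1) by linarith+
        then show False using 2 m by auto
      qed
    qed
    have "Re w = Re z" "Im w = Im z" using key[OF u(3) k(1)] key[OF u(4) l(1)] by simp_all
    then show False using \<open>w \<noteq> z\<close> by (simp add: complex_eq_iff)
  qed
qed


section \<open>Charts and crossings\<close>

lemma plane_chart_iff:
  "plane_chart X e \<longleftrightarrow> inj e \<and> continuous_map euclidean X e \<and> (\<forall>U. open U \<longrightarrow> openin X (e ` U))"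
proof
  assume e: "plane_chart X e"
  then have h: "homeomorphic_map euclidean (subtopology X (range e)) e" and o: "openin X (range e)"
    by (auto simp: plane_chart_def embedding_map_def)
  have "openin X (e ` U)" if "open U" for U
    using homeomorphic_imp_open_map[OF h] that o
    by (simp add: open_map_def openin_open_subtopology)
  then show "inj e \<and> continuous_map euclidean X e \<and> (\<forall>U. open U \<longrightarrow> openin X (e ` U))"
    using homeomorphic_imp_injective_map[OF h] homeomorphic_imp_continuous_map[OF h]
    by (auto simp: continuous_map_in_subtopology)
next
  assume "inj e \<and> continuous_map euclidean X e \<and> (\<forall>U. open U \<longrightarrow> openin X (e ` U))"
  then show "plane_chart X e"
    unfolding plane_chart_def
    by (auto intro!: injective_open_imp_embedding_map simp: open_map_def)
qed

lemma plane_chart_vimage: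
  assumes "plane_chart X e" "openin X V"
  shows "open (e -` V)"
  using assms unfolding plane_chart_iff continuous_map_def by (auto simp: vimage_def)

lemma transition_map:
  assumes e: "plane_chart X e" and e': "plane_chart X e'"
  shows "open (e -` range e')" "continuous_on (e -` range e') (inv e' \<circ> e)"
    "inj_on (inv e' \<circ> e) (e -` range e')" "\<And>u. e u \<in> range e' \<Longrightarrow> e' ((inv e' \<circ> e) u) = e u"
proof -
  have ch: "inj e" "inj e'" "\<And>U. open U \<Longrightarrow> openin X (e' ` U)" using e e' by (auto simp: plane_chart_iff)
  show "open (e -` range e')" by (rule plane_chart_vimage[OF e ch(3)]) simp
  then show "continuous_on (e -` range e') (inv e' \<circ> e)"
  proof (subst continuous_on_open_vimage, assumption, intro allI impI)
    fix B :: "complex set" assume "open B"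
    have "(inv e' \<circ> e) -` B \<inter> e -` range e' = e -` (e' ` B)" using ch(2) by (auto simp: inj_def)
    then show "open ((inv e' \<circ> e) -` B \<inter> e -` range e')"
      using plane_chart_vimage[OF e ch(3)[OF \<open>open B\<close>]] by simp
  qed
  show i: "e' ((inv e' \<circ> e) u) = e u" if "e u \<in> range e'" for u
    using that by (simp add: f_inv_into_f)
  show "inj_on (inv e' \<circ> e) (e -` range e')"
    by (rule inj_onI) (metis i ch(1) injD vimageE)
qed

text \<open>The definition looks at a single circle whose closed disc lies in the domain of the
  transition map. A slightly larger open ball lies there too; on it a degree exists, and the circle
  computes it.\<close>

lemma compatible_charts_iff:
  assumes e: "plane_chart X e" and e': "plane_chart X e'"
  shows "compatible_charts e e' \<longleftrightarrow> (\<forall>z w. e z = e' w \<longrightarrow> local_degree (inv e' \<circ> e) z 1)"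
proof -
  let ?g = "inv e' \<circ> e" and ?U = "e -` range e'"
  note T = transition_map[OF e e']
  have ij: "inj e'" using e' by (simp add: plane_chart_iff)
  have "(\<exists>r>0. e ` cball z r \<subseteq> range e' \<and> winding_number (?g \<circ> circlepath z r) w = 1)
      \<longleftrightarrow> local_degree ?g z 1" if zw: "e z = e' w" for z w
  proof -
    have gz: "?g z = w" using zw ij by simp
    have zU: "z \<in> ?U" using zw by auto
    show ?thesis
    proof
      assume "\<exists>r>0. e ` cball z r \<subseteq> range e' \<and> winding_number (?g \<circ> circlepath z r) w = 1"
      then obtain r where r: "r > 0" "cball z r \<subseteq> ?U" "winding_number (?g \<circ> circlepath z r) w = 1"
        unfolding image_subset_iff_subset_vimage by blast
      obtain \<epsilon> where eps: "\<epsilon> > 0" "(\<Union>x\<in>cball z r. ball x \<epsilon>) \<subseteq> ?U"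
        using compact_subset_open_imp_ball_epsilon_subset[OF compact_cball T(1) r(2)] .
      have "ball z (r + \<epsilon>) \<subseteq> ?U"
      proof
        fix y assume y: "y \<in> ball z (r + \<epsilon>)"
        show "y \<in> ?U"
        proof (cases "y \<in> cball z r")
          case False
          \<comment> \<open>The point where the segment from z to y leaves the closed disc.\<close>
          define x where "x = z + of_real (r / dist z y) * (y - z)"
          have d: "dist z y > r" using False by simp
          have yz: "y \<noteq> z" using d r(1) by auto
          have "dist z x = r" using d r(1) yz by (simp add: x_def dist_norm norm_mult norm_divide norm_minus_commute)
          moreover have "y - x = of_real (1 - r / dist z y) * (y - z)" by (simp add: x_def algebra_simps)
          then have "norm (y - x) = \<bar>1 - r / dist z y\<bar> * norm (y - z)"
            by (simp only: norm_mult norm_of_real)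
          then have "dist x y = dist z y - r"
            using d r(1) yz by (simp add: dist_norm norm_minus_commute field_simps)
          ultimately show ?thesis using eps(2) y by (intro subsetD[OF eps(2)] UN_I[of x]) auto
        qed (use r in auto)
      qed
      then obtain d where d: "degree_on ?g z (r + \<epsilon>) d"
        using degree_on_exists[of "r + \<epsilon>" z ?g] r(1) eps(1) T(2,3) zU
        by (metis add_pos_pos continuous_on_subset inj_onD subset_iff)
      from degree_on_circle[OF d r(1)] have "d = 1" using eps(1) gz r(3) by simp
      then show "local_degree ?g z 1" using d by (auto simp: local_degree_def)
    next
      assume "local_degree ?g z 1"
      then obtain R where R: "degree_on ?g z R 1" by (auto simp: local_degree_def)
      then have "R > 0" by (simp add: degree_on_def)
      obtain R' where R': "R' > 0" "ball z R' \<subseteq> ?U" using T(1) zU open_contains_ball by blast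
      define r where "r = min R R' / 2"
      have r: "r > 0" "r < R" "r < R'" using \<open>R > 0\<close> R'(1) by (auto simp: r_def)
      then have "cball z r \<subseteq> ?U" using R'(2) by force
      moreover have "winding_number (?g \<circ> circlepath z r) w = 1"
        using degree_on_circle[OF R r(1,2)] gz by simp
      ultimately show "\<exists>r>0. e ` cball z r \<subseteq> range e' \<and> winding_number (?g \<circ> circlepath z r) w = 1"
        using r(1) by blast
    qed
  qed
  then show ?thesis unfolding compatible_charts_def by blast
qed

lemma orientationD:
  assumes "orientation X C"
  shows "e \<in> C \<Longrightarrow> plane_chart X e" "e \<in> C \<Longrightarrow> e' \<in> C \<Longrightarrow> e z = e' w \<Longrightarrow> local_degree (inv e' \<circ> e) z 1"
    "x \<in> topspace X \<Longrightarrow> \<exists>e\<in>C. x \<in> range e"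
proof -
  show 1: "e \<in> C \<Longrightarrow> plane_chart X e" for e using assms unfolding orientation_def by blast
  show "local_degree (inv e' \<circ> e) z 1" if "e \<in> C" "e' \<in> C" "e z = e' w"
  proof -
    have "compatible_charts e e'" using assms that unfolding orientation_def by blast
    then show ?thesis using compatible_charts_iff[OF 1[OF that(1)] 1[OF that(2)]] that(3) by blast
  qed
  show "x \<in> topspace X \<Longrightarrow> \<exists>e\<in>C. x \<in> range e"
    using assms unfolding orientation_def by blast
qed

lemma orientation_maximal:
  assumes "orientation X C" "plane_chart X e"
    "\<And>e' z w. e' \<in> C \<Longrightarrow> e z = e' w \<Longrightarrow> local_degree (inv e' \<circ> e) z 1"
  shows "e \<in> C"
proof -
  have "compatible_charts e e'" if "e' \<in> C" for e'
    using compatible_charts_iff[OF assms(2) orientationD(1)[OF assms(1) that]] assms(3)[OF that] by blast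
  then show ?thesis using assms(1,2) unfolding orientation_def by blast
qed

lemma plane_chart_compose:
  assumes e: "plane_chart X e" and \<phi>: "continuous_on UNIV \<phi>" "inj \<phi>"
  shows "plane_chart X (e \<circ> \<phi>)"
proof -
  have "open (\<phi> ` U)" if "open U" for U
    using that \<phi> by (intro invariance_of_domain) (auto intro: continuous_on_subset inj_on_subset)
  moreover have "(e \<circ> \<phi>) ` U = e ` (\<phi> ` U)" for U by auto
  ultimately show ?thesis using assms unfolding plane_chart_iff
    by (metis inj_compose continuous_map_compose continuous_map_iff_continuous2)
qed

text \<open>By maximality, an orientation is closed under injective changes of coordinates of degree
  1, including those that are not onto the plane.\<close>

lemma chart_reparametrize:
  assumes C: "orientation X C" "e \<in> C" and \<phi>: "continuous_on UNIV \<phi>" "inj \<phi>" "\<And>z. local_degree \<phi> z 1"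
  shows "e \<circ> \<phi> \<in> C"
proof (rule orientation_maximal[OF C(1) plane_chart_compose[OF orientationD(1)[OF C] \<phi>(1,2)]])
  fix e' z w assume "e' \<in> C" "(e \<circ> \<phi>) z = e' w"
  then have "local_degree (inv e' \<circ> e) (\<phi> z) 1" using orientationD(2)[OF C] by simp
  moreover have "isCont \<phi> z" using \<phi>(1) by (simp add: continuous_on_eq_continuous_at)
  ultimately show "local_degree (inv e' \<circ> (e \<circ> \<phi>)) z 1"
    using local_degree_compose[OF \<phi>(3)[of z], of "inv e' \<circ> e" 1] by (simp add: o_assoc)
qed

text \<open>A homeomorphism of the line onto the interval from - 1 to 1 that is the identity near 0.\<close>

definition squash :: "real \<Rightarrow> real" where
  "squash x = max (min x (1 - 1 / (4 * max x (1/2)))) (- 1 - 1 / (4 * min x (- 1/2)))"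

lemma squash_eq:
  "\<bar>x\<bar> \<le> 1/2 \<Longrightarrow> squash x = x" "x \<ge> 1/2 \<Longrightarrow> squash x = 1 - 1 / (4 * x)"
  "x \<le> - 1/2 \<Longrightarrow> squash x = - 1 - 1 / (4 * x)"
proof -
  have 1: "1 - 1 / (4 * x) \<le> x" if "x \<ge> 1/2" for x :: real
  proof -
    have "0 \<le> (2 * x - 1)\<^sup>2" by simp
    then have "4 * x - 1 \<le> x * (4 * x)" by (simp add: power2_eq_square algebra_simps)
    then show ?thesis using that by (simp add: field_simps)
  qed
  show "squash x = x" if x: "\<bar>x\<bar> \<le> 1/2"
  proof -
    have "max x (1/2) = 1/2" "min x (- 1/2) = - 1/2" using x by linarith+
    then show ?thesis using x unfolding squash_def by (simp add: abs_le_iff)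
  qed
  show "squash x = 1 - 1 / (4 * x)" if x: "x \<ge> 1/2"
  proof -
    have "max x (1/2) = x" "min x (- 1/2) = - 1/2" "min x (1 - 1 / (4 * x)) = 1 - 1 / (4 * x)" using x 1[OF x] by linarith+
    moreover have "- 1/2 \<le> 1 - 1 / (4 * x)" using x by (simp add: field_simps)
    ultimately show ?thesis unfolding squash_def by (simp add: max_absorb1)
  qed
  show "squash x = - 1 - 1 / (4 * x)" if x: "x \<le> - 1/2"
  proof -
    have "x \<le> - 1 - 1 / (4 * x)" using 1[of "- x"] x by simp
    moreover have "min x (- 1/2) = x" "min x (1 - 1 / (4 * max x (1/2))) = x" using x by (auto simp: min_def max_def)
    ultimately show ?thesis unfolding squash_def by (simp only: max_absorb2)
  qed
qed

lemma squash_bound: "\<bar>squash x\<bar> < 1"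
proof -
  consider "\<bar>x\<bar> \<le> 1/2" | "x \<ge> 1/2" | "x \<le> - 1/2" by linarith
  then show ?thesis
  proof cases
    case 2 then show ?thesis by (simp add: squash_eq abs_if field_simps)
  next
    case 3 then show ?thesis by (simp add: squash_eq abs_if field_simps)
  qed (simp add: squash_eq)
qed

lemma continuous_squash: "continuous_on UNIV squash"
  unfolding squash_def by (intro continuous_intros) auto

lemma strict_mono_squash: "strict_mono squash"
proof (rule strict_monoI)
  fix x y :: real assume xy: "x < y"
  have a: "squash u < squash v" if "u < v" "1/2 \<le> u" for u v
    using that by (simp add: squash_eq field_simps)
  have b: "squash u < squash v" if "u < v" "v \<le> - 1/2" for u v
  proof -
    have "1 / (4 * v) < 1 / (4 * u)" using that by (simp add: divide_simps)
    then show ?thesis using that by (simp add: squash_eq)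
  qed
  have c: "squash u < squash v" if "u < v" "- 1/2 \<le> u" "v \<le> 1/2" for u v
    using that by (simp add: squash_eq)
  have d: "squash u < squash v" if "u < v" "- 1/2 \<le> u" for u v
    using that a[of u v] a[of "1/2" v] c[of u v] c[of u "1/2"] by linarith
  show "squash x < squash y"
    using xy b[of x y] b[of x "- 1/2"] d[of x y] d[of "- 1/2" y] by linarith
qed

text \<open>Charts are parametrised by the whole plane, so restricting one to a small neighbourhood
  means composing it with an embedding of the plane onto an open square. Near 0 the embedding is the
  identity, which keeps straight rays straight.\<close>

definition box_map :: "complex \<Rightarrow> complex" where
  "box_map w = Complex (squash (Re w)) (squash (Im w))"

lemma continuous_box_map: "continuous_on S box_map"
  unfolding box_map_def
  by (intro continuous_on_Complex continuous_on_compose2[OF continuous_squash] continuous_intros) auto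

lemma inj_box_map: "inj box_map"
  using strict_mono_eq[OF strict_mono_squash] by (auto simp: inj_def box_map_def complex_eq_iff)

lemma local_degree_box_map: "local_degree box_map z 1"
  unfolding box_map_def[abs_def] by (rule local_degree_box[OF strict_mono_squash continuous_squash strict_mono_squash continuous_squash])

lemma norm_box_map: "norm (box_map w) < 2"
  using norm_complex_def[of "box_map w"] cmod_le[of "box_map w"] squash_bound[of "Re w"] squash_bound[of "Im w"]
  by (simp add: box_map_def)

lemma box_map_id: "norm w \<le> 1/2 \<Longrightarrow> box_map w = w"
  using abs_Re_le_cmod[of w] abs_Im_le_cmod[of w] by (simp add: box_map_def squash_eq complex_eq_iff)

lemma shrink_chart:
  assumes "orientation X C" "e \<in> C" "r > 0"
  shows "(\<lambda>w. e (z + of_real r * box_map w)) \<in> C"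
proof -
  let ?\<phi> = "\<lambda>w. z + of_real r * box_map w"
  have d: "local_degree ((\<lambda>w. z + of_real r * w) \<circ> box_map) u (1 * 1)" for u
  proof (rule local_degree_compose[OF local_degree_box_map])
    show "local_degree (\<lambda>w. z + of_real r * w) (box_map u) 1"
      by (rule local_degree_deriv[where c = "of_real r" and R = 1])
         (use assms(3) in \<open>auto intro!: derivative_eq_intros continuous_intros\<close>)
    show "isCont box_map u" using continuous_box_map[of UNIV] by (simp add: continuous_on_eq_continuous_at)
  qed
  have "e \<circ> ?\<phi> \<in> C"
  proof (rule chart_reparametrize[OF assms(1,2)])
    show "continuous_on UNIV ?\<phi>" by (intro continuous_intros continuous_box_map)
    show "inj ?\<phi>" using assms(3) injD[OF inj_box_map] by (auto simp: inj_def)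
  qed (use d in \<open>simp add: o_def\<close>)
  then show ?thesis by (simp add: o_def)
qed

text \<open>A one-sided tangent for the topological category. Only the ray is recorded and not the
  progress along it, so that the notion survives changes of parameter.\<close>

definition departs :: "(complex \<Rightarrow> 'a) \<Rightarrow> complex \<Rightarrow> complex \<Rightarrow> (real \<Rightarrow> 'a) \<Rightarrow> bool" where
  "departs e z v p \<longleftrightarrow> (\<exists>\<delta>>0. \<forall>x. 0 < x \<and> x < \<delta> \<longrightarrow> (\<exists>\<rho>>0. p x = e (z + of_real \<rho> * v)))"

text \<open>Weaker than \<open>transverse_at\<close>: any two independent directions are allowed,
  and the chart need not match the parametrisations. This is the form that passes through all moves.
  The sign is the orientation of the direction at s followed by the direction at t.\<close>

definition crosses :: "(complex \<Rightarrow> 'a) set \<Rightarrow> (real \<Rightarrow> 'a) \<Rightarrow> real \<Rightarrow> real \<Rightarrow> int \<Rightarrow> bool" where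
  "crosses C c s t \<sigma> \<longleftrightarrow> (\<exists>e\<in>C. \<exists>z v w. c s = e z \<and> c t = e z \<and>
     departs e z v (\<lambda>x. c (s + x)) \<and> departs e z (- v) (\<lambda>x. c (s - x)) \<and>
     departs e z w (\<lambda>x. c (t + x)) \<and> departs e z (- w) (\<lambda>x. c (t - x)) \<and>
     Im (cnj v * w) \<noteq> 0 \<and> \<sigma> = (if Im (cnj v * w) > 0 then 1 else - 1))"

text \<open>The position on the ray depends continuously on the parameter, because charts are open
  maps, and it starts at 0; by the intermediate value theorem an initial piece of the ray is
  filled.\<close>

lemma departs_covers:
  assumes e: "plane_chart X e" and p: "continuous_map (top_of_set {0..}) X p" and p0: "p 0 = e z"
    and d: "departs e z v p" and "v \<noteq> 0" and "\<delta> > 0"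
  obtains \<rho> where "\<rho> > 0" "\<And>a. 0 < a \<Longrightarrow> a < \<rho> \<Longrightarrow> \<exists>x. 0 < x \<and> x < \<delta> \<and> p x = e (z + of_real a * v)"
proof -
  obtain \<delta>' where d': "\<delta>' > 0" "\<And>x. 0 < x \<Longrightarrow> x < \<delta>' \<Longrightarrow> \<exists>\<rho>>0. p x = e (z + of_real \<rho> * v)"
    using d by (auto simp: departs_def)
  define m where "m = min \<delta> \<delta>' / 2"
  have m: "0 < m" "m < \<delta>" "m < \<delta>'" using d'(1) \<open>\<delta> > 0\<close> by (auto simp: m_def)
  have ij: "inj e" using e by (simp add: plane_chart_iff)
  have "\<exists>\<rho>\<ge>0. p x = e (z + of_real \<rho> * v) \<and> (\<rho> = 0 \<longleftrightarrow> x = 0)" if x: "x \<in> {0..m}" for x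
  proof (cases "x = 0")
    case False
    then obtain \<rho> where "\<rho> > 0" "p x = e (z + of_real \<rho> * v)" using d'(2)[of x] x m by auto
    then show ?thesis using False by (intro exI[of _ \<rho>]) auto
  qed (use p0 in auto)
  then obtain f where f: "\<And>x. x \<in> {0..m} \<Longrightarrow> f x \<ge> 0 \<and> p x = e (z + of_real (f x) * v) \<and> (f x = 0 \<longleftrightarrow> x = 0)"
    by metis
  have "continuous_on {0..m} (\<lambda>x. z + of_real (f x) * v)"
    unfolding continuous_on_open_invariant
  proof (intro allI impI)
    fix B :: "complex set" assume "open B"
    then have oB: "openin X (e ` B)" using e by (simp add: plane_chart_iff)
    have "continuous_map (top_of_set {0..m}) X p"
      using continuous_map_from_subtopology_mono[OF p, of "{0..m}"] by (simp add: subset_iff)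
    then have "openin (top_of_set {0..m}) {x \<in> topspace (top_of_set {0..m}). p x \<in> e ` B}"
      using oB by (rule openin_continuous_map_preimage)
    then have "openin (top_of_set {0..m}) {x \<in> {0..m}. p x \<in> e ` B}" by simp
    then obtain A where A: "open A" "{x \<in> {0..m}. p x \<in> e ` B} = {0..m} \<inter> A" unfolding openin_open by blast
    have "A \<inter> {0..m} = (\<lambda>x. z + of_real (f x) * v) -` B \<inter> {0..m}"
    proof (intro set_eqI iffI)
      fix x assume x: "x \<in> A \<inter> {0..m}"
      then have "p x \<in> e ` B" using A(2) by blast
      then show "x \<in> (\<lambda>x. z + of_real (f x) * v) -` B \<inter> {0..m}" using f[of x] x ij by (auto dest: injD)
    next
      fix x assume x: "x \<in> (\<lambda>x. z + of_real (f x) * v) -` B \<inter> {0..m}"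
      then have "p x \<in> e ` B" using f[of x] by auto
      then show "x \<in> A \<inter> {0..m}" using A(2) x by blast
    qed
    then show "\<exists>A. open A \<and> A \<inter> {0..m} = (\<lambda>x. z + of_real (f x) * v) -` B \<inter> {0..m}" using A(1) by blast
  qed
  then have "continuous_on {0..m} (\<lambda>x. Re ((z + of_real (f x) * v - z) / v))"
    by (intro continuous_on_Re continuous_on_divide continuous_on_diff continuous_on_const) (use \<open>v \<noteq> 0\<close> in auto)
  then have cf: "continuous_on {0..m} f" using \<open>v \<noteq> 0\<close> by simp
  show ?thesis
  proof (rule that[of "f m"])
    show "f m > 0" using f[of m] m by (auto simp: less_le)
    fix a assume a: "0 < a" "a < f m"
    have "f 0 = 0" using f[of 0] m by auto
    then obtain x where x: "x \<ge> 0" "x \<le> m" "f x = a" using IVT'[of f 0 a m] cf a m by auto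
    then have "x \<noteq> 0" using a \<open>f 0 = 0\<close> by auto
    then show "\<exists>x. 0 < x \<and> x < \<delta> \<and> p x = e (z + of_real a * v)" using x m f[of x] by (intro exI[of _ x]) auto
  qed
qed

lemma curve_half:
  assumes "continuous_map euclideanreal X c"
  shows "continuous_map (top_of_set {0..}) X (\<lambda>x. c (s + x))" "continuous_map (top_of_set {0..}) X (\<lambda>x. c (s - x))"
  by (rule continuous_map_compose[OF _ assms, unfolded o_def];
      simp add: continuous_map_iff_continuous continuous_on_add continuous_on_diff; intro continuous_intros)+

text \<open>If two charts show the same pair of branches, the ray from the first point to a nearby point of
  the second one is determined.\<close>

lemma departs_transfer:
  assumes e: "plane_chart X e" and e': "plane_chart X e'" and p: "continuous_map (top_of_set {0..}) X p"
    and p0: "p 0 = e z" "p 0 = e' z'" and d: "departs e z v p" "departs e' z' v' p" and "v \<noteq> 0"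
  obtains \<rho> where "\<rho> > 0" "\<And>a. 0 < a \<Longrightarrow> a < \<rho> \<Longrightarrow> \<exists>b>0. e (z + of_real a * v) = e' (z' + of_real b * v')"
proof -
  obtain \<delta>' where d': "\<delta>' > 0" "\<And>x. 0 < x \<and> x < \<delta>' \<Longrightarrow> \<exists>\<rho>>0. p x = e' (z' + of_real \<rho> * v')"
    using d(2) by (auto simp: departs_def)
  obtain \<rho> where r: "\<rho> > 0" "\<And>a. 0 < a \<Longrightarrow> a < \<rho> \<Longrightarrow> \<exists>x. 0 < x \<and> x < \<delta>' \<and> p x = e (z + of_real a * v)"
    by (rule departs_covers[OF e p p0(1) d(1) \<open>v \<noteq> 0\<close> d'(1)]) (rule that)
  show ?thesis
  proof (rule that[OF r(1)])
    fix a assume "0 < a" "a < \<rho>"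
    then obtain x where x: "0 < x" "x < \<delta>'" "p x = e (z + of_real a * v)" using r(2) by blast
    then obtain b where "b > 0" "p x = e' (z' + of_real b * v')" using d'(2)[of x] by auto
    then show "\<exists>b>0. e (z + of_real a * v) = e' (z' + of_real b * v')" using x(3) by metis
  qed
qed

text \<open>A point off an axis can be joined parallel to the other axis, without touching the
  first, to a point where the sign of the corresponding coordinate of f is known. So f preserves the
  signs of both coordinates, and the straight homotopy to the identity avoids 0.\<close>

lemma local_degree_axes:
  assumes "R > 0" and cont: "continuous_on (ball 0 R) f"
    and re: "\<And>x. \<bar>x\<bar> < R \<Longrightarrow> Im (f (of_real x)) = 0 \<and> sgn (Re (f (of_real x))) = sgn x"
    and im: "\<And>x. \<bar>x\<bar> < R \<Longrightarrow> Re (f (\<i> * of_real x)) = 0 \<and> sgn (Im (f (\<i> * of_real x))) = sgn x"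
    and re0: "\<And>u. u \<in> ball 0 R \<Longrightarrow> Re (f u) = 0 \<Longrightarrow> Re u = 0"
    and im0: "\<And>u. u \<in> ball 0 R \<Longrightarrow> Im (f u) = 0 \<Longrightarrow> Im u = 0"
  shows "local_degree f 0 1"
proof (rule local_degree_compare[OF local_degree_id \<open>R > 0\<close> cont])
  have f0: "f 0 = 0" using re[of 0] \<open>R > 0\<close> by (simp add: complex_eq_iff sgn_eq_0_iff)
  have const: "sgn (h x) = sgn (h y)"
    if "connected S" "continuous_on S h" "\<And>u. u \<in> S \<Longrightarrow> h u \<noteq> (0::real)" "x \<in> S" "y \<in> S" for S :: "complex set" and h x y
  proof (rule ccontr)
    assume "sgn (h x) \<noteq> sgn (h y)"
    then have "0 \<in> h ` S"
      using connectedD_interval[OF connected_continuous_image[OF that(2,1)], of "h x" "h y" 0]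
        connectedD_interval[OF connected_continuous_image[OF that(2,1)], of "h y" "h x" 0] that(3)[OF that(4)] that(3)[OF that(5)] that(4,5)
      by (auto simp: sgn_if split: if_splits)
    then show False using that(3) by auto
  qed
  have sRe: "sgn (Re (f u)) = sgn (Re u)" if u: "u \<in> ball 0 R" for u
  proof (cases "Re u = 0")
    case True
    then have "u = \<i> * of_real (Im u)" by (simp add: complex_eq_iff)
    moreover have "\<bar>Im u\<bar> < R" using u abs_Im_le_cmod[of u] by (simp add: dist_norm)
    ultimately show ?thesis using im[of "Im u"] True by simp
  next
    case False
    have R: "\<bar>Re u\<bar> < R" using u abs_Re_le_cmod[of u] by (simp add: dist_norm)
    let ?x = "complex_of_real (Re u)"
    have seg: "y \<in> ball 0 R \<and> Re y = Re u" if "y \<in> closed_segment u ?x" for y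
    proof
      show "y \<in> ball 0 R" using closed_segment_subset[of u "ball 0 R" ?x] u R that by auto
    qed (use that in \<open>auto simp: closed_segment_def left_diff_distrib\<close>)
    have "sgn (Re (f u)) = sgn (Re (f ?x))"
    proof (rule const[of "closed_segment u ?x" "\<lambda>y. Re (f y)"])
      show "continuous_on (closed_segment u ?x) (\<lambda>y. Re (f y))"
        using seg by (intro continuous_on_Re continuous_on_Im continuous_on_subset[OF cont]) blast
      show "Re (f y) \<noteq> 0" if "y \<in> closed_segment u ?x" for y using re0 seg[OF that] False by metis
    qed auto
    then show ?thesis using re[OF R] by simp
  qed
  have sIm: "sgn (Im (f u)) = sgn (Im u)" if u: "u \<in> ball 0 R" for u
  proof (cases "Im u = 0")
    case True
    then have "u = of_real (Re u)" by (simp add: complex_eq_iff)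
    moreover have "\<bar>Re u\<bar> < R" using u abs_Re_le_cmod[of u] by (simp add: dist_norm)
    ultimately show ?thesis using re[of "Re u"] True by simp
  next
    case False
    have R: "\<bar>Im u\<bar> < R" using u abs_Im_le_cmod[of u] by (simp add: dist_norm)
    let ?x = "\<i> * complex_of_real (Im u)"
    have seg: "y \<in> ball 0 R \<and> Im y = Im u" if "y \<in> closed_segment u ?x" for y
    proof
      show "y \<in> ball 0 R" using closed_segment_subset[of u "ball 0 R" ?x] u R that by (auto simp: norm_mult)
    qed (use that in \<open>auto simp: closed_segment_def left_diff_distrib\<close>)
    have "sgn (Im (f u)) = sgn (Im (f ?x))"
    proof (rule const[of "closed_segment u ?x" "\<lambda>y. Im (f y)"])
      show "continuous_on (closed_segment u ?x) (\<lambda>y. Im (f y))"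
        using seg by (intro continuous_on_Re continuous_on_Im continuous_on_subset[OF cont]) blast
      show "Im (f y) \<noteq> 0" if "y \<in> closed_segment u ?x" for y using im0 seg[OF that] False by metis
    qed auto
    then show ?thesis using im[OF R] by simp
  qed
  have combo: "(x::real) = 0" if h: "(1 - t) * x + t * y = 0" "sgn y = sgn x" "0 \<le> t" "t \<le> 1" for x y t
  proof (rule ccontr)
    assume "x \<noteq> 0"
    then consider "x > 0" "y > 0" | "x < 0" "y < 0" using h(2) by (auto simp: sgn_if split: if_splits)
    then show False
    proof cases
      case 1
      then have "(1 - t) * x \<ge> 0" "t * y \<ge> 0" using h by auto
      then have "(1 - t) * x = 0" "t * y = 0" using h(1) by linarith+
      then show False using 1 by auto
    next
      case 2
      then have "(1 - t) * x \<le> 0" "t * y \<le> 0" using h by (auto intro: mult_nonneg_nonpos)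
      then have "(1 - t) * x = 0" "t * y = 0" using h(1) by linarith+
      then show False using 2 by auto
    qed
  qed
  fix w :: complex assume w: "w \<in> ball 0 R" "w \<noteq> 0"
  show "0 \<notin> closed_segment (w - 0) (f w - f 0)"
  proof
    assume "0 \<in> closed_segment (w - 0) (f w - f 0)"
    then obtain t where t: "0 \<le> t" "t \<le> 1" "(1 - t) * Re w + t * Re (f w) = 0" "(1 - t) * Im w + t * Im (f w) = 0"
      by (auto simp: closed_segment_def f0 complex_eq_iff)
    then have "Re w = 0" "Im w = 0" using combo sRe[OF w(1)] sIm[OF w(1)] by blast+
    then show False using w(2) by (simp add: complex_eq_iff)
  qed
qed

text \<open>Affine coordinates with origin z and axes v and w. The inverse \<open>unframe\<close> is
  Cramer's rule, with \<open>Im (cnj v * w)\<close> as the determinant of v and w.\<close>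

definition frame :: "complex \<Rightarrow> complex \<Rightarrow> complex \<Rightarrow> complex \<Rightarrow> complex" where
  "frame z v w u = z + of_real (Re u) * v + of_real (Im u) * w"

definition unframe :: "complex \<Rightarrow> complex \<Rightarrow> complex \<Rightarrow> complex \<Rightarrow> complex" where
  "unframe z v w y = Complex (Im (cnj (y - z) * w) / Im (cnj v * w)) (Im (cnj v * (y - z)) / Im (cnj v * w))"

lemma frame_unframe:
  assumes "Im (cnj v * w) \<noteq> 0"
  shows "unframe z v w (frame z v w u) = u" "frame z v w (unframe z v w y) = y"
proof -
  have 1: "Im (cnj (frame z v w u - z) * w) = Re u * Im (cnj v * w)" "Im (cnj v * (frame z v w u - z)) = Im u * Im (cnj v * w)"
    by (simp_all add: frame_def algebra_simps)
  show "unframe z v w (frame z v w u) = u" unfolding unframe_def 1 using assms by (simp add: complex_eq_iff)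
  define D where "D = Im (cnj v * w)"
  have D: "D = Re v * Im w - Im v * Re w" "D \<noteq> 0" using assms by (auto simp: D_def)
  have "of_real D * frame z v w (unframe z v w y) = of_real D * y"
    unfolding frame_def unframe_def D_def[symmetric] using D(2)
    by (simp add: complex_eq_iff field_simps) (simp add: D(1) algebra_simps)
  then show "frame z v w (unframe z v w y) = y" using D(2) by simp
qed

lemma continuous_frame: "continuous_on S (frame z v w)" "continuous_on S (unframe z v w)"
  unfolding frame_def unframe_def divide_inverse by (intro continuous_intros continuous_on_Complex)+

lemma local_degree_frame:
  assumes "Im (cnj v * w) \<noteq> 0"
  shows "local_degree (frame z v w) 0 (if Im (cnj v * w) > 0 then 1 else - 1)"
proof -
  have v: "v \<noteq> 0" using assms by auto
  define q where "q = Im (w / v)"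
  have q: "q = Im (cnj v * w) / (norm v)\<^sup>2"
    using v by (simp add: q_def Im_divide cmod_def power2_eq_square algebra_simps)
  then have q0: "q \<noteq> 0" "q > 0 \<longleftrightarrow> Im (cnj v * w) > 0"
    using assms v by (auto simp: zero_less_divide_iff)
  \<comment> \<open>After division by v the frame is a shear of this diagonal map, and q has the
    sign of the determinant. A negative q is reduced to a positive one by conjugation.\<close>
  define S where "S u = Complex (Re u) (q * Im u)" for u
  have dS: "local_degree S 0 (if q > 0 then 1 else - 1)"
  proof (cases "q > 0")
    case True
    have "local_degree (\<lambda>u. Complex (Re u) (q * Im u)) 0 1"
      by (rule local_degree_box[where k = "\<lambda>x. x"])
         (use True in \<open>auto simp: strict_mono_def intro!: continuous_intros\<close>)
    then show ?thesis using True unfolding S_def[abs_def] by simp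
  next
    case False
    have "local_degree (\<lambda>u. Complex (Re u) (- q * Im u)) (cnj 0) 1"
      by (rule local_degree_box[where k = "\<lambda>x. x"])
         (use False q0 in \<open>auto simp: strict_mono_def intro!: continuous_intros\<close>)
    then have "local_degree ((\<lambda>u. Complex (Re u) (- q * Im u)) \<circ> cnj) 0 (1 * - 1)"
      by (rule local_degree_compose[OF local_degree_cnj]) (intro continuous_intros)
    then show ?thesis using False by (simp add: S_def[abs_def] o_def)
  qed
  define p where "p = w / v"
  have qp: "q = Im p" by (simp add: q_def p_def)
  have d1: "local_degree (\<lambda>u. of_real (Re u) + of_real (Im u) * p) 0 (if q > 0 then 1 else - 1)"
  proof (rule local_degree_compare[OF dS zero_less_one])
    show "continuous_on (ball 0 1) (\<lambda>u. complex_of_real (Re u) + complex_of_real (Im u) * p)"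
      by (intro continuous_intros)
    fix u :: complex assume u: "u \<noteq> 0"
    show "0 \<notin> closed_segment (S u - S 0)
       (of_real (Re u) + of_real (Im u) * p - (of_real (Re 0) + of_real (Im 0) * p))"
    proof
      assume "0 \<in> closed_segment (S u - S 0)
       (of_real (Re u) + of_real (Im u) * p - (of_real (Re 0) + of_real (Im 0) * p))"
      then obtain t where t: "(1 - t) * Re u + t * (Re u + Im u * Re p) = 0" "(1 - t) * (q * Im u) + t * (Im u * q) = 0"
        unfolding closed_segment_def S_def qp by (auto simp: complex_eq_iff)
      have "q * Im u = 0" using t(2) by (simp add: algebra_simps)
      then have "Im u = 0" using q0 by simp
      moreover then have "Re u = 0" using t(1) by (simp add: algebra_simps)
      ultimately show False using u by (simp add: complex_eq_iff)
    qed
  qed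
  have "local_degree (\<lambda>y. z + v * y) y 1" for y
    by (rule local_degree_deriv[where c = v and R = 1])
       (use v in \<open>auto intro!: derivative_eq_intros continuous_intros\<close>)
  from local_degree_compose[OF d1 this]
  have "local_degree ((\<lambda>y. z + v * y) \<circ> (\<lambda>u. of_real (Re u) + of_real (Im u) * p)) 0 (1 * (if q > 0 then 1 else - 1))"
    by (rule meta_mp) (auto intro!: continuous_intros linear_continuous_at bounded_linear_Re bounded_linear_Im)
  moreover have "(\<lambda>y. z + v * y) \<circ> (\<lambda>u. of_real (Re u) + of_real (Im u) * p) = frame z v w"
    using v by (auto simp: p_def frame_def fun_eq_iff algebra_simps)
  ultimately show ?thesis using q0(2) by simp
qed


lemma departs_both:
  assumes e: "plane_chart X e" and e': "plane_chart X e'" and p: "continuous_map (top_of_set {0..}) X p"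
    and p0: "p 0 = e z" "p 0 = e' z'" and d: "departs e z v p" "departs e' z' v' p" and v: "v \<noteq> 0" "v' \<noteq> 0"
  shows "\<exists>\<rho>>0. \<forall>a. 0 < a \<and> a < \<rho> \<longrightarrow> (\<exists>b>0. e (z + of_real a * v) = e' (z' + of_real b * v')) \<and>
     (\<exists>b>0. e' (z' + of_real a * v') = e (z + of_real b * v))"
proof -
  obtain \<rho> where "\<rho> > 0" "\<And>a. 0 < a \<Longrightarrow> a < \<rho> \<Longrightarrow> \<exists>b>0. e (z + of_real a * v) = e' (z' + of_real b * v')"
    by (rule departs_transfer[OF e e' p p0 d v(1)]) (rule that)
  moreover obtain \<rho>' where "\<rho>' > 0" "\<And>a. 0 < a \<Longrightarrow> a < \<rho>' \<Longrightarrow> \<exists>b>0. e' (z' + of_real a * v') = e (z + of_real b * v)"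
    by (rule departs_transfer[OF e' e p p0(2,1) d(2,1) v(2)]) (rule that)
  ultimately show ?thesis by (intro exI[of _ "min \<rho> \<rho>'"]) auto
qed

text \<open>Written in the frames of two charts, the transition map sends each half-axis to the
  corresponding half-axis near 0, and only points of the axes to the axes; so it has degree 1. The
  transition map itself has degree 1 by compatibility, hence both frames have the same
  orientation.\<close>

theorem crosses_unique:
  assumes C: "orientation X C" and c: "continuous_map euclideanreal X c"
    and 1: "crosses C c s t \<sigma>" and 2: "crosses C c s t \<sigma>'"
  shows "\<sigma> = \<sigma>'"
proof -
  obtain e z v w where e: "e \<in> C" "c s = e z" "c t = e z"
     "departs e z v (\<lambda>x. c (s + x))" "departs e z (- v) (\<lambda>x. c (s - x))"
     "departs e z w (\<lambda>x. c (t + x))" "departs e z (- w) (\<lambda>x. c (t - x))"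
     "Im (cnj v * w) \<noteq> 0" "\<sigma> = (if Im (cnj v * w) > 0 then 1 else - 1)"
    using 1 unfolding crosses_def by blast
  obtain e' z' v' w' where e': "e' \<in> C" "c s = e' z'" "c t = e' z'"
     "departs e' z' v' (\<lambda>x. c (s + x))" "departs e' z' (- v') (\<lambda>x. c (s - x))"
     "departs e' z' w' (\<lambda>x. c (t + x))" "departs e' z' (- w') (\<lambda>x. c (t - x))"
     "Im (cnj v' * w') \<noteq> 0" "\<sigma>' = (if Im (cnj v' * w') > 0 then 1 else - 1)"
    using 2 unfolding crosses_def by blast
  have ch: "plane_chart X e" "plane_chart X e'" using orientationD(1)[OF C] e(1) e'(1) by auto
  have ij: "inj e" "inj e'" using ch by (auto simp: plane_chart_iff)
  define g where "g = inv e' \<circ> e"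
  define U where "U = e -` range e'"
  note T = transition_map[OF ch, folded g_def U_def]
  have eg: "e' (g u) = e u" if "u \<in> U" for u using T(4)[of u] that by (simp add: U_def)
  have ge: "g u = y" if "e u = e' y" for u y using that ij by (simp add: g_def)
  have dg: "local_degree g z 1"
    using orientationD(2)[OF C e(1) e'(1), of z z'] e(2) e'(2) by (simp add: g_def)
  have nz: "v \<noteq> 0" "w \<noteq> 0" "v' \<noteq> 0" "w' \<noteq> 0" using e(8) e'(8) by auto
  note h = curve_half[OF c, of s] curve_half[OF c, of t]
  \<comment> \<open>Two directions are needed: from e to e' one learns where the half-axes go, and
    from e' to e that nothing else is mapped into the axes.\<close>
  define both where "both k k' \<rho> \<longleftrightarrow> (\<forall>a. 0 < a \<and> a < \<rho> \<longrightarrow> (\<exists>b>0. e (z + of_real a * k) = e' (z' + of_real b * k')) \<and>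
     (\<exists>b>0. e' (z' + of_real a * k') = e (z + of_real b * k)))" for k k' and \<rho> :: real
  obtain \<rho>1 where r1: "\<rho>1 > 0" "both v v' \<rho>1"
    using departs_both[OF ch h(1) _ _ e(4) e'(4) nz(1,3)] e(2) e'(2) unfolding both_def by auto
  obtain \<rho>2 where r2: "\<rho>2 > 0" "both (- v) (- v') \<rho>2"
    using departs_both[OF ch h(2) _ _ e(5) e'(5)] nz e(2) e'(2) unfolding both_def by auto
  obtain \<rho>3 where r3: "\<rho>3 > 0" "both w w' \<rho>3"
    using departs_both[OF ch h(3) _ _ e(6) e'(6) nz(2,4)] e(3) e'(3) unfolding both_def by auto
  obtain \<rho>4 where r4: "\<rho>4 > 0" "both (- w) (- w') \<rho>4"
    using departs_both[OF ch h(4) _ _ e(7) e'(7)] nz e(3) e'(3) unfolding both_def by auto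
  define \<rho> where "\<rho> = min (min \<rho>1 \<rho>2) (min \<rho>3 \<rho>4)"
  have "\<rho> > 0" using r1 r2 r3 r4 by (simp add: \<rho>_def)
  have b: "both v v' \<rho>" "both (- v) (- v') \<rho>" "both w w' \<rho>" "both (- w) (- w') \<rho>"
    using r1 r2 r3 r4 unfolding both_def \<rho>_def by auto
  have bA: "\<exists>b>0. e (z + of_real a * k) = e' (z' + of_real b * k')" if "both k k' \<rho>" "0 < a" "a < \<rho>" for a k k'
    using that unfolding both_def by blast
  have bB: "\<exists>b>0. e' (z' + of_real a * k') = e (z + of_real b * k)" if "both k k' \<rho>" "0 < a" "a < \<rho>" for a k k'
    using that unfolding both_def by blast
  let ?T = "frame z v w" and ?T' = "frame z' v' w'"
  define f where "f u = unframe z' v' w' (g (?T u))" for u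
  have T0: "?T 0 = z" "?T' 0 = z'" by (simp_all add: frame_def)
  have zU: "z \<in> U" unfolding U_def vimage_def using e(2) e'(2) by (metis mem_Collect_eq rangeI)
  have gz: "g z = z'" using ge e(2) e'(2) by metis
  have f0: "f 0 = 0" using frame_unframe(1)[OF e'(8), of z' 0] by (simp add: f_def T0 gz)
  have T'f: "?T' (f u) = g (?T u)" for u by (simp add: f_def frame_unframe[OF e'(8)])
  have "open (?T -` U)" using T(1) continuous_frame(1)[of UNIV] by (simp add: continuous_on_open_vimage)
  moreover have cf: "continuous_on (?T -` U) f" unfolding f_def
    by (intro continuous_on_compose2[OF continuous_frame(2)[of UNIV]] continuous_on_compose2[OF T(2)] continuous_frame) auto
  ultimately have "open (f -` ball 0 \<rho> \<inter> ?T -` U)" by (simp add: continuous_on_open_vimage)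
  moreover have "0 \<in> f -` ball 0 \<rho> \<inter> ?T -` U" using T0 zU f0 \<open>\<rho> > 0\<close> by simp
  ultimately obtain R0 where R0: "R0 > 0" "ball 0 R0 \<subseteq> f -` ball 0 \<rho> \<inter> ?T -` U" using open_contains_ball by blast
  define R where "R = min R0 \<rho>"
  have R: "R > 0" "R \<le> \<rho>" using R0 \<open>\<rho> > 0\<close> by (auto simp: R_def)
  have RU: "?T u \<in> U" "norm (f u) < \<rho>" if "u \<in> ball 0 R" for u using that R0(2) by (auto simp: R_def)
  have key: "f u = u'" if "e (?T u) = e' (?T' u')" for u u'
    using ge[OF that] frame_unframe(1)[OF e'(8)] by (simp add: f_def)
  have bk: "u = y" if "u \<in> ball 0 R" "e' (?T' (f u)) = e (?T y)" for u y
  proof -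
    have "e (?T u) = e (?T y)" using eg[OF RU(1)[OF that(1)]] that(2) T'f by simp
    then have "?T u = ?T y" using ij by (auto dest: injD)
    then show ?thesis using frame_unframe(1)[OF e(8)] by metis
  qed
  have df: "local_degree f 0 1"
  proof (rule local_degree_axes[OF R(1)])
    show "continuous_on (ball 0 R) f" by (rule continuous_on_subset[OF cf]) (use RU in auto)
    show "Im (f (of_real x)) = 0 \<and> sgn (Re (f (of_real x))) = sgn x" if xR: "\<bar>x\<bar> < R" for x
    proof -
      consider "x = 0" | "x > 0" | "x < 0" by linarith
      then show ?thesis
      proof cases
        case 2
        then obtain b where "b > 0" "e (z + of_real x * v) = e' (z' + of_real b * v')"
          using bA[OF b(1), of "x"] xR R by auto
        then have "f (of_real x) = of_real b" by (intro key) (simp add: frame_def)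
        then show ?thesis using 2 \<open>b > 0\<close> by simp
      next
        case 3
        then obtain b where "b > 0" "e (z + of_real (- x) * - v) = e' (z' + of_real b * - v')"
          using bA[OF b(2), of "- x"] xR R by auto
        then have "f (of_real x) = of_real (- b)" by (intro key) (simp add: frame_def)
        then show ?thesis using 3 \<open>b > 0\<close> by simp
      qed (simp add: f0)
    qed
    show "Re (f (\<i> * of_real x)) = 0 \<and> sgn (Im (f (\<i> * of_real x))) = sgn x" if xR: "\<bar>x\<bar> < R" for x
    proof -
      consider "x = 0" | "x > 0" | "x < 0" by linarith
      then show ?thesis
      proof cases
        case 2
        then obtain b where "b > 0" "e (z + of_real x * w) = e' (z' + of_real b * w')"
          using bA[OF b(3), of "x"] xR R by auto
        then have "f (\<i> * of_real x) = \<i> * of_real b" by (intro key) (simp add: frame_def)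
        then show ?thesis using 2 \<open>b > 0\<close> by simp
      next
        case 3
        then obtain b where "b > 0" "e (z + of_real (- x) * - w) = e' (z' + of_real b * - w')"
          using bA[OF b(4), of "- x"] xR R by auto
        then have "f (\<i> * of_real x) = \<i> * of_real (- b)" by (intro key) (simp add: frame_def)
        then show ?thesis using 3 \<open>b > 0\<close> by simp
      qed (simp add: f0)
    qed
    fix u :: complex assume u: "u \<in> ball 0 R"
    have ab: "\<bar>Re (f u)\<bar> < \<rho>" "\<bar>Im (f u)\<bar> < \<rho>"
      using RU(2)[OF u] abs_Re_le_cmod[of "f u"] abs_Im_le_cmod[of "f u"] by linarith+
    show "Re u = 0" if "Re (f u) = 0"
    proof -
      consider "Im (f u) = 0" | "Im (f u) > 0" | "Im (f u) < 0" by linarith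
      then show ?thesis
      proof cases
        case 1
        then have "?T' (f u) = z'" using that by (simp add: frame_def)
        then have "u = 0" using bk[OF u, of 0] e(2) e'(2) T0 by simp
        then show ?thesis by simp
      next
        case 2
        then obtain b where "e' (z' + of_real (Im (f u)) * w') = e (z + of_real b * w)"
          using bB[OF b(3), of "Im (f u)"] ab by auto
        then have "u = \<i> * of_real b" using that by (intro bk[OF u]) (simp add: frame_def)
        then show ?thesis by simp
      next
        case 3
        then obtain b where "e' (z' + of_real (- Im (f u)) * - w') = e (z + of_real b * - w)"
          using bB[OF b(4), of "- Im (f u)"] ab by auto
        then have "u = \<i> * of_real (- b)" using that by (intro bk[OF u]) (simp add: frame_def)
        then show ?thesis by simp
      qed
    qed
    show "Im u = 0" if "Im (f u) = 0"
    proof -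
      consider "Re (f u) = 0" | "Re (f u) > 0" | "Re (f u) < 0" by linarith
      then show ?thesis
      proof cases
        case 1
        then have "?T' (f u) = z'" using that by (simp add: frame_def)
        then have "u = 0" using bk[OF u, of 0] e(2) e'(2) T0 by simp
        then show ?thesis by simp
      next
        case 2
        then obtain b where "e' (z' + of_real (Re (f u)) * v') = e (z + of_real b * v)"
          using bB[OF b(1), of "Re (f u)"] ab by auto
        then have "u = of_real b" using that by (intro bk[OF u]) (simp add: frame_def)
        then show ?thesis by simp
      next
        case 3
        then obtain b where "e' (z' + of_real (- Re (f u)) * - v') = e (z + of_real b * - v)"
          using bB[OF b(2), of "- Re (f u)"] ab by auto
        then have "u = of_real (- b)" using that by (intro bk[OF u]) (simp add: frame_def)
        then show ?thesis by simp
      qed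
    qed
  qed
  have T'd: "local_degree ?T' (f 0) \<sigma>'" using local_degree_frame[OF e'(8)] e'(9) f0 by simp
  have "continuous_on (ball 0 R) f" by (rule continuous_on_subset[OF cf]) (use RU in auto)
  then have "isCont f 0" using R(1) by (simp add: continuous_on_eq_continuous_at)
  then have A: "local_degree (?T' \<circ> f) 0 (\<sigma>' * 1)" by (rule local_degree_compose[OF df T'd])
  have "isCont ?T 0" using continuous_frame(1)[of UNIV] by (simp add: continuous_on_eq_continuous_at)
  moreover have "local_degree ?T 0 \<sigma>" using local_degree_frame[OF e(8)] e(9) by simp
  moreover have "local_degree g (?T 0) 1" using dg T0 by simp
  ultimately have B: "local_degree (g \<circ> ?T) 0 (1 * \<sigma>)" using local_degree_compose by blast
  have "?T' \<circ> f = g \<circ> ?T" using T'f by (simp add: fun_eq_iff)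
  then show ?thesis using local_degree_unique A B by fastforce
qed


section \<open>The Gauss diagram of a diagram\<close>

lemma periodic_int:
  assumes "\<And>t::real. f (t + 1) = f t"
  shows "f (t + of_int n) = f t"
proof (induction n rule: int_induct[of _ 0])
  case (step1 i) then show ?case using assms[of "t + of_int i"] by (simp add: add.assoc)
next
  case (step2 i) then show ?case using assms[of "t + of_int i - 1"] by (simp add: algebra_simps)
qed simp

lemma shift_int:
  assumes "\<And>t::real. h (t + 1) = h t + (1::real)"
  shows "h (t + of_int n) = h t + of_int n"
  using periodic_int[of "\<lambda>t. h t - t" t n] assms by (simp add: algebra_simps)

lemma frac_add_int: "frac (x + of_int n) = frac x"
  by (simp add: frac_def)

lemma frac_cong: "x - y \<in> \<int> \<Longrightarrow> frac x = frac y"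
  by (metis Ints_cases add.commute diff_add_cancel frac_add_int)

text \<open>Running forward from s, the parameter p is reached before t. Parameters count modulo 1;
  the arc contains its start but not its end.\<close>

definition arc :: "real \<Rightarrow> real \<Rightarrow> real \<Rightarrow> bool" where
  "arc s t p \<longleftrightarrow> frac (p - s) < frac (t - s)"

lemma arc_cong:
  assumes "s - s' \<in> \<int>" "t - t' \<in> \<int>" "p - p' \<in> \<int>"
  shows "arc s t p = arc s' t' p'"
proof -
  have "(p - s) - (p' - s') \<in> \<int>" "(t - s) - (t' - s') \<in> \<int>"
    using Ints_diff[OF assms(3,1)] Ints_diff[OF assms(2,1)] by (simp_all add: algebra_simps)
  then show ?thesis unfolding arc_def by (metis frac_cong)
qed

lemma frac_diff_eq:
  fixes a b :: real
  shows "frac (a - b) = (if frac b \<le> frac a then frac a - frac b else frac a - frac b + 1)"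
proof -
  have "frac (a - b) = frac (frac a - frac b)"
    by (rule frac_cong) (simp add: frac_def algebra_simps)
  also have "\<dots> = (if frac b \<le> frac a then frac a - frac b else frac a - frac b + 1)"
  proof (cases "frac b \<le> frac a")
    case True
    then have "0 \<le> frac a - frac b \<and> frac a - frac b < 1" using frac_lt_1[of a] frac_ge_0[of b] by linarith
    then have "frac (frac a - frac b) = frac a - frac b" by (simp only: frac_eq)
    then show ?thesis using True by simp
  next
    case False
    have "frac (frac a - frac b) = frac (frac a - frac b + 1)" by (rule frac_cong) simp
    moreover have "0 \<le> frac a - frac b + 1 \<and> frac a - frac b + 1 < 1"
      using False frac_lt_1[of b] frac_ge_0[of a] by linarith
    then have "frac (frac a - frac b + 1) = frac a - frac b + 1" by (simp only: frac_eq)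
    ultimately show ?thesis using False by simp
  qed
  finally show ?thesis .
qed

lemma arc_swap:
  assumes "s - t \<notin> \<int>" "p - s \<notin> \<int>" "p - t \<notin> \<int>"
  shows "arc t s p \<longleftrightarrow> \<not> arc s t p"
proof -
  have 1: "frac (p - t) = frac ((p - s) - (t - s))" "frac (s - t) = frac (0 - (t - s))" by simp_all
  have "t - s \<notin> \<int>" using assms(1) by (metis Ints_minus minus_diff_eq)
  then have pos: "frac (t - s) > 0" by (simp add: frac_gt_0_iff)
  have f0: "frac (0::real) = 0" by simp
  show ?thesis unfolding arc_def 1 frac_diff_eq[of _ "t - s"] f0
    using pos frac_lt_1[of "p - s"] frac_ge_0[of "p - s"] by (smt (verit))
qed

lemma arc_reflect:
  assumes "p - s \<notin> \<int>" "p - t \<notin> \<int>" "s - t \<notin> \<int>"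
  shows "arc (- s) (- t) (- p) \<longleftrightarrow> \<not> arc s t p"
proof -
  have n: "frac (- x) = 1 - frac x" if "x \<notin> \<int>" for x :: real using that by (simp add: frac_neg)
  have "t - s \<notin> \<int>" using assms(3) by (metis Ints_minus minus_diff_eq)
  then have "arc (- s) (- t) (- p) \<longleftrightarrow> frac (t - s) < frac (p - s)"
    unfolding arc_def using n[of "p - s"] n[of "t - s"] assms(1) by simp
  moreover have "frac (t - s) \<noteq> frac (p - s)"
  proof
    assume "frac (t - s) = frac (p - s)"
    then have "(p - s) - (t - s) = of_int (\<lfloor>p - s\<rfloor> - \<lfloor>t - s\<rfloor>)" by (simp add: frac_def)
    then have "(p - s) - (t - s) \<in> \<int>" by (metis Ints_of_int)
    then show False using assms(2) by simp
  qed
  ultimately show ?thesis unfolding arc_def by linarith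
qed

text \<open>A strictly increasing h that commutes with the shift by 1 is an orientation-preserving
  injection of the circle, and such maps keep cyclic order.\<close>

lemma arc_mono:
  assumes h: "strict_mono h" "\<And>t::real. h (t + 1) = h t + 1"
  shows "arc (h s) (h t) (h p) = arc s t p"
proof -
  have *: "frac (h p - h s) = h (s + frac (p - s)) - h s" for p s
  proof -
    define q where "q = s + frac (p - s)"
    have "p = q + of_int \<lfloor>p - s\<rfloor>" by (simp add: q_def frac_def)
    then have "h p = h q + of_int \<lfloor>p - s\<rfloor>" using shift_int[of h q] h(2) by metis
    then have "frac (h p - h s) = frac (h q - h s)" by (intro frac_cong) simp
    also have "\<dots> = h q - h s"
    proof -
      have "s \<le> q" "q < s + 1" using frac_ge_0[of "p - s"] frac_lt_1[of "p - s"] by (auto simp: q_def)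
      then have "h s \<le> h q" "h q < h (s + 1)" using h(1) by (auto simp: strict_mono_less strict_mono_less_eq)
      then show ?thesis using h(2) by (simp add: frac_eq)
    qed
    finally show ?thesis by (simp add: q_def)
  qed
  show ?thesis unfolding arc_def * using h(1) by (simp add: strict_mono_less)
qed

definition crossing_points :: "'a diagram \<Rightarrow> 'a set" where
  "crossing_points D = {curve D s |s. \<exists>t. double_params (curve D) s t}"

text \<open>The choice is unique modulo 1 only; this suffices because \<open>arc\<close> and
  \<open>crosses\<close> do not change under integer shifts of the parameters.\<close>

definition over_param :: "'a diagram \<Rightarrow> 'a \<Rightarrow> real" where
  "over_param D x = (SOME s. curve D s = x \<and> s \<in> over D)"

definition under_param :: "'a diagram \<Rightarrow> 'a \<Rightarrow> real" where
  "under_param D x = (SOME s. curve D s = x \<and> s \<notin> over D)"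

definition gauss_of :: "'a diagram \<Rightarrow> 'a gauss" where
  "gauss_of D = \<lparr>chords = crossing_points D,
     sign = \<lambda>x. THE \<sigma>. crosses (charts D) (curve D) (over_param D x) (under_param D x) \<sigma>,
     over_in = \<lambda>x y. arc (over_param D x) (under_param D x) (over_param D y),
     under_in = \<lambda>x y. arc (over_param D x) (under_param D x) (under_param D y)\<rparr>"

lemma chords_gauss_of [simp]: "chords (gauss_of D) = crossing_points D"
  by (simp add: gauss_of_def)

lemma diagramsD:
  assumes "D \<in> diagrams"
  shows "orientation (surface D) (charts D)" "continuous_map euclideanreal (surface D) (curve D)"
    "curve D (t + 1) = curve D t" "t + 1 \<in> over D \<longleftrightarrow> t \<in> over D"
    "curve D (t + of_int n) = curve D t" "t + of_int n \<in> over D \<longleftrightarrow> t \<in> over D"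
    "finite (crossing_points D)"
    "curve D r = curve D s \<Longrightarrow> curve D s = curve D t \<Longrightarrow> r - s \<in> \<int> \<or> s - t \<in> \<int> \<or> r - t \<in> \<int>"
    "double_params (curve D) s t \<Longrightarrow> transverse_at (charts D) (curve D) s t"
    "double_params (curve D) s t \<Longrightarrow> s \<in> over D \<longleftrightarrow> t \<notin> over D"
    "s \<in> over D \<Longrightarrow> \<exists>t. double_params (curve D) s t"
proof -
  note D = assms[unfolded diagrams_def closed_oriented_surface_def closed_curve_def
      generic_immersion_def crossing_information_def, simplified]
  show "orientation (surface D) (charts D)" "continuous_map euclideanreal (surface D) (curve D)"
    using D by auto
  show 1: "curve D (t + 1) = curve D t" "t + 1 \<in> over D \<longleftrightarrow> t \<in> over D" for t using D by auto
  show "curve D (t + of_int n) = curve D t" by (rule periodic_int) (rule 1)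
  show "t + of_int n \<in> over D \<longleftrightarrow> t \<in> over D" using periodic_int[of "\<lambda>t. t \<in> over D"] 1(2) by simp
  show "finite (crossing_points D)" using D by (simp add: crossing_points_def)
  show "curve D r = curve D s \<Longrightarrow> curve D s = curve D t \<Longrightarrow> r - s \<in> \<int> \<or> s - t \<in> \<int> \<or> r - t \<in> \<int>" using D by metis
  show "double_params (curve D) s t \<Longrightarrow> transverse_at (charts D) (curve D) s t" using D by metis
  show "double_params (curve D) s t \<Longrightarrow> s \<in> over D \<longleftrightarrow> t \<notin> over D" using D by metis
  show "s \<in> over D \<Longrightarrow> \<exists>t. double_params (curve D) s t" using D by auto
qed

lemma over_cong: "D \<in> diagrams \<Longrightarrow> s - t \<in> \<int> \<Longrightarrow> s \<in> over D \<longleftrightarrow> t \<in> over D"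
  using diagramsD(6)[of D t] by (metis Ints_cases add.commute diff_add_cancel)

lemma curve_cong: "D \<in> diagrams \<Longrightarrow> s - t \<in> \<int> \<Longrightarrow> curve D s = curve D t"
  using diagramsD(5)[of D t] by (metis Ints_cases add.commute diff_add_cancel)

text \<open>In the absence of triple points the passages through a crossing form exactly two classes
  modulo 1, and the crossing information makes one of them the over-passage.\<close>

lemma crossing_params:
  assumes D: "D \<in> diagrams" and x: "x \<in> crossing_points D"
  shows "curve D (over_param D x) = x" "over_param D x \<in> over D"
    "curve D (under_param D x) = x" "under_param D x \<notin> over D"
    "over_param D x - under_param D x \<notin> \<int>"
    "curve D s = x \<Longrightarrow> s \<in> over D \<Longrightarrow> s - over_param D x \<in> \<int>"
    "curve D s = x \<Longrightarrow> s \<notin> over D \<Longrightarrow> s - under_param D x \<in> \<int>"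
proof -
  obtain s0 t0 where st: "x = curve D s0" "double_params (curve D) s0 t0" using x by (auto simp: crossing_points_def)
  then have "curve D t0 = x" by (simp add: double_params_def)
  moreover have "s0 \<in> over D \<longleftrightarrow> t0 \<notin> over D" using diagramsD(10)[OF D st(2)] .
  ultimately have ex: "\<exists>s. curve D s = x \<and> s \<in> over D" "\<exists>s. curve D s = x \<and> s \<notin> over D" using st by metis+
  show o: "curve D (over_param D x) = x" "over_param D x \<in> over D"
    using someI_ex[OF ex(1)] by (auto simp: over_param_def)
  show u: "curve D (under_param D x) = x" "under_param D x \<notin> over D"
    using someI_ex[OF ex(2)] by (auto simp: under_param_def)
  show ou: "over_param D x - under_param D x \<notin> \<int>" using over_cong[OF D] o u by blast
  have tri: "s - over_param D x \<in> \<int> \<or> s - under_param D x \<in> \<int>" if "curve D s = x" for s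
    using diagramsD(8)[OF D, of s "over_param D x" "under_param D x"] that o u ou by auto
  show "s - over_param D x \<in> \<int>" if "curve D s = x" "s \<in> over D" for s
    using tri[OF that(1)] over_cong[OF D, of s "under_param D x"] that u by auto
  show "s - under_param D x \<in> \<int>" if "curve D s = x" "s \<notin> over D" for s
    using tri[OF that(1)] over_cong[OF D, of s "over_param D x"] that o by auto
qed

lemma crossing_pointI:
  assumes D: "D \<in> diagrams" and "curve D s = x" "curve D t = x" "s \<in> over D" "t \<notin> over D"
  shows "x \<in> crossing_points D"
proof -
  have "s - t \<notin> \<int>" using over_cong[OF D] assms by blast
  then have "double_params (curve D) s t" using assms by (simp add: double_params_def)
  then show ?thesis using assms by (auto simp: crossing_points_def)
qed

lemma params_distinct:
  assumes D: "D \<in> diagrams" and x: "x \<in> crossing_points D" "y \<in> crossing_points D" "x \<noteq> y"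
    and "p \<in> {over_param D x, under_param D x}" "q \<in> {over_param D y, under_param D y}"
  shows "p - q \<notin> \<int>"
  using curve_cong[OF D, of p q] crossing_params[OF D x(1)] crossing_params[OF D x(2)] assms by auto

lemma crosses_shift:
  assumes "\<And>t::real. c (t + 1) = c t" "s - s' \<in> \<int>" "t - t' \<in> \<int>" "crosses C c s t \<sigma>"
  shows "crosses C c s' t' \<sigma>"
proof -
  have "c (p + x) = c (p' + x)" if pp: "p - p' \<in> \<int>" for p p' x
  proof -
    obtain n where "p = p' + of_int n" using pp by (metis Ints_cases add.commute diff_add_cancel)
    then show ?thesis using periodic_int[of c "p' + x" n] assms(1) by (simp add: algebra_simps)
  qed
  from this[OF assms(2)] this[OF assms(3)]
  have "c s = c s'" "c t = c t'" "(\<lambda>x. c (s + x)) = (\<lambda>x. c (s' + x))" "(\<lambda>x. c (t + x)) = (\<lambda>x. c (t' + x))"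
    "(\<lambda>x. c (s - x)) = (\<lambda>x. c (s' - x))" "(\<lambda>x. c (t - x)) = (\<lambda>x. c (t' - x))"
    by (metis add_0_right, metis add_0_right, auto) (metis uminus_add_conv_diff add.commute)+
  then show ?thesis using assms(4) unfolding crosses_def by simp
qed

lemma crosses_sym: "crosses C c s t \<sigma> \<Longrightarrow> crosses C c t s (- \<sigma>)"
proof -
  assume "crosses C c s t \<sigma>"
  then obtain e z v w where e: "e \<in> C" "c s = e z" "c t = e z"
     "departs e z v (\<lambda>x. c (s + x))" "departs e z (- v) (\<lambda>x. c (s - x))"
     "departs e z w (\<lambda>x. c (t + x))" "departs e z (- w) (\<lambda>x. c (t - x))"
     "Im (cnj v * w) \<noteq> 0" "\<sigma> = (if Im (cnj v * w) > 0 then 1 else - 1)"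
    unfolding crosses_def by blast
  have *: "b \<noteq> 0 \<and> - \<sigma> = (if b > 0 then 1 else - 1)"
    if "a \<noteq> 0" "\<sigma> = (if a > 0 then 1 else - 1)" "b = - a" for a b :: real
    using that by auto
  have "Im (cnj w * v) = - Im (cnj v * w)" by (simp add: mult.commute)
  from *[OF e(8,9) this] have "Im (cnj w * v) \<noteq> 0" "- \<sigma> = (if Im (cnj w * v) > 0 then 1 else - 1)" by blast+
  then show ?thesis unfolding crosses_def using e by blast
qed

lemma crosses_transverse:
  assumes "transverse_at C c s t"
  shows "\<exists>\<sigma>. crosses C c s t \<sigma>"
proof -
  obtain e \<sigma> \<epsilon> where e: "e \<in> C" "\<sigma> \<in> {1, -1}" "\<epsilon> > 0"
    "\<And>x. \<bar>x\<bar> < \<epsilon> \<Longrightarrow> c (s + x) = e (Complex x 0) \<and> c (t + x) = e (Complex 0 (\<sigma> * x))"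
    using assms unfolding transverse_at_def by blast
  have 1: "c s = e 0" "c t = e 0" using e(4)[of 0] e(3) by (simp_all add: zero_complex.code)
  have E: "c (s + x) = e (0 + of_real x * 1)" "c (t + x) = e (0 + of_real x * (\<i> * of_real \<sigma>))" if "\<bar>x\<bar> < \<epsilon>" for x
    using e(4)[OF that] by (simp_all add: Complex_eq mult_ac)
  have E': "c (s - x) = e (0 + of_real x * - 1)" "c (t - x) = e (0 + of_real x * - (\<i> * of_real \<sigma>))" if "\<bar>x\<bar> < \<epsilon>" for x
    using E[of "- x"] that by simp_all
  have dep: "departs e 0 k p" if p: "\<And>x. \<bar>x\<bar> < \<epsilon> \<Longrightarrow> p x = e (0 + of_real x * k)" for k p
    unfolding departs_def
  proof (rule exI[of _ \<epsilon>], intro conjI allI impI)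
    fix x assume "0 < x \<and> x < \<epsilon>"
    then show "\<exists>\<rho>>0. p x = e (0 + of_real \<rho> * k)" using p[of x] by (intro exI[of _ x]) simp
  qed (rule e(3))
  have "departs e 0 1 (\<lambda>x. c (s + x))" "departs e 0 (- 1) (\<lambda>x. c (s - x))"
    "departs e 0 (\<i> * of_real \<sigma>) (\<lambda>x. c (t + x))" "departs e 0 (- (\<i> * of_real \<sigma>)) (\<lambda>x. c (t - x))"
    by (rule dep[where p = "\<lambda>x. c (s + x)", OF E(1)], assumption,
        rule dep[where p = "\<lambda>x. c (s - x)", OF E'(1)], assumption,
        rule dep[where p = "\<lambda>x. c (t + x)", OF E(2)], assumption,
        rule dep[where p = "\<lambda>x. c (t - x)", OF E'(2)], assumption)
  moreover have "Im (cnj 1 * (\<i> * of_real \<sigma>)) \<noteq> 0" using e(2) by auto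
  ultimately show ?thesis unfolding crosses_def using e(1) 1 by blast
qed

lemma sign_gauss_of:
  assumes D: "D \<in> diagrams" and x: "curve D s = x" "curve D t = x" "s \<in> over D" "t \<notin> over D"
    and cr: "crosses (charts D) (curve D) s t \<sigma>"
  shows "sign (gauss_of D) x = \<sigma>"
proof -
  have X: "x \<in> crossing_points D" by (rule crossing_pointI[OF D x])
  have "crosses (charts D) (curve D) (over_param D x) (under_param D x) \<sigma>"
    by (rule crosses_shift[OF diagramsD(3)[OF D] _ _ cr]) (use crossing_params[OF D X] x in auto)
  then show ?thesis unfolding gauss_of_def
    using crosses_unique[OF diagramsD(1,2)[OF D]] by auto
qed

lemma crosses_gauss_of:
  assumes D: "D \<in> diagrams" and x: "curve D s = x" "curve D t = x" "s \<in> over D" "t \<notin> over D"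
  shows "crosses (charts D) (curve D) s t (sign (gauss_of D) x)"
proof -
  have "s - t \<notin> \<int>" using over_cong[OF D] x by blast
  then have "double_params (curve D) s t" using x by (simp add: double_params_def)
  then obtain \<sigma> where "crosses (charts D) (curve D) s t \<sigma>"
    using diagramsD(9)[OF D] crosses_transverse by metis
  then show ?thesis using sign_gauss_of[OF D x] by simp
qed

lemma arcs_gauss_of:
  assumes D: "D \<in> diagrams" and x: "curve D s = x" "curve D t = x" "s \<in> over D" "t \<notin> over D"
    and y: "curve D p = y" "curve D q = y" "p \<in> over D" "q \<notin> over D"
  shows "over_in (gauss_of D) x y = arc s t p" "under_in (gauss_of D) x y = arc s t q"
proof -
  note X = crossing_params[OF D crossing_pointI[OF D x]] and Y = crossing_params[OF D crossing_pointI[OF D y]]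
  have "s - over_param D x \<in> \<int>" "t - under_param D x \<in> \<int>" "p - over_param D y \<in> \<int>" "q - under_param D y \<in> \<int>"
    using X Y x y by auto
  then show "over_in (gauss_of D) x y = arc s t p" "under_in (gauss_of D) x y = arc s t q"
    unfolding gauss_of_def using arc_cong by auto
qed

section \<open>Moves that carry the whole curve along: reparametrization, homeomorphism,
  stabilization\<close>

lemma departs_reparam:
  assumes "departs e z v p" "isCont k 0" "k 0 = 0" "\<And>x. x > 0 \<Longrightarrow> k x > (0::real)"
  shows "departs e z v (\<lambda>x. p (k x))"
proof -
  obtain \<delta> where d: "\<delta> > 0" "\<And>x. 0 < x \<Longrightarrow> x < \<delta> \<Longrightarrow> \<exists>\<rho>>0. p x = e (z + of_real \<rho> * v)"
    using assms(1) by (auto simp: departs_def)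
  obtain \<eta> where \<eta>: "\<eta> > 0" "\<And>x. dist x 0 < \<eta> \<Longrightarrow> dist (k x) (k 0) < \<delta>"
    using assms(2) d(1) unfolding continuous_at_eps_delta by metis
  have "k x < \<delta>" if "0 < x" "x < \<eta>" for x
    using \<eta>(2)[of x] that assms(3) by (simp add: dist_real_def)
  then show ?thesis unfolding departs_def using \<eta>(1) assms(4) d(2) by blast
qed

lemma crosses_compose:
  assumes h: "continuous_on UNIV h" "strict_mono h" and cr: "crosses C c (h s) (h t) \<sigma>"
  shows "crosses C (c \<circ> h) s t \<sigma>"
proof -
  obtain e z v w where e: "e \<in> C" "c (h s) = e z" "c (h t) = e z"
     "departs e z v (\<lambda>x. c (h s + x))" "departs e z (- v) (\<lambda>x. c (h s - x))"
     "departs e z w (\<lambda>x. c (h t + x))" "departs e z (- w) (\<lambda>x. c (h t - x))"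
     "Im (cnj v * w) \<noteq> 0" "\<sigma> = (if Im (cnj v * w) > 0 then 1 else - 1)"
    using cr unfolding crosses_def by blast
  have ch: "isCont h u" for u using h(1) by (simp add: continuous_on_eq_continuous_at)
  have a: "departs e z k (\<lambda>x. (c \<circ> h) (u + x))" if "departs e z k (\<lambda>x. c (h u + x))" for k u
  proof -
    have "isCont (\<lambda>x. h (u + x) - h u) 0" by (intro continuous_intros isCont_o2[OF _ ch])
    from departs_reparam[OF that this] show ?thesis using h(2) by (simp add: strict_mono_less)
  qed
  have b: "departs e z k (\<lambda>x. (c \<circ> h) (u - x))" if "departs e z k (\<lambda>x. c (h u - x))" for k u
  proof -
    have "isCont (\<lambda>x. h u - h (u - x)) 0" by (intro continuous_intros isCont_o2[OF _ ch])
    from departs_reparam[OF that this] show ?thesis using h(2) by (simp add: strict_mono_less)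
  qed
  show ?thesis unfolding crosses_def
  proof (intro bexI[OF _ e(1)] exI conjI)
    show "(c \<circ> h) s = e z" "(c \<circ> h) t = e z" using e(2,3) by simp_all
  qed (use a[OF e(4)] b[OF e(5)] a[OF e(6)] b[OF e(7)] e(8,9) in blast)+
qed

text \<open>A common form of these three moves. Injectivity of f is asked on the curve only, because
  in a stabilization f is a homeomorphism merely off the removed discs.\<close>

lemma gauss_transport:
  assumes D: "D \<in> diagrams" and E: "E \<in> diagrams"
    and c: "curve E = f \<circ> curve D \<circ> h" and o: "over E = h -` over D"
    and h: "continuous_on UNIV h" "strict_mono h" "\<And>t::real. h (t + 1) = h t + 1"
    and f: "inj_on f (range (curve D))"
    and cr: "\<And>s t \<sigma>. curve D (h s) = curve D (h t) \<Longrightarrow> crosses (charts D) (curve D) (h s) (h t) \<sigma> \<Longrightarrow> crosses (charts E) (curve E) s t \<sigma>"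
  shows "gauss_equal (gauss_of D) (gauss_of E)"
proof -
  have surj: "\<exists>s. h s = y" for y
  proof -
    define n where "n = \<lceil>\<bar>y - h 0\<bar>\<rceil>"
    have n: "\<bar>y - h 0\<bar> \<le> of_int n" by (simp add: n_def)
    have "h (of_int n) = h 0 + of_int n" "h (of_int (- n)) = h 0 - of_int n"
      using shift_int[of h 0 n, OF h(3)] shift_int[of h 0 "- n", OF h(3)] by simp_all
    then have "h (of_int (- n)) \<le> y" "y \<le> h (of_int n)" using n by auto
    moreover have "0 \<le> n" using n by linarith
    ultimately show ?thesis using IVT'[of h "of_int (- n)" y "of_int n"] continuous_on_subset[OF h(1)] by auto
  qed
  have params: "\<exists>s t. curve E s = f x \<and> curve E t = f x \<and> s \<in> over E \<and> t \<notin> over E \<and>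
      curve D (h s) = x \<and> curve D (h t) = x \<and> h s \<in> over D \<and> h t \<notin> over D" if x: "x \<in> crossing_points D" for x
  proof -
    obtain s t where "h s = over_param D x" "h t = under_param D x" using surj by metis
    then show ?thesis using crossing_params[OF D x] c o by (intro exI[of _ s] exI[of _ t]) simp
  qed
  have img: "crossing_points E = f ` crossing_points D"
  proof (intro set_eqI iffI)
    fix y assume "y \<in> f ` crossing_points D"
    then obtain x where "x \<in> crossing_points D" "y = f x" by blast
    then show "y \<in> crossing_points E" using params[of x] crossing_pointI[OF E] by metis
  next
    fix y assume y: "y \<in> crossing_points E"
    note Y = crossing_params[OF E y]
    let ?s = "h (over_param E y)" and ?t = "h (under_param E y)"
    have "f (curve D ?s) = y" "f (curve D ?t) = y" using Y(1,3) c by auto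
    then have "curve D ?s = curve D ?t" using f by (metis inj_onD rangeI)
    then have "curve D ?s \<in> crossing_points D" using Y(2,4) o by (intro crossing_pointI[OF D, of ?s _ ?t]) auto
    then show "y \<in> f ` crossing_points D" using \<open>f (curve D ?s) = y\<close> by (metis image_eqI)
  qed
  have sub: "crossing_points D \<subseteq> range (curve D)" by (auto simp: crossing_points_def)
  have "gauss_iso f (gauss_of D) (gauss_of E)"
    unfolding gauss_iso_def
  proof (intro conjI ballI impI)
    show "bij_betw f (chords (gauss_of D)) (chords (gauss_of E))"
      using inj_on_subset[OF f sub] img by (simp add: bij_betw_def)
    fix x assume "x \<in> chords (gauss_of D)"
    then have x: "x \<in> crossing_points D" by simp
    obtain s t where st: "curve E s = f x" "curve E t = f x" "s \<in> over E" "t \<notin> over E"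
      "curve D (h s) = x" "curve D (h t) = x" "h s \<in> over D" "h t \<notin> over D" using params[OF x] by blast
    show "sign (gauss_of E) (f x) = sign (gauss_of D) x"
      using st by (intro sign_gauss_of[OF E st(1-4)] cr crosses_gauss_of[OF D]) auto
    fix y assume "y \<in> chords (gauss_of D)"
    then have y: "y \<in> crossing_points D" by simp
    obtain p q where pq: "curve E p = f y" "curve E q = f y" "p \<in> over E" "q \<notin> over E"
      "curve D (h p) = y" "curve D (h q) = y" "h p \<in> over D" "h q \<notin> over D" using params[OF y] by blast
    show "over_in (gauss_of E) (f x) (f y) = over_in (gauss_of D) x y"
      "under_in (gauss_of E) (f x) (f y) = under_in (gauss_of D) x y"
      unfolding arcs_gauss_of[OF E st(1-4) pq(1-4)] arcs_gauss_of[OF D st(5-8) pq(5-8)]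
      by (simp_all add: arc_mono[OF h(2,3)])
  qed
  then show ?thesis by (rule gauss_iso_equal)
qed


lemma gauss_reparametrization:
  assumes "D \<in> diagrams" "E \<in> diagrams" "reparametrization D E"
  shows "gauss_equal (gauss_of D) (gauss_of E)"
proof -
  obtain h where h: "continuous_on UNIV h" "strict_mono h" "\<And>t::real. h (t + 1) = h t + 1"
    "curve E = curve D \<circ> h" "over E = h -` over D" and ch: "charts E = charts D"
    using assms(3) unfolding reparametrization_def by blast
  show ?thesis
    by (rule gauss_transport[OF assms(1,2) _ h(5,1,2,3), of "\<lambda>x. x"])
       (use h ch in \<open>auto simp: o_def dest!: crosses_compose[OF h(1,2)]\<close>)
qed

lemma departs_image: "departs e z v p \<Longrightarrow> departs (f \<circ> e) z v (\<lambda>x. f (p x))"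
  unfolding departs_def by (metis comp_apply)

lemma gauss_surface_homeo:
  assumes D: "D \<in> diagrams" "E \<in> diagrams" "surface_homeo D E"
  shows "gauss_equal (gauss_of D) (gauss_of E)"
proof -
  obtain f where f: "homeomorphic_map (surface D) (surface E) f" "\<And>e. e \<in> charts D \<Longrightarrow> f \<circ> e \<in> charts E"
    "curve E = f \<circ> curve D" "over E = over D"
    using assms(3) unfolding surface_homeo_def orientation_preserving_homeo_def by blast
  have sub: "range (curve D) \<subseteq> topspace (surface D)"
    using diagramsD(2)[OF D(1)] by (auto simp: continuous_map_def)
  show ?thesis
  proof (rule gauss_transport[OF D(1,2), of f "\<lambda>t. t"])
    show "inj_on f (range (curve D))"
      using inj_on_subset[OF homeomorphic_imp_injective_map[OF f(1)] sub] .
    fix s t \<sigma> assume "crosses (charts D) (curve D) s t \<sigma>"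
    then obtain e z v w where e: "e \<in> charts D" "curve D s = e z" "curve D t = e z"
     "departs e z v (\<lambda>x. curve D (s + x))" "departs e z (- v) (\<lambda>x. curve D (s - x))"
     "departs e z w (\<lambda>x. curve D (t + x))" "departs e z (- w) (\<lambda>x. curve D (t - x))"
     "Im (cnj v * w) \<noteq> 0" "\<sigma> = (if Im (cnj v * w) > 0 then 1 else - 1)"
      unfolding crosses_def by blast
    show "crosses (charts E) (curve E) s t \<sigma>"
      unfolding crosses_def f(3)
    proof (intro bexI[OF _ f(2)[OF e(1)]] exI conjI)
      show "(f \<circ> curve D) s = (f \<circ> e) z" "(f \<circ> curve D) t = (f \<circ> e) z" using e(2,3) by simp_all
      show "departs (f \<circ> e) z v (\<lambda>x. (f \<circ> curve D) (s + x))" "departs (f \<circ> e) z (- v) (\<lambda>x. (f \<circ> curve D) (s - x))"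
        "departs (f \<circ> e) z w (\<lambda>x. (f \<circ> curve D) (t + x))" "departs (f \<circ> e) z (- w) (\<lambda>x. (f \<circ> curve D) (t - x))"
        using e(4-7)[THEN departs_image[where f = f]] by simp_all
    qed (use e in auto)
  qed (use f in \<open>auto simp: o_def strict_mono_def\<close>)
qed

text \<open>Near its centre the smaller chart is the old one up to scale, and by continuity p stays
  in that region for a while; so the ray keeps its direction.\<close>

lemma departs_shrink:
  assumes e: "plane_chart X e" and p: "continuous_map (top_of_set {0..}) X p" "p 0 = e z"
    and d: "departs e z v p" and r: "r > 0"
  shows "departs (\<lambda>w. e (z + of_real r * box_map w)) 0 v p"
proof -
  obtain \<delta> where d: "\<delta> > 0" "\<And>x. 0 < x \<Longrightarrow> x < \<delta> \<Longrightarrow> \<exists>\<rho>>0. p x = e (z + of_real \<rho> * v)"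
    using d by (auto simp: departs_def)
  have ij: "inj e" using e by (simp add: plane_chart_iff)
  have "openin X (e ` ball z (r/2))" using e by (auto simp: plane_chart_iff)
  then have "openin (top_of_set {0..}) {x \<in> topspace (top_of_set {0..}). p x \<in> e ` ball z (r/2)}"
    by (rule openin_continuous_map_preimage[OF p(1)])
  then obtain A where A: "open A" "{x \<in> {0..}. p x \<in> e ` ball z (r/2)} = {0..} \<inter> A"
    by (auto simp: openin_open)
  have "0 \<in> A" using A(2) p(2) r by force
  then obtain \<eta> where \<eta>: "\<eta> > 0" "ball 0 \<eta> \<subseteq> A" using A(1) open_contains_ball by blast
  show ?thesis unfolding departs_def
  proof (rule exI[of _ "min \<delta> \<eta>"], intro conjI allI impI)
    show "min \<delta> \<eta> > 0" using d \<eta> by simp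
    fix x assume x: "0 < x \<and> x < min \<delta> \<eta>"
    then obtain \<rho> where \<rho>: "\<rho> > 0" "p x = e (z + of_real \<rho> * v)" using d(2)[of x] by auto
    have "x \<in> A" using \<eta>(2) x by (auto simp: subset_iff)
    then have "p x \<in> e ` ball z (r/2)" using A(2) x by (auto simp: set_eq_iff)
    then have "z + of_real \<rho> * v \<in> ball z (r/2)" using \<rho>(2) ij by (auto dest: injD)
    then have "norm (of_real \<rho> * v) < r / 2" by (simp add: dist_norm)
    then have "norm (of_real \<rho> * v) / r \<le> 1/2" using r by (simp add: divide_le_eq)
    moreover have "norm (of_real (\<rho> / r) * v) = norm (of_real \<rho> * v) / r" using r by (simp add: norm_mult norm_divide)
    ultimately have "norm (of_real (\<rho> / r) * v) \<le> 1/2" by (simp only:)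
    then have "box_map (0 + of_real (\<rho> / r) * v) = of_real (\<rho> / r) * v" by (simp add: box_map_id)
    then have "p x = e (z + of_real r * box_map (0 + of_real (\<rho> / r) * v))" using \<rho> r by simp
    then show "\<exists>\<rho>>0. p x = e (z + of_real r * box_map (0 + of_real \<rho> * v))"
      using \<rho>(1) r by (intro exI[of _ "\<rho> / r"]) simp
  qed
qed

lemma embedded_disc_closedin:
  assumes "Hausdorff_space X" "embedding_map (top_of_set (cball (0::complex) 1)) X \<delta>"
  shows "closedin X (\<delta> ` cball 0 1)"
proof (rule compactin_imp_closedin[OF assms(1)])
  have "compactin (top_of_set (cball (0::complex) 1)) (cball 0 1)" by (simp add: compactin_subtopology)
  moreover have "continuous_map (top_of_set (cball (0::complex) 1)) X \<delta>"
    using assms(2) by (meson embedding_map_def homeomorphic_imp_continuous_map continuous_map_in_subtopology)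
  ultimately show "compactin X (\<delta> ` cball 0 1)" by (rule image_compactin)
qed

text \<open>Charts of the new surface are available only for charts of the old one that miss the two
  discs. The discs are closed and the curve avoids them, so a chart at a crossing can be shrunk
  until it qualifies.\<close>

lemma gauss_stabilization:
  assumes D: "D \<in> diagrams" "E \<in> diagrams" "stabilization D E"
  shows "gauss_equal (gauss_of D) (gauss_of E)"
proof -
  obtain \<delta>1 \<delta>2 Y Z f where f:
    "embedding_map (top_of_set (cball (0::complex) 1)) (surface D) \<delta>1"
    "embedding_map (top_of_set (cball (0::complex) 1)) (surface D) \<delta>2"
    "range (curve D) \<inter> (\<delta>1 ` cball 0 1 \<union> \<delta>2 ` cball 0 1) = {}"
    "homeomorphic_map (subtopology (surface D) (topspace (surface D) - (\<delta>1 ` ball 0 1 \<union> \<delta>2 ` ball 0 1))) Z f"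
    "\<forall>e\<in>charts D. range e \<inter> (\<delta>1 ` cball 0 1 \<union> \<delta>2 ` cball 0 1) = {} \<longrightarrow> f \<circ> e \<in> charts E"
    "curve E = f \<circ> curve D" "over E = over D"
    using assms(3)[unfolded stabilization_def]
    apply (elim exE conjE)
    subgoal for a b c f
      by (rule that[of a b "subtopology (surface E) (topspace (surface E) - c ` (ball 0 2 - cball 0 1))" f])
    done
  let ?K = "\<delta>1 ` cball 0 1 \<union> \<delta>2 ` cball 0 1"
  have or: "orientation (surface D) (charts D)" and H: "Hausdorff_space (surface D)"
    and cont: "continuous_map euclideanreal (surface D) (curve D)"
    using diagramsD[OF D(1)] D(1) by (auto simp: diagrams_def closed_oriented_surface_def)
  have sub: "range (curve D) \<subseteq> topspace (surface D)"
    using cont by (auto simp: continuous_map_def)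
  have sub2: "range (curve D) \<subseteq> topspace (subtopology (surface D) (topspace (surface D) - (\<delta>1 ` ball 0 1 \<union> \<delta>2 ` ball 0 1)))"
    using sub f(3) by (auto dest!: subsetD[OF ball_subset_cball])
  have K: "openin (surface D) (topspace (surface D) - ?K)"
    using embedded_disc_closedin[OF H f(1)] embedded_disc_closedin[OF H f(2)] by (intro openin_diff closedin_Un) auto
  show ?thesis
  proof (rule gauss_transport[OF D(1,2), of f "\<lambda>t. t"])
    show "inj_on f (range (curve D))"
      using inj_on_subset[OF homeomorphic_imp_injective_map[OF f(4)] sub2] .
    fix s t \<sigma> assume "crosses (charts D) (curve D) s t \<sigma>"
    then obtain e z v w where e: "e \<in> charts D" "curve D s = e z" "curve D t = e z"
     "departs e z v (\<lambda>x. curve D (s + x))" "departs e z (- v) (\<lambda>x. curve D (s - x))"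
     "departs e z w (\<lambda>x. curve D (t + x))" "departs e z (- w) (\<lambda>x. curve D (t - x))"
     "Im (cnj v * w) \<noteq> 0" "\<sigma> = (if Im (cnj v * w) > 0 then 1 else - 1)"
      unfolding crosses_def by blast
    have ch: "plane_chart (surface D) e" using orientationD(1)[OF or e(1)] .
    have "open (e -` (topspace (surface D) - ?K))" by (rule plane_chart_vimage[OF ch K])
    moreover have "curve D s \<in> topspace (surface D)" "curve D s \<notin> ?K" using f(3) sub by blast+
    then have "z \<in> e -` (topspace (surface D) - ?K)" using e(2) by simp
    ultimately obtain R where R: "R > 0" "ball z R \<subseteq> e -` (topspace (surface D) - ?K)" using openE by metis
    \<comment> \<open>The factor R/2 suffices because \<open>box_map\<close> takes values of modulus
      below 2.\<close>
    define e2 where "e2 = (\<lambda>w. e (z + of_real (R/2) * box_map w))"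
    have e2C: "e2 \<in> charts D" unfolding e2_def by (rule shrink_chart[OF or e(1)]) (use R in simp)
    have "z + of_real (R/2) * box_map w \<in> ball z R" for w
      using R(1) norm_box_map[of w] by (simp add: dist_norm norm_mult)
    then have "e2 w \<notin> ?K" for w using subsetD[OF R(2)] unfolding e2_def by blast
    then have "range e2 \<inter> ?K = {}" by blast
    then have fe: "f \<circ> e2 \<in> charts E" using f(5) e2C by blast
    have b0: "box_map 0 = 0" by (simp add: box_map_id)
    note h = curve_half[OF cont, of s] curve_half[OF cont, of t]
    have dd: "departs (f \<circ> e2) 0 k (\<lambda>x. f (p x))"
      if "continuous_map (top_of_set {0..}) (surface D) p" "p 0 = e z" "departs e z k p" for k p
      unfolding e2_def by (intro departs_image departs_shrink[OF ch that]) (use R in simp)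
    show "crosses (charts E) (curve E) s t \<sigma>"
      unfolding crosses_def f(6)
    proof (intro bexI[OF _ fe] exI conjI)
      show "(f \<circ> curve D) s = (f \<circ> e2) 0" "(f \<circ> curve D) t = (f \<circ> e2) 0" using e(2,3) by (simp_all add: e2_def b0)
      show "departs (f \<circ> e2) 0 v (\<lambda>x. (f \<circ> curve D) (s + x))" using dd[OF h(1) _ e(4)] e(2) by simp
      show "departs (f \<circ> e2) 0 (- v) (\<lambda>x. (f \<circ> curve D) (s - x))" using dd[OF h(2) _ e(5)] e(2) by simp
      show "departs (f \<circ> e2) 0 w (\<lambda>x. (f \<circ> curve D) (t + x))" using dd[OF h(3) _ e(6)] e(3) by simp
      show "departs (f \<circ> e2) 0 (- w) (\<lambda>x. (f \<circ> curve D) (t - x))" using dd[OF h(4) _ e(7)] e(3) by simp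
    qed (use e in auto)
  qed (use f in \<open>auto simp: o_def strict_mono_def\<close>)
qed


section \<open>The reverse and the two mirror images of a diagram\<close>

lemma reverse_diagram_simps [simp]:
  "surface (reverse_diagram D) = surface D" "charts (reverse_diagram D) = charts D"
  "curve (reverse_diagram D) t = curve D (- t)" "t \<in> over (reverse_diagram D) \<longleftrightarrow> - t \<in> over D"
  by (simp_all add: reverse_diagram_def)

lemma double_params_reverse:
  "double_params (curve (reverse_diagram D)) s t \<longleftrightarrow> double_params (curve D) (- s) (- t)"
proof -
  have "- s - - t = - (s - t)" by simp
  then have "- s - - t \<in> \<int> \<longleftrightarrow> s - t \<in> \<int>" by (metis Ints_minus minus_minus)
  then show ?thesis by (simp add: double_params_def)
qed

lemma reverse_diagram_in_diagrams:
  assumes D: "D \<in> diagrams"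
  shows "reverse_diagram D \<in> diagrams"
proof -
  let ?c = "curve (reverse_diagram D)"
  note D' = D[unfolded diagrams_def closed_oriented_surface_def closed_curve_def
      generic_immersion_def crossing_information_def, simplified]
  have per: "curve D (t - 1) = curve D t" "t - 1 \<in> over D \<longleftrightarrow> t \<in> over D" for t
    using diagramsD(3,4)[OF D, of "t - 1"] by simp_all
  have "closed_curve (surface D) ?c"
    unfolding closed_curve_def
  proof
    have "continuous_map euclideanreal euclideanreal (\<lambda>t. - t)" by (simp add: continuous_on_minus)
    from continuous_map_compose[OF this diagramsD(2)[OF D]]
    show "continuous_map euclideanreal (surface D) ?c" by (simp add: o_def reverse_diagram_def)
    show "\<forall>t. ?c (t + 1) = ?c t" using per(1)[of "- t" for t] by simp
  qed
  moreover have "generic_immersion (charts D) ?c"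
    unfolding generic_immersion_def
  proof (intro conjI allI impI)
    fix t :: real
    obtain \<epsilon> where e: "\<epsilon> > 0" "inj_on (curve D) {- t - \<epsilon><..<- t + \<epsilon>}" using D' by blast
    have "inj_on ?c {t - \<epsilon><..<t + \<epsilon>}"
    proof (rule inj_onI)
      fix x y assume "x \<in> {t - \<epsilon><..<t + \<epsilon>}" "y \<in> {t - \<epsilon><..<t + \<epsilon>}" "?c x = ?c y"
      then show "x = y" using inj_onD[OF e(2), of "- x" "- y"] by simp
    qed
    then show "\<exists>\<epsilon>>0. inj_on ?c {t - \<epsilon><..<t + \<epsilon>}" using e(1) by blast
  next
    have "{?c s |s. \<exists>t. double_params ?c s t} \<subseteq> crossing_points D"
      unfolding double_params_reverse crossing_points_def by auto
    then show "finite {?c s |s. \<exists>t. double_params ?c s t}" using diagramsD(7)[OF D] finite_subset by blast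
  next
    fix r s t assume a: "?c r = ?c s \<and> ?c s = ?c t"
    have n: "x - y \<in> \<int>" if "- x - - y \<in> \<int>" for x y :: real using Ints_minus[OF that] by simp
    show "r - s \<in> \<int> \<or> s - t \<in> \<int> \<or> r - t \<in> \<int>"
      using diagramsD(8)[OF D, of "- r" "- s" "- t"] a n by (metis reverse_diagram_simps(3))
  next
    fix s t assume "double_params ?c s t"
    then have "transverse_at (charts D) (curve D) (- s) (- t)"
      using diagramsD(9)[OF D] double_params_reverse by metis
    then obtain e \<sigma> \<epsilon> where e: "e \<in> charts D" "\<sigma> \<in> {1, -1}" "\<epsilon> > 0"
      "\<And>x. \<bar>x\<bar> < \<epsilon> \<Longrightarrow> curve D (- s + x) = e (Complex x 0) \<and> curve D (- t + x) = e (Complex 0 (\<sigma> * x))"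
      unfolding transverse_at_def by blast
    \<comment> \<open>Reversal runs through both branches backwards; a half turn of the chart puts
      them right and preserves the orientation.\<close>
    have "e \<circ> uminus \<in> charts D"
    proof (rule chart_reparametrize[OF diagramsD(1)[OF D] e(1)])
      show "local_degree uminus z 1" for z using local_degree_linear[of "-1" z] by simp
    qed (auto intro: continuous_intros)
    moreover have "?c (s + x) = (e \<circ> uminus) (Complex x 0) \<and> ?c (t + x) = (e \<circ> uminus) (Complex 0 (\<sigma> * x))" if "\<bar>x\<bar> < \<epsilon>" for x
      using e(4)[of "- x"] that by (simp add: complex_eq_iff Complex_eq)
    ultimately show "transverse_at (charts D) ?c s t" unfolding transverse_at_def using e(2,3) by blast
  qed
  moreover have "crossing_information ?c (over (reverse_diagram D))"
    unfolding crossing_information_def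
  proof (intro conjI allI impI subsetI)
    fix s assume "s \<in> over (reverse_diagram D)"
    then obtain t where "double_params (curve D) (- s) t" using diagramsD(11)[OF D] by auto
    then have "double_params ?c s (- t)" by (simp add: double_params_reverse)
    then show "s \<in> {s. \<exists>t. double_params ?c s t}" by blast
  next
    show "t + 1 \<in> over (reverse_diagram D) \<longleftrightarrow> t \<in> over (reverse_diagram D)" for t
      using per(2)[of "- t"] by simp
    show "s \<in> over (reverse_diagram D) \<longleftrightarrow> t \<notin> over (reverse_diagram D)" if "double_params ?c s t" for s t
      using diagramsD(10)[OF D, of "- s" "- t"] that[unfolded double_params_reverse] by simp
  qed
  ultimately show ?thesis using D' by (simp add: diagrams_def closed_oriented_surface_def)
qed

lemma switch_diagram_in_diagrams:
  assumes D: "D \<in> diagrams"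
  shows "switch_diagram D \<in> diagrams"
proof -
  have "double_params (curve D) (t + 1) u \<longleftrightarrow> double_params (curve D) t u" for t u
  proof -
    have "t + 1 - u \<in> \<int> \<longleftrightarrow> t - u \<in> \<int>"
      using Ints_diff[of "t + 1 - u" 1] Ints_add[of "t - u" 1] by (auto simp: algebra_simps)
    then show ?thesis using diagramsD(3)[OF D] by (simp add: double_params_def)
  qed
  moreover have "s \<in> over D \<longleftrightarrow> t \<notin> over D" if "double_params (curve D) s t" for s t
    using diagramsD(10)[OF D that] .
  moreover have "double_params (curve D) s t \<Longrightarrow> double_params (curve D) t s" for s t
    unfolding double_params_def by (metis Ints_minus minus_diff_eq)
  ultimately have "crossing_information (curve D) (over (switch_diagram D))"
    unfolding crossing_information_def switch_diagram_def using diagramsD(4)[OF D] by simp blast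
  then show ?thesis using D unfolding diagrams_def by (simp add: switch_diagram_def)
qed

lemma mirror_diagram_in_diagrams:
  assumes D: "D \<in> diagrams" and m: "mirror_diagram D E"
  shows "E \<in> diagrams"
proof -
  obtain f where f: "orientation_reversing_homeo (surface D) (charts D) (surface D) (charts D) f"
    and E: "surface E = surface D" "charts E = charts D" "curve E = f \<circ> curve D" "over E = over D"
    using m unfolding mirror_diagram_def by blast
  note D' = D[unfolded diagrams_def closed_oriented_surface_def closed_curve_def
      generic_immersion_def crossing_information_def, simplified]
  have h: "homeomorphic_map (surface D) (surface D) f" "\<And>e. e \<in> charts D \<Longrightarrow> f \<circ> e \<circ> cnj \<in> charts D"
    using f by (auto simp: orientation_reversing_homeo_def)
  have "curve D t \<in> topspace (surface D)" for t
    using diagramsD(2)[OF D] by (auto simp: continuous_map_def)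
  then have inj: "f (curve D s) = f (curve D t) \<longleftrightarrow> curve D s = curve D t" for s t
    using inj_onD[OF homeomorphic_imp_injective_map[OF h(1)]] by metis
  have dp: "double_params (f \<circ> curve D) s t \<longleftrightarrow> double_params (curve D) s t" for s t
    by (simp add: double_params_def inj)
  have "closed_curve (surface D) (f \<circ> curve D)"
    unfolding closed_curve_def using continuous_map_compose[OF diagramsD(2)[OF D] homeomorphic_imp_continuous_map[OF h(1)]]
      diagramsD(3)[OF D] by simp
  moreover have "generic_immersion (charts D) (f \<circ> curve D)"
    unfolding generic_immersion_def dp
  proof (intro conjI allI impI)
    show "\<exists>\<epsilon>>0. inj_on (f \<circ> curve D) {t - \<epsilon><..<t + \<epsilon>}" for t
      using D' by (simp add: inj_on_def inj)
    have "{(f \<circ> curve D) s |s. \<exists>t. double_params (curve D) s t} = f ` crossing_points D"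
      by (auto simp: crossing_points_def)
    then show "finite {(f \<circ> curve D) s |s. \<exists>t. double_params (curve D) s t}" using diagramsD(7)[OF D] by simp
    show "r - s \<in> \<int> \<or> s - t \<in> \<int> \<or> r - t \<in> \<int>"
      if "(f \<circ> curve D) r = (f \<circ> curve D) s \<and> (f \<circ> curve D) s = (f \<circ> curve D) t" for r s t
      using diagramsD(8)[OF D, of r s t] that by (simp add: inj)
    fix s t assume "double_params (curve D) s t"
    then obtain e \<sigma> \<epsilon> where e: "e \<in> charts D" "\<sigma> \<in> {1, -1}" "\<epsilon> > 0"
      "\<And>x. \<bar>x\<bar> < \<epsilon> \<Longrightarrow> curve D (s + x) = e (Complex x 0) \<and> curve D (t + x) = e (Complex 0 (\<sigma> * x))"
      using diagramsD(9)[OF D] unfolding transverse_at_def by blast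
    \<comment> \<open>Conjugation makes the image chart positive again. It fixes the first axis and
      turns over the second, which the sign in \<open>transverse_at\<close> absorbs.\<close>
    have "(f \<circ> curve D) (s + x) = (f \<circ> e \<circ> cnj) (Complex x 0) \<and> (f \<circ> curve D) (t + x) = (f \<circ> e \<circ> cnj) (Complex 0 (- \<sigma> * x))"
      if "\<bar>x\<bar> < \<epsilon>" for x
    proof -
      have "cnj (Complex x 0) = Complex x 0" "cnj (Complex 0 (- \<sigma> * x)) = Complex 0 (\<sigma> * x)"
        by (simp_all add: complex_eq_iff)
      then show ?thesis using e(4)[OF that] by simp
    qed
    moreover have "- \<sigma> \<in> {1, - 1}" using e(2) by auto
    ultimately show "transverse_at (charts D) (f \<circ> curve D) s t"
      unfolding transverse_at_def using h(2)[OF e(1)] e(3) by blast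
  qed
  moreover have "crossing_information (f \<circ> curve D) (over D)"
    using D' unfolding crossing_information_def dp by simp
  ultimately show ?thesis using D' E by (simp add: diagrams_def closed_oriented_surface_def)
qed

text \<open>Both branch directions at a crossing are negated, so its sign persists; the way from the
  over- to the under-passage now leads through the complementary part of the curve.\<close>

lemma gauss_reverse:
  assumes D: "D \<in> diagrams"
  shows "index_writhe (gauss_of (reverse_diagram D)) n = index_writhe (gauss_of D) (- n)"
    "nesting S (gauss_of (reverse_diagram D)) = nesting (\<lambda>m n. S (- n) (- m)) (gauss_of D)"
proof -
  let ?E = "reverse_diagram D"
  have E: "?E \<in> diagrams" by (rule reverse_diagram_in_diagrams[OF D])
  have ch: "crossing_points ?E = crossing_points D"
  proof (intro set_eqI iffI)
    fix x assume "x \<in> crossing_points ?E"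
    from crossing_params[OF E this] show "x \<in> crossing_points D"
      by (intro crossing_pointI[OF D, of "- over_param ?E x" x "- under_param ?E x"]) auto
  next
    fix x assume "x \<in> crossing_points D"
    from crossing_params[OF D this] show "x \<in> crossing_points ?E"
      by (intro crossing_pointI[OF E, of "- over_param D x" x "- under_param D x"]) auto
  qed
  have sg: "sign (gauss_of ?E) x = sign (gauss_of D) x" if "x \<in> crossing_points D" for x
  proof -
    note X = crossing_params[OF D that]
    let ?s = "over_param D x" and ?t = "under_param D x"
    obtain e z v w where e: "e \<in> charts D" "curve D ?s = e z" "curve D ?t = e z"
     "departs e z v (\<lambda>x. curve D (?s + x))" "departs e z (- v) (\<lambda>x. curve D (?s - x))"
     "departs e z w (\<lambda>x. curve D (?t + x))" "departs e z (- w) (\<lambda>x. curve D (?t - x))"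
     "Im (cnj v * w) \<noteq> 0" "sign (gauss_of D) x = (if Im (cnj v * w) > 0 then 1 else - 1)"
      using crosses_gauss_of[OF D X(1,3,2,4)] unfolding crosses_def by blast
    have "crosses (charts ?E) (curve ?E) (- ?s) (- ?t) (sign (gauss_of D) x)"
      unfolding crosses_def
    proof (rule bexI[of _ e], rule exI[of _ z], rule exI[of _ "- v"], rule exI[of _ "- w"], intro conjI)
      show "departs e z (- v) (\<lambda>x. curve ?E (- ?s + x))" "departs e z (- (- v)) (\<lambda>x. curve ?E (- ?s - x))"
        "departs e z (- w) (\<lambda>x. curve ?E (- ?t + x))" "departs e z (- (- w)) (\<lambda>x. curve ?E (- ?t - x))"
        using e(4-7) by (simp_all add: add.commute)
      have "cnj (- v) * - w = cnj v * w" by simp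
      then have n: "Im (cnj (- v) * - w) = Im (cnj v * w)" by (simp only:)
      show "Im (cnj (- v) * - w) \<noteq> 0" unfolding n by (rule e(8))
      show "sign (gauss_of D) x = (if Im (cnj (- v) * - w) > 0 then 1 else - 1)" unfolding n by (rule e(9))
    qed (use e in auto)
    then show ?thesis using X by (intro sign_gauss_of[OF E]) auto
  qed
  have P: "curve ?E (- over_param D x) = x" "curve ?E (- under_param D x) = x"
    "- over_param D x \<in> over ?E" "- under_param D x \<notin> over ?E" if "x \<in> crossing_points D" for x
    using crossing_params[OF D that] by simp_all
  have arcs: "over_in (gauss_of ?E) x y = (\<not> over_in (gauss_of D) x y)" "under_in (gauss_of ?E) x y = (\<not> under_in (gauss_of D) x y)"
    if x: "x \<in> crossing_points D" and y: "y \<in> crossing_points D" and xy: "x \<noteq> y" for x y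
  proof -
    note X = crossing_params[OF D x] and Y = crossing_params[OF D y]
    have "over_in (gauss_of ?E) x y = arc (- over_param D x) (- under_param D x) (- over_param D y)"
      "under_in (gauss_of ?E) x y = arc (- over_param D x) (- under_param D x) (- under_param D y)"
      by (rule arcs_gauss_of[OF E P[OF x] P[OF y]])+
    moreover have "over_in (gauss_of D) x y = arc (over_param D x) (under_param D x) (over_param D y)"
      "under_in (gauss_of D) x y = arc (over_param D x) (under_param D x) (under_param D y)"
      by (simp_all add: gauss_of_def)
    moreover note params_distinct[OF D y x xy[symmetric]]
    ultimately show "over_in (gauss_of ?E) x y = (\<not> over_in (gauss_of D) x y)" "under_in (gauss_of ?E) x y = (\<not> under_in (gauss_of D) x y)"
      using arc_reflect X(5) by simp_all
  qed
  show "index_writhe (gauss_of ?E) n = index_writhe (gauss_of D) (- n)"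
    "nesting S (gauss_of ?E) = nesting (\<lambda>m n. S (- n) (- m)) (gauss_of D)"
    using gauss_flip[of "gauss_of D" "gauss_of ?E" 1] diagramsD(7)[OF D] ch sg arcs by auto
qed

text \<open>The two passages of every crossing exchange roles. This negates its sign, by
  antisymmetry of \<open>crosses\<close>, and replaces its arc by the complement, which is the case
  \<delta> = - 1 of \<open>gauss_flip\<close>.\<close>

lemma gauss_switch:
  assumes D: "D \<in> diagrams"
  shows "index_writhe (gauss_of (switch_diagram D)) n = - index_writhe (gauss_of D) (- n)"
    "nesting S (gauss_of (switch_diagram D)) = nesting (\<lambda>m n. S (- n) (- m)) (gauss_of D)"
proof -
  let ?E = "switch_diagram D"
  have E: "?E \<in> diagrams" by (rule switch_diagram_in_diagrams[OF D])
  have [simp]: "curve ?E = curve D" "charts ?E = charts D" by (simp_all add: switch_diagram_def)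
  have ch: "crossing_points ?E = crossing_points D" by (simp add: crossing_points_def)
  have ov: "s \<in> over ?E \<longleftrightarrow> s \<notin> over D" if "curve D s \<in> crossing_points D" for s
  proof -
    note X = crossing_params[OF D that]
    have "\<exists>t. double_params (curve D) s t"
    proof (cases "s - over_param D (curve D s) \<in> \<int>")
      case True
      then have "s - under_param D (curve D s) \<notin> \<int>"
        using X(5) Ints_diff[of "s - under_param D (curve D s)" "s - over_param D (curve D s)"] by auto
      then show ?thesis using X(3) by (intro exI[of _ "under_param D (curve D s)"]) (simp add: double_params_def)
    next
      case False
      then show ?thesis using X(1) by (intro exI[of _ "over_param D (curve D s)"]) (simp add: double_params_def)
    qed
    then show ?thesis by (simp add: switch_diagram_def)
  qed
  have P: "curve ?E (under_param D x) = x" "curve ?E (over_param D x) = x" "under_param D x \<in> over ?E" "over_param D x \<notin> over ?E"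
    if x: "x \<in> crossing_points D" for x
    using crossing_params[OF D x] ov x by auto
  have sg: "sign (gauss_of ?E) x = - sign (gauss_of D) x" if x: "x \<in> crossing_points D" for x
    using crosses_sym[OF crosses_gauss_of[OF D crossing_params(1,3,2,4)[OF D x]]]
    by (intro sign_gauss_of[OF E P[OF x]]) simp
  have arcs: "over_in (gauss_of ?E) x y = (\<not> under_in (gauss_of D) x y)" "under_in (gauss_of ?E) x y = (\<not> over_in (gauss_of D) x y)"
    if x: "x \<in> crossing_points D" and y: "y \<in> crossing_points D" and xy: "x \<noteq> y" for x y
  proof -
    note pd = params_distinct[OF D y x xy[symmetric]]
    have "over_in (gauss_of ?E) x y = arc (under_param D x) (over_param D x) (under_param D y)"
      "under_in (gauss_of ?E) x y = arc (under_param D x) (over_param D x) (over_param D y)"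
      by (rule arcs_gauss_of[OF E P[OF x] P[OF y]])+
    moreover have "over_in (gauss_of D) x y = arc (over_param D x) (under_param D x) (over_param D y)"
      "under_in (gauss_of D) x y = arc (over_param D x) (under_param D x) (under_param D y)"
      by (simp_all add: gauss_of_def)
    ultimately show "over_in (gauss_of ?E) x y = (\<not> under_in (gauss_of D) x y)" "under_in (gauss_of ?E) x y = (\<not> over_in (gauss_of D) x y)"
      using arc_swap pd crossing_params(5)[OF D x] by simp_all
  qed
  show "index_writhe (gauss_of ?E) n = - index_writhe (gauss_of D) (- n)"
    "nesting S (gauss_of ?E) = nesting (\<lambda>m n. S (- n) (- m)) (gauss_of D)"
    using gauss_flip[of "gauss_of D" "gauss_of ?E" "- 1"] diagramsD(7)[OF D] ch sg arcs by auto
qed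

text \<open>Parameters and crossing information are untouched, so all arcs persist, while conjugated
  coordinates negate the determinant of the two branches.\<close>

lemma gauss_mirror:
  assumes D: "D \<in> diagrams" and E: "E \<in> diagrams" and m: "mirror_diagram D E"
  shows "index_writhe (gauss_of E) n = - index_writhe (gauss_of D) (- n)"
    "nesting S (gauss_of E) = nesting (\<lambda>m n. S (- m) (- n)) (gauss_of D)"
proof -
  obtain f where f: "homeomorphic_map (surface D) (surface D) f" "\<And>e. e \<in> charts D \<Longrightarrow> f \<circ> e \<circ> cnj \<in> charts E"
    "curve E = f \<circ> curve D" "over E = over D"
    using m unfolding mirror_diagram_def orientation_reversing_homeo_def by force
  have "curve D t \<in> topspace (surface D)" for t
    using diagramsD(2)[OF D] by (auto simp: continuous_map_def)
  then have inj: "f (curve D s) = f (curve D t) \<longleftrightarrow> curve D s = curve D t" for s t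
    using inj_onD[OF homeomorphic_imp_injective_map[OF f(1)]] by metis
  have img: "crossing_points E = f ` crossing_points D"
    unfolding crossing_points_def f(3) double_params_def by (auto simp: inj)
  \<comment> \<open>An intermediate diagram on the old crossing points with negated signs, which f
    maps isomorphically to the new Gauss diagram.\<close>
  define H where "H = \<lparr>chords = crossing_points D, sign = \<lambda>x. - sign (gauss_of D) x,
     over_in = over_in (gauss_of D), under_in = under_in (gauss_of D)\<rparr>"
  have "gauss_iso f H (gauss_of E)"
    unfolding gauss_iso_def
  proof (intro conjI ballI impI)
    have "inj_on f (crossing_points D)" by (auto simp: inj_on_def crossing_points_def inj)
    then show "bij_betw f (chords H) (chords (gauss_of E))" by (simp add: H_def img bij_betw_def)
    have P: "curve E (over_param D x) = f x" "curve E (under_param D x) = f x"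
      "over_param D x \<in> over E" "under_param D x \<notin> over E" if "x \<in> crossing_points D" for x
      using crossing_params[OF D that] f(3,4) by auto
    fix x assume "x \<in> chords H"
    then have x: "x \<in> crossing_points D" by (simp add: H_def)
    let ?s = "over_param D x" and ?t = "under_param D x"
    obtain e z v w where e: "e \<in> charts D" "curve D ?s = e z" "curve D ?t = e z"
     "departs e z v (\<lambda>x. curve D (?s + x))" "departs e z (- v) (\<lambda>x. curve D (?s - x))"
     "departs e z w (\<lambda>x. curve D (?t + x))" "departs e z (- w) (\<lambda>x. curve D (?t - x))"
     "Im (cnj v * w) \<noteq> 0" "sign (gauss_of D) x = (if Im (cnj v * w) > 0 then 1 else - 1)"
      using crosses_gauss_of[OF D crossing_params(1,3,2,4)[OF D x]] unfolding crosses_def by blast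
    have dm: "departs (f \<circ> e \<circ> cnj) (cnj z) (cnj k) (\<lambda>x. (f \<circ> curve D) (q x))" if "departs e z k (\<lambda>x. curve D (q x))" for k q
      using that unfolding departs_def by (simp add: o_def) metis
    have "crosses (charts E) (curve E) ?s ?t (- sign (gauss_of D) x)"
      unfolding crosses_def f(3)
    proof (rule bexI[OF _ f(2)[OF e(1)]], rule exI[of _ "cnj z"], rule exI[of _ "cnj v"], rule exI[of _ "cnj w"], intro conjI)
      show "departs (f \<circ> e \<circ> cnj) (cnj z) (cnj v) (\<lambda>x. (f \<circ> curve D) (?s + x))"
        "departs (f \<circ> e \<circ> cnj) (cnj z) (- cnj v) (\<lambda>x. (f \<circ> curve D) (?s - x))"
        "departs (f \<circ> e \<circ> cnj) (cnj z) (cnj w) (\<lambda>x. (f \<circ> curve D) (?t + x))"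
        "departs (f \<circ> e \<circ> cnj) (cnj z) (- cnj w) (\<lambda>x. (f \<circ> curve D) (?t - x))"
        using e(4-7)[THEN dm] by simp_all
      have *: "b \<noteq> 0 \<and> - \<sigma> = (if b > 0 then 1 else - 1)"
        if "a \<noteq> 0" "\<sigma> = (if a > 0 then 1 else - 1)" "b = - a" for a b :: real and \<sigma> :: int
        using that by auto
      have "Im (cnj (cnj v) * cnj w) = - Im (cnj v * w)" by simp
      from *[OF e(8,9) this] show "Im (cnj (cnj v) * cnj w) \<noteq> 0"
        "- sign (gauss_of D) x = (if Im (cnj (cnj v) * cnj w) > 0 then 1 else - 1)" by blast+
    qed (use e in auto)
    then show "sign (gauss_of E) (f x) = sign H x" using sign_gauss_of[OF E P[OF x]] by (simp add: H_def)
    fix y assume "y \<in> chords H"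
    then have y: "y \<in> crossing_points D" by (simp add: H_def)
    show "over_in (gauss_of E) (f x) (f y) = over_in H x y" "under_in (gauss_of E) (f x) (f y) = under_in H x y"
      using arcs_gauss_of[OF E P[OF x] P[OF y]] by (simp_all add: H_def gauss_of_def)
  qed
  then have "index_writhe (gauss_of E) n = index_writhe H n" "nesting S (gauss_of E) = nesting S H"
    by (simp_all add: gauss_iso_index_writhe gauss_iso_nesting)
  then show "index_writhe (gauss_of E) n = - index_writhe (gauss_of D) (- n)"
    "nesting S (gauss_of E) = nesting (\<lambda>m n. S (- m) (- n)) (gauss_of D)"
    using gauss_negate[of H "gauss_of D"] by (simp_all add: H_def)
qed


section \<open>Invariance under Reidemeister moves\<close>

lemma Ints_diff_commute: "x - y \<in> \<int> \<longleftrightarrow> y - x \<in> (\<int> :: real set)"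
  by (metis Ints_minus minus_diff_eq)

lemma frac_eq_imp_Ints:
  assumes "frac x = frac (y::real)"
  shows "x - y \<in> \<int>"
proof -
  have "x - y = of_int (\<lfloor>x\<rfloor> - \<lfloor>y\<rfloor>)" using assms by (simp add: frac_def)
  then show ?thesis by (metis Ints_of_int)
qed

lemma arc_rotate:
  assumes "s - t \<notin> \<int>" "p - s \<notin> \<int>" "p - t \<notin> \<int>"
  shows "arc p s t \<longleftrightarrow> arc s t p"
proof -
  have eq: "frac (t - p) = frac ((t - s) - (p - s))" "frac (s - p) = frac (0 - (p - s))" by simp_all
  have f0: "frac (0::real) = 0" by simp
  have ne: "frac (p - s) \<noteq> frac (t - s)"
  proof
    assume "frac (p - s) = frac (t - s)"
    then have "p - t \<in> \<int>" using frac_eq_imp_Ints[of "p - s" "t - s"] by simp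
    then show False using assms(3) by blast
  qed
  have "frac (p - s) > 0" "frac (t - s) > 0"
    using assms(1,2) by (simp_all add: frac_gt_0_iff Ints_diff_commute[of t s])
  then show ?thesis unfolding arc_def eq frac_diff_eq[of _ "p - s"] f0
    using ne frac_lt_1[of "t - s"] frac_lt_1[of "p - s"] by (smt (verit))
qed

text \<open>While a parameter moves from p to p' it does not pass r modulo 1. A Reidemeister move
  shifts crossings along strands, and the arcs seen from outside persist because these shifts pass
  no other crossing.\<close>

definition avoids :: "real \<Rightarrow> real \<Rightarrow> real \<Rightarrow> bool" where
  "avoids p p' r \<longleftrightarrow> (\<forall>x\<in>closed_segment p p'. x - r \<notin> \<int>)"

lemma avoids_commute: "avoids p p' r \<longleftrightarrow> avoids p' p r"
  by (simp add: avoids_def closed_segment_commute)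

lemma avoidsD: "avoids p p' r \<Longrightarrow> p - r \<notin> \<int>" "avoids p p' r \<Longrightarrow> p' - r \<notin> \<int>"
  by (auto simp: avoids_def)

text \<open>No integer lies between \<open>p - r\<close> and \<open>p' - r\<close>, so both have the
  same integer part.\<close>

lemma avoids_frac:
  assumes "avoids p p' r" "p \<le> p'"
  shows "frac (p' - r) = frac (p - r) + (p' - p)"
proof -
  define k where "k = \<lfloor>p - r\<rfloor> + 1"
  have "p' - r < of_int k"
  proof (rule ccontr)
    assume "\<not> p' - r < of_int k"
    moreover have "p - r < of_int k" by (simp add: k_def)
    ultimately have "r + of_int k \<in> closed_segment p p'" using assms(2) by (simp add: closed_segment_eq_real_ivl)
    then have "r + of_int k - r \<notin> \<int>" using assms(1) unfolding avoids_def by blast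
    then show False by simp
  qed
  then have "\<lfloor>p' - r\<rfloor> = \<lfloor>p - r\<rfloor>" using assms(2) unfolding k_def by linarith
  then show ?thesis by (simp add: frac_def)
qed

lemma arc_avoid:
  assumes "avoids p p' s" "avoids p p' t"
  shows "arc s t p \<longleftrightarrow> arc s t p'"
proof -
  have *: "arc s t p \<longleftrightarrow> arc s t p'" if a: "avoids p p' s" "avoids p p' t" and le: "p \<le> p'" for p p'
  proof -
    have f: "frac (p' - s) = frac (p - s) + (p' - p)" by (rule avoids_frac[OF a(1) le])
    have "\<not> (frac (p - s) < frac (t - s) \<and> frac (t - s) \<le> frac (p' - s))"
    proof
      assume h: "frac (p - s) < frac (t - s) \<and> frac (t - s) \<le> frac (p' - s)"
      define r where "r = p + (frac (t - s) - frac (p - s))"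
      have "r \<in> closed_segment p p'" using h f by (simp add: r_def closed_segment_eq_real_ivl le)
      moreover have "r - t = of_int (\<lfloor>p - s\<rfloor> - \<lfloor>t - s\<rfloor>)" by (simp add: r_def frac_def)
      then have "r - t \<in> \<int>" by (metis Ints_of_int)
      ultimately show False using a(2) by (simp add: avoids_def)
    qed
    then show ?thesis unfolding arc_def using f le by linarith
  qed
  show ?thesis using *[of p p'] *[of p' p] assms avoids_commute by (meson linear)
qed

lemma arc_avoid_start:
  assumes "avoids p p' t" "avoids p p' x" "x - t \<notin> \<int>"
  shows "arc p t x \<longleftrightarrow> arc p' t x"
proof -
  have r: "arc q t x \<longleftrightarrow> arc t x q" if "q - t \<notin> \<int>" "q - x \<notin> \<int>" for q
    using arc_rotate[of t x q] that assms(3) by (simp add: Ints_diff_commute)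
  show ?thesis using r[of p] r[of p'] arc_avoid[OF assms(1,2)] assms by (simp add: avoidsD)
qed

lemma arc_avoid_end:
  assumes "avoids p p' s" "avoids p p' x" "x - s \<notin> \<int>"
  shows "arc s p x \<longleftrightarrow> arc s p' x"
proof -
  have r: "arc s q x \<longleftrightarrow> arc x s q" if "q - s \<notin> \<int>" "q - x \<notin> \<int>" for q
    using arc_rotate[of s q x] that assms(3) by (simp add: Ints_diff_commute)
  show ?thesis using r[of p] r[of p'] arc_avoid[OF assms(2,1)] assms by (simp add: avoidsD)
qed

text \<open>The segment between p and p' is shorter than a turn and does not contain r, so the
  cyclic order of the three is decided by which of p and p' is smaller.\<close>

lemma arc_order:
  assumes "avoids p p' r" "\<bar>p - p'\<bar> < 1" "p \<noteq> p'"
  shows "arc p r p' \<longleftrightarrow> p < p'" "arc r p p' \<longleftrightarrow> p' < p" "arc p p' r \<longleftrightarrow> p' < p"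
proof -
  have 1: "arc p r p' \<longleftrightarrow> p < p'" if a: "avoids p p' r" "\<bar>p - p'\<bar> < 1" "p \<noteq> p'" for p p'
  proof (cases "p < p'")
    case True
    have "frac (p' - p) = p' - p" using True a(2) by (simp add: frac_eq)
    moreover have "frac (p' - r) = frac (p - r) + (p' - p)" using avoids_frac[OF a(1)] True by simp
    moreover have "frac (r - p) = 1 - frac (p - r)"
      using frac_neg[of "p - r"] avoidsD(1)[OF a(1)] by simp
    ultimately show ?thesis unfolding arc_def using True frac_lt_1[of "p' - r"] by linarith
  next
    case False
    then have lt: "p' < p" using a(3) by simp
    have "p' - p \<notin> \<int>"
    proof
      assume "p' - p \<in> \<int>"
      then obtain n :: int where "p' - p = of_int n" by (auto elim: Ints_cases)
      then have "n = 0" using a(2) by (simp add: abs_less_iff)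
      then show False using \<open>p' - p = of_int n\<close> lt by simp
    qed
    then have "p - p' \<notin> \<int>" by (simp add: Ints_diff_commute)
    then have "frac (p' - p) = 1 - frac (p - p')" using frac_neg[of "p - p'"] by simp
    moreover have "frac (p - p') = p - p'" using lt a(2) by (simp add: frac_eq)
    moreover have "frac (p - r) = frac (p' - r) + (p - p')"
      using avoids_frac[of p' p r] a(1) lt avoids_commute by simp
    moreover have "frac (r - p) = 1 - frac (p - r)"
      using frac_neg[of "p - r"] avoidsD(1)[OF a(1)] by simp
    ultimately show ?thesis unfolding arc_def using lt frac_ge_0[of "p' - r"] by linarith
  qed
  show "arc p r p' \<longleftrightarrow> p < p'" using 1 assms .
  have np: "p - p' \<notin> \<int>"
  proof
    assume "p - p' \<in> \<int>"
    then obtain n :: int where n: "p - p' = of_int n" by (auto elim: Ints_cases)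
    then have "\<bar>of_int n\<bar> < (1::real)" using assms(2) by simp
    then have "n = 0" by linarith
    then show False using n assms(3) by simp
  qed
  have 2: "arc p' r p \<longleftrightarrow> p' < p" using 1[of p' p] assms avoids_commute[of p p'] by (simp add: abs_minus_commute)
  have a: "r - p \<notin> \<int>" "p' - r \<notin> \<int>" "p' - p \<notin> \<int>"
    using avoidsD[OF assms(1)] np by (simp_all add: Ints_diff_commute)
  show 3: "arc r p p' \<longleftrightarrow> p' < p" using arc_rotate[OF a(1,2,3)] 2 by simp
  show "arc p p' r \<longleftrightarrow> p' < p" using arc_rotate[of p p' r] a np 3 by (simp add: Ints_diff_commute)
qed

text \<open>The way from T to M and on to B ends at the first arrival at B if M lies on the arc from
  T to B; otherwise it makes one full turn more, which counts every parameter once in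
  excess.\<close>

lemma arc_additive:
  assumes "T - M \<notin> \<int>" "T - B \<notin> \<int>" "M - B \<notin> \<int>" "p - T \<notin> \<int>" "p - M \<notin> \<int>" "p - B \<notin> \<int>"
  shows "(of_bool (arc T B p) :: int) = of_bool (arc T M p) + of_bool (arc M B p) + (if arc T B M then 0 else - 1)"
proof -
  have eq: "frac (p - M) = frac ((p - T) - (M - T))" "frac (B - M) = frac ((B - T) - (M - T))" by simp_all
  have "frac (p - T) \<noteq> frac (M - T)" "frac (p - T) \<noteq> frac (B - T)" "frac (B - T) \<noteq> frac (M - T)"
    using frac_eq_imp_Ints[of "p - T" "M - T"] frac_eq_imp_Ints[of "p - T" "B - T"] frac_eq_imp_Ints[of "B - T" "M - T"]
      assms by (auto simp: Ints_diff_commute[of B M])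
  moreover have "(of_bool (x < \<beta>) :: int) = of_bool (x < m) + of_bool ((if m \<le> x then x - m else x - m + 1)
      < (if m \<le> \<beta> then \<beta> - m else \<beta> - m + 1)) + (if m < \<beta> then 0 else - 1)"
    if "0 \<le> x" "x < 1" "0 \<le> \<beta>" "\<beta> < 1" "0 \<le> m" "m < 1" "x \<noteq> m" "x \<noteq> \<beta>" "\<beta> \<noteq> m" for x \<beta> m :: real
    using that by auto
  ultimately show ?thesis unfolding arc_def eq frac_diff_eq[of _ "M - T"]
    by (simp add: frac_lt_1)
qed

text \<open>Strand i runs through the same parameters \<open>P i u\<close> in both diagrams.
  Everything outside the image \<open>Sq\<close> of the square coincides, in particular the set
  \<open>Y\<close> of crossings there with their signs and mutual arcs; each move then only has to
  deal with the crossings inside \<open>Sq\<close>.\<close>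

locale tangle_move =
  fixes D E :: "'a diagram" and ps qs :: "(real \<Rightarrow> complex) list" and e :: "complex \<Rightarrow> 'a"
    and a b :: "nat \<Rightarrow> real" and h :: "nat \<Rightarrow> nat"
  assumes D: "D \<in> diagrams" and E: "E \<in> diagrams"
    and same: "surface E = surface D" "charts E = charts D" and len: "length qs = length ps"
    and e: "e \<in> charts D" and b0: "\<And>i. i < length ps \<Longrightarrow> b i \<noteq> 0" and h: "inj_on h {..<length ps}"
    and TD: "shows_tangle ps e a b h D" and TE: "shows_tangle qs e a b h E"
    and outside: "\<And>t. (\<forall>i<length ps. \<forall>u\<in>{0..1}. t - (a i + b i * u) \<notin> \<int>) \<Longrightarrow>
        curve E t = curve D t \<and> (t \<in> over E \<longleftrightarrow> t \<in> over D)"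
    and sq: "\<And>i u. i < length ps \<Longrightarrow> u \<in> {0..1} \<Longrightarrow> (ps ! i) u \<in> unit_square \<and> (qs ! i) u \<in> unit_square"
begin

definition P :: "nat \<Rightarrow> real \<Rightarrow> real" where "P i u = a i + b i * u"

definition Sq :: "'a set" where "Sq = e ` unit_square"

definition Y :: "'a set" where "Y = {x \<in> crossing_points D. x \<notin> Sq}"

lemma inj_e: "inj e"
  using orientationD(1)[OF diagramsD(1)[OF D] e] by (simp add: plane_chart_iff)

lemma strandD: "i < length ps \<Longrightarrow> u \<in> {0..1} \<Longrightarrow> curve D (P i u) = e ((ps ! i) u)"
  using TD unfolding shows_tangle_def P_def by blast

lemma strandE: "i < length ps \<Longrightarrow> u \<in> {0..1} \<Longrightarrow> curve E (P i u) = e ((qs ! i) u)"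
  using TE len unfolding shows_tangle_def P_def by metis

lemma overD: "i < length ps \<Longrightarrow> j < length ps \<Longrightarrow> u \<in> {0..1} \<Longrightarrow> v \<in> {0..1} \<Longrightarrow> i \<noteq> j \<Longrightarrow>
    (ps ! i) u = (ps ! j) v \<Longrightarrow> P i u \<in> over D \<longleftrightarrow> h j < h i"
  using TD unfolding shows_tangle_def P_def by blast

lemma overE: "i < length ps \<Longrightarrow> j < length ps \<Longrightarrow> u \<in> {0..1} \<Longrightarrow> v \<in> {0..1} \<Longrightarrow> i \<noteq> j \<Longrightarrow>
    (qs ! i) u = (qs ! j) v \<Longrightarrow> P i u \<in> over E \<longleftrightarrow> h j < h i"
  using TE len unfolding shows_tangle_def P_def by metis

lemma Sq_D: "curve D t \<in> Sq \<longleftrightarrow> (\<exists>i<length ps. \<exists>u\<in>{0..1}. t - P i u \<in> \<int>)"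
proof
  assume "curve D t \<in> Sq"
  then show "\<exists>i<length ps. \<exists>u\<in>{0..1}. t - P i u \<in> \<int>"
    using TD unfolding shows_tangle_def Sq_def P_def by blast
next
  assume "\<exists>i<length ps. \<exists>u\<in>{0..1}. t - P i u \<in> \<int>"
  then obtain i u where iu: "i < length ps" "u \<in> {0..1}" "t - P i u \<in> \<int>" by blast
  then have "curve D t = e ((ps ! i) u)" using curve_cong[OF D iu(3)] strandD by simp
  then show "curve D t \<in> Sq" using sq iu by (auto simp: Sq_def)
qed

lemma Sq_E: "curve E t \<in> Sq \<longleftrightarrow> (\<exists>i<length ps. \<exists>u\<in>{0..1}. t - P i u \<in> \<int>)"
proof
  assume "curve E t \<in> Sq"
  then show "\<exists>i<length ps. \<exists>u\<in>{0..1}. t - P i u \<in> \<int>"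
    using TE len unfolding shows_tangle_def Sq_def P_def by metis
next
  assume "\<exists>i<length ps. \<exists>u\<in>{0..1}. t - P i u \<in> \<int>"
  then obtain i u where iu: "i < length ps" "u \<in> {0..1}" "t - P i u \<in> \<int>" by blast
  then have "curve E t = e ((qs ! i) u)" using curve_cong[OF E iu(3)] strandE by simp
  then show "curve E t \<in> Sq" using sq iu by (auto simp: Sq_def)
qed

lemma agree: "curve D t \<notin> Sq \<Longrightarrow> curve E t = curve D t" "curve D t \<notin> Sq \<Longrightarrow> t \<in> over E \<longleftrightarrow> t \<in> over D"
  using outside[of t] unfolding Sq_D by (auto simp: P_def)

lemma Sq_DE: "curve E t \<in> Sq \<longleftrightarrow> curve D t \<in> Sq"
  by (simp add: Sq_D Sq_E)

lemma Y_E: "Y = {x \<in> crossing_points E. x \<notin> Sq}"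
proof (intro set_eqI iffI)
  fix x assume "x \<in> Y"
  then have x: "x \<in> crossing_points D" "x \<notin> Sq" by (auto simp: Y_def)
  from crossing_params[OF D x(1)] have "x \<in> crossing_points E"
    by (intro crossing_pointI[OF E, of "over_param D x" x "under_param D x"]) (use agree x in auto)
  then show "x \<in> {x \<in> crossing_points E. x \<notin> Sq}" using x by simp
next
  fix x assume "x \<in> {x \<in> crossing_points E. x \<notin> Sq}"
  then have x: "x \<in> crossing_points E" "x \<notin> Sq" by auto
  note X = crossing_params[OF E x(1)]
  have "curve D (over_param E x) \<notin> Sq" "curve D (under_param E x) \<notin> Sq"
    using X(1,3) x(2) Sq_DE by metis+
  then have "x \<in> crossing_points D" using X agree
    by (intro crossing_pointI[OF D, of "over_param E x" x "under_param E x"]) auto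
  then show "x \<in> Y" using x by (simp add: Y_def)
qed

text \<open>The predicates under the choice operator coincide, so the chosen parameters are equal
  and not merely congruent modulo 1.\<close>

lemma params_E: "x \<in> Y \<Longrightarrow> over_param E x = over_param D x" "x \<in> Y \<Longrightarrow> under_param E x = under_param D x"
proof -
  assume "x \<in> Y"
  then have x: "x \<notin> Sq" by (simp add: Y_def)
  have "curve E s = x \<longleftrightarrow> curve D s = x" for s using agree(1)[of s] Sq_DE[of s] x by metis
  moreover have "s \<in> over E \<longleftrightarrow> s \<in> over D" if "curve D s = x" for s using agree(2)[of s] that x by auto
  ultimately have "(\<lambda>s. curve E s = x \<and> s \<in> over E) = (\<lambda>s. curve D s = x \<and> s \<in> over D)"
    "(\<lambda>s. curve E s = x \<and> s \<notin> over E) = (\<lambda>s. curve D s = x \<and> s \<notin> over D)" by (auto simp: fun_eq_iff)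
  then show "over_param E x = over_param D x" "under_param E x = under_param D x"
    by (simp_all add: over_param_def under_param_def)
qed

lemma Y_params:
  assumes "x \<in> Y"
  shows "curve D (over_param D x) = x" "over_param D x \<in> over D" "curve D (under_param D x) = x"
    "under_param D x \<notin> over D" "curve D (over_param D x) \<notin> Sq" "curve D (under_param D x) \<notin> Sq"
    "over_param D x - under_param D x \<notin> \<int>"
  using crossing_params[OF D, of x] assms by (auto simp: Y_def)

text \<open>Every parameter between two parameters of a strand belongs to the strand, and its point
  lies in the square; r has its point outside.\<close>

lemma avoids_outside:
  assumes "curve D r \<notin> Sq" "i < length ps" "u \<in> {0..1}" "v \<in> {0..1}"
  shows "avoids (P i u) (P i v) r"
  unfolding avoids_def
proof (intro ballI notI)
  fix x assume "x \<in> closed_segment (P i u) (P i v)" "x - r \<in> \<int>"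
  then obtain k where k: "0 \<le> k" "k \<le> 1" "x = (1 - k) * P i u + k * P i v" by (auto simp: closed_segment_def)
  have "x = P i ((1 - k) * u + k * v)" by (simp add: k(3) P_def algebra_simps)
  moreover have "(1 - k) * u + k * v \<in> {0..1}"
    using k assms(3,4) convex_bound_le[of u 1 v "1 - k" k] by auto
  moreover have "r - x \<in> \<int>" using \<open>x - r \<in> \<int>\<close> Ints_diff_commute[of r x] by simp
  ultimately have "curve D r \<in> Sq" unfolding Sq_D using assms(2) by blast
  then show False using assms(1) by blast
qed

lemma Sq_closed: "openin (surface D) (topspace (surface D) - Sq)"
proof -
  have ch: "continuous_map euclidean (surface D) e"
    using orientationD(1)[OF diagramsD(1)[OF D] e] by (simp add: plane_chart_iff)
  have "compactin euclidean unit_square" by (simp add: unit_square_def)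
  from image_compactin[OF this ch] have "compactin (surface D) Sq" by (simp add: Sq_def)
  moreover have "Hausdorff_space (surface D)" using D by (simp add: diagrams_def closed_oriented_surface_def)
  ultimately show ?thesis using compactin_imp_closedin by blast
qed

text \<open>The square is compact, hence closed, so the two curves agree on a neighbourhood of s and
  not only at s.\<close>

lemma departs_agree:
  assumes "curve D s \<notin> Sq"
  shows "departs e' z v (\<lambda>x. curve D (s + x)) \<Longrightarrow> departs e' z v (\<lambda>x. curve E (s + x))"
    "departs e' z v (\<lambda>x. curve D (s - x)) \<Longrightarrow> departs e' z v (\<lambda>x. curve E (s - x))"
proof -
  have "curve D t \<in> topspace (surface D)" for t using diagramsD(2)[OF D] by (auto simp: continuous_map_def)
  moreover have "openin euclideanreal {t \<in> topspace euclideanreal. curve D t \<in> topspace (surface D) - Sq}"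
    by (rule openin_continuous_map_preimage[OF diagramsD(2)[OF D] Sq_closed])
  ultimately have "open {t. curve D t \<notin> Sq}" by simp
  then obtain \<eta> where \<eta>: "\<eta> > 0" "ball s \<eta> \<subseteq> {t. curve D t \<notin> Sq}" using assms openE by (metis mem_Collect_eq)
  have *: "departs e' z v (\<lambda>x. curve E (s + k * x))" if h: "departs e' z v (\<lambda>x. curve D (s + k * x))" "\<bar>k\<bar> = 1" for k
  proof -
    obtain \<delta> where d: "\<delta> > 0" "\<And>x. 0 < x \<Longrightarrow> x < \<delta> \<Longrightarrow> \<exists>\<rho>>0. curve D (s + k * x) = e' (z + of_real \<rho> * v)"
      using h(1) by (auto simp: departs_def)
    have ag: "curve E (s + k * x) = curve D (s + k * x)" if "0 < x" "x < \<eta>" for x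
    proof (rule agree(1))
      have "dist s (s + k * x) < \<eta>" using that \<open>\<bar>k\<bar> = 1\<close> by (simp add: dist_real_def abs_mult)
      then show "curve D (s + k * x) \<notin> Sq" using \<eta>(2) by auto
    qed
    show ?thesis unfolding departs_def
      by (rule exI[of _ "min \<delta> \<eta>"]) (use d \<eta>(1) ag in auto)
  qed
  show "departs e' z v (\<lambda>x. curve D (s + x)) \<Longrightarrow> departs e' z v (\<lambda>x. curve E (s + x))"
    "departs e' z v (\<lambda>x. curve D (s - x)) \<Longrightarrow> departs e' z v (\<lambda>x. curve E (s - x))"
    using *[of 1] *[of "- 1"] by simp_all
qed

lemma gauss_outside:
  assumes x: "x \<in> Y"
  shows "sign (gauss_of E) x = sign (gauss_of D) x"
    "y \<in> Y \<Longrightarrow> over_in (gauss_of E) x y = over_in (gauss_of D) x y"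
    "y \<in> Y \<Longrightarrow> under_in (gauss_of E) x y = under_in (gauss_of D) x y"
proof -
  note X = Y_params[OF x]
  let ?s = "over_param D x" and ?t = "under_param D x"
  obtain e' z v w where e': "e' \<in> charts D" "curve D ?s = e' z" "curve D ?t = e' z"
     "departs e' z v (\<lambda>x. curve D (?s + x))" "departs e' z (- v) (\<lambda>x. curve D (?s - x))"
     "departs e' z w (\<lambda>x. curve D (?t + x))" "departs e' z (- w) (\<lambda>x. curve D (?t - x))"
     "Im (cnj v * w) \<noteq> 0" "sign (gauss_of D) x = (if Im (cnj v * w) > 0 then 1 else - 1)"
    using crosses_gauss_of[OF D X(1,3,2,4)] unfolding crosses_def by blast
  have eq: "curve E ?s = curve D ?s" "curve E ?t = curve D ?t" using agree X(5,6) by auto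
  have "crosses (charts E) (curve E) ?s ?t (sign (gauss_of D) x)"
    unfolding crosses_def eq same
    by (rule bexI[OF _ e'(1)], rule exI[of _ z], rule exI[of _ v], rule exI[of _ w])
       (use e' departs_agree[OF X(5)] departs_agree[OF X(6)] in blast)
  then show "sign (gauss_of E) x = sign (gauss_of D) x"
    using agree X by (intro sign_gauss_of[OF E]) auto
  show "y \<in> Y \<Longrightarrow> over_in (gauss_of E) x y = over_in (gauss_of D) x y"
    "y \<in> Y \<Longrightarrow> under_in (gauss_of E) x y = under_in (gauss_of D) x y"
    using x by (simp_all add: gauss_of_def params_E)
qed

lemma finite_Y: "finite Y"
  using diagramsD(7)[OF D] by (simp add: Y_def)

end

section \<open>The first Reidemeister move\<close>

lemma gauss_R1_move:
  assumes DE: "D \<in> diagrams" "E \<in> diagrams" "reidemeister1 D E"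
  shows "gauss_equal (gauss_of D) (gauss_of E)"
proof -
  define Q where "Q = (linepath (Complex (-1) 0) (Complex (1/2) (1/2)) +++
       linepath (Complex (1/2) (1/2)) (Complex (-1/2) (1/2))) +++
       linepath (Complex (-1/2) (1/2)) (Complex 1 0)"
  define L where "L = linepath (Complex (-1) 0) (Complex 1 0)"
  have L: "L u = Complex (2 * u - 1) 0" for u by (simp add: L_def linepath_def complex_eq_iff)
  have Q: "Q u = (if u \<le> 1/4 then Complex (6 * u - 1) (2 * u) else if u \<le> 1/2 then Complex (3/2 - 4 * u) (1/2)
     else Complex (3 * u - 2) (1 - u))" for u
    by (simp add: Q_def joinpaths_def linepath_def complex_eq_iff field_simps)
  obtain e a b h where m: "surface E = surface D" "charts E = charts D" "e \<in> charts D" "b (0::nat) \<noteq> 0" "inj_on h {..<1}"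
    "shows_tangle [L] e a b h D" "shows_tangle [Q] e a b h E"
    "\<And>t. (\<forall>u\<in>{0..1}. t - (a 0 + b 0 * u) \<notin> \<int>) \<Longrightarrow> curve E t = curve D t \<and> (t \<in> over E \<longleftrightarrow> t \<in> over D)"
    using DE(3) unfolding reidemeister1_def tangle_replacement_def L_def[symmetric] Q_def[symmetric] by auto
  interpret tangle_move D E "[L]" "[Q]" e a b h
  proof
    show "([L] ! i) u \<in> unit_square \<and> ([Q] ! i) u \<in> unit_square" if "i < length [L]" "u \<in> {0..1}" for i u
      using that by (auto simp: unit_square_def L Q in_cbox_complex_iff)
  qed (use DE m in auto)
  have SD: "curve D (P 0 u) = e (L u)" and SE: "curve E (P 0 u) = e (Q u)" if "u \<in> {0..1}" for u
    using strandD[of 0 u] strandE[of 0 u] that by simp_all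
  \<comment> \<open>A strand of parameter length at least 1 would return to its starting point,
    while the straight tangle is injective.\<close>
  have b1: "\<bar>b 0\<bar> < 1"
  proof (rule ccontr)
    assume b: "\<not> \<bar>b 0\<bar> < 1"
    then have u: "1 / \<bar>b 0\<bar> \<in> {0..1}" by simp
    have "P 0 (1 / \<bar>b 0\<bar>) - P 0 0 \<in> \<int>" using b by (auto simp: P_def abs_if)
    from curve_cong[OF DE(1) this] have "L (1 / \<bar>b 0\<bar>) = L 0" using SD[OF u] SD[of 0] injD[OF inj_e] by simp
    then show False using b by (auto simp: L)
  qed
  have Pint: "P 0 u - P 0 v \<in> \<int> \<longleftrightarrow> u = v" if "u \<in> {0..1}" "v \<in> {0..1}" for u v
  proof
    assume "P 0 u - P 0 v \<in> \<int>"
    from curve_cong[OF DE(1) this] have "L u = L v" using SD that injD[OF inj_e] by simp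
    then show "u = v" by (simp add: L)
  qed simp
  have YD: "crossing_points D = Y"
  proof -
    have "x \<notin> Sq" if x: "x \<in> crossing_points D" for x
    proof
      assume "x \<in> Sq"
      note X = crossing_params[OF DE(1) x]
      from \<open>x \<in> Sq\<close> X(1,3) obtain u v where uv: "u \<in> {0..1}" "over_param D x - P 0 u \<in> \<int>" "v \<in> {0..1}" "under_param D x - P 0 v \<in> \<int>"
        using Sq_D[of "over_param D x"] Sq_D[of "under_param D x"] by auto
      then have "e (L u) = e (L v)" using X(1,3) SD curve_cong[OF DE(1)] by metis
      then have "u = v" using injD[OF inj_e] by (fastforce simp: L)
      then show False using X(5) Ints_diff[OF uv(2,4)] by simp
    qed
    then show ?thesis by (auto simp: Y_def)
  qed
  \<comment> \<open>The double point of the kink, at height 1/3 on the vertical axis; it is passed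
    at u = 1/6 and at u = 2/3.\<close>
  define q where "q = e (Q (1/6))"
  have q': "q = e (Q (2/3))" by (simp add: q_def Q)
  have qp: "curve E (P 0 (1/6)) = q" "curve E (P 0 (2/3)) = q" using SE[of "1/6"] SE[of "2/3"] q_def q' by simp_all
  have nint: "P 0 (1/6) - P 0 (2/3) \<notin> \<int>" using Pint[of "1/6" "2/3"] by simp
  then have "double_params (curve E) (P 0 (1/6)) (P 0 (2/3))" using qp by (simp add: double_params_def)
  then have qE: "q \<in> crossing_points E" and ov: "P 0 (1/6) \<in> over E \<longleftrightarrow> P 0 (2/3) \<notin> over E"
    using qp diagramsD(10)[OF DE(2)] by (auto simp: crossing_points_def)
  \<comment> \<open>From here on u is the over-passage and v the under-passage; at a self-crossing
    of the strand the move leaves open which comes first.\<close>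
  obtain u v where uv': "u \<in> {0..1}" "v \<in> {0..1}" "u \<noteq> v" "curve E (P 0 u) = q" "curve E (P 0 v) = q"
    and uv: "P 0 u \<in> over E" "P 0 v \<notin> over E"
  proof (cases "P 0 (1/6) \<in> over E")
    case True
    then show ?thesis using that[of "1/6" "2/3"] qp ov by simp
  next
    case False
    then show ?thesis using that[of "2/3" "1/6"] qp ov by simp
  qed
  have qSq: "q \<in> Sq" using sq[of 0 "1/6"] by (auto simp: q_def Sq_def)
  have self: "x = q" if x: "x \<in> crossing_points E" "x \<in> Sq" for x
  proof -
    note X = crossing_params[OF DE(2) x(1)]
    obtain u v where uv: "u \<in> {0..1}" "over_param E x - P 0 u \<in> \<int>" "v \<in> {0..1}" "under_param E x - P 0 v \<in> \<int>"
      using Sq_E[of "over_param E x"] Sq_E[of "under_param E x"] X(1,3) x(2) by auto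
    have eq: "x = e (Q u)" "x = e (Q v)" using X(1,3) SE uv curve_cong[OF DE(2)] by metis+
    have "u \<noteq> v" using X(5) Ints_diff[OF uv(2,4)] by auto
    moreover have "Q u = Q v" using eq injD[OF inj_e] by metis
    ultimately have "{u, v} = {1/6, 2/3}" unfolding Q by (auto split: if_splits)
    then have "u = 1/6 \<or> u = 2/3" by blast
    then show "x = q" using eq(1) q_def q' by metis
  qed
  have XE: "crossing_points E = insert q Y"
  proof (intro set_eqI iffI)
    fix x assume "x \<in> crossing_points E"
    then show "x \<in> insert q Y" using self[of x] by (cases "x \<in> Sq") (simp_all add: Y_E)
  qed (use qE Y_E in blast)
  have qY: "q \<notin> Y" using qSq by (simp add: Y_def)
  show ?thesis
  \<comment> \<open>If the over-passage is the later of the two, the arc of q runs through the whole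
    curve outside the kink; otherwise it stays within the kink.\<close>
  proof (rule gauss_R1[where q = q and k = "P 0 v < P 0 u"])
    show "finite (chords (gauss_of D))" "q \<notin> chords (gauss_of D)"
      "chords (gauss_of E) = insert q (chords (gauss_of D))"
      using finite_Y qY XE by (simp_all add: YD)
    show "sign (gauss_of E) x = sign (gauss_of D) x" if "x \<in> chords (gauss_of D)" for x
      using gauss_outside(1)[of x] that YD by simp
    show "over_in (gauss_of E) x y = over_in (gauss_of D) x y \<and> under_in (gauss_of E) x y = under_in (gauss_of D) x y"
      if "x \<in> chords (gauss_of D)" "y \<in> chords (gauss_of D)" for x y
      using gauss_outside(2,3)[of x y] that YD by simp
    fix x assume "x \<in> chords (gauss_of D)"
    then have x: "x \<in> Y" using YD by simp
    note X = Y_params[OF x]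
    have XE': "curve E (over_param D x) = x" "curve E (under_param D x) = x" "over_param D x \<in> over E" "under_param D x \<notin> over E"
      using X agree by auto
    note A = arcs_gauss_of[OF DE(2)]
    have av: "avoids (P 0 u) (P 0 v) (over_param D x)" "avoids (P 0 u) (P 0 v) (under_param D x)"
      using avoids_outside[of _ 0 u v] X uv' by auto
    show "over_in (gauss_of E) x q = under_in (gauss_of E) x q"
      using A[OF XE' uv'(4,5) uv] arc_avoid[OF av] by simp
    have ne: "P 0 u \<noteq> P 0 v" "\<bar>P 0 u - P 0 v\<bar> < 1"
    proof -
      show "P 0 u \<noteq> P 0 v"
      proof
        assume eq: "P 0 u = P 0 v"
        have "P 0 u - P 0 v \<in> \<int>" unfolding eq by simp
        then show False using Pint[of u v] uv' by simp
      qed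
      have "\<bar>P 0 u - P 0 v\<bar> = \<bar>b 0\<bar> * \<bar>u - v\<bar>" by (simp add: P_def abs_mult[symmetric] algebra_simps)
      also have "\<dots> \<le> \<bar>b 0\<bar> * 1" using uv' by (intro mult_left_mono) auto
      finally show "\<bar>P 0 u - P 0 v\<bar> < 1" using b1 by simp
    qed
    show "over_in (gauss_of E) q x = (P 0 v < P 0 u) \<and> under_in (gauss_of E) q x = (P 0 v < P 0 u)"
      using A[OF uv'(4,5) uv XE'] arc_order(3)[OF av(1) ne(2,1)] arc_order(3)[OF av(2) ne(2,1)] by simp
  qed
qed


text \<open>In the second and third move all strands are graphs over the first coordinate
  \<open>2 * u - 1\<close>. Two strands can therefore meet only at equal u, and crossings in the
  square are solutions of \<open>f i u = f j u\<close> or \<open>g i u = g j u\<close>.\<close>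

locale graph_move = tangle_move +
  fixes f g :: "nat \<Rightarrow> real \<Rightarrow> real"
  assumes ps_graph: "\<And>i u. i < length ps \<Longrightarrow> u \<in> {0..1} \<Longrightarrow> (ps ! i) u = Complex (2 * u - 1) (f i u)"
    and qs_graph: "\<And>i u. i < length ps \<Longrightarrow> u \<in> {0..1} \<Longrightarrow> (qs ! i) u = Complex (2 * u - 1) (g i u)"
begin

text \<open>Two strands that share a parameter would meet there, and this single passage would have
  to be over and under at once, as the heights of the strands are different.\<close>

lemma strands_apart:
  assumes "i < length ps" "j < length ps" "i \<noteq> j" "u \<in> {0..1}" "v \<in> {0..1}"
  shows "P i u - P j v \<notin> \<int>"
proof
  assume *: "P i u - P j v \<in> \<int>"
  then have "(ps ! i) u = (ps ! j) v"
    using curve_cong[OF D *] strandD assms injD[OF inj_e] by metis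
  then have "P i u \<in> over D \<longleftrightarrow> h j < h i" "P j v \<in> over D \<longleftrightarrow> h i < h j"
    using overD[of i j u v] overD[of j i v u] assms by auto
  moreover have "P i u \<in> over D \<longleftrightarrow> P j v \<in> over D" using over_cong[OF D *] .
  moreover have "h i \<noteq> h j" using h assms by (auto dest: inj_onD)
  ultimately show False by linarith
qed

lemma strand_short:
  assumes "i < length ps" "u \<in> {0..1}" "v \<in> {0..1}"
  shows "P i u - P i v \<in> \<int> \<longleftrightarrow> u = v" "\<bar>P i u - P i v\<bar> < 1" "P i u = P i v \<longleftrightarrow> u = v"
    "P i u < P i v \<longleftrightarrow> (if b i > 0 then u < v else v < u)"
proof -
  have *: "u = v" if "P i u - P i v \<in> \<int>" "u \<in> {0..1}" "v \<in> {0..1}" for u v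
    using curve_cong[OF D that(1)] strandD[OF assms(1)] that injD[OF inj_e] ps_graph[OF assms(1)]
    by (metis complex.inject mult_cancel_left diff_add_cancel zero_neq_numeral)
  show 1: "P i u - P i v \<in> \<int> \<longleftrightarrow> u = v" using * assms by auto
  have b: "\<bar>b i\<bar> < 1"
  proof (rule ccontr)
    assume b: "\<not> \<bar>b i\<bar> < 1"
    then have "1 / \<bar>b i\<bar> \<in> {0..1}" by simp
    moreover have "P i (1 / \<bar>b i\<bar>) - P i 0 \<in> \<int>" using b by (auto simp: P_def abs_if)
    ultimately have "1 / \<bar>b i\<bar> = 0" using *[of "1 / \<bar>b i\<bar>" 0] by simp
    then show False using b by simp
  qed
  have "\<bar>P i u - P i v\<bar> = \<bar>b i\<bar> * \<bar>u - v\<bar>" by (simp add: P_def abs_mult[symmetric] algebra_simps)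
  also have "\<dots> \<le> \<bar>b i\<bar> * 1" using assms by (intro mult_left_mono) auto
  finally show "\<bar>P i u - P i v\<bar> < 1" using b by simp
  show "P i u = P i v \<longleftrightarrow> u = v" using b0[OF assms(1)] by (simp add: P_def)
  show "P i u < P i v \<longleftrightarrow> (if b i > 0 then u < v else v < u)"
    using b0[OF assms(1)] by (auto simp: P_def mult_less_cancel_left)
qed

lemma avoids_strand:
  assumes "i < length ps" "j < length ps" "i \<noteq> j" "u \<in> {0..1}" "v \<in> {0..1}" "w \<in> {0..1}"
  shows "avoids (P i u) (P i v) (P j w)"
  unfolding avoids_def
proof (intro ballI)
  fix x assume "x \<in> closed_segment (P i u) (P i v)"
  then obtain k where k: "0 \<le> k" "k \<le> 1" "x = (1 - k) * P i u + k * P i v" by (auto simp: closed_segment_def)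
  have "x = P i ((1 - k) * u + k * v)" by (simp add: k(3) P_def algebra_simps)
  moreover have "(1 - k) * u + k * v \<in> {0..1}"
    using k assms(4,5) convex_bound_le[of u 1 v "1 - k" k] by auto
  ultimately show "x - P j w \<notin> \<int>" using strands_apart assms by simp
qed

lemma inner_D:
  assumes "i < length ps" "j < length ps" "u \<in> {0..1}" "f i u = f j u" "h j < h i"
  shows "curve D (P i u) = e (Complex (2 * u - 1) (f i u))" "curve D (P j u) = e (Complex (2 * u - 1) (f i u))"
    "P i u \<in> over D" "P j u \<notin> over D"
  using strandD[OF assms(1,3)] strandD[OF assms(2,3)] overD[of i j u u] overD[of j i u u] assms ps_graph
  by auto

lemma inner_E:
  assumes "i < length ps" "j < length ps" "u \<in> {0..1}" "g i u = g j u" "h j < h i"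
  shows "curve E (P i u) = e (Complex (2 * u - 1) (g i u))" "curve E (P j u) = e (Complex (2 * u - 1) (g i u))"
    "P i u \<in> over E" "P j u \<notin> over E"
  using strandE[OF assms(1,3)] strandE[OF assms(2,3)] overE[of i j u u] overE[of j i u u] assms qs_graph
  by auto

lemma crossing_inner_D:
  assumes "x \<in> crossing_points D" "x \<in> Sq"
  shows "\<exists>i<length ps. \<exists>j<length ps. \<exists>u\<in>{0..1}. h j < h i \<and> f i u = f j u \<and> x = e (Complex (2 * u - 1) (f i u))"
proof -
  note X = crossing_params[OF D assms(1)]
  obtain i u j v where uv: "i < length ps" "u \<in> {0..1}" "over_param D x - P i u \<in> \<int>"
    "j < length ps" "v \<in> {0..1}" "under_param D x - P j v \<in> \<int>"
    using Sq_D[of "over_param D x"] Sq_D[of "under_param D x"] X(1,3) assms(2) by auto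
  have eq: "x = e ((ps ! i) u)" "x = e ((ps ! j) v)"
    using X(1,3) strandD[OF uv(1,2)] strandD[OF uv(4,5)] curve_cong[OF D uv(3)] curve_cong[OF D uv(6)] by simp_all
  then have "(ps ! i) u = (ps ! j) v" using injD[OF inj_e] by metis
  then have uv': "u = v" "f i u = f j u" using ps_graph uv by auto
  have "i \<noteq> j" using X(5) Ints_diff[OF uv(3,6)] uv'(1) by auto
  moreover have "P i u \<in> over D" using over_cong[OF D uv(3)] X(2) by simp
  ultimately have "h j < h i" using overD[of i j u u] uv uv' ps_graph by auto
  moreover have "x = e (Complex (2 * u - 1) (f i u))" using eq(1) ps_graph uv(1,2) by simp
  ultimately show ?thesis using uv(1,2,4) uv'(2) by blast
qed

lemma crossing_inner_E:
  assumes "x \<in> crossing_points E" "x \<in> Sq"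
  shows "\<exists>i<length ps. \<exists>j<length ps. \<exists>u\<in>{0..1}. h j < h i \<and> g i u = g j u \<and> x = e (Complex (2 * u - 1) (g i u))"
proof -
  note X = crossing_params[OF E assms(1)]
  obtain i u j v where uv: "i < length ps" "u \<in> {0..1}" "over_param E x - P i u \<in> \<int>"
    "j < length ps" "v \<in> {0..1}" "under_param E x - P j v \<in> \<int>"
    using Sq_E[of "over_param E x"] Sq_E[of "under_param E x"] X(1,3) assms(2) by auto
  have eq: "x = e ((qs ! i) u)" "x = e ((qs ! j) v)"
    using X(1,3) strandE[OF uv(1,2)] strandE[OF uv(4,5)] curve_cong[OF E uv(3)] curve_cong[OF E uv(6)] by simp_all
  then have "(qs ! i) u = (qs ! j) v" using injD[OF inj_e] by metis
  then have uv': "u = v" "g i u = g j u" using qs_graph uv by auto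
  have "i \<noteq> j" using X(5) Ints_diff[OF uv(3,6)] uv'(1) by auto
  moreover have "P i u \<in> over E" using over_cong[OF E uv(3)] X(2) by simp
  ultimately have "h j < h i" using overE[of i j u u] uv uv' qs_graph by auto
  moreover have "x = e (Complex (2 * u - 1) (g i u))" using eq(1) qs_graph uv(1,2) by simp
  ultimately show ?thesis using uv(1,2,4) uv'(2) by blast
qed

text \<open>A strand of slope \<mu> has the direction \<open>Complex 2 \<mu>\<close>, reversed if it
  is traversed backwards. The determinant of two such directions is twice the difference of the
  slopes, up to the product of the two senses of traversal.\<close>

lemma crosses_graph:
  assumes ij: "i < length ps" "j < length ps" and u: "0 < u" "u < 1" and F: "F i u = F j u"
    and c: "\<And>k v. k < length ps \<Longrightarrow> v \<in> {0..1} \<Longrightarrow> c (P k v) = e (Complex (2 * v - 1) (F k v))"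
    and sl: "\<delta> > 0" "\<And>\<eta>. \<bar>\<eta>\<bar> < \<delta> \<Longrightarrow> F i (u + \<eta>) = F i u + m * \<eta> \<and> F j (u + \<eta>) = F j u + m' * \<eta>"
    and "m \<noteq> m'"
  shows "crosses (charts D) c (P i u) (P j u) (if (b i > 0) = (b j > 0) \<longleftrightarrow> m' > m then 1 else - 1)"
proof -
  let ?z = "Complex (2 * u - 1) (F i u)"
  define dir where "dir k \<mu> = of_real (sgn (b k)) * Complex 2 \<mu>" for k \<mu>
  define \<delta>' where "\<delta>' = min \<delta> (min u (1 - u))"
  have d': "\<delta>' > 0" using sl(1) u by (simp add: \<delta>'_def)
  have dep: "departs e ?z (of_real s * dir k \<mu>) (\<lambda>x. c (P k u + s * x))"
    if k: "k < length ps" "F k u = F i u" "\<And>\<eta>. \<bar>\<eta>\<bar> < \<delta> \<Longrightarrow> F k (u + \<eta>) = F k u + \<mu> * \<eta>" "\<bar>s\<bar> = 1" for k \<mu> and s :: real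
    unfolding departs_def
  proof (rule exI[of _ "\<delta>' * \<bar>b k\<bar>"], intro conjI allI impI)
    show "\<delta>' * \<bar>b k\<bar> > 0" using d' b0[OF k(1)] by simp
    fix x assume x: "0 < x \<and> x < \<delta>' * \<bar>b k\<bar>"
    define \<eta> where "\<eta> = s * x / b k"
    have ab: "\<bar>\<eta>\<bar> = x / \<bar>b k\<bar>" using k(4) x by (simp add: \<eta>_def abs_mult)
    then have "\<bar>\<eta>\<bar> < \<delta>'" using x b0[OF k(1)] by (simp add: divide_less_eq)
    then have eta: "\<bar>\<eta>\<bar> < \<delta>" "u + \<eta> \<in> {0..1}" by (auto simp: \<delta>'_def abs_less_iff)
    have "P k u + s * x = P k (u + \<eta>)" using b0[OF k(1)] by (simp add: P_def \<eta>_def algebra_simps)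
    then have "c (P k u + s * x) = e (Complex (2 * (u + \<eta>) - 1) (F k (u + \<eta>)))" using c[OF k(1) eta(2)] by simp
    moreover have "\<eta> = (x / \<bar>b k\<bar>) * (s * sgn (b k))"
      using b0[OF k(1)] by (auto simp: \<eta>_def sgn_if abs_if)
    then have "Complex (2 * (u + \<eta>) - 1) (F k (u + \<eta>)) = ?z + of_real (x / \<bar>b k\<bar>) * (of_real s * dir k \<mu>)"
      using k(2) k(3)[OF eta(1)] by (simp add: dir_def complex_eq_iff algebra_simps)
    ultimately show "\<exists>\<rho>>0. c (P k u + s * x) = e (?z + of_real \<rho> * (of_real s * dir k \<mu>))"
      using x b0[OF k(1)] by (intro exI[of _ "x / \<bar>b k\<bar>"]) simp
  qed
  have im: "Im (cnj (dir i m) * dir j m') = sgn (b i) * sgn (b j) * (2 * (m' - m))"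
    by (simp add: dir_def algebra_simps)
  have sgs: "(sgn (b i) = 1 \<and> b i > 0) \<or> (sgn (b i) = -1 \<and> \<not> b i > 0)" "(sgn (b j) = 1 \<and> b j > 0) \<or> (sgn (b j) = -1 \<and> \<not> b j > 0)"
    using b0[OF ij(1)] b0[OF ij(2)] by (auto simp: sgn_if)
  show ?thesis unfolding crosses_def
  proof (rule bexI[OF _ e], rule exI[of _ ?z], rule exI[of _ "dir i m"], rule exI[of _ "dir j m'"], intro conjI)
    show "c (P i u) = e ?z" "c (P j u) = e ?z" using c[of i u] c[of j u] ij u F by simp_all
    show "departs e ?z (dir i m) (\<lambda>x. c (P i u + x))" "departs e ?z (- dir i m) (\<lambda>x. c (P i u - x))"
      using dep[of i m 1] dep[of i m "-1"] ij sl(2) by simp_all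
    show "departs e ?z (dir j m') (\<lambda>x. c (P j u + x))" "departs e ?z (- dir j m') (\<lambda>x. c (P j u - x))"
      using dep[of j m' 1] dep[of j m' "-1"] ij sl(2) F by simp_all
    show "Im (cnj (dir i m) * dir j m') \<noteq> 0" unfolding im using sgs \<open>m \<noteq> m'\<close> by auto
    show "(if (b i > 0) = (b j > 0) \<longleftrightarrow> m' > m then 1 else - 1) = (if Im (cnj (dir i m) * dir j m') > 0 then 1 else (- 1 :: int))"
      unfolding im using sgs \<open>m \<noteq> m'\<close> by auto
  qed
qed

lemma strand_params_E:
  "x \<in> Y \<Longrightarrow> curve E (over_param D x) = x" "x \<in> Y \<Longrightarrow> curve E (under_param D x) = x"
  "x \<in> Y \<Longrightarrow> over_param D x \<in> over E" "x \<in> Y \<Longrightarrow> under_param D x \<notin> over E"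
  using Y_params[of x] agree by auto

lemma outside_strand:
  "x \<in> Y \<Longrightarrow> i < length ps \<Longrightarrow> u \<in> {0..1} \<Longrightarrow> over_param D x - P i u \<notin> \<int>"
  "x \<in> Y \<Longrightarrow> i < length ps \<Longrightarrow> u \<in> {0..1} \<Longrightarrow> under_param D x - P i u \<notin> \<int>"
  using Y_params(5,6)[of x] Sq_D by blast+

lemma arc_slide:
  assumes "i < length ps" "u \<in> {0..1}" "u' \<in> {0..1}" "curve D s \<notin> Sq \<or> (\<exists>j v. j < length ps \<and> j \<noteq> i \<and> v \<in> {0..1} \<and> s = P j v)"
    "curve D t \<notin> Sq \<or> (\<exists>j v. j < length ps \<and> j \<noteq> i \<and> v \<in> {0..1} \<and> t = P j v)" "s - t \<notin> \<int>"
  shows "arc s t (P i u) = arc s t (P i u')" "arc (P i u) s t = arc (P i u') s t" "arc s (P i u) t = arc s (P i u') t"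
proof -
  have av: "avoids (P i u) (P i u') s" "avoids (P i u) (P i u') t"
    using avoids_outside[of _ i u u'] avoids_strand[of i _ u u'] assms by metis+
  show "arc s t (P i u) = arc s t (P i u')" by (rule arc_avoid[OF av])
  show "arc (P i u) s t = arc (P i u') s t" using arc_avoid_start[OF av] assms(6) by (simp add: Ints_diff_commute)
  show "arc s (P i u) t = arc s (P i u') t" using arc_avoid_end[OF av] assms(6) by (simp add: Ints_diff_commute)
qed

end

section \<open>The second Reidemeister move\<close>

lemma gauss_R2_move:
  assumes DE: "D \<in> diagrams" "E \<in> diagrams" "reidemeister2 D E"
  shows "gauss_equal (gauss_of D) (gauss_of E)"
proof -
  define L0 where "L0 = linepath (Complex (-1) 0) (Complex 1 0)"
  define L1 where "L1 = linepath (Complex (-1) (1/2)) (Complex 1 (1/2))"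
  define L2 where "L2 = linepath (Complex (-1) (1/2)) (Complex 0 (-1/2)) +++ linepath (Complex 0 (-1/2)) (Complex 1 (1/2))"
  have L: "L0 u = Complex (2 * u - 1) 0" "L1 u = Complex (2 * u - 1) (1/2)" "L2 u = Complex (2 * u - 1) (\<bar>2 * u - 1\<bar> - 1/2)" for u
    by (simp_all add: L0_def L1_def L2_def linepath_def joinpaths_def complex_eq_iff abs_if field_simps)
  obtain e a b h where m: "surface E = surface D" "charts E = charts D" "e \<in> charts D" "\<forall>i<2. b i \<noteq> 0" "inj_on h {..<2::nat}"
    "shows_tangle [L0, L1] e a b h D" "shows_tangle [L0, L2] e a b h E"
    "\<And>t. (\<forall>i<2. \<forall>u\<in>{0..1}. t - (a i + b i * u) \<notin> \<int>) \<Longrightarrow> curve E t = curve D t \<and> (t \<in> over E \<longleftrightarrow> t \<in> over D)"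
    using DE(3) unfolding reidemeister2_def tangle_replacement_def L0_def[symmetric] L1_def[symmetric] L2_def[symmetric]
    by (auto simp: numeral_2_eq_2)
  define f where "f i u = (if i = 0 then 0 else 1/2 :: real)" for i :: nat and u :: real
  define g where "g i u = (if i = 0 then 0 else \<bar>2 * u - 1\<bar> - 1/2)" for i :: nat and u :: real
  have two: "i < 2 \<longleftrightarrow> i = 0 \<or> i = 1" for i :: nat by auto
  interpret graph_move D E "[L0, L1]" "[L0, L2]" e a b h f g
  proof
    show "([L0, L1] ! i) u = Complex (2 * u - 1) (f i u)" "([L0, L2] ! i) u = Complex (2 * u - 1) (g i u)"
      if "i < length [L0, L1]" "u \<in> {0..1}" for i u
      using that by (auto simp: L f_def g_def less_Suc_eq numeral_2_eq_2)
    show "([L0, L1] ! i) u \<in> unit_square \<and> ([L0, L2] ! i) u \<in> unit_square" if "i < length [L0, L1]" "u \<in> {0..1}" for i u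
      using that by (auto simp: unit_square_def L in_cbox_complex_iff less_Suc_eq numeral_2_eq_2 abs_if)
  qed (use DE m in \<open>auto simp: numeral_2_eq_2\<close>)
  have n2: "length [L0, L1] = 2" by simp
  have hne: "h 0 \<noteq> h 1" using m(5) by (auto dest: inj_onD)
  define i j where "i = (if h 1 < h 0 then 0 else 1 :: nat)" and "j = (if h 1 < h 0 then 1 else 0 :: nat)"
  have ij: "i < length [L0, L1]" "j < length [L0, L1]" "i \<noteq> j" "h j < h i" "{i, j} = {0, 1}" using hne by (auto simp: i_def j_def)
  have YD: "crossing_points D = Y"
  proof -
    have "x \<notin> Sq" if x: "x \<in> crossing_points D" for x
    proof
      assume "x \<in> Sq"
      from crossing_inner_D[OF x this] show False by (auto simp: f_def less_Suc_eq numeral_2_eq_2 split: if_splits)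
    qed
    then show ?thesis by (auto simp: Y_def)
  qed
  \<comment> \<open>The bent strand has height \<open>\<bar>2 * u - 1\<bar> - 1/2\<close>, which
    vanishes at these two parameters.\<close>
  have gq: "g i (1/4) = g j (1/4)" "g i (3/4) = g j (3/4)" using ij(5) by (auto simp: g_def doubleton_eq_iff)
  define q where "q = e (Complex (2 * (1/4) - 1) (g i (1/4)))"
  define r where "r = e (Complex (2 * (3/4) - 1) (g i (3/4)))"
  have I: "1/4 \<in> {0..1::real}" "3/4 \<in> {0..1::real}" by auto
  note Q = inner_E[OF ij(1,2) I(1) gq(1) ij(4), folded q_def]
  note R = inner_E[OF ij(1,2) I(2) gq(2) ij(4), folded r_def]
  have qr: "q \<noteq> r" unfolding q_def r_def inj_eq[OF inj_e] by simp
  have inSq: "q \<in> Sq" "r \<in> Sq" using sq[of i "1/4"] sq[of i "3/4"] strandE[OF ij(1) I(1)] strandE[OF ij(1) I(2)] Q(1) R(1) ij(1) I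
    by (auto simp: Sq_def)
  have XE: "crossing_points E = insert q (insert r Y)"
  proof -
    have "x = q \<or> x = r" if x: "x \<in> crossing_points E" "x \<in> Sq" for x
    proof -
      obtain i' j' u where c: "i' < 2" "j' < 2" "u \<in> {0..1}" "h j' < h i'" "g i' u = g j' u" "x = e (Complex (2 * u - 1) (g i' u))"
        using crossing_inner_E[OF x] unfolding n2 by blast
      then have "i' \<noteq> j'" by auto
      then have "\<bar>2 * u - 1\<bar> = 1/2" using c(1,2,5) by (auto simp: g_def two)
      then have "u = 1/4 \<or> u = 3/4" by linarith
      moreover have "g i' u = g i u" using c(1,2,5) gq \<open>i' \<noteq> j'\<close> ij(5) by (auto simp: two doubleton_eq_iff)
      ultimately show ?thesis using c(6) unfolding q_def r_def by metis
    qed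
    moreover have "q \<in> crossing_points E" "r \<in> crossing_points E" using crossing_pointI[OF DE(2)] Q R by metis+
    ultimately show ?thesis using Y_E inSq by auto
  qed
  have slopes: "(if b i > 0 then True else False) = (b i > 0)" by simp
  have sqr: "sign (gauss_of E) r = - sign (gauss_of E) q"
  proof -
    \<comment> \<open>The bent strand has slope - 2 at the first crossing and 2 at the second, the
      straight strand slope 0. The comparison of the slopes is therefore reversed, which gives
      opposite signs.\<close>
    define \<mu> where "\<mu> k = (if k = (0::nat) then 0 else 2 :: real)" for k
    have cE: "curve E (P k v) = e (Complex (2 * v - 1) (g k v))" if "k < length [L0, L1]" "v \<in> {0..1}" for k v
      using strandE[OF that] qs_graph[OF that] by simp
    have mu: "- \<mu> i \<noteq> - \<mu> j" "\<mu> i \<noteq> \<mu> j" using ij(5) by (auto simp: \<mu>_def doubleton_eq_iff)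
    have "crosses (charts D) (curve E) (P i (1/4)) (P j (1/4)) (if (b i > 0) = (b j > 0) \<longleftrightarrow> - \<mu> j > - \<mu> i then 1 else - 1)"
      by (rule crosses_graph[OF ij(1,2) _ _ gq(1) cE, of "1/4"])
         (use mu in \<open>auto simp: g_def \<mu>_def abs_if\<close>)
    then have s1: "sign (gauss_of E) q = (if (b i > 0) = (b j > 0) \<longleftrightarrow> - \<mu> j > - \<mu> i then 1 else - 1)"
      using sign_gauss_of[OF DE(2) Q] m(2) by simp
    have "crosses (charts D) (curve E) (P i (3/4)) (P j (3/4)) (if (b i > 0) = (b j > 0) \<longleftrightarrow> \<mu> j > \<mu> i then 1 else - 1)"
      by (rule crosses_graph[OF ij(1,2) _ _ gq(2) cE, of "1/4"])
         (use mu in \<open>auto simp: g_def \<mu>_def abs_if\<close>)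
    then have "sign (gauss_of E) r = (if (b i > 0) = (b j > 0) \<longleftrightarrow> \<mu> j > \<mu> i then 1 else - 1)"
      using sign_gauss_of[OF DE(2) R] m(2) by simp
    then show ?thesis using s1 mu by auto
  qed
  note A = arcs_gauss_of[OF DE(2)]
  have nY: "q \<notin> Y" "r \<notin> Y" using inSq by (simp_all add: Y_def)
  show ?thesis
  proof (rule gauss_R2[where q = q and r = r])
    show "finite (chords (gauss_of D))" "q \<notin> chords (gauss_of D)" "r \<notin> chords (gauss_of D)"
      "chords (gauss_of E) = insert q (insert r (chords (gauss_of D)))"
      using finite_Y nY XE by (simp_all add: YD)
    show "q \<noteq> r" "sign (gauss_of E) r = - sign (gauss_of E) q" by fact+
    show "sign (gauss_of E) x = sign (gauss_of D) x" if "x \<in> chords (gauss_of D)" for x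
      using gauss_outside(1)[of x] that YD by simp
    show "over_in (gauss_of E) x y = over_in (gauss_of D) x y \<and> under_in (gauss_of E) x y = under_in (gauss_of D) x y"
      if "x \<in> chords (gauss_of D)" "y \<in> chords (gauss_of D)" for x y
      using gauss_outside(2,3)[of x y] that YD by simp
    show "over_in (gauss_of E) x q = over_in (gauss_of E) x r \<and> under_in (gauss_of E) x q = under_in (gauss_of E) x r"
      if "x \<in> chords (gauss_of D)" for x
    proof -
      have x: "x \<in> Y" using that YD by simp
      show ?thesis unfolding A[OF strand_params_E[OF x] Q] A[OF strand_params_E[OF x] R]
        using arc_slide(1)[of _ "1/4" "3/4" "over_param D x" "under_param D x"] ij I Y_params[OF x] by blast
    qed
    show "over_in (gauss_of E) q x = over_in (gauss_of E) r x \<and> under_in (gauss_of E) q x = under_in (gauss_of E) r x"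
      if "x \<in> chords (gauss_of D)" for x
    proof -
      have x: "x \<in> Y" using that YD by simp
      have "arc (P i (1/4)) (P j (1/4)) p = arc (P i (3/4)) (P j (3/4)) p" if p: "p \<in> {over_param D x, under_param D x}" for p
      proof -
        have pS: "curve D p \<notin> Sq" using p Y_params[OF x] by auto
        then have pi: "P j (1/4) - p \<notin> \<int>" "P i (3/4) - p \<notin> \<int>"
          using outside_strand[OF x] p ij I by (auto simp: Ints_diff_commute[of _ p])
        have "arc (P i (1/4)) (P j (1/4)) p = arc (P i (3/4)) (P j (1/4)) p"
          using arc_slide(2)[of i "1/4" "3/4" "P j (1/4)" p] ij I pS pi by blast
        also have "\<dots> = arc (P i (3/4)) (P j (3/4)) p"
          using arc_slide(3)[of j "1/4" "3/4" "P i (3/4)" p] ij I pS pi by blast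
        finally show ?thesis .
      qed
      then show ?thesis unfolding A[OF Q strand_params_E[OF x]] A[OF R strand_params_E[OF x]] by simp
    qed
    have o: "arc (P i u) (P j u) (P i v) \<longleftrightarrow> P i u < P i v" "arc (P i u) (P j u) (P j v) \<longleftrightarrow> P j v < P j u"
      if "u \<in> {0..1}" "v \<in> {0..1}" "u \<noteq> v" for u v
      using arc_order(1)[OF avoids_strand[OF ij(1,2,3) that(1,2,1)]] arc_order(2)[OF avoids_strand[OF ij(2,1) ij(3)[symmetric] that(1,2,1)]]
        strand_short[OF ij(1) that(1,2)] strand_short[OF ij(2) that(1,2)] that(3) by auto
    show "(over_in (gauss_of E) q r, under_in (gauss_of E) q r, over_in (gauss_of E) r q, under_in (gauss_of E) r q)
       \<in> {(True, False, False, True), (False, True, True, False), (False, False, True, True), (True, True, False, False)}"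
      unfolding A[OF Q R] A[OF R Q] using o[OF I] o[OF I(2,1)] strand_short(4)[OF ij(1) I] strand_short(4)[OF ij(1) I(2,1)]
        strand_short(4)[OF ij(2) I] strand_short(4)[OF ij(2) I(2,1)] by simp
  qed
qed


section \<open>The third Reidemeister move\<close>

definition R3_pos :: "nat \<Rightarrow> nat \<Rightarrow> real" where
  "R3_pos i j = (if {i, j} = {0, 1} then 1/2 else if {i, j} = {0, 2} then 2/3 else 1/3)"

text \<open>The slope of strand i at its crossing with strand j. Two strands that meet at u =
  \<open>R3_pos i j\<close> before the move meet at 1 - u after it, with the same slopes. So every
  crossing keeps its sign, and the order of the two crossings on each strand is reversed.\<close>

definition R3_slope :: "nat \<Rightarrow> nat \<Rightarrow> real" where
  "R3_slope i j = (if i = 0 then 2 else if i = 1 then - 2 else if j = 0 then - 1 else 1)"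

lemma gauss_R3_move:
  assumes DE: "D \<in> diagrams" "E \<in> diagrams" "reidemeister3 D E"
  shows "gauss_equal (gauss_of D) (gauss_of E)"
proof -
  define L0 where "L0 = linepath (Complex (-1) (-1)) (Complex 1 1)"
  define L1 where "L1 = linepath (Complex (-1) 1) (Complex 1 (-1))"
  define L2 where "L2 = linepath (Complex (-1) 0) (Complex 0 (1/2)) +++ linepath (Complex 0 (1/2)) (Complex 1 0)"
  define L3 where "L3 = linepath (Complex (-1) 0) (Complex 0 (-1/2)) +++ linepath (Complex 0 (-1/2)) (Complex 1 0)"
  have L: "L0 u = Complex (2 * u - 1) (2 * u - 1)" "L1 u = Complex (2 * u - 1) (1 - 2 * u)"
    "L2 u = Complex (2 * u - 1) (min u (1 - u))" "L3 u = Complex (2 * u - 1) (- min u (1 - u))" for u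
    by (simp_all add: L0_def L1_def L2_def L3_def linepath_def joinpaths_def complex_eq_iff min_def field_simps)
  have three: "i < 3 \<longleftrightarrow> i = 0 \<or> i = 1 \<or> i = 2" for i :: nat by auto
  obtain e a b h where m: "surface E = surface D" "charts E = charts D" "e \<in> charts D" "\<forall>i<3. b i \<noteq> 0" "inj_on h {..<3::nat}"
    "shows_tangle [L0, L1, L2] e a b h D" "shows_tangle [L0, L1, L3] e a b h E"
    "\<And>t. (\<forall>i<3. \<forall>u\<in>{0..1}. t - (a i + b i * u) \<notin> \<int>) \<Longrightarrow> curve E t = curve D t \<and> (t \<in> over E \<longleftrightarrow> t \<in> over D)"
    using DE(3) unfolding reidemeister3_def tangle_replacement_def L0_def[symmetric] L1_def[symmetric] L2_def[symmetric] L3_def[symmetric]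
    by (auto simp: numeral_3_eq_3)
  define f where "f i u = (if i = 0 then 2 * u - 1 else if i = 1 then 1 - 2 * u else min u (1 - u))" for i :: nat and u :: real
  define g where "g i u = (if i = 0 then 2 * u - 1 else if i = 1 then 1 - 2 * u else - min u (1 - u))" for i :: nat and u :: real
  interpret graph_move D E "[L0, L1, L2]" "[L0, L1, L3]" e a b h f g
  proof
    show "([L0, L1, L2] ! i) u = Complex (2 * u - 1) (f i u)" "([L0, L1, L3] ! i) u = Complex (2 * u - 1) (g i u)"
      if "i < length [L0, L1, L2]" "u \<in> {0..1}" for i u
      using that by (auto simp: L f_def g_def less_Suc_eq numeral_3_eq_3)
    show "([L0, L1, L2] ! i) u \<in> unit_square \<and> ([L0, L1, L3] ! i) u \<in> unit_square" if "i < length [L0, L1, L2]" "u \<in> {0..1}" for i u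
      using that by (auto simp: unit_square_def L in_cbox_complex_iff less_Suc_eq numeral_3_eq_3 min_def)
  qed (use DE m in \<open>auto simp: numeral_3_eq_3\<close>)
  have len3: "length [L0, L1, L2] = 3" by simp
  have hne: "h 0 \<noteq> h 1" "h 0 \<noteq> h 2" "h 1 \<noteq> h 2" using m(5) by (auto dest: inj_onD)
  \<comment> \<open>The top, middle and bottom strand according to the heights h; which of the three
    lines of the picture they are is left open.\<close>
  obtain T M B where TMB: "T < 3" "M < 3" "B < 3" "h M < h T" "h B < h M" "{T, M, B} = {0, 1, 2}"
  proof -
    consider "h 2 < h 1" "h 1 < h 0" | "h 1 < h 2" "h 2 < h 0" | "h 2 < h 0" "h 0 < h 1"
      | "h 0 < h 2" "h 2 < h 1" | "h 1 < h 0" "h 0 < h 2" | "h 0 < h 1" "h 1 < h 2" using hne by linarith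
    then show ?thesis
    proof cases
      case 1 then show ?thesis using that[of 0 1 2] by auto
    next
      case 2 then show ?thesis using that[of 0 2 1] by auto
    next
      case 3 then show ?thesis using that[of 1 0 2] by auto
    next
      case 4 then show ?thesis using that[of 1 2 0] by auto
    next
      case 5 then show ?thesis using that[of 2 0 1] by auto
    next
      case 6 then show ?thesis using that[of 2 1 0] by auto
    qed
  qed
  have dist3: "T \<noteq> M" "T \<noteq> B" "M \<noteq> B" "h B < h T" using TMB by auto
  have lT: "T < length [L0, L1, L2]" "M < length [L0, L1, L2]" "B < length [L0, L1, L2]" using TMB by simp_all
  have pos: "R3_pos i j \<in> {0..1}" "1 - R3_pos i j \<in> {0..1}" "R3_pos i j > 0" "R3_pos i j < 1" for i j
    by (auto simp: R3_pos_def)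
  have pos_com: "R3_pos i j = R3_pos j i" for i j by (simp add: R3_pos_def insert_commute)
  have fpos: "f i (R3_pos i j) = f j (R3_pos i j)" "g i (1 - R3_pos i j) = g j (1 - R3_pos i j)"
    if "i < 3" "j < 3" "i \<noteq> j" for i j
    using that by (auto simp: three f_def g_def R3_pos_def doubleton_eq_iff)
  have unique: "u = R3_pos i j" if "i < 3" "j < 3" "i \<noteq> j" "f i u = f j u" for i j u
    using that by (auto simp: three f_def R3_pos_def doubleton_eq_iff min_def split: if_splits)
  have unique': "u = 1 - R3_pos i j" if "i < 3" "j < 3" "i \<noteq> j" "g i u = g j u" for i j u
    using that by (auto simp: three g_def R3_pos_def doubleton_eq_iff min_def split: if_splits)
  define xD where "xD i j = e (Complex (2 * R3_pos i j - 1) (f i (R3_pos i j)))" for i j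
  define xE where "xE i j = e (Complex (2 * (1 - R3_pos i j) - 1) (g i (1 - R3_pos i j)))" for i j
  have ID: "curve D (P i (R3_pos i j)) = xD i j" "curve D (P j (R3_pos i j)) = xD i j"
     "P i (R3_pos i j) \<in> over D" "P j (R3_pos i j) \<notin> over D" if "i < 3" "j < 3" "h j < h i" for i j
  proof -
    have "i \<noteq> j" using that(3) by auto
    from inner_D[of i j "R3_pos i j"] that fpos(1)[OF that(1,2) this] pos
    show "curve D (P i (R3_pos i j)) = xD i j" "curve D (P j (R3_pos i j)) = xD i j"
     "P i (R3_pos i j) \<in> over D" "P j (R3_pos i j) \<notin> over D" by (simp_all add: xD_def)
  qed
  have IE: "curve E (P i (1 - R3_pos i j)) = xE i j" "curve E (P j (1 - R3_pos i j)) = xE i j"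
     "P i (1 - R3_pos i j) \<in> over E" "P j (1 - R3_pos i j) \<notin> over E" if "i < 3" "j < 3" "h j < h i" for i j
  proof -
    have "i \<noteq> j" using that(3) by auto
    from inner_E[of i j "1 - R3_pos i j"] that fpos(2)[OF that(1,2) this] pos
    show "curve E (P i (1 - R3_pos i j)) = xE i j" "curve E (P j (1 - R3_pos i j)) = xE i j"
     "P i (1 - R3_pos i j) \<in> over E" "P j (1 - R3_pos i j) \<notin> over E" by (simp_all add: xE_def)
  qed
  have order: "(h j < h i \<and> i < 3 \<and> j < 3) \<longleftrightarrow> (i = T \<and> j = M) \<or> (i = T \<and> j = B) \<or> (i = M \<and> j = B)" for i j
  proof -
    have three': "i < 3 \<longleftrightarrow> i = T \<or> i = M \<or> i = B" for i
    proof -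
      have "i < 3 \<longleftrightarrow> i \<in> {0, 1, 2}" by (simp add: three)
      then show ?thesis unfolding TMB(6)[symmetric] by simp
    qed
    have n: "\<not> h T < h M" "\<not> h T < h B" "\<not> h M < h B" using TMB(4,5) dist3(4) by linarith+
    show ?thesis unfolding three'
      by (cases "i = T"; cases "i = M"; cases "i = B"; cases "j = T"; cases "j = M"; cases "j = B")
         (simp_all add: n TMB(4,5) dist3 dist3(1-3)[symmetric])
  qed
  have strand_in_Sq: "curve D (P i u) \<in> Sq" "curve E (P i u) \<in> Sq" if "i < 3" "u \<in> {0..1}" for i u
  proof -
    have "\<exists>k<length [L0, L1, L2]. \<exists>v\<in>{0..1}. P i u - P k v \<in> \<int>"
      by (rule exI[of _ i], rule conjI[OF _ bexI[of _ u]]) (use that in auto)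
    then show "curve D (P i u) \<in> Sq" "curve E (P i u) \<in> Sq" unfolding Sq_D Sq_E by blast+
  qed
  have sub: "x \<in> Sq" if "x = xD i j \<or> x = xE i j" "i < 3" "j < 3" "h j < h i" for x i j
  proof -
    have "curve D (P i (R3_pos i j)) \<in> Sq" "curve E (P i (1 - R3_pos i j)) \<in> Sq"
      using strand_in_Sq[OF that(2), of "R3_pos i j"] strand_in_Sq[OF that(2), of "1 - R3_pos i j"] pos by blast+
    then show ?thesis using that(1) ID(1)[OF that(2-4)] IE(1)[OF that(2-4)] by (elim disjE) simp_all
  qed
  have XD: "crossing_points D = insert (xD T M) (insert (xD T B) (insert (xD M B) Y))"
  proof -
    have "x \<in> {xD T M, xD T B, xD M B}" if x: "x \<in> crossing_points D" "x \<in> Sq" for x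
    proof -
      obtain i j u where c: "i < 3" "j < 3" "h j < h i" "f i u = f j u" "x = e (Complex (2 * u - 1) (f i u))"
        using crossing_inner_D[OF x] unfolding len3 by blast
      have ij: "i \<noteq> j" using c(3) by auto
      have "x = xD i j" unfolding xD_def c(5) unique[OF c(1,2) ij c(4)] ..
      moreover have "i = T \<and> j = M \<or> i = T \<and> j = B \<or> i = M \<and> j = B" using order[of j i] c(1-3) by blast
      ultimately show ?thesis by (elim disjE conjE) simp_all
    qed
    moreover have "xD T M \<in> crossing_points D" "xD T B \<in> crossing_points D" "xD M B \<in> crossing_points D"
      using crossing_pointI[OF DE(1) ID[OF TMB(1,2,4)]] crossing_pointI[OF DE(1) ID[OF TMB(1,3) dist3(4)]]
        crossing_pointI[OF DE(1) ID[OF TMB(2,3,5)]] by blast+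
    moreover have "x \<in> crossing_points D \<longleftrightarrow> x \<in> Y" if "x \<notin> Sq" for x
      using that Y_E Y_def by blast
    moreover have "Y \<subseteq> crossing_points D" using Y_E Y_def by blast
    ultimately show ?thesis by blast
  qed
  have XE: "crossing_points E = insert (xE T M) (insert (xE T B) (insert (xE M B) Y))"
  proof -
    have "x \<in> {xE T M, xE T B, xE M B}" if x: "x \<in> crossing_points E" "x \<in> Sq" for x
    proof -
      obtain i j u where c: "i < 3" "j < 3" "h j < h i" "g i u = g j u" "x = e (Complex (2 * u - 1) (g i u))"
        using crossing_inner_E[OF x] unfolding len3 by blast
      have ij: "i \<noteq> j" using c(3) by auto
      have "x = xE i j" unfolding xE_def c(5) unique'[OF c(1,2) ij c(4)] ..
      moreover have "i = T \<and> j = M \<or> i = T \<and> j = B \<or> i = M \<and> j = B" using order[of j i] c(1-3) by blast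
      ultimately show ?thesis by (elim disjE conjE) simp_all
    qed
    moreover have "xE T M \<in> crossing_points E" "xE T B \<in> crossing_points E" "xE M B \<in> crossing_points E"
      using crossing_pointI[OF DE(2) IE[OF TMB(1,2,4)]] crossing_pointI[OF DE(2) IE[OF TMB(1,3) dist3(4)]]
        crossing_pointI[OF DE(2) IE[OF TMB(2,3,5)]] by blast+
    moreover have "x \<in> crossing_points E \<longleftrightarrow> x \<in> Y" if "x \<notin> Sq" for x
      using that Y_E Y_def by blast
    moreover have "Y \<subseteq> crossing_points E" using Y_E Y_def by blast
    ultimately show ?thesis by blast
  qed
  have pne: "R3_pos T M \<noteq> R3_pos T B" "R3_pos T M \<noteq> R3_pos M B" "R3_pos T B \<noteq> R3_pos M B"
    using TMB(1-3) dist3 by (auto simp: three R3_pos_def doubleton_eq_iff)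
  have ne: "xD T M \<noteq> xD T B" "xD T M \<noteq> xD M B" "xD T B \<noteq> xD M B"
    "xE T M \<noteq> xE T B" "xE T M \<noteq> xE M B" "xE T B \<noteq> xE M B"
    unfolding xD_def xE_def inj_eq[OF inj_e] using pne by simp_all
  have nY: "xD i j \<notin> Y" "xE i j \<notin> Y" if "i < 3" "j < 3" "h j < h i" for i j
    using sub[of _ i j] that by (auto simp: Y_def)
  \<comment> \<open>Three instances are the flags of \<open>triangle\<close>. As positions turn into
    1 - u, the move negates them.\<close>
  define \<tau> where "\<tau> i j k \<longleftrightarrow> P i (R3_pos i j) < P i (R3_pos i k)" for i j k
  have tau: "\<tau> i j k \<longleftrightarrow> (if b i > 0 then R3_pos i j < R3_pos i k else R3_pos i k < R3_pos i j)" if "i < 3" for i j k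
    unfolding \<tau>_def using strand_short(4)[of i] that pos by simp
  have tauE: "P i (1 - R3_pos i j) < P i (1 - R3_pos i k) \<longleftrightarrow> \<tau> i k j" if "i < 3" for i j k
    unfolding tau[OF that] using strand_short(4)[of i "1 - R3_pos i j" "1 - R3_pos i k"] that pos by simp
  define \<sigma> where "\<sigma> i j = (if (b i > 0) = (b j > 0) \<longleftrightarrow> R3_slope j i > R3_slope i j then 1 else - 1 :: int)" for i j
  have slope: "R3_slope i j \<noteq> R3_slope j i" if "i < 3" "j < 3" "i \<noteq> j" for i j
    using that by (auto simp: three R3_slope_def)
  \<comment> \<open>The bent strand has its corner at u = 1/2, at distance 1/6 from its crossings at
    1/3 and 2/3.\<close>
  have affD: "f i (R3_pos i j + \<eta>) = f i (R3_pos i j) + R3_slope i j * \<eta>" if "i < 3" "j < 3" "i \<noteq> j" "\<bar>\<eta>\<bar> < 1/6" for i j \<eta>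
    using that by (auto simp: three f_def R3_pos_def R3_slope_def doubleton_eq_iff min_def abs_less_iff)
  have affE: "g i (1 - R3_pos i j + \<eta>) = g i (1 - R3_pos i j) + R3_slope i j * \<eta>" if "i < 3" "j < 3" "i \<noteq> j" "\<bar>\<eta>\<bar> < 1/6" for i j \<eta>
    using that by (auto simp: three g_def R3_pos_def R3_slope_def doubleton_eq_iff min_def abs_less_iff)
  have sgD: "sign (gauss_of D) (xD i j) = \<sigma> i j" if "i < 3" "j < 3" "h j < h i" for i j
  proof -
    have ij: "i \<noteq> j" using that(3) by auto
    have "crosses (charts D) (curve D) (P i (R3_pos i j)) (P j (R3_pos i j)) (\<sigma> i j)"
      unfolding \<sigma>_def
    proof (rule crosses_graph[where F = f and \<delta> = "1/6"])
      show "curve D (P k v) = e (Complex (2 * v - 1) (f k v))" if "k < length [L0, L1, L2]" "v \<in> {0..1}" for k v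
        using strandD[OF that] ps_graph[OF that] by simp
      show "f i (R3_pos i j + \<eta>) = f i (R3_pos i j) + R3_slope i j * \<eta> \<and> f j (R3_pos i j + \<eta>) = f j (R3_pos i j) + R3_slope j i * \<eta>"
        if "\<bar>\<eta>\<bar> < 1/6" for \<eta>
        using affD[of i j \<eta>] affD[of j i \<eta>] ij that \<open>i < 3\<close> \<open>j < 3\<close> pos_com[of i j] by simp
    qed (use that ij fpos slope pos in auto)
    then show ?thesis using sign_gauss_of[OF DE(1) ID[OF that]] by simp
  qed
  have sgE: "sign (gauss_of E) (xE i j) = \<sigma> i j" if "i < 3" "j < 3" "h j < h i" for i j
  proof -
    have ij: "i \<noteq> j" using that(3) by auto
    have "crosses (charts D) (curve E) (P i (1 - R3_pos i j)) (P j (1 - R3_pos i j)) (\<sigma> i j)"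
      unfolding \<sigma>_def
    proof (rule crosses_graph[where F = g and \<delta> = "1/6"])
      show "curve E (P k v) = e (Complex (2 * v - 1) (g k v))" if "k < length [L0, L1, L2]" "v \<in> {0..1}" for k v
        using strandE[OF that] qs_graph[OF that] by simp
      show "g i (1 - R3_pos i j + \<eta>) = g i (1 - R3_pos i j) + R3_slope i j * \<eta> \<and> g j (1 - R3_pos i j + \<eta>) = g j (1 - R3_pos i j) + R3_slope j i * \<eta>"
        if "\<bar>\<eta>\<bar> < 1/6" for \<eta>
        using affE[of i j \<eta>] affE[of j i \<eta>] ij that \<open>i < 3\<close> \<open>j < 3\<close> pos_com[of i j] by simp
    qed (use that ij fpos slope pos in auto)
    then show ?thesis using sign_gauss_of[OF DE(2) IE[OF that]] m(2) by simp
  qed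
  \<comment> \<open>The parameter intervals of the strands are disjoint, so the cyclic order of the
    strands can be read off anywhere on them, for instance at their starting points.\<close>
  define \<kappa> where "\<kappa> \<longleftrightarrow> arc (P T 0) (P B 0) (P M 0)"
  have zero_in: "0 \<in> {0..1::real}" by simp
  have lt: "i < length [L0, L1, L2]" if "i < 3" for i using that by simp
  have other: "curve D (P j v) \<notin> Sq \<or> (\<exists>j' v'. j' < length [L0, L1, L2] \<and> j' \<noteq> i \<and> v' \<in> {0..1} \<and> P j v = P j' v')"
    if "j < 3" "j \<noteq> i" "v \<in> {0..1}" for i j v
    using lt[OF that(1)] that(2,3) by blast
  have cyc: "arc (P i u) (P j v) (P k w) \<longleftrightarrow> arc (P i 0) (P j 0) (P k 0)"
    if "i < 3" "j < 3" "k < 3" "i \<noteq> j" "i \<noteq> k" "j \<noteq> k" "u \<in> {0..1}" "v \<in> {0..1}" "w \<in> {0..1}" for i j k u v w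
  proof -
    have ap: "P i u' - P j v' \<notin> \<int>" if "i < 3" "j < 3" "i \<noteq> j" "u' \<in> {0..1}" "v' \<in> {0..1}" for i j u' v'
      using strands_apart[of i j u' v'] that by simp
    note ne = that(4-6) that(4-6)[symmetric]
    have "arc (P i u) (P j v) (P k w) \<longleftrightarrow> arc (P i u) (P j v) (P k 0)"
      by (rule arc_slide(1)[OF lt[OF that(3)] that(9) zero_in other[OF that(1) ne(2) that(7)] other[OF that(2) ne(3) that(8)] ap[OF that(1,2) ne(1) that(7,8)]])
    also have "\<dots> \<longleftrightarrow> arc (P i 0) (P j v) (P k 0)"
      by (rule arc_slide(2)[OF lt[OF that(1)] that(7) zero_in other[OF that(2) ne(4) that(8)] other[OF that(3) ne(5) zero_in] ap[OF that(2,3) ne(3) that(8) zero_in]])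
    also have "\<dots> \<longleftrightarrow> arc (P i 0) (P j 0) (P k 0)"
      by (rule arc_slide(3)[OF lt[OF that(2)] that(8) zero_in other[OF that(1) ne(1) zero_in] other[OF that(3) ne(6) zero_in] ap[OF that(1,3) ne(2) zero_in zero_in]])
    finally show ?thesis .
  qed
  have ap0: "P i u - P j v \<notin> \<int>" if "i < 3" "j < 3" "i \<noteq> j" "u \<in> {0..1}" "v \<in> {0..1}" for i j u v
    using strands_apart[of i j u v] that by simp
  have z01: "0 \<in> {0..1::real}" by simp
  have k1: "arc (P T 0) (P M 0) (P B 0) \<longleftrightarrow> \<not> \<kappa>"
  proof -
    have "arc (P T 0) (P M 0) (P B 0) \<longleftrightarrow> arc (P B 0) (P T 0) (P M 0)"
      using arc_rotate[of "P T 0" "P M 0" "P B 0"] ap0 TMB(1-3) dist3 z01 by metis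
    also have "\<dots> \<longleftrightarrow> \<not> arc (P T 0) (P B 0) (P M 0)"
      using arc_swap[of "P T 0" "P B 0" "P M 0"] ap0 TMB(1-3) dist3 z01 by metis
    finally show ?thesis by (simp add: \<kappa>_def)
  qed
  have k2: "arc (P M 0) (P B 0) (P T 0) \<longleftrightarrow> \<not> \<kappa>"
  proof -
    have "arc (P M 0) (P B 0) (P T 0) \<longleftrightarrow> arc (P T 0) (P M 0) (P B 0)"
      using arc_rotate[of "P M 0" "P B 0" "P T 0"] ap0 TMB(1-3) dist3 z01 by metis
    then show ?thesis using k1 by simp
  qed
  have C: "arc (P T u) (P M v) (P B w) \<longleftrightarrow> \<not> \<kappa>" "arc (P T u) (P B v) (P M w) \<longleftrightarrow> \<kappa>" "arc (P M u) (P B v) (P T w) \<longleftrightarrow> \<not> \<kappa>"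
    if "u \<in> {0..1}" "v \<in> {0..1}" "w \<in> {0..1}" for u v w
    using cyc[of T M B u v w] cyc[of T B M u v w] cyc[of M B T u v w] k1 k2 TMB(1-3) dist3 that by (simp_all add: \<kappa>_def)
  have O: "arc (P i u) (P j w) (P i v) \<longleftrightarrow> P i u < P i v" "arc (P j w) (P i u) (P i v) \<longleftrightarrow> P i v < P i u"
    if "i < 3" "j < 3" "i \<noteq> j" "u \<in> {0..1}" "v \<in> {0..1}" "w \<in> {0..1}" "u \<noteq> v" for i j u v w
  proof -
    have av: "avoids (P i u) (P i v) (P j w)" using avoids_strand[of i j u v w] that by simp
    have "\<bar>P i u - P i v\<bar> < 1" "P i u \<noteq> P i v" using strand_short(2,3)[of i u v] that by auto
    from arc_order(1,2)[OF av this] show "arc (P i u) (P j w) (P i v) \<longleftrightarrow> P i u < P i v" "arc (P j w) (P i u) (P i v) \<longleftrightarrow> P i v < P i u"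
      by blast+
  qed
  have tn: "\<tau> i k j \<longleftrightarrow> \<not> \<tau> i j k" if "i < 3" "R3_pos i j \<noteq> R3_pos i k" for i j k
    using tau[OF that(1)] that(2) by auto
  note hs = TMB(1-5) dist3
  note pc = pos_com[of M T] pos_com[of B T] pos_com[of B M]
  have tns: "\<tau> T B M = (\<not> \<tau> T M B)" "\<tau> M B T = (\<not> \<tau> M T B)" "\<tau> B M T = (\<not> \<tau> B T M)"
    using tn[of T M B] tn[of M T B] tn[of B T M] pne pc TMB(1-3) by auto
  note aD = arcs_gauss_of[OF DE(1)] and aE = arcs_gauss_of[OF DE(2)]
  note TMd = ID[of T M, OF TMB(1,2,4)] and TBd = ID[of T B, OF TMB(1,3) dist3(4)] and MBd = ID[of M B, OF TMB(2,3,5)]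
  note TMe = IE[of T M, OF TMB(1,2,4)] and TBe = IE[of T B, OF TMB(1,3) dist3(4)] and MBe = IE[of M B, OF TMB(2,3,5)]
  have triD: "triangle (gauss_of D) (xD T M) (xD T B) (xD M B) \<kappa> (\<tau> T M B) (\<tau> M T B) (\<tau> B T M)"
    unfolding triangle_def aD[OF TMd TBd] aD[OF TBd TMd] aD[OF TMd MBd] aD[OF MBd TMd] aD[OF TBd MBd] aD[OF MBd TBd]
    using C[OF pos(1) pos(1) pos(1)]
      O(1)[of T M "R3_pos T M" "R3_pos T B" "R3_pos T M"] O(1)[of T B "R3_pos T B" "R3_pos T M" "R3_pos T B"]
      O(2)[of M T "R3_pos T M" "R3_pos M B" "R3_pos T M"] O(1)[of M B "R3_pos M B" "R3_pos T M" "R3_pos M B"]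
      O(2)[of B T "R3_pos T B" "R3_pos M B" "R3_pos T B"] O(2)[of B M "R3_pos M B" "R3_pos T B" "R3_pos M B"]
      hs pos(1) pne pne[symmetric] tns pc
    unfolding \<tau>_def by simp
  have triE: "triangle (gauss_of E) (xE T M) (xE T B) (xE M B) \<kappa> (\<not> \<tau> T M B) (\<not> \<tau> M T B) (\<not> \<tau> B T M)"
    unfolding triangle_def aE[OF TMe TBe] aE[OF TBe TMe] aE[OF TMe MBe] aE[OF MBe TMe] aE[OF TBe MBe] aE[OF MBe TBe]
    using C[OF pos(2) pos(2) pos(2)]
      O(1)[of T M "1 - R3_pos T M" "1 - R3_pos T B" "1 - R3_pos T M"] O(1)[of T B "1 - R3_pos T B" "1 - R3_pos T M" "1 - R3_pos T B"]
      O(2)[of M T "1 - R3_pos T M" "1 - R3_pos M B" "1 - R3_pos T M"] O(1)[of M B "1 - R3_pos M B" "1 - R3_pos T M" "1 - R3_pos M B"]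
      O(2)[of B T "1 - R3_pos T B" "1 - R3_pos M B" "1 - R3_pos T B"] O(2)[of B M "1 - R3_pos M B" "1 - R3_pos T B" "1 - R3_pos M B"]
      tauE[of T M B] tauE[of T B M] tauE[of M T B] tauE[of M B T] tauE[of B T M] tauE[of B M T]
      hs pos(2) pne pne[symmetric] tns pc
    by simp
  \<comment> \<open>Matches the three crossings of the triangle before and after the move. The
    diagram H below has the chords of D and the data of E.\<close>
  define F where "F x = (if x = xD T M then xE T M else if x = xD T B then xE T B else if x = xD M B then xE M B else x)" for x
  have F: "F (xD T M) = xE T M" "F (xD T B) = xE T B" "F (xD M B) = xE M B" "\<And>x. x \<in> Y \<Longrightarrow> F x = x"
    using ne nY[of T M] nY[of T B] nY[of M B] hs by (auto simp: F_def)
  define H where "H = \<lparr>chords = crossing_points D, sign = \<lambda>x. sign (gauss_of E) (F x),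
    over_in = \<lambda>x y. over_in (gauss_of E) (F x) (F y), under_in = \<lambda>x y. under_in (gauss_of E) (F x) (F y)\<rparr>"
  have "bij_betw F (crossing_points D) (crossing_points E)"
    unfolding bij_betw_def
  proof
    show "inj_on F (crossing_points D)"
      unfolding XD using ne nY[of T M] nY[of T B] nY[of M B] hs
      by (auto simp: inj_on_def F)
    show "F ` crossing_points D = crossing_points E" unfolding XD XE using F by (auto simp: image_iff)
  qed
  then have "gauss_iso F H (gauss_of E)" by (simp add: gauss_iso_def H_def)
  then have HE: "gauss_equal H (gauss_of E)" by (rule gauss_iso_equal)
  have "gauss_equal (gauss_of D) H"
  proof (rule gauss_R3_aux[OF finite_Y _ _ _ ne(1-3)])
    show "xD T M \<notin> Y" "xD T B \<notin> Y" "xD M B \<notin> Y" using nY hs by auto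
    show "chords (gauss_of D) = insert (xD T M) (insert (xD T B) (insert (xD M B) Y))" "chords H = chords (gauss_of D)"
      by (simp_all add: XD H_def)
    show "sign H x = sign (gauss_of D) x" if "x \<in> chords (gauss_of D)" for x
      using that gauss_outside(1)[of x] hs F sgD sgE unfolding H_def by (auto simp: XD)
    show "triangle (gauss_of D) (xD T M) (xD T B) (xD M B) \<kappa> (\<tau> T M B) (\<tau> M T B) (\<tau> B T M)" by (rule triD)
    show "triangle H (xD T M) (xD T B) (xD M B) \<kappa> (\<not> \<tau> T M B) (\<not> \<tau> M T B) (\<not> \<tau> B T M)"
      using triE unfolding triangle_def by (simp add: H_def F)
    show "sign (gauss_of D) (xD T M) \<in> {1, - 1}" "sign (gauss_of D) (xD T B) \<in> {1, - 1}" "sign (gauss_of D) (xD M B) \<in> {1, - 1}"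
      using sgD hs by (auto simp: \<sigma>_def)
    have bs: "(b i > 0) \<or> \<not> (b i > 0)" for i by blast
    have sg: "sign (gauss_of D) (xD T M) = \<sigma> T M" "sign (gauss_of D) (xD T B) = \<sigma> T B" "sign (gauss_of D) (xD M B) = \<sigma> M B"
      using sgD hs by auto
    \<comment> \<open>A fact about three lines in the plane, checked over all labelings: the slope
      of i compares with that of j as with that of k exactly if j and k meet i both before, or both
      after, their common crossing. Traversing a strand backwards affects the signs and the flags in
      the same way.\<close>
    have comb: "((R3_slope i j < R3_slope j i) = (R3_slope i k < R3_slope k i)) = ((R3_pos j i < R3_pos j k) = (R3_pos k i < R3_pos k j))"
      if "i < 3" "j < 3" "k < 3" "i \<noteq> j" "i \<noteq> k" "j \<noteq> k" for i j k
      using that unfolding three by (elim disjE) (simp_all add: R3_slope_def R3_pos_def doubleton_eq_iff)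
    have flip: "R3_pos T B < R3_pos T M \<longleftrightarrow> \<not> R3_pos T M < R3_pos T B" "R3_pos M B < R3_pos T M \<longleftrightarrow> \<not> R3_pos T M < R3_pos M B"
      "R3_pos M B < R3_pos T B \<longleftrightarrow> \<not> R3_pos T B < R3_pos M B" "R3_slope M T < R3_slope T M \<longleftrightarrow> \<not> R3_slope T M < R3_slope M T"
      using pne slope[of T M] TMB(1-3) dist3 by linarith+
    note c1 = comb[of T M B, OF TMB(1-3) dist3(1-3), unfolded pc flip]
      and c2 = comb[of M T B, OF TMB(2,1,3) dist3(1)[symmetric] dist3(3,2), unfolded pc flip]
    show "(sign (gauss_of D) (xD T M) = sign (gauss_of D) (xD T B)) = (\<tau> M T B = \<tau> B T M)"
      unfolding sg tau[OF TMB(2)] tau[OF TMB(3)] \<sigma>_def pc flip using c1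
      by (cases "b T > 0"; cases "b M > 0"; cases "b B > 0"; cases "R3_slope T M < R3_slope M T"; cases "R3_slope T B < R3_slope B T") simp_all
    show "(sign (gauss_of D) (xD T M) = sign (gauss_of D) (xD M B)) = (\<tau> T M B = \<tau> B T M)"
      unfolding sg tau[OF TMB(1)] tau[OF TMB(3)] \<sigma>_def pc flip using c2
      by (cases "b T > 0"; cases "b M > 0"; cases "b B > 0"; cases "R3_slope T M < R3_slope M T"; cases "R3_slope M B < R3_slope B M") simp_all
    have par: "over_param D x - P i u \<notin> \<int>" "under_param D x - P i u \<notin> \<int>" "curve D (over_param D x) \<notin> Sq" "curve D (under_param D x) \<notin> Sq"
      if "x \<in> Y" "i < 3" "u \<in> {0..1}" for x i u
      using outside_strand[OF that(1), of i u] that Y_params[OF that(1)] by simp_all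
    have slide: "arc (P i u) (P j u) p = arc (P i v) (P j v) p"
      if "i < 3" "j < 3" "i \<noteq> j" "u \<in> {0..1}" "v \<in> {0..1}" "p \<in> {over_param D x, under_param D x}" "x \<in> Y" for i j u v p x
    proof -
      have pS: "curve D p \<notin> Sq" "p - P i v \<notin> \<int>" "p - P j u \<notin> \<int>"
        using par[OF that(7,1,5)] par[OF that(7,2,4)] that(6) by auto
      have "arc (P i u) (P j u) p = arc (P i v) (P j u) p"
        by (rule arc_slide(2)[OF lt[OF that(1)] that(4,5) other[OF that(2) that(3)[symmetric] that(4)] disjI1[OF pS(1)]])
           (use pS(3) Ints_diff_commute[of p] in blast)
      also have "\<dots> = arc (P i v) (P j v) p"
        by (rule arc_slide(3)[OF lt[OF that(2)] that(4,5) other[OF that(1) that(3) that(5)] disjI1[OF pS(1)]])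
           (use pS(2) Ints_diff_commute[of p] in blast)
      finally show ?thesis .
    qed
    have YDp: "curve D (over_param D x) = x" "curve D (under_param D x) = x" "over_param D x \<in> over D" "under_param D x \<notin> over D" if "x \<in> Y" for x
      using Y_params[OF that] by auto
    have yt: "over_in (gauss_of E) y (xE i j) = over_in (gauss_of D) y (xD i j) \<and> under_in (gauss_of E) y (xE i j) = under_in (gauss_of D) y (xD i j) \<and>
       over_in (gauss_of E) (xE i j) y = over_in (gauss_of D) (xD i j) y \<and> under_in (gauss_of E) (xE i j) y = under_in (gauss_of D) (xD i j) y"
      if "i < 3" "j < 3" "h j < h i" and y: "y \<in> Y" for i j y
    proof -
      have ij: "i \<noteq> j" using that(3) by auto
      have 1: "arc (over_param D y) (under_param D y) (P k u) = arc (over_param D y) (under_param D y) (P k v)"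
        if "k < 3" "u \<in> {0..1}" "v \<in> {0..1}" for k u v
        by (rule arc_slide(1)[OF lt[OF that(1)] that(2,3)]) (use Y_params[OF y] in blast)+
      have 2: "arc (P i (1 - R3_pos i j)) (P j (1 - R3_pos i j)) p = arc (P i (R3_pos i j)) (P j (R3_pos i j)) p"
        if "p \<in> {over_param D y, under_param D y}" for p
        by (rule slide[OF _ _ ij _ _ that y]) (use \<open>i < 3\<close> \<open>j < 3\<close> pos in auto)
      show ?thesis
        unfolding aE[OF strand_params_E[OF y] IE[OF that(1-3)]] aE[OF IE[OF that(1-3)] strand_params_E[OF y]]
          aD[OF YDp[OF y] ID[OF that(1-3)]] aD[OF ID[OF that(1-3)] YDp[OF y]]
        using 1[OF that(1) pos(2) pos(1)] 1[OF that(2) pos(2) pos(1)] 2 by simp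
    qed
    show "over_in H x y = over_in (gauss_of D) x y \<and> under_in H x y = under_in (gauss_of D) x y"
      if "x \<in> chords (gauss_of D)" "y \<in> chords (gauss_of D)" "x \<noteq> y" "x \<in> Y \<or> y \<in> Y" for x y
    proof -
      have Y2: "x \<in> Y \<or> x = xD T M \<or> x = xD T B \<or> x = xD M B" if "x \<in> chords (gauss_of D)" for x
        using that by (auto simp: XD)
      note yts = yt[OF TMB(1,2,4)] yt[OF TMB(1,3) dist3(4)] yt[OF TMB(2,3,5)]
      show ?thesis
      proof (cases "x \<in> Y")
        case x: True
        from Y2[OF that(2)] show ?thesis
        proof (elim disjE)
          assume y: "y \<in> Y"
          show ?thesis using gauss_outside(2,3)[OF x y] by (simp add: H_def F(4)[OF x] F(4)[OF y])
        next
          assume y: "y = xD T M"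
          show ?thesis using yts(1)[OF x] by (simp add: H_def F(4)[OF x] F(1) y)
        next
          assume y: "y = xD T B"
          show ?thesis using yts(2)[OF x] by (simp add: H_def F(4)[OF x] F(2) y)
        next
          assume y: "y = xD M B"
          show ?thesis using yts(3)[OF x] by (simp add: H_def F(4)[OF x] F(3) y)
        qed
      next
        case False
        then have y: "y \<in> Y" using that(4) by simp
        from Y2[OF that(1)] False consider "x = xD T M" | "x = xD T B" | "x = xD M B" by blast
        then show ?thesis
        proof cases
          case 1
          show ?thesis using yts(1)[OF y] by (simp add: H_def F(4)[OF y] F(1) 1)
        next
          case 2
          show ?thesis using yts(2)[OF y] by (simp add: H_def F(4)[OF y] F(2) 2)
        next
          case 3
          show ?thesis using yts(3)[OF y] by (simp add: H_def F(4)[OF y] F(3) 3)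
        qed
      qed
    qed
    show "(of_bool (over_in (gauss_of D) (xD T B) y) :: int) = of_bool (over_in (gauss_of D) (xD T M) y) +
        of_bool (over_in (gauss_of D) (xD M B) y) + (if \<kappa> then 0 else - 1) \<and>
      (of_bool (under_in (gauss_of D) (xD T B) y) :: int) = of_bool (under_in (gauss_of D) (xD T M) y) +
        of_bool (under_in (gauss_of D) (xD M B) y) + (if \<kappa> then 0 else - 1)" if y: "y \<in> Y" for y
    proof -
      have s: "arc (P i (R3_pos i j)) (P j (R3_pos i j)) p = arc (P i 0) (P j 0) p"
        if "i < 3" "j < 3" "i \<noteq> j" "p \<in> {over_param D y, under_param D y}" for i j p
        by (rule slide[OF that(1-3) _ _ that(4) y]) (use pos in auto)
      \<comment> \<open>This supplies the constant d of \<open>gauss_R3_aux\<close>: 0 if M comes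
        between T and B, and - 1 otherwise.\<close>
      have ad: "(of_bool (arc (P T 0) (P B 0) p) :: int) = of_bool (arc (P T 0) (P M 0) p) + of_bool (arc (P M 0) (P B 0) p) + (if \<kappa> then 0 else - 1)"
        if "p \<in> {over_param D y, under_param D y}" for p
        unfolding \<kappa>_def by (rule arc_additive) (use ap0 TMB(1-3) dist3 par[OF y] that in auto)
      show ?thesis
        unfolding aD[OF TBd YDp[OF y]] aD[OF TMd YDp[OF y]] aD[OF MBd YDp[OF y]]
        using ad s[of T B] s[of T M] s[of M B] TMB(1-3) dist3 by simp
    qed
  qed
  then show ?thesis using HE gauss_equal_trans by blast
qed

lemma gauss_move:
  assumes "move D E"
  shows "gauss_equal (gauss_of D) (gauss_of E)"
  using assms unfolding move_def
  by (auto intro: gauss_reparametrization gauss_surface_homeo gauss_R1_move gauss_R2_move gauss_R3_move gauss_stabilization)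

lemma gauss_virtual_equivalence:
  assumes "(D, E) \<in> virtual_equivalence"
  shows "gauss_equal (gauss_of D) (gauss_of E)"
proof -
  have "equivclp move D E" using assms by (simp add: virtual_equivalence_def)
  then show ?thesis
  proof (induction rule: equivclp_induct)
    case (step y z)
    then have "gauss_equal (gauss_of y) (gauss_of z)" using gauss_move gauss_equal_sym by blast
    then show ?case using step.IH gauss_equal_trans by blast
  qed (rule gauss_equal_refl)
qed


section \<open>A surface of genus two\<close>

lemma squash_minus: "squash (- x) = - squash x"
proof -
  consider "\<bar>x\<bar> \<le> 1/2" | "x \<ge> 1/2" | "x \<le> - 1/2" by linarith
  then show ?thesis by cases (simp_all add: squash_eq)
qed

lemma unbox_exists: "\<exists>g. continuous_on (range box_map) g \<and> (\<forall>w. g (box_map w) = w)"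
proof -
  obtain g where "homeomorphism UNIV (range box_map) box_map g"
    using invariance_of_domain_homeomorphism[OF open_UNIV continuous_box_map _ inj_box_map] by auto
  then show ?thesis by (auto simp: homeomorphism_def)
qed

definition unbox :: "complex \<Rightarrow> complex" where
  "unbox = (SOME g. continuous_on (range box_map) g \<and> (\<forall>w. g (box_map w) = w))"

lemma unbox: "continuous_on (range box_map) unbox" "unbox (box_map w) = w"
  using someI_ex[OF unbox_exists] unfolding unbox_def[symmetric] by auto

lemma open_range_box_map: "open (range box_map)"
  using invariance_of_domain[OF continuous_box_map open_UNIV inj_box_map] .

section \<open>The integer lattice and the covering of the torus by the plane\<close>

definition gauss_ints :: "complex set" where
  "gauss_ints = {z. Re z \<in> \<int> \<and> Im z \<in> \<int>}"

lemma gauss_ints_0 [simp]: "0 \<in> gauss_ints"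
  by (simp add: gauss_ints_def)

lemma gauss_ints_add: "x \<in> gauss_ints \<Longrightarrow> y \<in> gauss_ints \<Longrightarrow> x + y \<in> gauss_ints"
  by (simp add: gauss_ints_def)

lemma gauss_ints_diff: "x \<in> gauss_ints \<Longrightarrow> y \<in> gauss_ints \<Longrightarrow> x - y \<in> gauss_ints"
  by (simp add: gauss_ints_def)

lemma Ints_abs_less_1: "x \<in> \<int> \<Longrightarrow> \<bar>x\<bar> < 1 \<Longrightarrow> x = (0::real)"
  by (auto elim!: Ints_cases)

lemma gauss_ints_small: "x \<in> gauss_ints \<Longrightarrow> norm x < 1 \<Longrightarrow> x = 0"
  using abs_Re_le_cmod[of x] abs_Im_le_cmod[of x] Ints_abs_less_1[of "Re x"] Ints_abs_less_1[of "Im x"]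
  by (auto simp: gauss_ints_def complex_eq_iff)

lemma closed_gauss_ints: "closed gauss_ints"
proof -
  have "gauss_ints = Re -` \<int> \<inter> Im -` \<int>" by (auto simp: gauss_ints_def)
  moreover have "closed (Re -` (\<int> :: real set))" "closed (Im -` (\<int> :: real set))"
    by (intro closed_vimage closed_Ints continuous_intros)+
  ultimately show ?thesis by (metis closed_Int)
qed

text \<open>In each coordinate of absolute value at most 1/2, no integer is closer than 0.\<close>

lemma infdist_gauss_ints_near:
  assumes "\<bar>Re z\<bar> \<le> 1/2" "\<bar>Im z\<bar> \<le> 1/2"
  shows "infdist z gauss_ints = norm z"
proof (rule antisym)
  show "infdist z gauss_ints \<le> norm z" using infdist_le[OF gauss_ints_0, of z] by (simp add: dist_norm)
  have *: "\<bar>x\<bar> \<le> \<bar>x - i\<bar>" if "i \<in> \<int>" "\<bar>x\<bar> \<le> 1/2" for x i :: real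
  proof (cases "i = 0")
    case False
    then have "\<bar>i\<bar> \<ge> 1" using Ints_abs_less_1[OF that(1)] by fastforce
    then show ?thesis using that(2) by linarith
  qed simp
  have "norm z \<le> dist z l" if "l \<in> gauss_ints" for l
    unfolding dist_norm norm_complex_def minus_complex.sel
    using that assms * by (intro real_sqrt_le_mono add_mono) (auto simp: gauss_ints_def abs_le_square_iff)
  moreover have "gauss_ints \<noteq> {}" using gauss_ints_0 by blast
  ultimately show "norm z \<le> infdist z gauss_ints"
    by (auto simp: infdist_def intro!: cINF_greatest)
qed

lemma infdist_gauss_ints_shift:
  assumes "l \<in> gauss_ints"
  shows "infdist (z + l) gauss_ints = infdist z gauss_ints"
proof -
  have *: "infdist (z + l) gauss_ints \<le> infdist z gauss_ints" if "l \<in> gauss_ints" for z l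
  proof -
    obtain m where m: "m \<in> gauss_ints" "infdist z gauss_ints = dist z m"
      using infdist_attains_inf[OF closed_gauss_ints, of z] gauss_ints_0 by blast
    have "infdist (z + l) gauss_ints \<le> dist (z + l) (m + l)"
      by (rule infdist_le) (use m that gauss_ints_add in blast)
    then show ?thesis using m by simp
  qed
  have "- l \<in> gauss_ints" using gauss_ints_diff[OF gauss_ints_0 assms] by simp
  then show ?thesis using *[OF assms, of z] *[of "- l" "z + l"] by simp
qed

text \<open>The torus times the line, embedded in the type of points: the arguments of the two
  coordinates are the point of the torus, and the modulus of the first encodes the height.\<close>

definition torus_point :: "complex \<Rightarrow> real \<Rightarrow> complex \<times> complex" where
  "torus_point z h = (exp h *\<^sub>R cis (2 * pi * Re z), cis (2 * pi * Im z))"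

definition height :: "complex \<times> complex \<Rightarrow> real" where
  "height x = ln (norm (fst x))"

lemma height_torus_point [simp]: "height (torus_point z h) = h"
  by (simp add: height_def torus_point_def)

lemma cis_2pi_eq: "cis (2 * pi * x) = cis (2 * pi * y) \<longleftrightarrow> x - y \<in> \<int>"
proof -
  have "cis (2 * pi * x) = cis (2 * pi * y) \<longleftrightarrow> cis (2 * pi * (x - y)) = 1"
    by (simp add: right_diff_distrib cis_divide[symmetric])
  also have "\<dots> \<longleftrightarrow> (\<exists>n::int. 2 * pi * (x - y) = of_int (2 * n) * pi)"
    by (simp add: cis_conv_exp exp_eq_1)
  also have "\<dots> \<longleftrightarrow> x - y \<in> \<int>"
    by (auto simp: Ints_def)
  finally show ?thesis .
qed

lemma torus_point_eq: "torus_point z h = torus_point z' h' \<longleftrightarrow> h = h' \<and> z - z' \<in> gauss_ints"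
proof
  assume eq: "torus_point z h = torus_point z' h'"
  then have "h = h'" using height_torus_point by metis
  moreover have "cis (2 * pi * Re z) = cis (2 * pi * Re z')" "cis (2 * pi * Im z) = cis (2 * pi * Im z')"
    using eq \<open>h = h'\<close> by (auto simp: torus_point_def)
  ultimately show "h = h' \<and> z - z' \<in> gauss_ints" by (simp add: cis_2pi_eq gauss_ints_def)
next
  assume "h = h' \<and> z - z' \<in> gauss_ints"
  then show "torus_point z h = torus_point z' h'" by (simp add: torus_point_def gauss_ints_def cis_2pi_eq)
qed

lemma continuous_torus_point:
  assumes "continuous_on S f" "continuous_on S k"
  shows "continuous_on S (\<lambda>x. torus_point (f x) (k x))"
  unfolding torus_point_def by (intro continuous_intros assms)

text \<open>A local inverse of the covering: principal logarithms measure the angles relative to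
  those of z, so the value is the lift in the open unit square centred at z.\<close>

definition section_at :: "complex \<Rightarrow> complex \<times> complex \<Rightarrow> complex" where
  "section_at z x = z + of_real (1 / (2 * pi)) *
     Complex (Im (Ln (fst x / cis (2 * pi * Re z)))) (Im (Ln (snd x / cis (2 * pi * Im z))))"

definition section_dom :: "complex \<Rightarrow> (complex \<times> complex) set" where
  "section_dom z = {x. fst x / cis (2 * pi * Re z) \<notin> \<real>\<^sub>\<le>\<^sub>0 \<and> snd x / cis (2 * pi * Im z) \<notin> \<real>\<^sub>\<le>\<^sub>0}"

lemma open_section_dom: "open (section_dom z)"
proof -
  have "open ((\<lambda>x. fst x / cis (2 * pi * Re z)) -` (- \<real>\<^sub>\<le>\<^sub>0) \<inter> (\<lambda>x::complex \<times> complex. snd x / cis (2 * pi * Im z)) -` (- \<real>\<^sub>\<le>\<^sub>0))"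
    by (intro open_Int open_vimage open_Compl closed_nonpos_Reals_complex continuous_intros) auto
  then show ?thesis by (simp add: section_dom_def vimage_def Int_def)
qed

lemma continuous_section_at: "continuous_on (section_dom z) (section_at z)"
  unfolding section_at_def section_dom_def
  by (intro continuous_intros continuous_on_Complex) auto

lemma Ln_exp_Complex:
  assumes "\<bar>y\<bar> < pi"
  shows "Ln (exp (Complex k y)) = Complex k y" "exp (Complex k y) \<notin> \<real>\<^sub>\<le>\<^sub>0"
proof -
  show 1: "Ln (exp (Complex k y)) = Complex k y" using assms by (intro Ln_exp) auto
  show "exp (Complex k y) \<notin> \<real>\<^sub>\<le>\<^sub>0"
  proof
    assume n: "exp (Complex k y) \<in> \<real>\<^sub>\<le>\<^sub>0"
    then obtain r where r: "exp (Complex k y) = of_real r" "r \<le> 0" by (auto simp: nonpos_Reals_def)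
    then have "r < 0" by (metis exp_not_eq_zero less_le of_real_0)
    then have "Im (Ln (of_real r)) = pi" using Im_Ln_eq_pi[of "of_real r"] by simp
    then show False using 1 r assms by simp
  qed
qed

lemma section_at_torus_point:
  assumes "\<bar>Re w - Re z\<bar> < 1/2" "\<bar>Im w - Im z\<bar> < 1/2"
  shows "torus_point w h \<in> section_dom z" "section_at z (torus_point w h) = w"
proof -
  have d: "exp h *\<^sub>R cis (2 * pi * Re w) / cis (2 * pi * Re z) = exp (Complex h (2 * pi * (Re w - Re z)))"
    "cis (2 * pi * Im w) / cis (2 * pi * Im z) = exp (Complex 0 (2 * pi * (Im w - Im z)))"
    by (simp_all add: exp_eq_polar cis_divide[symmetric] right_diff_distrib scaleR_conv_of_real)
  have b: "\<bar>2 * pi * (Re w - Re z)\<bar> < pi" "\<bar>2 * pi * (Im w - Im z)\<bar> < pi"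
    using assms by (auto simp: abs_mult)
  note l = Ln_exp_Complex
  show "torus_point w h \<in> section_dom z"
    unfolding section_dom_def torus_point_def using l(2) b d by simp
  have "2 * pi * x / (2 * pi) = x" for x by simp
  then show "section_at z (torus_point w h) = w"
    unfolding section_at_def torus_point_def fst_conv snd_conv d l(1)[OF b(1)] l(1)[OF b(2)]
    by (simp add: complex_eq_iff)
qed

text \<open>Valid on the entire domain: the value may differ from w by a lattice vector but lies
  over the same point.\<close>

lemma section_at_lift:
  assumes "torus_point w h \<in> section_dom z"
  shows "torus_point (section_at z (torus_point w h)) h = torus_point w h"
proof -
  let ?x = "torus_point w h"
  have n: "fst ?x / cis (2 * pi * Re z) \<noteq> 0" "snd ?x / cis (2 * pi * Im z) \<noteq> 0" by (simp_all add: torus_point_def)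
  have c: "cis (2 * pi * (y + Im (Ln u) / (2 * pi))) = cis (2 * pi * y) * sgn u" if "u \<noteq> 0" for y u
  proof -
    have "cis (Im (Ln u)) = sgn u"
      using that by (metis cis_Arg Arg_eq_Im_Ln)
    then show ?thesis by (simp add: distrib_left cis_mult[symmetric])
  qed
  have s: "sgn (fst ?x / cis (2 * pi * Re z)) = cis (2 * pi * Re w) / cis (2 * pi * Re z)"
    "sgn (snd ?x / cis (2 * pi * Im z)) = cis (2 * pi * Im w) / cis (2 * pi * Im z)"
    by (simp_all add: torus_point_def sgn_eq scaleR_conv_of_real norm_mult norm_divide)
  have "Re (section_at z ?x) = Re z + Im (Ln (fst ?x / cis (2 * pi * Re z))) / (2 * pi)"
    "Im (section_at z ?x) = Im z + Im (Ln (snd ?x / cis (2 * pi * Im z))) / (2 * pi)"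
    by (simp_all add: section_at_def)
  then have "cis (2 * pi * Re (section_at z ?x)) = cis (2 * pi * Re w)"
    "cis (2 * pi * Im (section_at z ?x)) = cis (2 * pi * Im w)"
    using c[OF n(1)] c[OF n(2)] s by simp_all
  then show ?thesis unfolding torus_point_def by simp
qed

locale double_torus =
  fixes \<rho> :: real
  assumes rho: "0 < \<rho>" "\<rho> \<le> 1/8"
begin

definition F :: "complex \<Rightarrow> real" where
  "F z = infdist z gauss_ints - \<rho>"

text \<open>The sheets at height \<open>F\<close> and \<open>- F\<close> over the torus without the disc of radius \<open>\<rho>\<close> about the
  lattice point, glued along the boundary of the disc, where \<open>F\<close> vanishes.\<close>

definition X :: "(complex \<times> complex) set" where
  "X = {torus_point z h |z h. \<bar>h\<bar> = F z}"

abbreviation XT :: "(complex \<times> complex) topology" where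
  "XT \<equiv> top_of_set X"

lemma F_square: "\<bar>Re z\<bar> \<le> 1/2 \<Longrightarrow> \<bar>Im z\<bar> \<le> 1/2 \<Longrightarrow> F z = norm z - \<rho>"
  by (simp add: F_def infdist_gauss_ints_near)

lemma F_near: "norm z \<le> 1/2 \<Longrightarrow> F z = norm z - \<rho>"
  using F_square[of z] abs_Re_le_cmod[of z] abs_Im_le_cmod[of z] by linarith

lemma F_shift: "l \<in> gauss_ints \<Longrightarrow> F (z + l) = F z"
  by (simp add: F_def infdist_gauss_ints_shift)

lemma F_cong: "z - z' \<in> gauss_ints \<Longrightarrow> F z = F z'"
  using F_shift[of "z - z'" z'] by simp

lemma continuous_F: "continuous_on S F"
  unfolding F_def by (intro continuous_intros)

lemma X_I: "\<bar>h\<bar> = F z \<Longrightarrow> torus_point z h \<in> X"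
  by (auto simp: X_def)

lemma torus_point_in_X: "torus_point z h \<in> X \<longleftrightarrow> \<bar>h\<bar> = F z"
proof
  assume "torus_point z h \<in> X"
  then obtain z' where "z - z' \<in> gauss_ints" "\<bar>h\<bar> = F z'" by (auto simp: X_def torus_point_eq)
  then show "\<bar>h\<bar> = F z" using F_cong by simp
qed (rule X_I)

lemma X_E:
  assumes "x \<in> X"
  obtains z h where "x = torus_point z h" "\<bar>h\<bar> = F z"
  using assms by (auto simp: X_def)

lemma chart_in_X: "plane_chart XT e \<Longrightarrow> e w \<in> X"
  unfolding plane_chart_iff using continuous_map_image_subset_topspace[of euclidean XT e] by auto

lemma plane_chartI:
  assumes cont: "continuous_on UNIV e" and Q: "open Q" and \<Psi>: "continuous_on (X \<inter> Q) \<Psi>"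
    and 1: "\<And>w. e w \<in> X \<inter> Q \<and> \<Psi> (e w) = w" and 2: "\<And>x. x \<in> X \<inter> Q \<Longrightarrow> e (\<Psi> x) = x"
  shows "plane_chart XT e"
  unfolding plane_chart_iff
proof (intro conjI allI impI)
  show "inj e" by (metis 1 injI)
  show "continuous_map euclidean XT e" using cont 1 by (auto simp: continuous_map_in_subtopology image_subset_iff)
  fix U :: "complex set" assume "open U"
  have "e ` U = \<Psi> -` U \<inter> (X \<inter> Q)" using 1 2 by force
  moreover have "openin (top_of_set (X \<inter> Q)) (\<Psi> -` U \<inter> (X \<inter> Q))"
    using continuous_openin_preimage_gen[OF \<Psi> \<open>open U\<close>] by (simp add: Int_commute)
  moreover have "openin XT (X \<inter> Q)" using Q by (simp add: openin_open_Int)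
  ultimately show "openin XT (e ` U)" using openin_trans by metis
qed

text \<open>Winding numbers need maps into the plane, so the projection of a chart to the torus is
  lifted locally before its degree is taken.\<close>

definition is_lift :: "(complex \<Rightarrow> complex \<times> complex) \<Rightarrow> (complex \<Rightarrow> complex) \<Rightarrow> complex \<Rightarrow> bool" where
  "is_lift e q z \<longleftrightarrow> (\<exists>R>0. continuous_on (ball z R) q \<and> (\<forall>w\<in>ball z R. torus_point (q w) (height (e w)) = e w))"

definition sheet :: "complex \<times> complex \<Rightarrow> int" where
  "sheet x = (if height x > 0 then 1 else - 1)"

text \<open>The projection to the torus preserves the orientation on the upper sheet and reverses it on the
  lower one. No condition is needed on the seam, where \<open>height\<close> is 0, because its complement is dense.\<close>

definition C :: "(complex \<Rightarrow> complex \<times> complex) set" where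
  "C = {e. plane_chart XT e \<and> (\<forall>z. height (e z) \<noteq> 0 \<longrightarrow> (\<exists>q. is_lift e q z \<and> local_degree q z (sheet (e z))))}"

lemma C_I:
  assumes "plane_chart XT e" "\<And>z. height (e z) \<noteq> 0 \<Longrightarrow> is_lift e q z \<and> local_degree q z (sheet (e z))"
  shows "e \<in> C"
  using assms by (auto simp: C_def)

text \<open>The difference of two lifts is continuous with values in the lattice, hence locally
  constant. So degrees do not depend on the lift.\<close>

lemma is_lift_unique:
  assumes "is_lift e q z" "is_lift e q' z"
  shows "\<exists>R>0. \<exists>l. \<forall>w\<in>ball z R. q' w = q w + l"
proof -
  obtain R R' where R: "R > 0" "continuous_on (ball z R) q" "\<And>w. w \<in> ball z R \<Longrightarrow> torus_point (q w) (height (e w)) = e w"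
    "R' > 0" "continuous_on (ball z R') q'" "\<And>w. w \<in> ball z R' \<Longrightarrow> torus_point (q' w) (height (e w)) = e w"
    using assms unfolding is_lift_def by blast
  let ?B = "ball z (min R R')"
  have l: "q' w - q w \<in> gauss_ints" if "w \<in> ?B" for w
  proof -
    have "torus_point (q' w) (height (e w)) = torus_point (q w) (height (e w))"
      using R(3)[of w] R(6)[of w] that by simp
    then show ?thesis by (simp add: torus_point_eq)
  qed
  have "continuous_on ?B (\<lambda>w. q' w - q w)"
    by (intro continuous_intros continuous_on_subset[OF R(2)] continuous_on_subset[OF R(5)]) auto
  then have "continuous (at z within ?B) (\<lambda>w. q' w - q w)" using R(1,4) by (simp add: continuous_on_eq_continuous_within)
  then obtain d where d: "d > 0" "\<And>w. w \<in> ?B \<Longrightarrow> dist w z < d \<Longrightarrow> dist (q' w - q w) (q' z - q z) < 1"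
    unfolding continuous_within_eps_delta using zero_less_one by blast
  have "q' w = q w + (q' z - q z)" if w: "w \<in> ball z (min d (min R R'))" for w
  proof -
    have "norm ((q' w - q w) - (q' z - q z)) < 1" using d(2)[of w] w by (simp add: dist_norm norm_minus_commute)
    moreover have "(q' w - q w) - (q' z - q z) \<in> gauss_ints" by (rule gauss_ints_diff[OF l l]) (use w R(1,4) in auto)
    ultimately have "(q' w - q w) - (q' z - q z) = 0" by (rule gauss_ints_small[rotated])
    then show ?thesis by (simp add: algebra_simps)
  qed
  moreover have "min d (min R R') > 0" using d(1) R(1,4) by simp
  ultimately show ?thesis by blast
qed

lemma local_degree_translate: "local_degree (\<lambda>w. w + l) z 1"
  by (rule local_degree_deriv[where c = 1 and R = 1]) (auto intro!: derivative_eq_intros continuous_intros)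

lemma lift_degree_unique:
  assumes "is_lift e q z" "is_lift e q' z" "local_degree q z d"
  shows "local_degree q' z d"
proof -
  obtain R l where R: "R > 0" "\<forall>w\<in>ball z R. q' w = q w + l" using is_lift_unique[OF assms(1,2)] by blast
  have "isCont q z"
    using assms(1) unfolding is_lift_def by (metis centre_in_ball continuous_on_interior interior_ball)
  then have "local_degree ((\<lambda>w. w + l) \<circ> q) z (1 * d)" by (rule local_degree_compose[OF assms(3) local_degree_translate])
  then show ?thesis using local_degree_cong[OF _ R(1)] R(2) by simp
qed

lemma is_lift_transition:
  assumes e: "plane_chart XT e" and e': "plane_chart XT e'" and zw: "e z = e' w" and q: "is_lift e' q w"
  shows "is_lift e (q \<circ> (inv e' \<circ> e)) z"
proof -
  let ?g = "inv e' \<circ> e" and ?U = "e -` range e'"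
  note T = transition_map[OF e e']
  have gz: "?g z = w" using zw e' by (simp add: plane_chart_iff)
  have zU: "z \<in> ?U" using zw by auto
  obtain R where R: "R > 0" "continuous_on (ball w R) q" "\<And>u. u \<in> ball w R \<Longrightarrow> torus_point (q u) (height (e' u)) = e' u"
    using q unfolding is_lift_def by blast
  have "open (?g -` ball w R \<inter> ?U)" using T(1,2) continuous_on_open_vimage by blast
  moreover have "z \<in> ?g -` ball w R \<inter> ?U" using gz zU R(1) by simp
  ultimately obtain r where r: "r > 0" "ball z r \<subseteq> ?g -` ball w R \<inter> ?U" using openE by blast
  show ?thesis unfolding is_lift_def
  proof (rule exI[of _ r], intro conjI ballI)
    show "continuous_on (ball z r) (q \<circ> ?g)"
      by (rule continuous_on_compose[OF continuous_on_subset[OF T(2)] continuous_on_subset[OF R(2)]]) (use r in auto)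
    fix u assume "u \<in> ball z r"
    then have "?g u \<in> ball w R" "e u \<in> range e'" using r(2) by auto
    then show "torus_point ((q \<circ> ?g) u) (height (e u)) = e u" using R(3)[of "?g u"] T(4)[of u] by simp
  qed (rule r(1))
qed

lemma nearest:
  assumes "F z = 0"
  obtains z0 where "norm z0 = \<rho>" "z - z0 \<in> gauss_ints"
proof -
  obtain m where m: "m \<in> gauss_ints" "infdist z gauss_ints = dist z m"
    using infdist_attains_inf[OF closed_gauss_ints, of z] gauss_ints_0 by blast
  then have "norm (z - m) = \<rho>" using assms by (simp add: F_def dist_norm)
  then show ?thesis using m(1) by (intro that[of "z - m"]) auto
qed

text \<open>From a point of the seam, the radial path outwards on the upper sheet leaves height 0 at
  once.\<close>

lemma seam_nowhere_dense:
  assumes U: "openin XT U" "x \<in> U"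
  shows "\<exists>y\<in>U. height y \<noteq> 0"
proof (cases "height x = 0")
  case True
  have "x \<in> X" using U openin_subset by fastforce
  then obtain z h where zh: "x = torus_point z h" "\<bar>h\<bar> = F z" by (auto simp: X_def)
  then have "h = 0" "F z = 0" using True by auto
  then obtain z0 where z0: "norm z0 = \<rho>" "z - z0 \<in> gauss_ints" using nearest by blast
  have x: "x = torus_point z0 0" using zh \<open>h = 0\<close> z0 by (simp add: torus_point_eq)
  define p where "p t = torus_point ((1 + of_real t) * z0) (\<rho> * t)" for t :: real
  have pX: "p t \<in> X" if "0 \<le> t" "t \<le> 1" for t
  proof -
    have "norm ((1 + of_real t) * z0) = (1 + t) * \<rho>"
      using that z0(1) by (simp add: norm_mult) (metis abs_of_nonneg add_nonneg_nonneg norm_of_real of_real_1 of_real_add zero_le_one)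
    moreover have "(1 + t) * \<rho> \<le> 2 * (1/8)" using that rho by (intro mult_mono) auto
    ultimately show ?thesis unfolding p_def torus_point_in_X using that rho F_near[of "(1 + of_real t) * z0"]
      by (simp add: abs_mult algebra_simps)
  qed
  have "continuous_on {0..1} p" unfolding p_def by (intro continuous_torus_point continuous_intros)
  then have "continuous_map (top_of_set {0..1}) XT p" using pX by (auto simp: continuous_map_in_subtopology)
  from openin_continuous_map_preimage[OF this U(1)]
  have "openin (top_of_set {0..1}) {t \<in> {0..1}. p t \<in> U}" by simp
  then obtain A where A: "open A" "{t \<in> {0..1}. p t \<in> U} = {0..1} \<inter> A" by (auto simp: openin_open)
  have "p 0 = x" using x by (simp add: p_def)
  have A': "t \<in> A \<longleftrightarrow> p t \<in> U" if "t \<in> {0..1}" for t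
  proof -
    have "t \<in> {t \<in> {0..1}. p t \<in> U} \<longleftrightarrow> t \<in> {0..1} \<inter> A" unfolding A(2) ..
    then show ?thesis using that by simp
  qed
  have "0 \<in> A" using A'[of 0] U(2) \<open>p 0 = x\<close> by simp
  then obtain d where d: "d > 0" "ball 0 d \<subseteq> A" using A(1) openE by blast
  define t where "t = min (d / 2) 1"
  have "0 < t" "t \<le> 1" "t < d" using d(1) by (auto simp: t_def min_def)
  moreover from this have "t \<in> ball 0 d" by (simp add: dist_norm)
  ultimately have t: "0 < t" "t \<le> 1" "t \<in> A" using d(2) by auto
  then have "p t \<in> U" using A'[of t] by simp
  moreover have "height (p t) \<noteq> 0" using t rho by (simp add: p_def)
  ultimately show ?thesis by blast
qed (use U in auto)

text \<open>Off the seam, both charts have lifts of the same degree, namely the sign of the sheet,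
  so the transition map has degree 1. It is injective, hence its degree is constant on a ball, and
  every ball about a parameter of a seam point contains parameters off the seam.\<close>

lemma C_compatible:
  assumes e: "e \<in> C" and e': "e' \<in> C" and zw: "e z = e' w"
  shows "local_degree (inv e' \<circ> e) z 1"
proof -
  have ch: "plane_chart XT e" "plane_chart XT e'" using e e' by (auto simp: C_def)
  let ?g = "inv e' \<circ> e" and ?U = "e -` range e'"
  note T = transition_map[OF ch]
  have ge: "?g u = y" if "e u = e' y" for u y using that ch(2) by (simp add: plane_chart_iff)
  have main: "local_degree ?g u 1" if u: "e u = e' y" "height (e u) \<noteq> 0" for u y
  proof -
    obtain q where q: "is_lift e q u" "local_degree q u (sheet (e u))" using e u(2) by (auto simp: C_def)
    obtain q' where q': "is_lift e' q' y" "local_degree q' y (sheet (e u))" using e' u by (auto simp: C_def)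
    have uU: "u \<in> ?U" using u(1) by auto
    obtain d where d: "local_degree ?g u d" using local_degree_exists[OF T(1) uU T(2,3)] .
    have "isCont ?g u" using T(1,2) uU by (simp add: continuous_on_eq_continuous_at o_def)
    then have "local_degree (q' \<circ> ?g) u (sheet (e u) * d)"
      using local_degree_compose[OF d] q'(2) ge[OF u(1)] by simp
    moreover have "local_degree (q' \<circ> ?g) u (sheet (e u))"
      by (rule lift_degree_unique[OF q(1) is_lift_transition[OF ch u(1) q'(1)] q(2)])
    ultimately have "sheet (e u) * d = sheet (e u)" using local_degree_unique by blast
    then have "d = 1" by (auto simp: sheet_def split: if_splits)
    then show ?thesis using d by simp
  qed
  have zU: "z \<in> ?U" using zw by auto
  then obtain R where R: "R > 0" "ball z R \<subseteq> ?U" using T(1) openE by blast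
  have "openin XT (e ` ball z R)" using ch(1) by (auto simp: plane_chart_iff)
  then obtain u where u: "u \<in> ball z R" "height (e u) \<noteq> 0"
    using seam_nowhere_dense[of "e ` ball z R" "e z"] R(1) by auto
  then obtain y where "e u = e' y" using R(2) by auto
  then have "local_degree ?g u 1" using main u(2) by blast
  then show ?thesis
    by (rule local_degree_constant[OF open_ball connected_ball continuous_on_subset[OF T(2) R(2)] inj_on_subset[OF T(3) R(2)] u(1)])
       (use R(1) in simp)
qed

lemma local_degree_frame_all:
  assumes "Im (cnj v * w) \<noteq> 0"
  shows "local_degree (frame z v w) u (if Im (cnj v * w) > 0 then 1 else - 1)"
proof (rule local_degree_constant[OF open_UNIV connected_UNIV continuous_frame(1) _ UNIV_I local_degree_frame[OF assms] UNIV_I])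
  show "inj (frame z v w)" by (metis frame_unframe(1)[OF assms] injI)
qed

text \<open>A frame over the torus, cut down to a square by \<open>box_map\<close> and raised to one
  sheet. Its orientation has to be that of the sheet, whence the factor s in front of the
  determinant; \<open>small\<close> keeps the square off the hole and within the range of one
  section.\<close>

lemma sheet_chart:
  assumes s: "s \<in> {1, - 1 :: real}" and D: "s * Im (cnj v * v') > 0" and \<mu>: "\<mu> > 0"
    and small: "\<And>u. norm u < 2 \<Longrightarrow> F (frame z0 v v' u) > 0 \<and> \<bar>Re (frame z0 v v' u) - Re z0\<bar> < 1/2 \<and> \<bar>Im (frame z0 v v' u) - Im z0\<bar> < 1/2"
  shows "(\<lambda>w. torus_point (frame z0 v v' (box_map (of_real \<mu> * w))) (s * F (frame z0 v v' (box_map (of_real \<mu> * w))))) \<in> C"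
    (is "?e \<in> C")
proof -
  have D0: "Im (cnj v * v') \<noteq> 0" using D by auto
  define \<phi> where "\<phi> w = frame z0 v v' (box_map (of_real \<mu> * w))" for w
  have contb: "continuous_on S (\<lambda>w. box_map (of_real \<mu> * w))" for S
    by (rule continuous_on_compose2[OF continuous_box_map[of UNIV]]) (auto intro: continuous_intros)
  have cont\<phi>: "continuous_on S \<phi>" for S unfolding \<phi>_def
    by (rule continuous_on_compose2[OF continuous_frame(1)[of UNIV] contb]) auto
  have e: "?e = (\<lambda>w. torus_point (\<phi> w) (s * F (\<phi> w)))" by (simp add: \<phi>_def)
  have F0: "F (\<phi> w) > 0" "\<bar>Re (\<phi> w) - Re z0\<bar> < 1/2" "\<bar>Im (\<phi> w) - Im z0\<bar> < 1/2" for w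
    using small[OF norm_box_map] by (auto simp: \<phi>_def)
  define Q where "Q = section_dom z0 \<inter> section_at z0 -` (frame z0 v v' ` range box_map) \<inter> {x. s * height x > 0 \<and> fst x \<noteq> 0}"
  define \<Psi> where "\<Psi> x = unbox (unframe z0 v v' (section_at z0 x)) / of_real \<mu>" for x
  have fo: "open (frame z0 v v' ` range box_map)"
    by (rule invariance_of_domain[OF continuous_frame(1) open_range_box_map])
       (metis frame_unframe(1)[OF D0] inj_onI)
  have "open (section_at z0 -` (frame z0 v v' ` range box_map) \<inter> section_dom z0)"
    using continuous_on_open_vimage[OF open_section_dom] continuous_section_at fo by blast
  moreover have "open ({x::complex \<times> complex. fst x \<noteq> 0} \<inter> {x. s * height x > 0})"
  proof -
    have o: "open {x::complex \<times> complex. fst x \<noteq> 0}" by (intro open_Collect_neq continuous_intros)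
    have "continuous_on {x::complex \<times> complex. fst x \<noteq> 0} (\<lambda>x. s * height x)"
      unfolding height_def by (intro continuous_intros) auto
    then have "open ((\<lambda>x. s * height x) -` {0<..} \<inter> {x::complex \<times> complex. fst x \<noteq> 0})"
      using continuous_on_open_vimage[OF o] open_greaterThan by blast
    then show ?thesis by (simp add: vimage_def Int_commute Collect_conj_eq)
  qed
  moreover have "Q = (section_at z0 -` (frame z0 v v' ` range box_map) \<inter> section_dom z0) \<inter> ({x. fst x \<noteq> 0} \<inter> {x. s * height x > 0})"
    by (auto simp: Q_def)
  ultimately have Q: "open Q" by (simp add: open_Int)
  have ch: "plane_chart XT ?e"
    unfolding e
  proof (rule plane_chartI[OF _ Q, of _ \<Psi>])
    show "continuous_on UNIV (\<lambda>w. torus_point (\<phi> w) (s * F (\<phi> w)))"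
      by (intro continuous_torus_point cont\<phi> continuous_intros continuous_on_compose2[OF continuous_F[of UNIV] cont\<phi>]) auto
    show "continuous_on (X \<inter> Q) \<Psi>" unfolding \<Psi>_def
    proof (intro continuous_intros)
      show "continuous_on (X \<inter> Q) (\<lambda>x. unbox (unframe z0 v v' (section_at z0 x)))"
        by (rule continuous_on_compose2[OF unbox(1)], rule continuous_on_compose2[OF continuous_frame(2)[of UNIV]],
            rule continuous_on_subset[OF continuous_section_at])
           (auto simp: Q_def frame_unframe[OF D0])
    qed (use \<mu> in auto)
    show "torus_point (\<phi> w) (s * F (\<phi> w)) \<in> X \<inter> Q \<and> \<Psi> (torus_point (\<phi> w) (s * F (\<phi> w))) = w" for w
    proof -
      note S = section_at_torus_point[OF F0(2,3)]
      have ss: "s * (s * F (\<phi> w)) > 0" for w using s F0(1)[of w] by auto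
      have "\<bar>s * F (\<phi> w)\<bar> = F (\<phi> w)" using s F0(1)[of w] by auto
      moreover have "section_at z0 (torus_point (\<phi> w) (s * F (\<phi> w))) \<in> frame z0 v v' ` range box_map"
        unfolding S(2) by (simp add: \<phi>_def)
      moreover have "fst (torus_point (\<phi> w) (s * F (\<phi> w))) \<noteq> 0" by (simp add: torus_point_def)
      ultimately have "torus_point (\<phi> w) (s * F (\<phi> w)) \<in> X \<inter> Q"
        unfolding Q_def using S(1) ss[of w] by (simp add: torus_point_in_X)
      moreover have "\<Psi> (torus_point (\<phi> w) (s * F (\<phi> w))) = w"
        unfolding \<Psi>_def S(2) unfolding \<phi>_def frame_unframe(1)[OF D0] unbox(2) using \<mu> by simp
      ultimately show ?thesis ..
    qed
    fix x assume x: "x \<in> X \<inter> Q"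
    then obtain z h where zh: "x = torus_point z h" "\<bar>h\<bar> = F z" by (auto simp: X_def)
    have xd: "torus_point z h \<in> section_dom z0" using x zh by (simp add: Q_def)
    define z' where "z' = section_at z0 x"
    have x': "x = torus_point z' h" using section_at_lift[OF xd] zh by (simp add: z'_def)
    then have "\<bar>h\<bar> = F z'" using x torus_point_in_X by blast
    moreover have "s * h > 0" using x zh by (simp add: Q_def)
    ultimately have h: "h = s * F z'" using s by auto
    obtain b where b: "z' = frame z0 v v' (box_map b)" using x by (auto simp: Q_def z'_def)
    have "of_real \<mu> * \<Psi> x = b" using \<mu> by (simp add: \<Psi>_def z'_def[symmetric] b frame_unframe[OF D0] unbox(2))
    then have "\<phi> (\<Psi> x) = z'" by (simp add: \<phi>_def b)
    then show "torus_point (\<phi> (\<Psi> x)) (s * F (\<phi> (\<Psi> x))) = x" using x' h by simp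
  qed
  have deg: "local_degree \<phi> z (if Im (cnj v * v') > 0 then 1 else - 1)" for z
  proof -
    have 1: "local_degree (box_map \<circ> (\<lambda>w. of_real \<mu> * w)) z (1 * 1)"
      by (rule local_degree_compose[OF local_degree_linear local_degree_box_map]) (use \<mu> in auto)
    have "isCont (box_map \<circ> (\<lambda>w. of_real \<mu> * w)) z"
      using contb[of UNIV] by (simp add: continuous_on_eq_continuous_at o_def)
    from local_degree_compose[OF 1 local_degree_frame_all[OF D0] this]
    have "local_degree (frame z0 v v' \<circ> (box_map \<circ> (\<lambda>w. of_real \<mu> * w))) z ((if Im (cnj v * v') > 0 then 1 else - 1) * (1 * 1))" .
    moreover have "frame z0 v v' \<circ> (box_map \<circ> (\<lambda>w. of_real \<mu> * w)) = \<phi>" by (simp add: \<phi>_def fun_eq_iff)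
    ultimately show ?thesis by simp
  qed
  have lift: "is_lift ?e \<phi> z" for z unfolding is_lift_def e
    by (rule exI[of _ 1]) (use cont\<phi> in auto)
  have sheet: "sheet (?e z) = (if Im (cnj v * v') > 0 then 1 else - 1)" for z
  proof -
    have "?e z = torus_point (\<phi> z) (s * F (\<phi> z))" by (simp add: \<phi>_def)
    then show ?thesis using s D F0(1)[of z] unfolding sheet_def by auto
  qed
  show ?thesis
  proof (rule C_I[OF ch], rule conjI)
    fix z
    show "is_lift ?e \<phi> z" by (rule lift)
    show "local_degree \<phi> z (sheet (?e z))" unfolding sheet by (rule deg)
  qed
qed


text \<open>Polar coordinates about the lattice point: \<open>Im w\<close> is the signed height,
  with which the radius grows in modulus, and \<open>Re w\<close> is the angle run backwards. This
  direction makes the projection positive on the upper sheet; on the lower one the radius decreases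
  with \<open>Im w\<close>, which reverses it as required.\<close>

lemma seam_chart:
  fixes \<theta> :: real
  shows "(\<lambda>w. torus_point (of_real (\<rho> + \<rho> * \<bar>squash (Im w)\<bar>) * cis (\<theta> - squash (Re w))) (\<rho> * squash (Im w))) \<in> C"
    (is "?e \<in> C")
proof -
  define \<phi> where "\<phi> w = of_real (\<rho> + \<rho> * \<bar>squash (Im w)\<bar>) * cis (\<theta> - squash (Re w))" for w
  have e: "?e = (\<lambda>w. torus_point (\<phi> w) (\<rho> * squash (Im w)))" by (simp add: \<phi>_def)
  have sq: "continuous_on S (\<lambda>w. squash (Re w))" "continuous_on S (\<lambda>w. squash (Im w))" for S
    by (rule continuous_on_compose2[OF continuous_squash]; auto intro: continuous_intros)+
  have cont\<phi>: "continuous_on S \<phi>" for S unfolding \<phi>_def by (intro continuous_intros sq)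
  have pos: "\<rho> + \<rho> * \<bar>squash (Im w)\<bar> > 0" for w using rho by (simp add: add_pos_nonneg)
  have n\<phi>: "norm (\<phi> w) = \<rho> + \<rho> * \<bar>squash (Im w)\<bar>" for w
    using pos[of w] by (simp add: \<phi>_def norm_mult del: of_real_add of_real_mult)
  have small: "norm (\<phi> w) < 1/2" for w
  proof -
    have "\<rho> * \<bar>squash (Im w)\<bar> \<le> \<rho>" using mult_left_mono[of "\<bar>squash (Im w)\<bar>" 1 \<rho>] rho squash_bound[of "Im w"] by simp
    then show ?thesis unfolding n\<phi> using rho by linarith
  qed
  have F\<phi>: "F (\<phi> w) = \<bar>\<rho> * squash (Im w)\<bar>" for w
    using F_near[of "\<phi> w"] small[of w] n\<phi>[of w] rho by (simp add: abs_mult)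
  have S: "torus_point (\<phi> w) h \<in> section_dom 0" "section_at 0 (torus_point (\<phi> w) h) = \<phi> w" for w h
    using section_at_torus_point[of "\<phi> w" 0 h] small[of w] abs_Re_le_cmod[of "\<phi> w"] abs_Im_le_cmod[of "\<phi> w"] by auto
  have quot: "\<phi> w / cis \<theta> = exp (Complex (ln (\<rho> + \<rho> * \<bar>squash (Im w)\<bar>)) (- squash (Re w)))" for w
  proof -
    have 1: "cis (\<theta> - x) / cis \<theta> = cis (- x)" for x by (simp add: cis_divide)
    show ?thesis using pos[of w]
      by (simp add: \<phi>_def exp_eq_polar times_divide_eq_right[symmetric] 1 del: of_real_add of_real_mult times_divide_eq_right)
  qed
  have pi1: "\<bar>- squash x\<bar> < pi" for x using squash_bound[of x] pi_gt3 by simp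
  define G where "G x = Complex (- Im (Ln (section_at 0 x / cis \<theta>))) (height x / \<rho>)" for x
  define A where "A = {z. z / cis \<theta> \<notin> \<real>\<^sub>\<le>\<^sub>0 \<and> norm z < 1/2}"
  define O1 where "O1 = (section_at 0 -` A \<inter> section_dom 0) \<inter> {x. fst x \<noteq> 0}"
  have "open ((\<lambda>z. z / cis \<theta>) -` (- \<real>\<^sub>\<le>\<^sub>0) \<inter> norm -` {..<1/2})"
    by (intro open_Int open_vimage open_Compl closed_nonpos_Reals_complex continuous_intros open_lessThan) auto
  moreover have "A = (\<lambda>z. z / cis \<theta>) -` (- \<real>\<^sub>\<le>\<^sub>0) \<inter> norm -` {..<1/2}" by (auto simp: A_def)
  ultimately have "open A" by simp
  then have "open (section_at 0 -` A \<inter> section_dom 0)"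
    using continuous_on_open_vimage[OF open_section_dom] continuous_section_at by blast
  moreover have "open {x::complex \<times> complex. fst x \<noteq> 0}" by (intro open_Collect_neq continuous_intros)
  ultimately have O1: "open O1" unfolding O1_def by (rule open_Int)
  have contG: "continuous_on O1 G"
    unfolding G_def height_def
    by (intro continuous_intros continuous_on_Complex continuous_on_subset[OF continuous_section_at])
       (use rho in \<open>auto simp: O1_def A_def\<close>)
  define Q where "Q = G -` range box_map \<inter> O1"
  have Q: "open Q" unfolding Q_def using continuous_on_open_vimage[OF O1] contG open_range_box_map by blast
  have Gbox: "G (torus_point (\<phi> w) (\<rho> * squash (Im w))) = box_map w" for w
    unfolding G_def S(2) quot Ln_exp_Complex(1)[OF pi1] using rho by (simp add: box_map_def)
  have ch: "plane_chart XT ?e"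
    unfolding e
  proof (rule plane_chartI[OF _ Q, of _ "unbox \<circ> G"])
    show "continuous_on UNIV (\<lambda>w. torus_point (\<phi> w) (\<rho> * squash (Im w)))"
      by (intro continuous_torus_point cont\<phi> continuous_intros sq)
    show "continuous_on (X \<inter> Q) (unbox \<circ> G)"
      by (rule continuous_on_compose[OF continuous_on_subset[OF contG] continuous_on_subset[OF unbox(1)]]) (auto simp: Q_def)
    show "torus_point (\<phi> w) (\<rho> * squash (Im w)) \<in> X \<inter> Q \<and> (unbox \<circ> G) (torus_point (\<phi> w) (\<rho> * squash (Im w))) = w" for w
    proof -
      have "torus_point (\<phi> w) (\<rho> * squash (Im w)) \<in> O1"
        using S[of w] small[of w] Ln_exp_Complex(2)[OF pi1] quot[of w] by (simp add: O1_def A_def torus_point_def)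
      then show ?thesis using Gbox[of w] F\<phi>[of w] by (simp add: Q_def torus_point_in_X unbox(2))
    qed
    fix x assume x: "x \<in> X \<inter> Q"
    then obtain z h where zh: "x = torus_point z h" "\<bar>h\<bar> = F z" by (auto simp: X_def)
    have xd: "torus_point z h \<in> section_dom 0" using x zh by (simp add: Q_def O1_def)
    define z' where "z' = section_at 0 x"
    have x': "x = torus_point z' h" using section_at_lift[OF xd] zh by (simp add: z'_def)
    then have "\<bar>h\<bar> = F z'" using x torus_point_in_X by blast
    moreover have A': "z' / cis \<theta> \<notin> \<real>\<^sub>\<le>\<^sub>0" "norm z' < 1/2" using x by (auto simp: Q_def O1_def A_def z'_def)
    ultimately have h: "norm z' = \<rho> + \<bar>h\<bar>" using F_near[of z'] by simp
    obtain b where b: "G x = box_map b" using x by (auto simp: Q_def)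
    have hx: "height x = h" using zh by simp
    have "squash (Re b) = - Im (Ln (z' / cis \<theta>))" "squash (Im b) = h / \<rho>"
      using arg_cong[OF b, of Re] arg_cong[OF b, of Im] by (simp_all add: G_def box_map_def z'_def[symmetric] hx)
    moreover have "cis (\<theta> + Im (Ln (z' / cis \<theta>))) = cis \<theta> * sgn (z' / cis \<theta>)"
    proof -
      have "z' / cis \<theta> \<noteq> 0" using A'(1) by auto
      then have "cis (Im (Ln (z' / cis \<theta>))) = sgn (z' / cis \<theta>)" by (metis cis_Arg Arg_eq_Im_Ln)
      then show ?thesis by (simp add: cis_mult[symmetric])
    qed
    moreover have "of_real (norm z') * (cis \<theta> * sgn (z' / cis \<theta>)) = z'"
    proof -
      have "z' \<noteq> 0" using h rho by auto
      then show ?thesis by (simp add: sgn_eq norm_divide)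
    qed
    ultimately have "\<phi> b = z'" "\<rho> * squash (Im b) = h"
      using rho h by (simp_all add: \<phi>_def abs_mult)
    then show "torus_point (\<phi> ((unbox \<circ> G) x)) (\<rho> * squash (Im ((unbox \<circ> G) x))) = x"
      unfolding o_def b unbox(2) using x' by simp
  qed
  \<comment> \<open>Without the absolute value the map is an exponential of rotated monotone
    coordinates and has degree 1 everywhere. It agrees with \<phi> in the upper half-plane and,
    composed with conjugation, in the lower one.\<close>
  define \<phi>' where "\<phi>' w = exp (\<i> * of_real \<theta>) * exp (- \<i> * Complex (squash (Re w)) (ln (\<rho> + \<rho> * squash (Im w))))" for w
  have pos': "\<rho> + \<rho> * squash y > 0" for y
  proof -
    have "\<rho> * (- 1) < \<rho> * squash y" using rho squash_bound[of y] by (intro mult_strict_left_mono) auto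
    then show ?thesis by simp
  qed
  have \<phi>': "\<phi>' w = of_real (\<rho> + \<rho> * squash (Im w)) * cis (\<theta> - squash (Re w))" for w
  proof -
    have 1: "- \<i> * Complex x y = Complex y (- x)" for x y by (simp add: complex_eq_iff)
    have 2: "exp (Complex (ln (\<rho> + \<rho> * squash (Im w))) (- squash (Re w))) = of_real (\<rho> + \<rho> * squash (Im w)) * cis (- squash (Re w))"
      using pos'[of "Im w"] by (simp add: exp_eq_polar del: of_real_add of_real_mult)
    show ?thesis unfolding \<phi>'_def 1 2 cis_conv_exp[symmetric] by (simp add: cis_mult algebra_simps del: of_real_add of_real_mult)
  qed
  have deg': "local_degree \<phi>' w 1" for w
  proof -
    have b: "local_degree (\<lambda>w. Complex (squash (Re w)) (ln (\<rho> + \<rho> * squash (Im w)))) w 1"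
    proof (rule local_degree_box[OF strict_mono_squash continuous_squash])
      show "strict_mono (\<lambda>y. ln (\<rho> + \<rho> * squash y))"
        using strict_monoD[OF strict_mono_squash] rho pos' by (auto intro!: strict_monoI)
      show "continuous_on UNIV (\<lambda>y. ln (\<rho> + \<rho> * squash y))"
        using pos' by (intro continuous_intros continuous_squash) (auto simp: less_le)
    qed
    have c: "isCont (\<lambda>w. Complex (squash (Re w)) (ln (\<rho> + \<rho> * squash (Im w)))) w"
    proof -
      have "continuous_on UNIV (\<lambda>w. Complex (squash (Re w)) (ln (\<rho> + \<rho> * squash (Im w))))"
        using pos' by (intro continuous_intros continuous_on_Complex sq) (auto simp: less_le)
      then show ?thesis by (simp add: continuous_on_eq_continuous_at)
    qed
    have d: "local_degree (\<lambda>u. exp (\<i> * of_real \<theta>) * exp (- \<i> * u)) u 1" for u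
      by (rule local_degree_deriv[where R = 1 and c = "exp (\<i> * of_real \<theta>) * (exp (- \<i> * u) * (- \<i>))"])
         (auto intro!: derivative_eq_intros continuous_intros)
    from local_degree_compose[OF b d c] show ?thesis by (simp add: o_def \<phi>'_def[abs_def])
  qed
  have cont\<phi>': "isCont \<phi>' w" for w
  proof -
    have "continuous_on UNIV \<phi>'" unfolding \<phi>'[abs_def] by (intro continuous_intros sq)
    then show ?thesis by (simp add: continuous_on_eq_continuous_at)
  qed
  have squash0: "squash y > 0 \<longleftrightarrow> y > 0" "squash y < 0 \<longleftrightarrow> y < 0" for y
    using strict_mono_less[OF strict_mono_squash, of 0 y] strict_mono_less[OF strict_mono_squash, of y 0] squash_eq(1)[of 0] by simp_all
  have deg: "local_degree \<phi> w (sheet (?e w))" if h: "height (?e w) \<noteq> 0" for w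
  proof -
    have "\<rho> * squash (Im w) \<noteq> 0" using h by simp
    then consider "Im w > 0" | "Im w < 0" using squash0[of "Im w"] by force
    then show ?thesis
    proof cases
      case 1
      then have "sheet (?e w) = 1" using squash0 rho by (simp add: sheet_def)
      moreover have "local_degree \<phi> w 1"
      proof (rule local_degree_cong[OF deg' 1])
        fix u assume "u \<in> ball w (Im w)"
        then have "Im u > 0" using abs_Im_le_cmod[of "w - u"] by (simp add: dist_norm)
        then show "\<phi> u = \<phi>' u" using squash0(1)[of "Im u"] by (simp add: \<phi>_def \<phi>')
      qed
      ultimately show ?thesis by simp
    next
      case 2
      then have "\<not> squash (Im w) > 0" using squash0(1)[of "Im w"] by simp
      then have "sheet (?e w) = - 1" using rho by (simp add: sheet_def zero_less_mult_iff)
      moreover have "local_degree (\<phi>' \<circ> cnj) w (1 * (- 1))"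
        by (rule local_degree_compose[OF local_degree_cnj deg']) (intro continuous_intros)
      then have "local_degree \<phi> w (1 * (- 1))"
      proof (rule local_degree_cong)
        show "- Im w > 0" using 2 by simp
        fix u assume "u \<in> ball w (- Im w)"
        then have "Im u < 0" using abs_Im_le_cmod[of "w - u"] by (simp add: dist_norm)
        then show "\<phi> u = (\<phi>' \<circ> cnj) u" using squash0(2)[of "Im u"] by (simp add: \<phi>_def \<phi>' squash_minus)
      qed
      ultimately show ?thesis by simp
    qed
  qed
  have lift: "is_lift ?e \<phi> w" for w unfolding is_lift_def e
    by (rule exI[of _ 1]) (use cont\<phi> in auto)
  show ?thesis by (rule C_I[OF ch, OF conjI[OF lift deg]])
qed

lemma C_covers:
  assumes "x \<in> X"
  shows "\<exists>e\<in>C. x \<in> range e"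
proof -
  obtain z h where zh: "x = torus_point z h" "\<bar>h\<bar> = F z" using assms by (auto simp: X_def)
  show ?thesis
  proof (cases "h = 0")
    case True
    then obtain z0 where z0: "norm z0 = \<rho>" "z - z0 \<in> gauss_ints" using nearest[of z] zh by auto
    let ?e = "\<lambda>w. torus_point (of_real (\<rho> + \<rho> * \<bar>squash (Im w)\<bar>) * cis (Arg z0 - squash (Re w))) (\<rho> * squash (Im w))"
    have "squash 0 = 0" using squash_eq(1)[of 0] by simp
    moreover have "of_real (norm z0) * cis (Arg z0) = z0" by (metis rcis_cmod_Arg rcis_def)
    ultimately have "?e 0 = torus_point z0 0" using z0(1) by simp
    also have "\<dots> = x"
    proof -
      have "z0 - z \<in> gauss_ints" using gauss_ints_diff[OF gauss_ints_0 z0(2)] by simp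
      then show ?thesis unfolding zh(1) True torus_point_eq by simp
    qed
    finally have eq: "?e 0 = x" .
    show ?thesis
    proof (rule bexI[where x = ?e])
      show "x \<in> range ?e" by (rule range_eqI[where f = ?e and x = 0, OF eq[symmetric]])
    qed (rule seam_chart)
  next
    case False
    have "open (F -` {0<..})" by (intro open_vimage open_greaterThan continuous_F)
    moreover have "z \<in> F -` {0<..}" using zh False by simp
    ultimately obtain \<delta> where \<delta>: "\<delta> > 0" "ball z \<delta> \<subseteq> F -` {0<..}" using openE by blast
    define \<epsilon> where "\<epsilon> = min (\<delta> / 2) (1/4)"
    have \<epsilon>: "\<epsilon> > 0" "2 * \<epsilon> \<le> \<delta>" "2 * \<epsilon> \<le> 1/2" using \<delta> by (auto simp: \<epsilon>_def)
    let ?s = "sgn h"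
    \<comment> \<open>The factor \<open>?s\<close> turns over the second axis on the lower sheet, as
      the orientation condition of \<open>sheet_chart\<close> demands.\<close>
    let ?fr = "frame z (of_real \<epsilon>) (\<i> * of_real (?s * \<epsilon>))"
    have s: "?s \<in> {1, - 1}" using False by (auto simp: sgn_if)
    have d: "norm (?fr u - z) = \<epsilon> * norm u" for u
    proof -
      have "?fr u - z = Complex (\<epsilon> * Re u) (?s * (\<epsilon> * Im u))" by (simp add: frame_def complex_eq_iff)
      moreover have "(?s * (\<epsilon> * Im u))\<^sup>2 = (\<epsilon> * Im u)\<^sup>2" using s by auto
      ultimately have "norm (?fr u - z) = sqrt (\<epsilon>\<^sup>2 * ((Re u)\<^sup>2 + (Im u)\<^sup>2))"
        by (simp add: norm_complex_def power_mult_distrib distrib_left)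
      then show ?thesis using \<epsilon> by (simp add: real_sqrt_mult norm_complex_def)
    qed
    have "(\<lambda>w. torus_point (?fr (box_map (of_real 1 * w))) (?s * F (?fr (box_map (of_real 1 * w))))) \<in> C" (is "?e \<in> C")
    proof (rule sheet_chart[OF s])
      show "?s * Im (cnj (of_real \<epsilon>) * (\<i> * of_real (?s * \<epsilon>))) > 0" using s \<epsilon> by auto
      fix u :: complex assume "norm u < 2"
      then have "norm (?fr u - z) < 2 * \<epsilon>" unfolding d using \<epsilon> by simp
      then have b: "norm (?fr u - z) < \<delta>" "norm (?fr u - z) < 1/2" using \<epsilon> by linarith+
      then have "?fr u \<in> ball z \<delta>" by (simp add: dist_norm norm_minus_commute)
      then show "F (?fr u) > 0 \<and> \<bar>Re (?fr u) - Re z\<bar> < 1/2 \<and> \<bar>Im (?fr u) - Im z\<bar> < 1/2"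
        using \<delta>(2) b(2) abs_Re_le_cmod[of "?fr u - z"] abs_Im_le_cmod[of "?fr u - z"] by auto
    qed simp
    moreover have eq: "?e 0 = x"
    proof -
      have 1: "?fr (box_map (of_real 1 * 0)) = z" by (simp add: box_map_id frame_def)
      have 2: "?s * F z = h" unfolding zh(2)[symmetric] by (rule sgn_mult_abs)
      show ?thesis unfolding 1 2 zh(1) ..
    qed
    show ?thesis
    proof (rule bexI[where x = ?e])
      show "x \<in> range ?e" by (rule range_eqI[where f = ?e and x = 0, OF eq[symmetric]])
    qed fact
  qed
qed

lemma orientation_C: "orientation XT C"
  unfolding orientation_def
proof (intro conjI ballI allI impI)
  show ch: "plane_chart XT e" if "e \<in> C" for e using that by (simp add: C_def)
  show "(\<Union>e\<in>C. range e) = topspace XT"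
  proof
    show "(\<Union>e\<in>C. range e) \<subseteq> topspace XT" using chart_in_X[OF ch] by auto
    show "topspace XT \<subseteq> (\<Union>e\<in>C. range e)"
    proof
      fix x assume "x \<in> topspace XT"
      then have "x \<in> X" by simp
      from C_covers[OF this] show "x \<in> (\<Union>e\<in>C. range e)" by (rule UN_iff[THEN iffD2])
    qed
  qed
  show "compatible_charts e e'" if "e \<in> C" "e' \<in> C" for e e'
    unfolding compatible_charts_iff[OF ch[OF that(1)] ch[OF that(2)]] using C_compatible[OF that] by blast
  \<comment> \<open>For maximality, a lift and its degree are transported from a chart in C by a
    transition map of degree 1.\<close>
  fix e assume e: "plane_chart XT e \<and> (\<forall>e'\<in>C. compatible_charts e e')"
  have "\<exists>q. is_lift e q z \<and> local_degree q z (sheet (e z))" if h: "height (e z) \<noteq> 0" for z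
  proof -
    have "e z \<in> X" using e chart_in_X by blast
    then obtain e' w where e': "e' \<in> C" "e z = e' w" using C_covers by blast
    then obtain q where q: "is_lift e' q w" "local_degree q w (sheet (e' w))" using h by (auto simp: C_def)
    let ?g = "inv e' \<circ> e"
    have "compatible_charts e e'" using e e'(1) by blast
    then have deg: "local_degree ?g z 1" unfolding compatible_charts_iff[OF conjunct1[OF e] ch[OF e'(1)]] using e'(2) by blast
    have gz: "?g z = w" using e' ch[OF e'(1)] by (simp add: plane_chart_iff)
    have "isCont ?g z"
      using transition_map(1,2)[OF conjunct1[OF e] ch[OF e'(1)]] e'(2) by (auto simp: continuous_on_eq_continuous_at o_def)
    then have "local_degree (q \<circ> ?g) z (sheet (e' w) * 1)"
      using local_degree_compose[OF deg, of q] q(2) gz by simp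
    moreover have "is_lift e (q \<circ> ?g) z"
      by (rule is_lift_transition[OF conjunct1[OF e] ch[OF e'(1)] e'(2) q(1)])
    ultimately show ?thesis using e'(2) by auto
  qed
  then show "e \<in> C" using e by (simp add: C_def)
qed

lemma closed_oriented_surface_C: "closed_oriented_surface XT C"
proof -
  \<comment> \<open>The unit square without the disc. Each sheet is a continuous image of it, and
    the two images share the seam; hence X is compact and connected.\<close>
  define K where "K = cbox (Complex (- 1/2) (- 1/2)) (Complex (1/2) (1/2)) - ball 0 \<rho>"
  have KI: "z \<in> K \<longleftrightarrow> \<bar>Re z\<bar> \<le> 1/2 \<and> \<bar>Im z\<bar> \<le> 1/2 \<and> norm z \<ge> \<rho>" for z
    by (auto simp: K_def in_cbox_complex_iff)
  have FK: "F z = norm z - \<rho>" "F z \<ge> 0" if "z \<in> K" for z using that F_square[of z] by (auto simp: KI)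
  have "compact K" unfolding K_def by (intro compact_diff compact_cbox open_ball)
  have "connected K"
    unfolding K_def
  proof (rule connected_diff_ball)
    show "cball 0 \<rho> \<subseteq> cbox (Complex (- 1/2) (- 1/2)) (Complex (1/2) (1/2))"
    proof
      fix z :: complex assume "z \<in> cball 0 \<rho>"
      then show "z \<in> cbox (Complex (- 1/2) (- 1/2)) (Complex (1/2) (1/2))"
        using abs_Re_le_cmod[of z] abs_Im_le_cmod[of z] rho by (auto simp: in_cbox_complex_iff)
    qed
  qed (auto simp: convex_connected)
  define T where "T s z = torus_point z (s * F z)" for s :: real and z
  have contT: "continuous_on K (T s)" for s unfolding T_def
    by (intro continuous_torus_point continuous_intros continuous_F)
  have X: "X = T 1 ` K \<union> T (- 1) ` K"
  proof (intro set_eqI iffI)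
    fix x assume "x \<in> X"
    then obtain z h where zh: "x = torus_point z h" "\<bar>h\<bar> = F z" by (auto simp: X_def)
    define z' where "z' = Complex (Re z - of_int (round (Re z))) (Im z - of_int (round (Im z)))"
    have "z - z' \<in> gauss_ints" by (simp add: z'_def gauss_ints_def)
    then have x: "x = torus_point z' h" "\<bar>h\<bar> = F z'" using zh F_cong torus_point_eq by metis+
    have sq: "\<bar>Re z'\<bar> \<le> 1/2" "\<bar>Im z'\<bar> \<le> 1/2"
      using of_int_round_abs_le[of "Re z"] of_int_round_abs_le[of "Im z"] by (auto simp: z'_def abs_minus_commute)
    then have "z' \<in> K" using F_square[OF sq] x(2) by (simp add: KI)
    moreover have "h = 1 * F z' \<or> h = - 1 * F z'" using x(2) by linarith
    ultimately show "x \<in> T 1 ` K \<union> T (- 1) ` K" using x(1) unfolding T_def by blast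
  next
    fix x assume "x \<in> T 1 ` K \<union> T (- 1) ` K"
    then show "x \<in> X" using FK(2) by (auto simp: T_def torus_point_in_X)
  qed
  have "compact X" unfolding X by (intro compact_Un compact_continuous_image contT \<open>compact K\<close>)
  moreover have "connected X" unfolding X
  proof (rule connected_Un)
    show "connected (T 1 ` K)" "connected (T (- 1) ` K)" by (intro connected_continuous_image contT \<open>connected K\<close>)+
    have K: "of_real \<rho> \<in> K" using rho by (simp add: KI)
    then have "F (of_real \<rho>) = 0" using FK(1)[OF K] rho by simp
    then have "T 1 (of_real \<rho>) = T (- 1) (of_real \<rho>)" by (simp add: T_def)
    then show "T 1 ` K \<inter> T (- 1) ` K \<noteq> {}" using K by blast
  qed
  ultimately show ?thesis unfolding closed_oriented_surface_def
    by (simp add: orientation_C compact_space_subtopology connected_space_subtopology Hausdorff_space_subtopology)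
qed

text \<open>Inversion in the unit circle on the first coordinate, which negates the height and keeps
  the point of the torus.\<close>

definition turn_over :: "complex \<times> complex \<Rightarrow> complex \<times> complex" where
  "turn_over x = (fst x / of_real ((norm (fst x))\<^sup>2), snd x)"

lemma turn_over: "turn_over (torus_point z h) = torus_point z (- h)"
  by (simp add: turn_over_def torus_point_def power2_eq_square exp_minus scaleR_conv_of_real norm_mult field_simps)

text \<open>The projection to the torus stays the same while the sheets, and so the required
  degrees, are exchanged; conjugating the chart compensates for this.\<close>

lemma orientation_reversing_turn_over: "orientation_reversing_homeo XT C XT C turn_over"
proof -
  have X: "x \<in> X \<Longrightarrow> turn_over x \<in> X" "x \<in> X \<Longrightarrow> turn_over (turn_over x) = x" "x \<in> X \<Longrightarrow> height (turn_over x) = - height x" for x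
    by (auto simp: turn_over torus_point_in_X elim!: X_E)
  have "continuous_on X turn_over"
    unfolding turn_over_def by (intro continuous_intros) (auto simp: X_def torus_point_def)
  then have c: "continuous_map XT XT turn_over" using X(1) by auto
  have "homeomorphic_maps XT XT turn_over turn_over"
    unfolding homeomorphic_maps_def using c X by auto
  then have h: "homeomorphic_map XT XT turn_over" using homeomorphic_maps_map by blast
  have "turn_over \<circ> e \<circ> cnj \<in> C" if e: "e \<in> C" for e
  proof -
    have ch: "plane_chart XT e" using e by (simp add: C_def)
    have eX: "e w \<in> X" for w by (rule chart_in_X[OF ch])
    have "plane_chart XT (turn_over \<circ> e)"
      unfolding plane_chart_iff
    proof (intro conjI allI impI)
      show "inj (turn_over \<circ> e)"
      proof (rule injI)
        fix u v assume "(turn_over \<circ> e) u = (turn_over \<circ> e) v"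
        then have "turn_over (turn_over (e u)) = turn_over (turn_over (e v))" by simp
        then have "e u = e v" unfolding X(2)[OF eX] .
        then show "u = v" using ch unfolding plane_chart_iff by (blast dest: injD)
      qed
      have "continuous_map euclidean XT e" using ch unfolding plane_chart_iff by blast
      then show "continuous_map euclidean XT (turn_over \<circ> e)" using c by (rule continuous_map_compose)
      fix U :: "complex set" assume "open U"
      then have "openin XT (e ` U)" using ch by (simp add: plane_chart_iff)
      then have "openin XT (turn_over ` e ` U)" using h by (meson homeomorphic_imp_open_map open_map_def)
      then show "openin XT ((turn_over \<circ> e) ` U)" by (simp add: image_comp)
    qed
    then have p: "plane_chart XT (turn_over \<circ> e \<circ> cnj)"
      by (rule plane_chart_compose) (auto intro: continuous_intros injI)
    have "\<exists>q. is_lift (turn_over \<circ> e \<circ> cnj) q z \<and> local_degree q z (sheet ((turn_over \<circ> e \<circ> cnj) z))"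
      if hz: "height ((turn_over \<circ> e \<circ> cnj) z) \<noteq> 0" for z
    proof -
      have hh: "height ((turn_over \<circ> e \<circ> cnj) w) = - height (e (cnj w))" for w using X(3)[OF eX] by simp
      obtain q where q: "is_lift e q (cnj z)" "local_degree q (cnj z) (sheet (e (cnj z)))"
        using e hz hh[of z] by (auto simp: C_def)
      obtain R where R: "R > 0" "continuous_on (ball (cnj z) R) q" "\<And>w. w \<in> ball (cnj z) R \<Longrightarrow> torus_point (q w) (height (e w)) = e w"
        using q(1) unfolding is_lift_def by blast
      have cb: "cnj w \<in> ball (cnj z) R" if "w \<in> ball z R" for w
        using that by (simp add: dist_norm) (metis complex_cnj_diff complex_mod_cnj)
      have "is_lift (turn_over \<circ> e \<circ> cnj) (q \<circ> cnj) z"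
        unfolding is_lift_def
      proof (rule exI[of _ R], intro conjI ballI R(1))
        show "continuous_on (ball z R) (q \<circ> cnj)"
          by (rule continuous_on_compose[OF _ continuous_on_subset[OF R(2)]]) (use cb in \<open>auto intro: continuous_intros\<close>)
        fix w assume "w \<in> ball z R"
        then have "turn_over (torus_point (q (cnj w)) (height (e (cnj w)))) = turn_over (e (cnj w))" using R(3)[OF cb] by simp
        then show "torus_point ((q \<circ> cnj) w) (height ((turn_over \<circ> e \<circ> cnj) w)) = (turn_over \<circ> e \<circ> cnj) w"
          unfolding hh by (simp add: turn_over)
      qed
      moreover have "local_degree (q \<circ> cnj) z (sheet (e (cnj z)) * (- 1))"
        by (rule local_degree_compose[OF local_degree_cnj q(2)]) (intro continuous_intros)
      moreover have "sheet ((turn_over \<circ> e \<circ> cnj) z) = sheet (e (cnj z)) * (- 1)"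
        using hz unfolding sheet_def hh by auto
      ultimately show ?thesis by auto
    qed
    then show ?thesis using p by (simp add: C_def)
  qed
  then show ?thesis using h by (simp add: orientation_reversing_homeo_def)
qed

end


section \<open>The Gauss diagrams of the examples\<close>

definition in_arc :: "int \<Rightarrow> int \<Rightarrow> int \<Rightarrow> bool" where
  "in_arc s t p \<longleftrightarrow> (if s < t then s < p \<and> p < t else s < p \<or> p < t)"

type_synonym label = "bool \<times> bool \<times> nat"

text \<open>A crossing is labelled by the sheet (\<open>True\<close> for the lower one), the family (\<open>False\<close> for crossings at
  \<open>1 - 2k/H\<close> on the first edge and \<open>k/H\<close> on the second, \<open>True\<close> for \<open>2k/H\<close> and \<open>1 - k/H\<close>, where \<open>2H = 4N + 1\<close>)
  and k. The passages on the first and second edge are placed at integer positions along the curve: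
  lengths on the edges are multiplied by \<open>4N + 1\<close>, and the lower sheet is traversed backwards.\<close>

definition end_a :: "nat \<Rightarrow> label \<Rightarrow> int" where
  "end_a N = (\<lambda>(s, b, k). let q = (if b then 4 * int k else 4 * int N + 1 - 4 * int k) in if s then 4 * (4 * int N + 1) - q else q)"

definition end_b :: "nat \<Rightarrow> label \<Rightarrow> int" where
  "end_b N = (\<lambda>(s, b, k). let q = (if b then 2 * (4 * int N + 1) - 2 * int k else 4 * int N + 1 + 2 * int k)
     in if s then 4 * (4 * int N + 1) - q else q)"

definition special :: "nat \<Rightarrow> label \<Rightarrow> bool" where
  "special N x \<longleftrightarrow> x = (False, False, N)"

definition over_end :: "nat \<Rightarrow> label \<Rightarrow> int" where
  "over_end N x = (if special N x then end_b N x else end_a N x)"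

definition under_end :: "nat \<Rightarrow> label \<Rightarrow> int" where
  "under_end N x = (if special N x then end_a N x else end_b N x)"

definition labels :: "nat \<Rightarrow> label set" where
  "labels N = UNIV \<times> UNIV \<times> {1..N}"

text \<open>The directions of the first and second edge have negative determinant. This makes the
  signs - 1 on the upper sheet, where the projection preserves orientation, and 1 on the lower one;
  at the special crossing, on the upper sheet, the other edge is on top.\<close>

definition knot_gauss :: "nat \<Rightarrow> label gauss" where
  "knot_gauss N = \<lparr>chords = labels N, sign = \<lambda>x. if fst x \<or> special N x then 1 else - 1,
     over_in = \<lambda>x y. in_arc (over_end N x) (under_end N x) (over_end N y),
     under_in = \<lambda>x y. in_arc (over_end N x) (under_end N x) (under_end N y)\<rparr>"

lemmas ends_def = over_end_def under_end_def end_a_def end_b_def special_def Let_def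

lemma finite_labels: "finite (labels N)"
  by (simp add: labels_def)

text \<open>A chord has exactly one passage on the arc of another only if both belong to the same
  sheet and to opposite families, and k + l exceeds N. After the case split this is linear
  arithmetic on integer positions.\<close>

lemma crossing_term:
  assumes "(s, b, k) \<in> labels N" "(s', b', l) \<in> labels N" "(s, b, k) \<noteq> (s', b', l)"
  shows "sign (knot_gauss N) (s', b', l) * (of_bool (over_in (knot_gauss N) (s, b, k) (s', b', l)) -
      of_bool (under_in (knot_gauss N) (s, b, k) (s', b', l))) =
    (if s' = s \<and> b' = (\<not> b) \<and> N < k + l then if special N (s, b, k) \<or> b then 1 else - 1 else 0)"
proof -
  have k: "1 \<le> k" "k \<le> N" "1 \<le> l" "l \<le> N" using assms by (auto simp: labels_def)
  have d: "s \<noteq> s' \<or> b \<noteq> b' \<or> k \<noteq> l" using assms(3) by auto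
  show ?thesis
    using k d
    by (cases s; cases b; cases s'; cases b'; cases "k = N"; cases "l = N"; cases "N < k + l"; cases "k < l")
       (simp_all add: knot_gauss_def in_arc_def ends_def)
qed

definition label_index :: "nat \<Rightarrow> label \<Rightarrow> int" where
  "label_index N = (\<lambda>(s, b, k). if b \<or> special N (s, b, k) then int k else - int k)"

lemma chord_index_knot_gauss:
  assumes "x \<in> labels N"
  shows "chord_index (knot_gauss N) x = label_index N x"
proof -
  obtain s b k where x: "x = (s, b, k)" by (cases x)
  have k: "1 \<le> k" "k \<le> N" using assms x by (auto simp: labels_def)
  define c :: int where "c = (if special N x \<or> b then 1 else - 1)"
  \<comment> \<open>The k chords of the opposite family that satisfy N < k + l; all of them
    contribute the same c.\<close>
  let ?T = "(\<lambda>l. (s, \<not> b, l)) ` {Suc N - k..N}"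
  have "chord_index (knot_gauss N) x = (\<Sum>y\<in>?T. c)"
    unfolding chord_index_def
  proof (rule sum.mono_neutral_cong_right)
    show "finite (chords (knot_gauss N) - {x})" by (simp add: knot_gauss_def finite_labels)
    show "?T \<subseteq> chords (knot_gauss N) - {x}" using k by (auto simp: knot_gauss_def labels_def x)
    show "\<forall>y\<in>chords (knot_gauss N) - {x} - ?T. sign (knot_gauss N) y *
        (of_bool (over_in (knot_gauss N) x y) - of_bool (under_in (knot_gauss N) x y)) = 0"
    proof
      fix y assume y: "y \<in> chords (knot_gauss N) - {x} - ?T"
      obtain s' b' l where y': "y = (s', b', l)" by (cases y)
      have yl: "(s', b', l) \<in> labels N" using y y' by (simp add: knot_gauss_def)
      have "\<not> (s' = s \<and> b' = (\<not> b) \<and> N < k + l)"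
      proof
        assume h: "s' = s \<and> b' = (\<not> b) \<and> N < k + l"
        then have "l \<in> {Suc N - k..N}" using yl k by (auto simp: labels_def)
        then show False using y y' h by auto
      qed
      then show "sign (knot_gauss N) y * (of_bool (over_in (knot_gauss N) x y) - of_bool (under_in (knot_gauss N) x y)) = 0"
        using crossing_term[of s b k N s' b' l] assms x y y' yl by auto
    qed
    show "sign (knot_gauss N) y * (of_bool (over_in (knot_gauss N) x y) - of_bool (under_in (knot_gauss N) x y)) = c"
      if yT: "y \<in> ?T" for y
    proof -
      from yT obtain l where l: "y = (s, \<not> b, l)" "l \<in> {Suc N - k..N}" by (rule imageE)
      then have "N < k + l" "1 \<le> l" "l \<le> N" using k by auto
      then have y: "(s, \<not> b, l) \<in> labels N" by (simp add: labels_def)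
      have "(s, b, k) \<noteq> (s, \<not> b, l)" by simp
      from crossing_term[OF assms[unfolded x] y this] \<open>N < k + l\<close> show ?thesis
        unfolding l(1) x c_def by simp
    qed
  qed
  also have "\<dots> = int k * c"
  proof -
    have "card ?T = card {Suc N - k..N}" by (rule card_image) (auto simp: inj_on_def)
    then show ?thesis using k by simp
  qed
  finally show ?thesis by (auto simp: c_def label_index_def x)
qed

lemma sum_labels: "(\<Sum>x\<in>labels N. g x) =
   (\<Sum>k\<in>{1..N}. g (False, False, k) + g (True, False, k) + g (False, True, k) + g (True, True, k))"
  unfolding labels_def sum.cartesian_product' by (simp add: UNIV_bool sum.distrib add_ac)

text \<open>Crossings with equal family and k on the two sheets have opposite signs and, apart from
  the special one, equal indices, so they cancel. The special crossing moves from index - N to N and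
  changes its sign, which leaves 1 at both places.\<close>

lemma index_writhe_knot_gauss:
  assumes "N \<ge> 1" "n \<noteq> 0"
  shows "index_writhe (knot_gauss N) n = (if \<bar>n\<bar> = int N then 1 else 0)"
proof -
  have "index_writhe (knot_gauss N) n = (\<Sum>x\<in>labels N. if label_index N x = n then if fst x \<or> special N x then 1 else - 1 else 0)"
    unfolding index_writhe_def by (rule sum.cong) (simp_all add: knot_gauss_def chord_index_knot_gauss[unfolded knot_gauss_def])
  also have "\<dots> = (\<Sum>k\<in>{1..N}. if k = N then (if \<bar>n\<bar> = int N then 1 else 0) else 0)"
    unfolding sum_labels by (rule sum.cong) (use assms in \<open>auto simp: label_index_def special_def\<close>)
  finally show ?thesis using assms by simp
qed

section \<open>Nesting numbers of the examples\<close>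

definition delta :: "int \<Rightarrow> int \<Rightarrow> int \<Rightarrow> int \<Rightarrow> int" where
  "delta m n = (\<lambda>i j. of_bool (i = m \<and> j = n))"

text \<open>Disjoint and covering pairs evaluate the weight at two numbers that differ by the index
  of a chord, hence by at most N. The gap between m and n rules them out, and only nested pairs are
  counted.\<close>

lemma pair_term_delta:
  assumes x: "x \<in> labels N" and y: "y \<in> labels N" and mn: "m - n < - int N \<or> int N < m - n"
  shows "pair_term (delta m n) (knot_gauss N) x y =
    (if label_index N x = m \<and> label_index N y = n \<and>
        \<not> over_in (knot_gauss N) x y \<and> \<not> under_in (knot_gauss N) x y \<and>
        over_in (knot_gauss N) y x \<and> under_in (knot_gauss N) y x
     then sign (knot_gauss N) x * sign (knot_gauss N) y else 0)"
proof -
  have "\<bar>label_index N z\<bar> \<le> int N" if "z \<in> labels N" for z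
    using that by (auto simp: label_index_def labels_def)
  then have "\<bar>label_index N x\<bar> \<le> int N" "\<bar>label_index N y\<bar> \<le> int N" using x y by blast+
  then show ?thesis using mn
    unfolding pair_term_def pair_weight_def chord_index_knot_gauss[OF x] chord_index_knot_gauss[OF y] delta_def by auto
qed

lemma nesting_single:
  assumes "finite (chords G)" "x0 \<in> chords G" "y0 \<in> chords G" "x0 \<noteq> y0"
    and "\<And>x y. x \<in> chords G \<Longrightarrow> y \<in> chords G \<Longrightarrow> x \<noteq> y \<Longrightarrow> pair_term S G x y = (if x = x0 \<and> y = y0 then v else 0)"
  shows "nesting S G = v"
proof -
  have "nesting S G = (\<Sum>x\<in>chords G. \<Sum>y\<in>chords G - {x}. if x = x0 \<and> y = y0 then v else 0)"
    unfolding nesting_def using assms(5) by (intro sum.cong) auto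
  also have "\<dots> = (\<Sum>x\<in>chords G. if x = x0 then v else 0)"
    using assms by (intro sum.cong refl) (auto simp: sum.delta cong: if_cong)
  also have "\<dots> = v" using assms by simp
  finally show ?thesis .
qed

lemma label_index_cases:
  assumes "x \<in> labels N" "N \<ge> 2"
  shows "label_index N x = int N \<Longrightarrow> x \<in> {(False, True, N), (True, True, N), (False, False, N)}"
    "label_index N x = - int N \<Longrightarrow> x \<in> {(True, False, N)}"
    "label_index N x = int (N - 1) \<Longrightarrow> x \<in> {(False, True, N - 1), (True, True, N - 1)}"
    "label_index N x = - int (N - 1) \<Longrightarrow> x \<in> {(False, False, N - 1), (True, False, N - 1)}"
proof -
  obtain s b k where x: "x = (s, b, k)" by (cases x)
  have k: "1 \<le> k" "k \<le> N" using assms by (auto simp: labels_def x)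
  show "label_index N x = int N \<Longrightarrow> x \<in> {(False, True, N), (True, True, N), (False, False, N)}"
    "label_index N x = - int N \<Longrightarrow> x \<in> {(True, False, N)}"
    "label_index N x = int (N - 1) \<Longrightarrow> x \<in> {(False, True, N - 1), (True, True, N - 1)}"
    "label_index N x = - int (N - 1) \<Longrightarrow> x \<in> {(False, False, N - 1), (True, False, N - 1)}"
    using k assms(2) unfolding x label_index_def special_def
    by (cases s; cases b; auto split: if_splits)+
qed

text \<open>Only crossings with k = N or k = N - 1 have the indices in question, so few candidates
  remain to be compared. With the first edge on top everywhere, the arc of
  \<open>(False, False, N)\<close> would be nested in that of \<open>(True, True, N - 1)\<close>;
  altering this crossing replaces its arc by the complement and removes the pair, whence the single
  0.\<close>

lemma nesting_knot_gauss:
  assumes N: "N \<ge> 2"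
  shows "nesting (delta (- int N) (int (N - 1))) (knot_gauss N) = 0"
    "nesting (delta (int N) (- int (N - 1))) (knot_gauss N) = - 1"
    "nesting (delta (- int (N - 1)) (int N)) (knot_gauss N) = - 1"
    "nesting (delta (int (N - 1)) (- int N)) (knot_gauss N) = - 1"
proof -
  have ch: "chords (knot_gauss N) = labels N" by (simp add: knot_gauss_def)
  have fin: "finite (chords (knot_gauss N))" by (simp add: ch finite_labels)
  note defs = knot_gauss_def in_arc_def ends_def
  have i1: "int (N - 1) = int N - 1" using N by simp
  have nn: "N - 1 \<noteq> N" "N - Suc 0 \<noteq> N" "N \<noteq> N - Suc 0" "int (N - Suc 0) = int N - 1" using N by auto
  have idx: "label_index N (s, True, k) = int k" "label_index N (True, False, k) = - int k"
    "label_index N (False, False, k) = (if k = N then int k else - int k)" for s k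
    by (simp_all add: label_index_def special_def)
  have "pair_term (delta (- int N) (int (N - 1))) (knot_gauss N) x y = 0"
    if xy: "x \<in> labels N" "y \<in> labels N" for x y
  proof (cases "label_index N x = - int N \<and> label_index N y = int (N - 1)")
    case True
    have mn: "- int N - int (N - 1) < - int N \<or> int N < - int N - int (N - 1)" using N by auto
    from label_index_cases(2)[OF xy(1) N] label_index_cases(3)[OF xy(2) N] True
    consider "x = (True, False, N)" "y = (False, True, N - 1)" | "x = (True, False, N)" "y = (True, True, N - 1)" by blast
    then show ?thesis unfolding pair_term_delta[OF xy mn] using N by cases (simp_all add: defs nn)
  next
    case False
    have mn: "- int N - int (N - 1) < - int N \<or> int N < - int N - int (N - 1)" using N by auto
    show ?thesis unfolding pair_term_delta[OF xy mn] using False by auto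
  qed
  then show "nesting (delta (- int N) (int (N - 1))) (knot_gauss N) = 0"
    unfolding nesting_def ch by (intro sum.neutral ballI) auto
  show "nesting (delta (int N) (- int (N - 1))) (knot_gauss N) = - 1"
  proof (rule nesting_single[OF fin, of "(False, True, N)" "(True, False, N - 1)"])
    fix x y assume "x \<in> chords (knot_gauss N)" "y \<in> chords (knot_gauss N)"
    then have xy: "x \<in> labels N" "y \<in> labels N" by (simp_all add: ch)
    have mn: "int N - (- int (N - 1)) < - int N \<or> int N < int N - (- int (N - 1))" using N by auto
    show "pair_term (delta (int N) (- int (N - 1))) (knot_gauss N) x y = (if x = (False, True, N) \<and> y = (True, False, N - 1) then - 1 else 0)"
    proof (cases "label_index N x = int N \<and> label_index N y = - int (N - 1)")
      case True
      from label_index_cases(1)[OF xy(1) N] label_index_cases(4)[OF xy(2) N] True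
      consider "x = (False, True, N)" "y = (False, False, N - 1)" | "x = (False, True, N)" "y = (True, False, N - 1)" | "x = (True, True, N)" "y = (False, False, N - 1)" | "x = (True, True, N)" "y = (True, False, N - 1)" | "x = (False, False, N)" "y = (False, False, N - 1)" | "x = (False, False, N)" "y = (True, False, N - 1)" by blast
      then show ?thesis unfolding pair_term_delta[OF xy mn] using N by cases (simp_all add: defs nn idx)
    next
      case False
      then have "\<not> (x = (False, True, N) \<and> y = (True, False, N - 1))" using nn by (auto simp: idx)
      then show ?thesis unfolding pair_term_delta[OF xy mn] using False by auto
    qed
  qed (use N in \<open>auto simp: ch labels_def\<close>)
  show "nesting (delta (- int (N - 1)) (int N)) (knot_gauss N) = - 1"
  proof (rule nesting_single[OF fin, of "(False, False, N - 1)" "(True, True, N)"])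
    fix x y assume "x \<in> chords (knot_gauss N)" "y \<in> chords (knot_gauss N)"
    then have xy: "x \<in> labels N" "y \<in> labels N" by (simp_all add: ch)
    have mn: "- int (N - 1) - int N < - int N \<or> int N < - int (N - 1) - int N" using N by auto
    show "pair_term (delta (- int (N - 1)) (int N)) (knot_gauss N) x y = (if x = (False, False, N - 1) \<and> y = (True, True, N) then - 1 else 0)"
    proof (cases "label_index N x = - int (N - 1) \<and> label_index N y = int N")
      case True
      from label_index_cases(4)[OF xy(1) N] label_index_cases(1)[OF xy(2) N] True
      consider "x = (False, False, N - 1)" "y = (False, True, N)" | "x = (False, False, N - 1)" "y = (True, True, N)" | "x = (False, False, N - 1)" "y = (False, False, N)" | "x = (True, False, N - 1)" "y = (False, True, N)" | "x = (True, False, N - 1)" "y = (True, True, N)" | "x = (True, False, N - 1)" "y = (False, False, N)" by blast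
      then show ?thesis unfolding pair_term_delta[OF xy mn] using N by cases (simp_all add: defs nn idx)
    next
      case False
      then have "\<not> (x = (False, False, N - 1) \<and> y = (True, True, N))" using nn by (auto simp: idx)
      then show ?thesis unfolding pair_term_delta[OF xy mn] using False by auto
    qed
  qed (use N in \<open>auto simp: ch labels_def\<close>)
  show "nesting (delta (int (N - 1)) (- int N)) (knot_gauss N) = - 1"
  proof (rule nesting_single[OF fin, of "(False, True, N - 1)" "(True, False, N)"])
    fix x y assume "x \<in> chords (knot_gauss N)" "y \<in> chords (knot_gauss N)"
    then have xy: "x \<in> labels N" "y \<in> labels N" by (simp_all add: ch)
    have mn: "int (N - 1) - (- int N) < - int N \<or> int N < int (N - 1) - (- int N)" using N by auto
    show "pair_term (delta (int (N - 1)) (- int N)) (knot_gauss N) x y = (if x = (False, True, N - 1) \<and> y = (True, False, N) then - 1 else 0)"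
    proof (cases "label_index N x = int (N - 1) \<and> label_index N y = - int N")
      case True
      from label_index_cases(3)[OF xy(1) N] label_index_cases(2)[OF xy(2) N] True
      consider "x = (False, True, N - 1)" "y = (True, False, N)" | "x = (True, True, N - 1)" "y = (True, False, N)" by blast
      then show ?thesis unfolding pair_term_delta[OF xy mn] using N by cases (simp_all add: defs nn idx)
    next
      case False
      then have "\<not> (x = (False, True, N - 1) \<and> y = (True, False, N))" using nn by (auto simp: idx)
      then show ?thesis unfolding pair_term_delta[OF xy mn] using False by auto
    qed
  qed (use N in \<open>auto simp: ch labels_def\<close>)
qed


section \<open>The examples\<close>

context double_torus
begin

text \<open>Two straight branches on one sheet become the axes of a chart built from their
  directions; \<sigma> turns over the second axis where this is needed to make the chart
  positive.\<close>

lemma straight_crossing: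
  assumes s: "s \<in> {1, - 1 :: real}" and z0: "F z0 > 0" and det: "Im (cnj v * v') \<noteq> 0" and \<epsilon>: "\<epsilon> > 0"
    and a: "\<And>x. \<bar>x\<bar> < \<epsilon> \<Longrightarrow> c (a + x) = torus_point (z0 + of_real x * v) (s * F (z0 + of_real x * v))"
    and b: "\<And>x. \<bar>x\<bar> < \<epsilon> \<Longrightarrow> c (b + x) = torus_point (z0 + of_real x * v') (s * F (z0 + of_real x * v'))"
  shows "transverse_at C c a b" "crosses C c a b (if s * Im (cnj v * v') > 0 then 1 else - 1)"
proof -
  define \<sigma> :: real where "\<sigma> = (if s * Im (cnj v * v') > 0 then 1 else - 1)"
  have \<sigma>: "\<sigma> \<in> {1, - 1}" "\<sigma> * \<sigma> = 1" "\<bar>\<sigma>\<bar> = 1" by (auto simp: \<sigma>_def)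
  have s0: "s * Im (cnj v * v') \<noteq> 0" using s det by auto
  have "\<sigma> * (s * Im (cnj v * v')) > 0"
  proof (cases "s * Im (cnj v * v') > 0")
    case True
    then show ?thesis by (simp only: \<sigma>_def if_True mult_1)
  next
    case False
    then have "s * Im (cnj v * v') < 0" using s0 by linarith
    then show ?thesis using False by (simp only: \<sigma>_def if_False)
  qed
  then have sg: "s * \<sigma> * Im (cnj v * v') > 0" by (simp only: mult_ac)
  have "open (F -` {0<..})" by (intro open_vimage open_greaterThan continuous_F)
  moreover have "z0 \<in> F -` {0<..}" using z0 by simp
  ultimately obtain \<delta> where \<delta>: "\<delta> > 0" "ball z0 \<delta> \<subseteq> F -` {0<..}" using openE by blast
  define A where "A = norm v + norm v' + 1"
  have A: "A > 0" "norm v + norm v' \<le> A" by (auto simp: A_def add_nonneg_pos)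
  \<comment> \<open>Arguments of the frame have modulus below 2 and A bounds the sum of the two
    directions, so the frame stays within distance \<delta>, where F is positive, and within
    distance 1/2, where one section is defined.\<close>
  define r where "r = min \<delta> (1/2) / (2 * A)"
  have r: "r > 0" "r * 2 * A \<le> \<delta>" "r * 2 * A \<le> 1/2" using \<delta>(1) A by (auto simp: r_def)
  let ?fr = "frame z0 (of_real r * v) (of_real (r * \<sigma>) * v')"
  have small: "norm (?fr u - z0) < min \<delta> (1/2)" if u: "norm u < 2" for u
  proof -
    have "norm (?fr u - z0) \<le> norm (of_real (Re u) * (of_real r * v)) + norm (of_real (Im u) * (of_real (r * \<sigma>) * v'))"
      unfolding frame_def using norm_triangle_ineq[of "of_real (Re u) * (of_real r * v)" "of_real (Im u) * (of_real (r * \<sigma>) * v')"]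
      by (simp add: add.assoc)
    also have "\<dots> = \<bar>Re u\<bar> * (r * norm v) + \<bar>Im u\<bar> * (r * norm v')"
      using r(1) \<sigma>(3) by (simp add: norm_mult abs_mult)
    also have "\<dots> \<le> norm u * (r * norm v) + norm u * (r * norm v')"
      using r(1) by (intro add_mono mult_right_mono abs_Re_le_cmod abs_Im_le_cmod) auto
    also have "\<dots> = norm u * (r * (norm v + norm v'))" by (simp add: algebra_simps)
    also have "\<dots> \<le> norm u * (r * A)" using A(2) r(1) by (intro mult_left_mono) auto
    also have "\<dots> < 2 * (r * A)" using u r(1) A(1) by (intro mult_strict_right_mono) auto
    also have "\<dots> \<le> min \<delta> (1/2)" using r by simp
    finally show ?thesis .
  qed
  define e where "e w = torus_point (?fr (box_map (of_real (1 / r) * w))) (s * F (?fr (box_map (of_real (1 / r) * w))))" for w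
  have eC: "e \<in> C" unfolding e_def[abs_def]
  proof (rule sheet_chart[OF s])
    have "Im (cnj (of_real r * v) * (of_real (r * \<sigma>) * v')) = r * r * (\<sigma> * Im (cnj v * v'))"
      by (simp add: algebra_simps)
    then have "s * Im (cnj (of_real r * v) * (of_real (r * \<sigma>) * v')) = (r * r) * (s * \<sigma> * Im (cnj v * v'))" by simp
    then show "s * Im (cnj (of_real r * v) * (of_real (r * \<sigma>) * v')) > 0" using sg r(1) by (metis mult_pos_pos)
    show "1 / r > 0" using r(1) by simp
    fix u :: complex assume u: "norm u < 2"
    have "?fr u \<in> ball z0 \<delta>" using small[OF u] by (simp add: dist_norm norm_minus_commute)
    then show "F (?fr u) > 0 \<and> \<bar>Re (?fr u) - Re z0\<bar> < 1/2 \<and> \<bar>Im (?fr u) - Im z0\<bar> < 1/2"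
      using \<delta>(2) small[OF u] abs_Re_le_cmod[of "?fr u - z0"] abs_Im_le_cmod[of "?fr u - z0"] by auto
  qed
  define \<epsilon>' where "\<epsilon>' = min \<epsilon> (r / 2)"
  have \<epsilon>': "\<epsilon>' > 0" "\<epsilon>' \<le> \<epsilon>" "\<epsilon>' \<le> r / 2" using \<epsilon> r(1) by (auto simp: \<epsilon>'_def)
  have fr: "?fr (box_map (of_real (1 / r) * w)) = z0 + of_real (Re w) * v + of_real (Im w * \<sigma>) * v'" if "norm w < \<epsilon>'" for w
  proof -
    have "norm (of_real (1 / r) * w) = norm w / r" using r(1) by (simp add: norm_mult norm_divide)
    also have "\<dots> \<le> 1/2" using that \<epsilon>'(3) r(1) by (simp add: field_simps)
    finally show ?thesis using r(1) by (simp add: box_map_id frame_def)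
  qed
  have ea: "c (a + x) = e (Complex x 0)" if "\<bar>x\<bar> < \<epsilon>'" for x
  proof -
    have "norm (Complex x 0) < \<epsilon>'" using that by (simp add: complex_norm)
    from fr[OF this] show ?thesis unfolding e_def using a[of x] that \<epsilon>'(2) by simp
  qed
  have eb: "c (b + x) = e (Complex 0 (\<sigma> * x))" if "\<bar>x\<bar> < \<epsilon>'" for x
  proof -
    have "norm (Complex 0 (\<sigma> * x)) < \<epsilon>'" using that \<sigma>(3) by (simp add: complex_norm abs_mult)
    note n = this
    have m: "\<sigma> * x * \<sigma> = x" using \<sigma>(2) by (metis mult.assoc mult.commute mult.right_neutral)
    have fr': "?fr (box_map (of_real (1 / r) * Complex 0 (\<sigma> * x))) = z0 + of_real x * v'"
      using fr[OF n] by (simp only: complex.sel m of_real_0 mult_zero_left add_0_right)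
    show ?thesis unfolding e_def fr' using b[of x] that \<epsilon>'(2) by simp
  qed
  show "transverse_at C c a b"
    unfolding transverse_at_def using eC \<sigma>(1) \<epsilon>'(1) ea eb by blast
  have dep: "departs e 0 u p" if "\<And>x. 0 < x \<Longrightarrow> x < \<epsilon>' \<Longrightarrow> p x = e (of_real x * u)" for u p
    unfolding departs_def using that \<epsilon>'(1) by (metis add_0)
  have d1: "departs e 0 1 (\<lambda>x. c (a + x))"
  proof (rule dep)
    fix x assume "0 < x" "x < \<epsilon>'"
    moreover have eq: "of_real x * 1 = Complex x 0" by (simp add: complex_eq_iff)
    ultimately show "c (a + x) = e (of_real x * 1)" unfolding eq using ea[of x] by simp
  qed
  have d2: "departs e 0 (- 1) (\<lambda>x. c (a - x))"
  proof (rule dep)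
    fix x assume "0 < x" "x < \<epsilon>'"
    moreover have eq: "of_real x * - 1 = Complex (- x) 0" by (simp add: complex_eq_iff)
    ultimately show "c (a - x) = e (of_real x * - 1)" unfolding eq using ea[of "- x"] by simp
  qed
  have d3: "departs e 0 (\<i> * of_real \<sigma>) (\<lambda>x. c (b + x))"
  proof (rule dep)
    fix x assume "0 < x" "x < \<epsilon>'"
    moreover have eq: "of_real x * (\<i> * of_real \<sigma>) = Complex 0 (\<sigma> * x)" by (simp add: complex_eq_iff)
    ultimately show "c (b + x) = e (of_real x * (\<i> * of_real \<sigma>))" unfolding eq using eb[of x] by simp
  qed
  have d4: "departs e 0 (- (\<i> * of_real \<sigma>)) (\<lambda>x. c (b - x))"
  proof (rule dep)
    fix x assume "0 < x" "x < \<epsilon>'"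
    moreover have eq: "of_real x * - (\<i> * of_real \<sigma>) = Complex 0 (\<sigma> * - x)" by (simp add: complex_eq_iff)
    ultimately show "c (b - x) = e (of_real x * - (\<i> * of_real \<sigma>))" unfolding eq using eb[of "- x"] by simp
  qed
  have "crosses C c a b (if Im (cnj 1 * (\<i> * of_real \<sigma>)) > 0 then 1 else - 1)"
    unfolding crosses_def
  proof (intro bexI[OF _ eC] exI conjI)
    show "c a = e 0" "c b = e 0" using ea[of 0] eb[of 0] \<epsilon>'(1) by (simp_all add: zero_complex.code)
    show "departs e 0 1 (\<lambda>x. c (a + x))" "departs e 0 (- 1) (\<lambda>x. c (a - x))"
      "departs e 0 (\<i> * of_real \<sigma>) (\<lambda>x. c (b + x))" "departs e 0 (- (\<i> * of_real \<sigma>)) (\<lambda>x. c (b - x))"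
      by (rule d1, rule d2, rule d3, rule d4)
    show "Im (cnj 1 * (\<i> * of_real \<sigma>)) \<noteq> 0" using \<sigma>(1) by auto
  qed simp
  then show "crosses C c a b (if s * Im (cnj v * v') > 0 then 1 else - 1)"
    by (simp add: \<sigma>_def split: if_splits)
qed

end

text \<open>Where the sign jumps, the other factor vanishes. In this way the curve changes from one
  sheet to the other at the seam.\<close>

lemma continuous_sgn_mult:
  fixes f s :: "real \<Rightarrow> real"
  assumes "continuous_on UNIV f" "continuous_on UNIV s" "\<And>t. s t = 0 \<Longrightarrow> f t = 0"
  shows "continuous_on UNIV (\<lambda>t. sgn (s t) * f t)"
  unfolding continuous_on_eq_continuous_at[OF open_UNIV]
proof
  fix t :: real
  have c: "isCont f t" "isCont s t" using assms(1,2) by (simp_all add: continuous_on_eq_continuous_at)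
  show "isCont (\<lambda>t. sgn (s t) * f t) t"
  proof (cases "s t = 0")
    case False
    then show ?thesis using c by (intro continuous_intros) auto
  next
    case True
    have "((\<lambda>x. \<bar>f x\<bar>) \<longlongrightarrow> 0) (at t)"
      using c(1) assms(3)[OF True] unfolding isCont_def by (auto intro: tendsto_rabs_zero)
    then have "((\<lambda>x. sgn (s x) * f x) \<longlongrightarrow> 0) (at t)"
      by (rule Lim_null_comparison[rotated]) (auto simp: abs_mult sgn_if)
    then show ?thesis using True by (simp add: isCont_def)
  qed
qed

text \<open>The distance to the nearest integer.\<close>

definition wave :: "real \<Rightarrow> real" where
  "wave t = arccos (cos (2 * pi * t)) / (2 * pi)"

lemma wave_eq: "\<bar>t\<bar> \<le> 1/2 \<Longrightarrow> wave t = \<bar>t\<bar>"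
proof -
  assume "\<bar>t\<bar> \<le> 1/2"
  then have "2 * pi * \<bar>t\<bar> \<le> 2 * pi * (1/2)" by (intro mult_left_mono) auto
  moreover have "cos (2 * pi * t) = cos (2 * pi * \<bar>t\<bar>)" by (simp add: abs_if)
  ultimately show "wave t = \<bar>t\<bar>" unfolding wave_def by (simp add: arccos_cos)
qed

lemma cos_sin_period: "cos (2 * pi * (t + of_int n)) = cos (2 * pi * t)" "sin (2 * pi * (t + of_int n)) = sin (2 * pi * t)"
proof -
  have 1: "2 * pi * (t + of_int n) = 2 * pi * t + of_int n * (2 * pi)" by (simp add: algebra_simps)
  have "cis (of_int n * (2 * pi)) = 1" using cis_multiple_2pi[of "of_int n"] by (simp add: mult_ac)
  then have "cos (of_int n * (2 * pi)) = 1" "sin (of_int n * (2 * pi)) = 0" by (simp_all add: complex_eq_iff)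
  then show "cos (2 * pi * (t + of_int n)) = cos (2 * pi * t)" "sin (2 * pi * (t + of_int n)) = sin (2 * pi * t)"
    unfolding 1 by (simp_all add: cos_add sin_add)
qed

lemma wave_cong: "s - t \<in> \<int> \<Longrightarrow> wave s = wave t"
  unfolding wave_def using cos_sin_period(1) by (metis Ints_cases add.commute diff_add_cancel)

lemma sin_cong: "s - t \<in> \<int> \<Longrightarrow> sin (2 * pi * s) = sin (2 * pi * t)"
  using cos_sin_period(2) by (metis Ints_cases add.commute diff_add_cancel)

lemma continuous_wave: "continuous_on S wave"
proof -
  have "continuous_on UNIV (\<lambda>t. arccos (cos (2 * pi * t)))"
    by (rule continuous_on_compose2[OF continuous_on_arccos']) (auto intro!: continuous_intros)
  then have "continuous_on UNIV wave" unfolding wave_def[abs_def] by (intro continuous_intros) auto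
  then show ?thesis by (rule continuous_on_subset) simp
qed

lemma wave_cases:
  obtains y where "t - y \<in> \<int>" "- 1/2 < y" "y \<le> 1/2" "wave t = \<bar>y\<bar>"
    "sgn (sin (2 * pi * t)) = (if y = 1/2 then 0 else sgn y)"
proof -
  define y where "y = t - of_int \<lceil>t - 1/2\<rceil>"
  have y: "t - y \<in> \<int>" "- 1/2 < y" "y \<le> 1/2" unfolding y_def by (auto, linarith+)
  have "wave t = \<bar>y\<bar>" using wave_cong[OF y(1)] wave_eq[of y] y by simp
  moreover have "sgn (sin (2 * pi * y)) = (if y = 1/2 then 0 else sgn y)"
  proof -
    consider "y = 0" | "y = 1/2" | "0 < y" "y < 1/2" | "- 1/2 < y" "y < 0" using y by linarith
    then show ?thesis
    proof cases
      case 2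
      then have e: "2 * pi * y = pi" by simp
      show ?thesis unfolding e using 2 by simp
    next
      case 3
      then have "sin (2 * pi * y) > 0" by (intro sin_gt_zero) auto
      then show ?thesis using 3 by simp
    next
      case 4
      have "pi * (- (2 * y)) < pi * 1" using 4 by (intro mult_strict_left_mono) auto
      then have "2 * pi * (- y) < pi" by simp
      moreover have "0 < 2 * pi * (- y)" using 4 by (intro mult_pos_pos) auto
      ultimately have "sin (2 * pi * (- y)) > 0" by (intro sin_gt_zero)
      then show ?thesis using 4 by simp
    qed auto
  qed
  ultimately show ?thesis using y sin_cong[OF y(1)] by (intro that[of y]) simp_all
qed

section \<open>The broken line on the torus and its crossings modulo the lattice\<close>

locale knot_family =
  fixes N :: nat
  assumes N2: "N \<ge> 2"
begin

text \<open>The corner of the line has height H, with fractional part 1/2, and the midpoint of the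
  second edge has height \<open>H / 2\<close>, with fractional part 1/4. These fractions keep the
  line off the lattice and prevent the second edge from meeting itself.\<close>

definition H :: real where "H = 2 * real N + 1/2"

text \<open>Within horizontal distance \<open>hole\<close> of a lattice column, the height of an
  edge varies by at most \<open>hole * H\<close>. With the radius itself this adds up to 1/8, less
  than the distances 1/2 and 1/4 of the critical heights from the integers.\<close>

definition hole :: real where "hole = 1 / (8 * (H + 1))"

lemma H: "H \<ge> 4" "real N \<le> H / 2" using N2 by (auto simp: H_def)

lemma hole: "0 < hole" "hole \<le> 1/8" "hole * (H + 1) = 1/8"
  using H by (auto simp: hole_def field_simps)

sublocale double_torus hole
  by unfold_locales (rule hole)+

text \<open>The two edges add up to the lattice point 1, so the line leads from the hole to the
  hole. Their determinant is - H, in keeping with 2N crossings on the torus.\<close>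

definition va :: complex where "va = Complex (- 1) H"
definition vb :: complex where "vb = Complex 2 (- H)"

definition route :: "real \<Rightarrow> complex" where
  "route p = (if p \<le> 1 then of_real p * va else va + of_real (p - 1) * vb)"

text \<open>Here the line leaves the hole about 0, and at \<open>pmax\<close> it reaches the hole
  about 1.\<close>

definition pmin :: real where "pmin = hole / norm va"
definition pmax :: real where "pmax = 2 - hole / norm vb"

lemma norm_edges: "norm va > H" "norm vb > H"
proof -
  have "sqrt (H\<^sup>2) < sqrt ((- 1)\<^sup>2 + H\<^sup>2)" "sqrt (H\<^sup>2) < sqrt (2\<^sup>2 + (- H)\<^sup>2)"
    by (simp_all only: real_sqrt_less_iff) simp_all
  then show "norm va > H" "norm vb > H" using H by (simp_all add: va_def vb_def complex_norm)
qed

lemma pmin_pmax: "0 < pmin" "pmin < 1 / (4 * H)" "2 - 1 / (4 * H) < pmax" "pmax < 2" "pmin < 1" "1 < pmax"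
proof -
  have "hole / n < 1 / (4 * H)" if "n > H" for n
  proof -
    have "hole * (4 * H) \<le> 1/8 * (4 * H)" using hole H by (intro mult_right_mono) auto
    then have "hole * (4 * H) < n" using that H by linarith
    then show ?thesis using that H by (simp add: field_simps)
  qed
  then have "hole / norm va < 1 / (4 * H)" "hole / norm vb < 1 / (4 * H)" using norm_edges by blast+
  moreover have "1 / (4 * H) < 1" using H by simp
  moreover have "0 < norm va" "0 < norm vb" using norm_edges H by linarith+
  moreover from this have "0 < hole / norm va" "0 < hole / norm vb" using hole(1) by (intro divide_pos_pos; simp)+
  ultimately show "0 < pmin" "pmin < 1 / (4 * H)" "2 - 1 / (4 * H) < pmax" "pmax < 2" "pmin < 1" "1 < pmax"
    unfolding pmin_def pmax_def by linarith+
qed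

lemma route_ends: "F (route pmin) = 0" "F (route pmax) = 0"
proof -
  have n: "norm va > 0" "norm vb > 0" using norm_edges H by linarith+
  have "norm (route pmin) = hole" using pmin_pmax n hole by (simp add: route_def norm_mult) (simp add: pmin_def)
  then show "F (route pmin) = 0" using F_near[of "route pmin"] hole by simp
  have "route pmax = - of_real (hole / norm vb) * vb + 1"
    using pmin_pmax by (simp add: route_def) (simp add: pmax_def va_def vb_def complex_eq_iff algebra_simps)
  moreover have "1 \<in> gauss_ints" by (simp add: gauss_ints_def)
  ultimately have "F (route pmax) = F (- of_real (hole / norm vb) * vb)" using F_shift by metis
  also have "\<dots> = 0" using F_near[of "- of_real (hole / norm vb) * vb"] n hole by (simp add: norm_mult norm_divide)
  finally show "F (route pmax) = 0" .
qed

lemma far_from_Ints: "\<bar>real N + x - j\<bar> > 1/8" if "j \<in> \<int>" "1/8 < x" "x < 7/8"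
proof -
  obtain i where i: "j = of_int i" using \<open>j \<in> \<int>\<close> by (rule Ints_cases)
  consider "i \<le> int N" | "i \<ge> int N + 1" by linarith
  then show ?thesis
  proof cases
    case 1
    then have "of_int i \<le> real N" by linarith
    then show ?thesis using that i by linarith
  next
    case 2
    then have "of_int i \<ge> real N + 1" by linarith
    then show ?thesis using that i by linarith
  qed
qed

text \<open>A point close to a lattice point is close to one of the lattice columns - 1, 0, 1. Near
  the corner and near the midpoint of the second edge its height is far from all integers. Near the
  ends of the line the lattice point is 0 or 1 itself, which the bounds on p exclude.\<close>

lemma route_clear:
  assumes "pmin < p" "p < pmax"
  shows "F (route p) > 0"
proof (rule ccontr)
  assume neg: "\<not> F (route p) > 0"
  obtain l where l: "l \<in> gauss_ints" "infdist (route p) gauss_ints = dist (route p) l"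
    using infdist_attains_inf[OF closed_gauss_ints, of "route p"] gauss_ints_0 by blast
  have near: "norm (route p - l) \<le> hole" using neg l(2) by (simp add: F_def dist_norm)
  then have RI: "\<bar>Re (route p) - Re l\<bar> \<le> hole" "\<bar>Im (route p) - Im l\<bar> \<le> hole"
    using abs_Re_le_cmod[of "route p - l"] abs_Im_le_cmod[of "route p - l"] by simp_all
  have lI: "Re l \<in> \<int>" "Im l \<in> \<int>" using l(1) by (simp_all add: gauss_ints_def)
  obtain i :: int where i: "Re l = of_int i" using lI(1) by (rule Ints_cases)
  define b where "b = hole * H"
  have hH: "b + hole = 1/8" using hole(3) by (simp add: b_def algebra_simps)
  have b: "0 < b" using hole H by (simp add: b_def)
  have n: "norm va > 0" "norm vb > 0" using norm_edges H by linarith+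
  show False
  proof (cases "p \<le> 1")
    case True
    then have ri: "\<bar>- p - of_int i\<bar> \<le> hole" "\<bar>p * H - Im l\<bar> \<le> hole" using RI i by (simp_all add: route_def va_def)
    have "of_int i > - (2::real)" "of_int i < (1::real)" using ri(1) True assms(1) pmin_pmax(1) hole by linarith+
    then consider "i = 0" | "i = - 1" by linarith
    then show False
    proof cases
      case 1
      then have "p \<le> hole" using ri(1) assms(1) pmin_pmax(1) by simp
      then have "p * H \<le> hole * H" using H by (intro mult_right_mono) auto
      then have "p * H \<le> b" by (simp add: b_def)
      moreover have "0 \<le> p * H" using assms(1) pmin_pmax(1) H by simp
      ultimately have "\<bar>Im l\<bar> < 1" using ri(2) hole hH by linarith
      then have "l = 0" using Ints_abs_less_1[OF lI(2)] 1 i by (simp add: complex_eq_iff)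
      then have "p * norm va \<le> hole" using near True assms(1) pmin_pmax(1) by (simp add: route_def norm_mult)
      then have "p \<le> pmin" using n by (simp add: pmin_def field_simps)
      then show False using assms by simp
    next
      case 2
      then have "1 - p \<le> hole" using ri(1) by simp
      then have "(1 - p) * H \<le> hole * H" using H by (intro mult_right_mono) auto
      then have "H - p * H \<le> b" by (simp add: b_def left_diff_distrib)
      moreover have "p * H \<le> 1 * H" using True H by (intro mult_right_mono) auto
      ultimately have "\<bar>H - Im l\<bar> \<le> 1/8" using ri(2) hH by linarith
      moreover have "Im l - real N \<in> \<int>" using lI(2) by simp
      then have "\<bar>real N + 1/2 - (Im l - real N)\<bar> > 1/8" by (rule far_from_Ints) simp_all
      ultimately show False unfolding H_def by linarith
    qed
  next
    case False
    \<comment> \<open>The second edge is measured from its end, the lattice point 1.\<close>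
    define u where "u = 2 - p"
    have u: "0 < u" "u < 1" using False assms(2) pmin_pmax(4) by (auto simp: u_def)
    have "route p = Complex (1 - 2 * u) (H * u)" using False
      by (simp add: route_def va_def vb_def u_def complex_eq_iff algebra_simps)
    then have ri: "\<bar>1 - 2 * u - of_int i\<bar> \<le> hole" "\<bar>H * u - Im l\<bar> \<le> hole" using RI i by simp_all
    have "of_int i > - (2::real)" "of_int i < (2::real)" using ri(1) u hole by linarith+
    then consider "i = - 1" | "i = 0" | "i = 1" by linarith
    then show False
    proof cases
      case 1
      then have "1 - u \<le> hole" using ri(1) u by simp
      then have "H * (1 - u) \<le> H * hole" using H by (intro mult_left_mono) auto
      then have "H - H * u \<le> b" by (simp add: b_def right_diff_distrib mult.commute)
      moreover have "H * u \<le> H * 1" using u H by (intro mult_left_mono) auto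
      ultimately have "\<bar>H - Im l\<bar> \<le> 1/8" using ri(2) hH by linarith
      moreover have "Im l - real N \<in> \<int>" using lI(2) by simp
      then have "\<bar>real N + 1/2 - (Im l - real N)\<bar> > 1/8" by (rule far_from_Ints) simp_all
      ultimately show False unfolding H_def by linarith
    next
      case 2
      then have "\<bar>1 - 2 * u\<bar> \<le> hole" using ri(1) by simp
      then have "\<bar>u - 1/2\<bar> \<le> hole / 2" by linarith
      then have "H * \<bar>u - 1/2\<bar> \<le> H * (hole / 2)" using H by (intro mult_left_mono) auto
      moreover have "\<bar>H * u - H / 2\<bar> = H * \<bar>u - 1/2\<bar>"
      proof -
        have "H * u - H / 2 = H * (u - 1/2)" by (simp add: right_diff_distrib)
        then show ?thesis using H by (simp add: abs_mult)
      qed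
      ultimately have "\<bar>H * u - H / 2\<bar> \<le> b / 2" by (simp add: b_def mult.commute)
      then have "\<bar>H / 2 - Im l\<bar> \<le> 1/8" using ri(2) hH b by linarith
      moreover have "H / 2 = real N + 1/4" by (simp add: H_def field_simps)
      moreover have "\<bar>real N + 1/4 - Im l\<bar> > 1/8" by (rule far_from_Ints[OF lI(2)]) simp_all
      ultimately show False by linarith
    next
      case 3
      then have "2 * u \<le> hole" using ri(1) u by simp
      then have "H * u \<le> H * hole" using H u by (intro mult_left_mono) auto
      then have "H * u \<le> b" by (simp add: b_def mult.commute)
      moreover have "0 \<le> H * u" using u H by simp
      ultimately have "\<bar>Im l\<bar> < 1" using ri(2) hole hH by linarith
      then have "l = 1" using Ints_abs_less_1[OF lI(2)] 3 i by (simp add: complex_eq_iff)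
      moreover have "route p = 1 - of_real u * vb" using False
        by (simp add: route_def va_def vb_def u_def complex_eq_iff algebra_simps)
      ultimately have "u * norm vb \<le> hole" using near u by (simp add: norm_mult)
      then have "u \<le> hole / norm vb" using n by (simp add: field_simps)
      then show False using assms(2) by (simp add: u_def pmax_def)
    qed
  qed
qed

lemma continuous_route: "continuous_on S route"
proof -
  have "continuous_on ({..1} \<union> {1..}) (\<lambda>p. if p \<le> 1 then of_real p * va else va + of_real (p - 1) * vb)"
    by (rule continuous_on_If) (auto intro!: continuous_intros)
  moreover have "{..1} \<union> {1..} = (UNIV :: real set)" by auto
  ultimately have "continuous_on UNIV route" by (simp add: route_def[abs_def])
  then show ?thesis by (rule continuous_on_subset) simp
qed

lemma Ints_between: "x \<in> \<int> \<Longrightarrow> - 1 < x \<Longrightarrow> x < 1 \<Longrightarrow> x = (0::real)"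
  using Ints_abs_less_1[of x] by simp

text \<open>On the first edge the horizontal displacement is below 1, on the second below 2. The
  only possible nonzero integral displacement is half of the second edge, and its height
  \<open>H / 2\<close> is not an integer.\<close>

lemma route_edge:
  assumes "pmin \<le> p" "p \<le> pmax" "pmin \<le> q" "q \<le> pmax" "route p - route q \<in> gauss_ints"
    "p \<le> 1 \<and> q \<le> 1 \<or> 1 \<le> p \<and> 1 \<le> q"
  shows "p = q"
proof -
  consider "p \<le> 1" "q \<le> 1" | "1 \<le> p" "1 \<le> q" using assms(6) by blast
  then show ?thesis
  proof cases
    case 1
    then have "q - p \<in> \<int>" using assms(5) by (simp add: gauss_ints_def route_def va_def)
    then have "q - p = 0" by (rule Ints_between) (use 1 assms pmin_pmax in linarith)+
    then show ?thesis by simp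
  next
    case 2
    have r: "route x = va + of_real (x - 1) * vb" if "1 \<le> x" for x using that by (auto simp: route_def)
    have "route p - route q = Complex (2 * (p - q)) (H * (q - p))"
      unfolding r[OF 2(1)] r[OF 2(2)] by (simp add: vb_def complex_eq_iff algebra_simps)
    then have I: "2 * (p - q) \<in> \<int>" "H * (q - p) \<in> \<int>" using assms(5) by (simp_all add: gauss_ints_def)
    obtain i :: int where i: "2 * (p - q) = of_int i" using I(1) by (rule Ints_cases)
    have "p - q < 1" "q - p < 1" using 2 assms pmin_pmax by linarith+
    then have "2 * (p - q) < 2 \<and> 2 * (p - q) > - 2" by auto
    then have "of_int i < (2::real)" "of_int i > - (2::real)" unfolding i by blast+
    then consider "i = 0" | "i = 1" | "i = - 1" by linarith
    then have "i = 0"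
    proof cases
      case 2
      then have e: "q - p = - 1/2" using i by simp
      have "H * (q - p) = - (real N + 1/4)" unfolding e by (simp add: H_def field_simps)
      then have "real N + 1/4 \<in> \<int>" using I(2) by (metis Ints_minus minus_minus)
      then show ?thesis using far_from_Ints[of "real N + 1/4" "1/4"] by simp
    next
      case 3
      then have e: "q - p = 1/2" using i by simp
      have "H * (q - p) = real N + 1/4" unfolding e by (simp add: H_def field_simps)
      then show ?thesis using I(2) far_from_Ints[of "real N + 1/4" "1/4"] by simp
    qed
    then show ?thesis using i by simp
  qed
qed

definition pa :: "bool \<Rightarrow> nat \<Rightarrow> real" where
  "pa b k = (if b then 2 * real k / H else 1 - 2 * real k / H)"

definition pb :: "bool \<Rightarrow> nat \<Rightarrow> real" where
  "pb b k = (if b then 2 - real k / H else 1 + real k / H)"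

lemma pa_mult: "pa b k * H = (if b then 2 * real k else H - 2 * real k)"
  and pb_mult: "pb b k * H = (if b then 2 * H - real k else H + real k)"
proof -
  have "H \<noteq> 0" using H by simp
  then show "pa b k * H = (if b then 2 * real k else H - 2 * real k)" "pb b k * H = (if b then 2 * H - real k else H + real k)"
    by (simp_all add: pa_def pb_def left_diff_distrib distrib_right)
qed

lemma pa_pb:
  assumes "1 \<le> k" "k \<le> N"
  shows "pmin < pa b k" "pa b k < 1" "1 < pb b k" "pb b k < pmax" "1 / H \<le> pb b k - pa b k"
    "route (pa b k) - route (pb b k) \<in> gauss_ints"
proof -
  have k: "1 \<le> real k" "real k \<le> real N" using assms by auto
  have H0: "H > 0" "H = 2 * real N + 1/2" using H by (auto simp: H_def)
  \<comment> \<open>In terms of i = 1/H the choice of H reads N i = 1/2 - i/4. So r = k/H keeps away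
    from 1/2, and every crossing lies outside the holes at the ends of the line.\<close>
  define i r where "i = 1 / H" and "r = real k / H"
  have i: "0 < i" "i \<le> 1/4" using H by (simp_all add: i_def field_simps)
  have "(2 * real N + 1/2) * i = 1" using H0 by (simp add: i_def)
  then have "real N * i = 1/2 - i / 4" by (simp add: algebra_simps)
  moreover have "r = real k * i" by (simp add: r_def i_def)
  moreover have "1 * i \<le> real k * i" "real k * i \<le> real N * i" using k i by (intro mult_right_mono; simp)+
  ultimately have r: "i \<le> r" "r \<le> 1/2 - i / 4" by simp_all
  have p: "pa b k = (if b then 2 * r else 1 - 2 * r)" "pb b k = (if b then 2 - r else 1 + r)" "1 / (4 * H) = i / 4"
    by (simp_all add: pa_def pb_def r_def i_def)
  have a: "1 / (4 * H) \<le> pa b k" "pa b k < 1" "1 < pb b k" "pb b k \<le> 2 - 1 / (4 * H)" "1 / H \<le> pb b k - pa b k"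
    unfolding p i_def[symmetric] using i r by auto
  then show "pmin < pa b k" "pa b k < 1" "1 < pb b k" "pb b k < pmax" "1 / H \<le> pb b k - pa b k"
    using pmin_pmax(2,3) by linarith+
  have "route (pa b k) - route (pb b k) = (if b then Complex (- 1) (real k) else Complex 0 (- real k))"
    using a H0(1) by (auto simp: route_def pa_def pb_def va_def vb_def complex_eq_iff field_simps)
  then show "route (pa b k) - route (pb b k) \<in> gauss_ints" by (simp add: gauss_ints_def)
qed

text \<open>With u = 1 - p and t = q - 1, the numbers n = 2t - u and j = H (t - u) are integers, and
  t = n - j/H, u = n - 2j/H. The bounds on u and t leave n = 1 for positive j and n = 0 for negative
  j, the two families with k = \<bar>j\<bar>; for j = 0 both points are the common corner.\<close>

lemma route_meet:
  assumes p: "pmin \<le> p" "p \<le> 1" and q: "1 \<le> q" "q \<le> pmax" and l: "route p - route q \<in> gauss_ints" and ne: "p \<noteq> q"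
  obtains b k where "1 \<le> k" "k \<le> N" "p = pa b k" "q = pb b k"
proof -
  define u t where "u = 1 - p" and "t = q - 1"
  have ut: "0 \<le> u" "u < 1" "0 \<le> t" "t < 1" using assms pmin_pmax by (auto simp: u_def t_def)
  have H0: "H > 0" "H = 2 * real N + 1/2" using H by (auto simp: H_def)
  have "route q = va + of_real t * vb" using q by (auto simp: route_def t_def)
  then have "route p - route q = Complex (u - 2 * t) (H * (t - u))"
    using p by (simp add: route_def va_def vb_def u_def complex_eq_iff algebra_simps)
  then have "2 * t - u \<in> \<int>" "H * (t - u) \<in> \<int>" using l Ints_minus[of "u - 2 * t"] by (simp_all add: gauss_ints_def)
  then obtain n j :: int where nj: "2 * t - u = of_int n" "H * (t - u) = of_int j" by (metis Ints_cases)
  define y where "y = of_int j / H"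
  have "H \<noteq> 0" using H0(1) by simp
  then have "t - u = y" unfolding y_def nj(2)[symmetric] by simp
  then have t: "t = of_int n - y" "u = of_int n - 2 * y" using nj(1) by linarith+
  have yH: "of_int j = y * H" using H0(1) by (simp add: y_def)
  consider "j = 0" | "j > 0" | "j < 0" by linarith
  then show ?thesis
  proof cases
    case 1
    then have "t = of_int n" "u = of_int n" using t by (auto simp: y_def)
    then have "n = 0" using ut by simp
    then show ?thesis using ne \<open>t = of_int n\<close> \<open>u = of_int n\<close> by (simp add: u_def t_def)
  next
    case 2
    then have y: "y > 0" using H0(1) by (simp add: y_def)
    have "of_int n < (2::real)" "of_int n > (0::real)" using t ut y by linarith+
    then have n: "n = 1" by simp
    define k where "k = nat j"
    have k: "of_int j = real k" "1 \<le> k" using 2 by (auto simp: k_def)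
    have "2 * y \<le> 1" using t ut n by simp
    then have "2 * (y * H) \<le> H" using H0(1) mult_right_mono[of "2 * y" 1 H] by (simp add: mult.assoc)
    then have "2 * real k \<le> 2 * real N + 1/2" using yH k H0(2) by linarith
    then have "k \<le> N" by linarith
    moreover have "p = pa True k" "q = pb True k"
      using t n k(1) by (auto simp: pa_def pb_def u_def t_def y_def)
    ultimately show ?thesis using that k(2) by blast
  next
    case 3
    then have y: "y < 0" using H0(1) by (simp add: y_def divide_neg_pos)
    have "of_int n < (1::real)" "of_int n > - (1::real)" using t ut y by linarith+
    then have n: "n = 0" by simp
    define k where "k = nat (- j)"
    have k: "of_int j = - real k" "1 \<le> k" using 3 by (auto simp: k_def)
    have "- (2 * y) < 1" using t ut n by simp
    then have "- (2 * (y * H)) < H" using H0(1) mult_strict_right_mono[of "- (2 * y)" 1 H] by (simp add: mult.assoc)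
    then have "2 * real k < 2 * real N + 1/2" using yH k H0(2) by linarith
    then have "k \<le> N" by linarith
    moreover have "p = pa False k" "q = pb False k"
      using t n k(1) by (auto simp: pa_def pb_def u_def t_def y_def)
    ultimately show ?thesis using that k(2) by blast
  qed
qed

section \<open>The curve on the doubled torus and its double points\<close>

definition speed :: real where "speed = 2 * (pmax - pmin)"

definition pos :: "real \<Rightarrow> real" where "pos t = pmin + speed * wave t"

definition side :: "real \<Rightarrow> real" where "side t = sgn (sin (2 * pi * t))"

text \<open>In one period the position goes from \<open>pmin\<close> to \<open>pmax\<close> and
  back. At the two turning points F vanishes and \<open>side\<close> changes its sign, so the way
  out is on the upper sheet and the way back on the lower.\<close>

definition kcurve :: "real \<Rightarrow> complex \<times> complex" where
  "kcurve t = torus_point (route (pos t)) (side t * F (route (pos t)))"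

text \<open>The parameter at which the curve runs through position \<open>p\<close> of the route on the lower sheet
  (if \<open>s\<close> holds) or on the upper sheet.\<close>

definition param :: "bool \<Rightarrow> real \<Rightarrow> real" where
  "param s p = (if s then 1 - (p - pmin) / speed else (p - pmin) / speed)"

lemma speed: "speed > 0" using pmin_pmax by (simp add: speed_def)

lemma pos_cases:
  obtains "side t = 0" "pos t = pmin" "t \<in> \<int>" | "side t = 0" "pos t = pmax" "t - 1/2 \<in> \<int>"
    | s where "side t = (if s then - 1 else 1)" "pmin < pos t" "pos t < pmax" "t - param s (pos t) \<in> \<int>"
proof -
  obtain y where y: "t - y \<in> \<int>" "- 1/2 < y" "y \<le> 1/2" "wave t = \<bar>y\<bar>"
    "side t = (if y = 1/2 then 0 else sgn y)" using wave_cases[of t] unfolding side_def by blast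
  have ps: "pos t = pmin + speed * \<bar>y\<bar>" using y(4) by (simp add: pos_def)
  then have par: "(pos t - pmin) / speed = \<bar>y\<bar>" using speed by simp
  have half: "speed * (1/2) = pmax - pmin" by (simp add: speed_def field_simps)
  consider "y = 0" | "y = 1/2" | "0 < y" "y < 1/2" | "y < 0" using y by linarith
  then show ?thesis
  proof cases
    case 1 then show ?thesis using that(1) ps y by simp
  next
    case 2
    have "pos t = pmin + speed * (1/2)" using ps unfolding 2 by simp
    then have "pos t = pmax" by (simp add: speed_def field_simps)
    moreover have "side t = 0" using y(5) 2 by simp
    moreover have "t - 1/2 \<in> \<int>" using y(1) unfolding 2 .
    ultimately show ?thesis using that(2) by blast
  next
    case 3
    have "speed * y < speed * (1/2)" using 3 speed by (intro mult_strict_left_mono) auto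
    moreover have "speed * y > 0" using 3 speed by simp
    ultimately have "pos t < pmax" "pmin < pos t" using ps 3 half by simp_all
    moreover have "t - param False (pos t) \<in> \<int>" using y(1) par 3 by (simp add: param_def)
    ultimately show ?thesis using that(3)[of False] y(5) 3 by simp
  next
    case 4
    have "speed * (- y) < speed * (1/2)" using 4 y speed by (intro mult_strict_left_mono) auto
    moreover have "speed * (- y) > 0" using 4 speed by (intro mult_pos_pos) auto
    ultimately have "pos t < pmax" "pmin < pos t" using ps 4 half by simp_all
    moreover have "t - param True (pos t) \<in> \<int>" using Ints_diff[OF y(1) Ints_1] par 4 by (simp add: param_def algebra_simps)
    ultimately show ?thesis using that(3)[of True] y(5) 4 by simp
  qed
qed

lemma param:
  assumes "pmin < p" "p < pmax"
  shows "pos (param s p) = p" "side (param s p) = (if s then - 1 else 1)" "0 < param s p" "param s p < 1"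
    "param False p < 1/2" "1/2 < param True p"
proof -
  define y where "y = (p - pmin) / speed"
  have y: "0 < y" "y < 1/2" using assms speed by (auto simp: y_def speed_def field_simps)
  have ps: "param s p = (if s then 1 - y else y)" for s by (simp add: param_def y_def)
  show "0 < param s p" "param s p < 1" "param False p < 1/2" "1/2 < param True p" using y by (simp_all add: ps)
  have w: "wave (param s p) = y"
  proof (cases s)
    case True
    have "wave (1 - y) = wave (- y)" by (rule wave_cong) simp
    then show ?thesis using True wave_eq[of "- y"] y by (simp add: ps)
  qed (use wave_eq[of y] y in \<open>simp add: ps\<close>)
  show "pos (param s p) = p" unfolding pos_def w using speed by (simp add: y_def)
  have "sin (2 * pi * y) > 0" by (rule sin_gt_zero) (use y in auto)
  moreover have "sin (2 * pi * (1 - y)) = sin (2 * pi * (- y))" by (rule sin_cong) simp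
  ultimately show "side (param s p) = (if s then - 1 else 1)" by (simp add: side_def ps)
qed

lemma F_route: "0 \<le> F (route (pos t))" "F (route (pos t)) = 0 \<longleftrightarrow> side t = 0"
proof -
  have "0 \<le> F (route (pos t)) \<and> (F (route (pos t)) = 0 \<longleftrightarrow> side t = 0)"
  proof (rule pos_cases[of t])
    fix s assume "side t = (if s then - 1 else 1)" "pmin < pos t" "pos t < pmax"
    then show ?thesis using route_clear[of "pos t"] by (cases s) simp_all
  qed (use route_ends in simp_all)
  then show "0 \<le> F (route (pos t))" "F (route (pos t)) = 0 \<longleftrightarrow> side t = 0" by blast+
qed

lemma pos_range: "pmin \<le> pos t" "pos t \<le> pmax"
  by (rule pos_cases[of t]; use pmin_pmax in simp)+

lemma pos_cong: "s - t \<in> \<int> \<Longrightarrow> pos s = pos t" "s - t \<in> \<int> \<Longrightarrow> side s = side t" "s - t \<in> \<int> \<Longrightarrow> kcurve s = kcurve t"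
  unfolding kcurve_def pos_def side_def using wave_cong sin_cong by metis+

lemma pos_side_inj:
  assumes "pos s = pos t" "side s = side t"
  shows "s - t \<in> \<int>"
proof (rule pos_cases[of s])
  assume s: "side s = 0" "pos s = pmin" "s \<in> \<int>"
  show ?thesis by (rule pos_cases[of t]) (use s assms pmin_pmax in \<open>auto split: if_splits\<close>)
next
  assume s: "side s = 0" "pos s = pmax" "s - 1/2 \<in> \<int>"
  show ?thesis by (rule pos_cases[of t]) (use s assms pmin_pmax Ints_diff[of "s - 1/2" "t - 1/2"] in \<open>auto split: if_splits\<close>)
next
  fix b assume s: "side s = (if b then - 1 else 1)" "pmin < pos s" "pos s < pmax" "s - param b (pos s) \<in> \<int>"
  show ?thesis
  proof (rule pos_cases[of t])
    fix b' assume t: "side t = (if b' then - 1 else 1)" "t - param b' (pos t) \<in> \<int>"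
    then have "b' = b" using s assms by (auto split: if_splits)
    then show ?thesis using Ints_diff[OF s(4) t(2)] assms by simp
  qed (use s assms in \<open>auto split: if_splits\<close>)
qed

lemma kcurve_eq:
  assumes "kcurve s = kcurve t"
  shows "side s = side t" "route (pos s) - route (pos t) \<in> gauss_ints"
proof -
  have "side s * F (route (pos s)) = side t * F (route (pos t))"
    and d: "route (pos s) - route (pos t) \<in> gauss_ints" using assms by (simp_all add: kcurve_def torus_point_eq)
  moreover have "F (route (pos s)) = F (route (pos t))" using F_cong[OF d] .
  ultimately show "side s = side t" using F_route(2)[of s] F_route(2)[of t] by auto
qed (use assms in \<open>simp add: kcurve_def torus_point_eq\<close>)

lemma kcurve_same_edge:
  assumes "kcurve s = kcurve t" "pos s \<le> 1 \<and> pos t \<le> 1 \<or> 1 \<le> pos s \<and> 1 \<le> pos t"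
  shows "s - t \<in> \<int>"
  using pos_side_inj[OF route_edge] kcurve_eq[OF assms(1)] assms(2) pos_range by blast

definition ta :: "label \<Rightarrow> real" where "ta = (\<lambda>(s, b, k). param s (pa b k))"
definition tb :: "label \<Rightarrow> real" where "tb = (\<lambda>(s, b, k). param s (pb b k))"

lemma label_params:
  assumes "(s, b, k) \<in> labels N"
  shows "pos (ta (s, b, k)) = pa b k" "pos (tb (s, b, k)) = pb b k"
    "side (ta (s, b, k)) = (if s then - 1 else 1)" "side (tb (s, b, k)) = (if s then - 1 else 1)"
    "kcurve (tb (s, b, k)) = kcurve (ta (s, b, k))" "ta (s, b, k) - tb (s, b, k) \<notin> \<int>"
proof -
  have k: "1 \<le> k" "k \<le> N" using assms by (auto simp: labels_def)
  note P = pa_pb[OF k, of b]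
  have r: "pmin < pa b k" "pa b k < pmax" "pmin < pb b k" "pb b k < pmax" using P pmin_pmax by linarith+
  show p: "pos (ta (s, b, k)) = pa b k" "pos (tb (s, b, k)) = pb b k"
    "side (ta (s, b, k)) = (if s then - 1 else 1)" "side (tb (s, b, k)) = (if s then - 1 else 1)"
    unfolding ta_def tb_def prod.case using param[OF r(1,2)] param[OF r(3,4)] by blast+
  have "route (pb b k) - route (pa b k) \<in> gauss_ints" using gauss_ints_diff[OF gauss_ints_0 P(6)] by simp
  then show "kcurve (tb (s, b, k)) = kcurve (ta (s, b, k))"
    unfolding kcurve_def p torus_point_eq using F_cong by auto
  show "ta (s, b, k) - tb (s, b, k) \<notin> \<int>" using pos_cong(1)[of "ta (s, b, k)" "tb (s, b, k)"] p P by auto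
qed

text \<open>Each edge is simple modulo the lattice, so a double point is passed once on either edge;
  \<open>route_meet\<close> yields the family and k, and the common side the sheet.\<close>

lemma double_label:
  assumes "double_params kcurve s t"
  obtains x where "x \<in> labels N" "s - ta x \<in> \<int> \<and> t - tb x \<in> \<int> \<or> s - tb x \<in> \<int> \<and> t - ta x \<in> \<int>"
proof -
  have *: "\<exists>x\<in>labels N. s - ta x \<in> \<int> \<and> t - tb x \<in> \<int>" if st: "kcurve s = kcurve t" "s - t \<notin> \<int>" "pos s \<le> 1" "1 \<le> pos t" for s t
  proof -
    note e = kcurve_eq[OF st(1)]
    have ne: "pos s \<noteq> pos t" using pos_side_inj e(1) st(2) by blast
    obtain b k where bk: "1 \<le> k" "k \<le> N" "pos s = pa b k" "pos t = pb b k"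
      using route_meet[OF pos_range(1) st(3,4) pos_range(2) e(2) ne] .
    note P = pa_pb[OF bk(1,2), of b]
    obtain l where "side s = (if l then - 1 else 1)"
      by (rule pos_cases[of s]) (use bk P pmin_pmax in auto)
    moreover have x: "(l, b, k) \<in> labels N" using bk by (simp add: labels_def)
    ultimately show ?thesis
      using label_params[OF x] bk e(1) pos_side_inj[of s "ta (l, b, k)"] pos_side_inj[of t "tb (l, b, k)"]
      by (intro bexI[OF _ x]) auto
  qed
  have st: "kcurve s = kcurve t" "s - t \<notin> \<int>" using assms by (auto simp: double_params_def)
  have ts: "t - s \<notin> \<int>" using st(2) Ints_minus[of "t - s"] by auto
  consider "pos s \<le> 1" "1 \<le> pos t" | "pos t \<le> 1" "1 \<le> pos s"
    using kcurve_same_edge[OF st(1)] st(2) by linarith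
  then show ?thesis
  proof cases
    case 1 then show ?thesis using *[OF st 1] that by blast
  next
    case 2 then show ?thesis using *[OF st(1)[symmetric] ts 2] that by blast
  qed
qed

lemma label_curve_inj:
  assumes x: "x \<in> labels N" and y: "y \<in> labels N" and eq: "kcurve (ta x) = kcurve (ta y)"
  shows "x = y"
proof -
  obtain s b k where x': "x = (s, b, k)" by (cases x)
  obtain s' b' l where y': "y = (s', b', l)" by (cases y)
  note X = label_params[OF x[unfolded x']] and Y = label_params[OF y[unfolded y']]
  have kl: "1 \<le> k" "k \<le> N" "1 \<le> l" "l \<le> N" using x y by (auto simp: labels_def x' y')
  have "s = s'" using kcurve_eq(1)[OF eq] X Y by (auto simp: x' y' split: if_splits)
  have "ta x - ta y \<in> \<int>"
    by (rule kcurve_same_edge[OF eq]) (use X Y pa_pb[OF kl(1,2), of b] pa_pb[OF kl(3,4), of b'] in \<open>simp add: x' y'\<close>)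
  then have pp: "pa b k = pa b' l" using pos_cong(1)[of "ta x" "ta y"] X Y by (simp add: x' y')
  \<comment> \<open>Modulo 4. A position 2k/H of one family cannot equal a position 1 - 2l/H of the
    other, as this would mean 4k + 4l = 4N + 1.\<close>
  have "4 * int N + 1 \<noteq> 4 * int k + 4 * int l" by presburger
  then have ne: "4 * real N + 1 \<noteq> 4 * real k + 4 * real l" by linarith
  have "(if b then 2 * real k else H - 2 * real k) = (if b' then 2 * real l else H - 2 * real l)"
    using pa_mult[of b k] pa_mult[of b' l] pp by simp
  then have "b = b' \<and> k = l" using ne by (cases b; cases b') (simp_all add: H_def)
  then show ?thesis using \<open>s = s'\<close> by (simp add: x' y')
qed

lemma straight_strand:
  assumes "pmin < p" "p < pmax" "p \<noteq> 1"
  shows "\<exists>\<epsilon>>0. \<forall>x. \<bar>x\<bar> < \<epsilon> \<longrightarrow> (let z = route p + of_real x * (of_real ((if s then - speed else speed)) * (if p < 1 then va else vb)) in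
     kcurve (param s p + x) = torus_point z ((if s then - 1 else 1) * F z))"
proof -
  define \<eta> where "\<eta> = (if s then - speed else speed)"
  define d where "d = Min {p - pmin, pmax - p, \<bar>p - 1\<bar>}"
  have d: "d > 0" "d \<le> p - pmin" "d \<le> pmax - p" "d \<le> \<bar>p - 1\<bar>" using assms by (auto simp: d_def)
  show ?thesis
  proof (rule exI[of _ "d / speed"], intro conjI allI impI)
    show "d / speed > 0" using d speed by simp
    fix x assume x: "\<bar>x\<bar> < d / speed"
    then have "\<bar>x\<bar> * speed < d" using speed by (simp add: field_simps)
    moreover have "\<bar>\<eta> * x\<bar> = \<bar>x\<bar> * speed" using speed by (simp add: \<eta>_def abs_mult)
    ultimately have "\<bar>\<eta> * x\<bar> < d" by simp
    then have a: "\<eta> * x < d" "- d < \<eta> * x" by linarith+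
    have "p + \<eta> * x < 1 \<and> p < 1 \<or> 1 < p + \<eta> * x \<and> 1 < p"
    proof (cases "p < 1")
      case True
      then have "p + \<eta> * x < 1" using a(1) d(4) by linarith
      then show ?thesis using True by blast
    next
      case False
      then have "1 < p + \<eta> * x" using a(2) d(4) assms(3) by linarith
      then show ?thesis using False assms(3) by linarith
    qed
    then have q: "pmin < p + \<eta> * x" "p + \<eta> * x < pmax" "p + \<eta> * x < 1 \<longleftrightarrow> p < 1" "p + \<eta> * x \<noteq> 1"
      using a d(2,3) by auto
    have "param s p + x = param s (p + \<eta> * x)" using speed by (simp add: param_def \<eta>_def field_simps)
    moreover have "route (p + \<eta> * x) = route p + of_real x * (of_real \<eta> * (if p < 1 then va else vb))"
      using q(3,4) assms(3) by (auto simp: route_def algebra_simps)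
    ultimately show "let z = route p + of_real x * (of_real (if s then - speed else speed) * (if p < 1 then va else vb)) in
        kcurve (param s p + x) = torus_point z ((if s then - 1 else 1) * F z)"
      using param(1,2)[OF q(1,2), of s] by (simp add: kcurve_def \<eta>_def[symmetric] Let_def)
  qed
qed

text \<open>A lattice translation lets both branches pass through the same point of the plane. On
  the lower sheet both are traversed backwards, which preserves their determinant, but the
  projection reverses orientation; so the sheets have opposite signs.\<close>

lemma label_crossing:
  assumes x: "x \<in> labels N"
  shows "transverse_at C kcurve (ta x) (tb x)" "transverse_at C kcurve (tb x) (ta x)"
    "crosses C kcurve (ta x) (tb x) (if fst x then 1 else - 1)" "crosses C kcurve (tb x) (ta x) (if fst x then - 1 else 1)"
proof -
  obtain s b k where x': "x = (s, b, k)" by (cases x)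
  have k: "1 \<le> k" "k \<le> N" using x by (auto simp: labels_def x')
  note P = pa_pb[OF k, of b]
  have r: "pmin < pa b k" "pa b k < pmax" "pa b k \<noteq> 1" "pmin < pb b k" "pb b k < pmax" "pb b k \<noteq> 1" using P pmin_pmax by linarith+
  define \<eta> where "\<eta> = (if s then - speed else speed)"
  define \<sigma> where "\<sigma> = (if s then - 1 else 1 :: real)"
  define z0 l where "z0 = route (pa b k)" and "l = route (pb b k) - route (pa b k)"
  have l: "l \<in> gauss_ints" using gauss_ints_diff[OF gauss_ints_0 P(6)] by (simp add: l_def)
  obtain \<epsilon>1 where e1: "\<epsilon>1 > 0" "\<And>x. \<bar>x\<bar> < \<epsilon>1 \<Longrightarrow> kcurve (param s (pa b k) + x) =
      torus_point (z0 + of_real x * (of_real \<eta> * va)) (\<sigma> * F (z0 + of_real x * (of_real \<eta> * va)))"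
    using straight_strand[OF r(1-3), of s] P(2) by (auto simp: Let_def z0_def \<eta>_def \<sigma>_def)
  obtain \<epsilon>2 where e2: "\<epsilon>2 > 0" "\<And>x. \<bar>x\<bar> < \<epsilon>2 \<Longrightarrow> kcurve (param s (pb b k) + x) =
      torus_point (route (pb b k) + of_real x * (of_real \<eta> * vb)) (\<sigma> * F (route (pb b k) + of_real x * (of_real \<eta> * vb)))"
    using straight_strand[OF r(4-6), of s] P(3) by (auto simp: Let_def \<eta>_def \<sigma>_def)
  define \<epsilon> where "\<epsilon> = min \<epsilon>1 \<epsilon>2"
  have \<epsilon>: "\<epsilon> > 0" "\<epsilon> \<le> \<epsilon>1" "\<epsilon> \<le> \<epsilon>2" using e1(1) e2(1) by (auto simp: \<epsilon>_def)
  have A: "kcurve (ta x + y) = torus_point (z0 + of_real y * (of_real \<eta> * va)) (\<sigma> * F (z0 + of_real y * (of_real \<eta> * va)))"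
    if "\<bar>y\<bar> < \<epsilon>" for y
    using e1(2)[of y] that \<epsilon> by (simp add: ta_def x')
  have B: "kcurve (tb x + y) = torus_point (z0 + of_real y * (of_real \<eta> * vb)) (\<sigma> * F (z0 + of_real y * (of_real \<eta> * vb)))"
    if "\<bar>y\<bar> < \<epsilon>" for y
  proof -
    define w where "w = z0 + of_real y * (of_real \<eta> * vb)"
    have eq: "route (pb b k) + of_real y * (of_real \<eta> * vb) = w + l" by (simp add: z0_def l_def w_def)
    have "kcurve (tb x + y) = torus_point (w + l) (\<sigma> * F (w + l))"
      using e2(2)[of y] that \<epsilon> unfolding eq by (simp add: tb_def x')
    also have "\<dots> = torus_point w (\<sigma> * F w)" unfolding torus_point_eq F_shift[OF l] using l by simp
    finally show ?thesis unfolding w_def .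
  qed
  have \<sigma>: "\<sigma> \<in> {1, - 1}" by (simp add: \<sigma>_def)
  have z0: "F z0 > 0" using route_clear[OF r(1,2)] by (simp add: z0_def)
  have D: "Im (cnj (of_real \<eta> * va) * (of_real \<eta> * vb)) = - (speed * speed * H)"
    "Im (cnj (of_real \<eta> * vb) * (of_real \<eta> * va)) = speed * speed * H"
    by (simp_all add: va_def vb_def \<eta>_def algebra_simps)
  have SH: "speed * speed * H > 0" using speed H by simp
  have n: "Im (cnj (of_real \<eta> * va) * (of_real \<eta> * vb)) \<noteq> 0" "Im (cnj (of_real \<eta> * vb) * (of_real \<eta> * va)) \<noteq> 0"
    unfolding D using speed H by simp_all
  have g: "\<sigma> * - (speed * speed * H) > 0 \<longleftrightarrow> s" "\<sigma> * (speed * speed * H) > 0 \<longleftrightarrow> \<not> s" using SH by (auto simp: \<sigma>_def)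
  note S1 = straight_crossing[OF \<sigma> z0 n(1) \<epsilon>(1) A B, unfolded D g] and S2 = straight_crossing[OF \<sigma> z0 n(2) \<epsilon>(1) B A, unfolded D g]
  show "transverse_at C kcurve (ta x) (tb x)" "transverse_at C kcurve (tb x) (ta x)" using S1(1) S2(1) by blast+
  show "crosses C kcurve (ta x) (tb x) (if fst x then 1 else - 1)" "crosses C kcurve (tb x) (ta x) (if fst x then - 1 else 1)"
    using S1(2) S2(2) by (auto simp: x' split: if_splits)
qed

definition over_time :: "label \<Rightarrow> real" where "over_time x = (if special N x then tb x else ta x)"
definition under_time :: "label \<Rightarrow> real" where "under_time x = (if special N x then ta x else tb x)"

definition knot :: "point diagram" where
  "knot = \<lparr>surface = XT, charts = C, curve = kcurve, over = {t. \<exists>x\<in>labels N. t - over_time x \<in> \<int>}\<rparr>"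

lemma times:
  assumes "x \<in> labels N"
  shows "kcurve (over_time x) = kcurve (ta x)" "kcurve (under_time x) = kcurve (ta x)" "over_time x - under_time x \<notin> \<int>"
proof -
  obtain s b k where x: "x = (s, b, k)" by (cases x)
  note L = label_params[OF assms[unfolded x], folded x]
  show "kcurve (over_time x) = kcurve (ta x)" "kcurve (under_time x) = kcurve (ta x)" using L by (simp_all add: over_time_def under_time_def)
  show "over_time x - under_time x \<notin> \<int>"
    using L(6) Ints_minus[of "tb x - ta x"] by (auto simp: over_time_def under_time_def)
qed

lemma over_times:
  assumes "x \<in> labels N"
  shows "over_time x \<in> over knot" "under_time x \<notin> over knot"
proof -
  show "over_time x \<in> over knot" using assms by (auto simp: knot_def intro!: bexI[of _ x])
  show "under_time x \<notin> over knot"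
  proof
    assume "under_time x \<in> over knot"
    then obtain y where y: "y \<in> labels N" "under_time x - over_time y \<in> \<int>" by (auto simp: knot_def)
    then have "kcurve (ta x) = kcurve (ta y)" using pos_cong(3)[OF y(2)] times assms by simp
    then have "x = y" using label_curve_inj assms y(1) by blast
    then show False using y(2) times(3)[OF assms] Ints_minus[of "under_time x - over_time x"] by simp
  qed
qed

lemma knot_over_cong: "s - t \<in> \<int> \<Longrightarrow> s \<in> over knot \<longleftrightarrow> t \<in> over knot"
proof -
  have "t \<in> over knot" if st: "s - t \<in> \<int>" "s \<in> over knot" for s t
  proof -
    obtain x where x: "x \<in> labels N" "s - over_time x \<in> \<int>" using st(2) by (auto simp: knot_def)
    have "t - over_time x \<in> \<int>" using Ints_diff[OF x(2) st(1)] by simp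
    then show ?thesis using x(1) by (auto simp: knot_def)
  qed
  moreover assume "s - t \<in> \<int>"
  moreover from this have "t - s \<in> \<int>" using Ints_minus[of "s - t"] by simp
  ultimately show ?thesis by blast
qed

lemma continuous_pos: "continuous_on S pos"
  unfolding pos_def[abs_def] by (intro continuous_intros continuous_wave)

lemma closed_kcurve: "closed_curve XT kcurve"
proof -
  have "continuous_on UNIV (\<lambda>t. side t * F (route (pos t)))"
    unfolding side_def
  proof (rule continuous_sgn_mult)
    show "continuous_on UNIV (\<lambda>t. F (route (pos t)))"
      by (rule continuous_on_compose2[OF continuous_F[of UNIV]])
         (auto intro: continuous_on_compose2[OF continuous_route[of UNIV] continuous_pos])
    show "F (route (pos t)) = 0" if "sin (2 * pi * t) = 0" for t using F_route(2)[of t] that by (simp add: side_def)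
  qed (intro continuous_intros)
  then have "continuous_on UNIV kcurve" unfolding kcurve_def[abs_def]
    by (intro continuous_torus_point continuous_on_compose2[OF continuous_route[of UNIV] continuous_pos]) auto
  moreover have "kcurve t \<in> X" for t
  proof -
    have "\<bar>side t\<bar> = 1 \<or> side t = 0" by (auto simp: side_def sgn_if)
    then have "\<bar>side t * F (route (pos t))\<bar> = F (route (pos t))" using F_route[of t] by (auto simp: abs_mult)
    then show ?thesis by (simp add: kcurve_def torus_point_in_X)
  qed
  moreover have "kcurve (t + 1) = kcurve t" for t by (rule pos_cong(3)) simp
  ultimately show ?thesis by (auto simp: closed_curve_def continuous_map_in_subtopology image_subset_iff)
qed

lemma transverse_shift:
  assumes "transverse_at C kcurve s' t'" "s - s' \<in> \<int>" "t - t' \<in> \<int>"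
  shows "transverse_at C kcurve s t"
proof -
  have "kcurve (s + x) = kcurve (s' + x)" "kcurve (t + x) = kcurve (t' + x)" for x
    by (rule pos_cong(3); use assms in simp)+
  then show ?thesis using assms(1) unfolding transverse_at_def by simp
qed

lemma crossing_points_knot: "crossing_points knot = (\<lambda>x. kcurve (ta x)) ` labels N"
proof (intro set_eqI iffI)
  fix p assume "p \<in> crossing_points knot"
  then obtain s t where st: "p = kcurve s" "double_params kcurve s t" by (auto simp: crossing_points_def knot_def)
  obtain x where x: "x \<in> labels N" "s - ta x \<in> \<int> \<and> t - tb x \<in> \<int> \<or> s - tb x \<in> \<int> \<and> t - ta x \<in> \<int>"
    using double_label[OF st(2)] .
  have "kcurve s = kcurve t" using st(2) by (simp add: double_params_def)
  then have "p = kcurve (ta x)" using x(2) st(1) pos_cong(3) by metis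
  then show "p \<in> (\<lambda>x. kcurve (ta x)) ` labels N" using x(1) by blast
next
  fix p assume "p \<in> (\<lambda>x. kcurve (ta x)) ` labels N"
  then obtain x where x: "x \<in> labels N" "p = kcurve (ta x)" by blast
  then show "p \<in> crossing_points knot"
    using times[OF x(1)] unfolding crossing_points_def double_params_def knot_def by simp metis
qed

lemma generic_kcurve: "generic_immersion C kcurve"
  unfolding generic_immersion_def
proof (intro conjI allI impI)
  fix t
  have "isCont pos t" using continuous_pos[of UNIV] by (simp add: continuous_on_eq_continuous_at)
  \<comment> \<open>The two positions of a crossing are at least 1/H apart, so a parameter interval
    on which the position stays within 1/(2 H) of its value at the centre contains no double
    point.\<close>
  then obtain d where d: "d > 0" "\<And>s. dist s t < d \<Longrightarrow> dist (pos s) (pos t) < 1 / (2 * H)"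
    unfolding continuous_at_eps_delta using H by (metis divide_pos_pos less_le_trans mult_pos_pos zero_less_numeral zero_less_one)
  define \<epsilon> where "\<epsilon> = min d (1/2)"
  have "inj_on kcurve {t - \<epsilon><..<t + \<epsilon>}"
  proof (rule inj_onI, rule ccontr)
    fix r s assume rs: "r \<in> {t - \<epsilon><..<t + \<epsilon>}" "s \<in> {t - \<epsilon><..<t + \<epsilon>}" "kcurve r = kcurve s" "r \<noteq> s"
    have "\<bar>r - s\<bar> < 1" "dist r t < d" "dist s t < d" using rs(1,2) by (auto simp: \<epsilon>_def dist_real_def)
    then have "r - s \<notin> \<int>" using Ints_abs_less_1[of "r - s"] rs(4) by auto
    then have "double_params kcurve r s" using rs(3) by (simp add: double_params_def)
    then obtain x where x: "x \<in> labels N" "r - ta x \<in> \<int> \<and> s - tb x \<in> \<int> \<or> r - tb x \<in> \<int> \<and> s - ta x \<in> \<int>"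
      using double_label by blast
    obtain l b k where x': "x = (l, b, k)" by (cases x)
    have k: "1 \<le> k" "k \<le> N" using x(1) by (auto simp: labels_def x')
    have "pos r = pa b k \<and> pos s = pb b k \<or> pos r = pb b k \<and> pos s = pa b k"
      using x(2) label_params(1,2)[OF x(1)[unfolded x']] pos_cong(1) unfolding x' by metis
    then have "1 / H \<le> \<bar>pos r - pos s\<bar>" using pa_pb(5)[OF k, of b] by auto
    moreover have "\<bar>pos r - pos s\<bar> < 1 / (2 * H) + 1 / (2 * H)"
      using d(2)[OF \<open>dist r t < d\<close>] d(2)[OF \<open>dist s t < d\<close>] by (simp add: dist_real_def)
    ultimately show False by (simp add: field_simps)
  qed
  then show "\<exists>\<epsilon>>0. inj_on kcurve {t - \<epsilon><..<t + \<epsilon>}" using d(1) by (intro exI[of _ \<epsilon>]) (simp add: \<epsilon>_def)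
next
  have "finite (crossing_points knot)" unfolding crossing_points_knot using finite_labels by simp
  then show "finite {kcurve s |s. \<exists>t. double_params kcurve s t}" by (simp add: crossing_points_def knot_def)
next
  fix r s t assume eq: "kcurve r = kcurve s \<and> kcurve s = kcurve t"
  consider "pos r \<le> 1 \<and> pos s \<le> 1 \<or> 1 \<le> pos r \<and> 1 \<le> pos s" | "pos s \<le> 1 \<and> pos t \<le> 1 \<or> 1 \<le> pos s \<and> 1 \<le> pos t"
    | "pos r \<le> 1 \<and> pos t \<le> 1 \<or> 1 \<le> pos r \<and> 1 \<le> pos t" by linarith
  then show "r - s \<in> \<int> \<or> s - t \<in> \<int> \<or> r - t \<in> \<int>"
    using kcurve_same_edge[of r s] kcurve_same_edge[of s t] kcurve_same_edge[of r t] eq by metis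
next
  fix s t assume "double_params kcurve s t"
  then obtain x where x: "x \<in> labels N" "s - ta x \<in> \<int> \<and> t - tb x \<in> \<int> \<or> s - tb x \<in> \<int> \<and> t - ta x \<in> \<int>"
    using double_label by blast
  then show "transverse_at C kcurve s t"
    using transverse_shift[OF label_crossing(1)[OF x(1)]] transverse_shift[OF label_crossing(2)[OF x(1)]] by blast
qed

lemma knot_in_diagrams: "knot \<in> diagrams"
proof -
  have "crossing_information kcurve (over knot)"
    unfolding crossing_information_def
  proof (intro conjI allI impI)
    show "over knot \<subseteq> {s. \<exists>t. double_params kcurve s t}"
    proof
      fix s assume "s \<in> over knot"
      then obtain x where x: "x \<in> labels N" "s - over_time x \<in> \<int>" by (auto simp: knot_def)
      have "kcurve s = kcurve (under_time x)" using pos_cong(3)[OF x(2)] times[OF x(1)] by simp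
      moreover have "s - under_time x \<notin> \<int>"
        using Ints_diff[of "s - under_time x" "s - over_time x"] x(2) times(3)[OF x(1)] by auto
      ultimately show "s \<in> {s. \<exists>t. double_params kcurve s t}" by (auto simp: double_params_def)
    qed
    show "t + 1 \<in> over knot \<longleftrightarrow> t \<in> over knot" for t by (rule knot_over_cong) simp
    fix s t assume "double_params kcurve s t"
    then obtain x where x: "x \<in> labels N" "s - ta x \<in> \<int> \<and> t - tb x \<in> \<int> \<or> s - tb x \<in> \<int> \<and> t - ta x \<in> \<int>"
      using double_label by blast
    have "ta x \<in> over knot \<longleftrightarrow> tb x \<notin> over knot"
      using over_times[OF x(1)] by (auto simp: over_time_def under_time_def split: if_splits)
    then show "s \<in> over knot \<longleftrightarrow> t \<notin> over knot" using x(2) knot_over_cong by blast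
  qed
  then show ?thesis
    using closed_oriented_surface_C closed_kcurve generic_kcurve by (simp add: diagrams_def knot_def)
qed

text \<open>Along the curve a position p on the upper sheet counts as p, which is below 2, and on
  the lower sheet as 4 - p, which is above 2. At crossings the factor 4N + 1 = 2H turns these
  numbers into the integers \<open>end_a\<close> and \<open>end_b\<close>.\<close>

lemma param_order:
  fixes V W :: int
  assumes p: "pmin < p" "p < pmax" and q: "pmin < q" "q < pmax"
    and V: "real_of_int V = (if s then 4 * (4 * real N + 1) - (4 * real N + 1) * p else (4 * real N + 1) * p)"
    and W: "real_of_int W = (if s' then 4 * (4 * real N + 1) - (4 * real N + 1) * q else (4 * real N + 1) * q)"
  shows "param s p < param s' q \<longleftrightarrow> V < W"
proof -
  have "V < W \<longleftrightarrow> real_of_int V < real_of_int W" by simp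
  also have "\<dots> \<longleftrightarrow> (if s then 4 - p else p) < (if s' then 4 - q else q)"
  proof -
    have "real_of_int V = (4 * real N + 1) * (if s then 4 - p else p)" "real_of_int W = (4 * real N + 1) * (if s' then 4 - q else q)"
      using V W by (simp_all add: algebra_simps)
    then show ?thesis by (simp only: mult_less_cancel_left_pos)
  qed
  also have "\<dots> \<longleftrightarrow> param s p < param s' q"
  proof (cases "s = s'")
    case True
    then show ?thesis using speed by (auto simp: param_def divide_less_cancel)
  next
    case False
    then show ?thesis using param(5,6)[OF p] param(5,6)[OF q] p q pmin_pmax by (cases s) auto
  qed
  finally show ?thesis ..
qed

lemma arc_in_arc:
  assumes "0 \<le> s" "s < 1" "0 \<le> t" "t < 1" "0 \<le> p" "p < 1"
    and "s < t \<longleftrightarrow> S < T" "s < p \<longleftrightarrow> S < P" "p < t \<longleftrightarrow> P < T" and "s \<noteq> p" "t \<noteq> s" "t \<noteq> p"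
  shows "arc s t p \<longleftrightarrow> in_arc S T P"
proof -
  have "frac s = s" "frac t = t" "frac p = p" using assms(1-6) by (simp_all add: frac_eq)
  then have "frac (p - s) = (if s \<le> p then p - s else p - s + 1)" "frac (t - s) = (if s \<le> t then t - s else t - s + 1)"
    by (simp_all add: frac_diff_eq)
  then show ?thesis using assms unfolding arc_def in_arc_def by (auto split: if_splits)
qed

lemma end_params:
  assumes x: "x \<in> labels N"
  obtains s p where "ta x = param s p" "pmin < p" "p < pmax"
    "real_of_int (end_a N x) = (if s then 4 * (4 * real N + 1) - (4 * real N + 1) * p else (4 * real N + 1) * p)"
proof -
  obtain s b k where x': "x = (s, b, k)" by (cases x)
  have k: "1 \<le> k" "k \<le> N" using x by (auto simp: labels_def x')
  note P = pa_pb[OF k, of b]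
  have "(4 * real N + 1) * pa b k = 2 * (pa b k * H)" by (simp add: H_def algebra_simps)
  also have "\<dots> = (if b then 4 * real k else 4 * real N + 1 - 4 * real k)" unfolding pa_mult by (simp add: H_def)
  finally have e: "(4 * real N + 1) * pa b k = (if b then 4 * real k else 4 * real N + 1 - 4 * real k)" .
  have r: "pmin < pa b k" "pa b k < pmax" using P pmin_pmax by linarith+
  show ?thesis
    by (rule that[of s "pa b k", OF _ r]) (simp_all add: ta_def x' end_a_def e Let_def)
qed

lemma end_params':
  assumes x: "x \<in> labels N"
  obtains s p where "tb x = param s p" "pmin < p" "p < pmax"
    "real_of_int (end_b N x) = (if s then 4 * (4 * real N + 1) - (4 * real N + 1) * p else (4 * real N + 1) * p)"
proof -
  obtain s b k where x': "x = (s, b, k)" by (cases x)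
  have k: "1 \<le> k" "k \<le> N" using x by (auto simp: labels_def x')
  note P = pa_pb[OF k, of b]
  have "(4 * real N + 1) * pb b k = 2 * (pb b k * H)" by (simp add: H_def algebra_simps)
  also have "\<dots> = (if b then 2 * (4 * real N + 1) - 2 * real k else 4 * real N + 1 + 2 * real k)" unfolding pb_mult by (simp add: H_def)
  finally have e: "(4 * real N + 1) * pb b k = (if b then 2 * (4 * real N + 1) - 2 * real k else 4 * real N + 1 + 2 * real k)" .
  have r: "pmin < pb b k" "pb b k < pmax" using P pmin_pmax by linarith+
  show ?thesis
    by (rule that[of s "pb b k", OF _ r]) (simp_all add: tb_def x' end_b_def e Let_def)
qed

lemma knot_arc:
  assumes "x \<in> labels N" "y \<in> labels N"
    and u: "u = over_time y \<and> W = over_end N y \<or> u = under_time y \<and> W = under_end N y" and "x \<noteq> y"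
  shows "arc (over_time x) (under_time x) u \<longleftrightarrow> in_arc (over_end N x) (under_end N x) W"
proof -
  have ends: "\<exists>s p. t = param s p \<and> pmin < p \<and> p < pmax \<and>
      real_of_int E = (if s then 4 * (4 * real N + 1) - (4 * real N + 1) * p else (4 * real N + 1) * p)"
    if "z \<in> labels N" "t = over_time z \<and> E = over_end N z \<or> t = under_time z \<and> E = under_end N z" for z t E
  proof -
    have "t = ta z \<and> E = end_a N z \<or> t = tb z \<and> E = end_b N z"
      using that(2) by (auto simp: over_time_def under_time_def over_end_def under_end_def)
    then show ?thesis using end_params[OF that(1)] end_params'[OF that(1)] by metis
  qed
  have X: "over_time x = over_time x \<and> over_end N x = over_end N x \<or> over_time x = under_time x \<and> over_end N x = under_end N x"
    "under_time x = over_time x \<and> under_end N x = over_end N x \<or> under_time x = under_time x \<and> under_end N x = under_end N x"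
    by blast+
  obtain s1 p1 where 1: "over_time x = param s1 p1" "pmin < p1" "p1 < pmax"
    "real_of_int (over_end N x) = (if s1 then 4 * (4 * real N + 1) - (4 * real N + 1) * p1 else (4 * real N + 1) * p1)"
    using ends[OF assms(1) X(1)] by blast
  obtain s2 p2 where 2: "under_time x = param s2 p2" "pmin < p2" "p2 < pmax"
    "real_of_int (under_end N x) = (if s2 then 4 * (4 * real N + 1) - (4 * real N + 1) * p2 else (4 * real N + 1) * p2)"
    using ends[OF assms(1) X(2)] by blast
  obtain s3 p3 where 3: "u = param s3 p3" "pmin < p3" "p3 < pmax"
    "real_of_int W = (if s3 then 4 * (4 * real N + 1) - (4 * real N + 1) * p3 else (4 * real N + 1) * p3)"
    using ends[OF assms(2) u] by blast
  have "kcurve u = kcurve (ta y)" using times[OF assms(2)] u by auto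
  then have ne: "u \<noteq> over_time x" "u \<noteq> under_time x" "over_time x \<noteq> under_time x"
    using times[OF assms(1)] label_curve_inj[OF assms(1,2)] assms(4) by auto
  show ?thesis
    by (rule arc_in_arc)
       (use ne 1 2 3 param(3,4)[OF 1(2,3)] param(3,4)[OF 2(2,3)] param(3,4)[OF 3(2,3)]
          param_order[OF 1(2,3) 2(2,3) 1(4) 2(4)] param_order[OF 1(2,3) 3(2,3) 1(4) 3(4)] param_order[OF 3(2,3) 2(2,3) 3(4) 2(4)]
        in \<open>auto simp: less_imp_le\<close>)
qed

lemma knot_iso: "gauss_iso (\<lambda>x. kcurve (ta x)) (knot_gauss N) (gauss_of knot)"
  unfolding gauss_iso_def
proof (intro conjI ballI impI)
  have c: "curve knot = kcurve" "charts knot = C" by (simp_all add: knot_def)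
  have ch: "chords (knot_gauss N) = labels N" by (simp add: knot_gauss_def)
  show "bij_betw (\<lambda>x. kcurve (ta x)) (chords (knot_gauss N)) (chords (gauss_of knot))"
  proof -
    have "inj_on (\<lambda>x. kcurve (ta x)) (labels N)" by (rule inj_onI) (rule label_curve_inj)
    then show ?thesis by (simp add: bij_betw_def ch crossing_points_knot)
  qed
  fix x assume "x \<in> chords (knot_gauss N)"
  then have x: "x \<in> labels N" by (simp add: ch)
  have X: "curve knot (over_time x) = kcurve (ta x)" "curve knot (under_time x) = kcurve (ta x)"
    "over_time x \<in> over knot" "under_time x \<notin> over knot"
    using times[OF x] over_times[OF x] by (simp_all add: c)
  have "crosses (charts knot) (curve knot) (over_time x) (under_time x) (if fst x \<or> special N x then 1 else - 1)"
    unfolding c using label_crossing(3,4)[OF x] by (auto simp: over_time_def under_time_def special_def split: if_splits)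
  from sign_gauss_of[OF knot_in_diagrams X this]
  show "sign (gauss_of knot) (kcurve (ta x)) = sign (knot_gauss N) x" by (simp add: knot_gauss_def)
  fix y assume "y \<in> chords (knot_gauss N)" and xy: "x \<noteq> y"
  then have y: "y \<in> labels N" by (simp add: ch)
  have Y: "curve knot (over_time y) = kcurve (ta y)" "curve knot (under_time y) = kcurve (ta y)"
    "over_time y \<in> over knot" "under_time y \<notin> over knot"
    using times[OF y] over_times[OF y] by (simp_all add: c)
  show "over_in (gauss_of knot) (kcurve (ta x)) (kcurve (ta y)) = over_in (knot_gauss N) x y"
    "under_in (gauss_of knot) (kcurve (ta x)) (kcurve (ta y)) = under_in (knot_gauss N) x y"
    unfolding arcs_gauss_of[OF knot_in_diagrams X Y]
    using knot_arc[OF x y _ xy] by (simp_all add: knot_gauss_def)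
qed

end


section \<open>Symmetries\<close>

definition reverse_weight :: "(int \<Rightarrow> int \<Rightarrow> int) \<Rightarrow> int \<Rightarrow> int \<Rightarrow> int" where
  "reverse_weight S = (\<lambda>m n. S (- n) (- m))"

definition negate_weight :: "(int \<Rightarrow> int \<Rightarrow> int) \<Rightarrow> int \<Rightarrow> int \<Rightarrow> int" where
  "negate_weight S = (\<lambda>m n. S (- m) (- n))"

lemma reduced_weights: "reduced S \<Longrightarrow> reduced (reverse_weight S)" "reduced S \<Longrightarrow> reduced (negate_weight S)"
  by (simp_all add: reduced_def reverse_weight_def negate_weight_def)

lemma weights_delta: "reverse_weight (delta a b) = delta (- b) (- a)" "negate_weight (delta a b) = delta (- a) (- b)"
  by (auto simp: reverse_weight_def negate_weight_def delta_def fun_eq_iff minus_equation_iff)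

lemma reduced_delta: "a \<noteq> 0 \<Longrightarrow> b \<noteq> 0 \<Longrightarrow> a \<noteq> b \<Longrightarrow> reduced (delta a b)"
  by (auto simp: reduced_def delta_def)

text \<open>The orientation-reversing homeomorphism of one surface guarantees that the horizontal
  mirror image of the class is not empty. The clause is inherited by reverse and mirror images, as
  these keep the surface.\<close>

definition profile :: "'a diagram set \<Rightarrow> (int \<Rightarrow> int) \<Rightarrow> ((int \<Rightarrow> int \<Rightarrow> int) \<Rightarrow> int) \<Rightarrow> bool" where
  "profile K f g \<longleftrightarrow> K \<subseteq> diagrams \<and>
     (\<exists>D\<in>K. \<exists>\<phi>. orientation_reversing_homeo (surface D) (charts D) (surface D) (charts D) \<phi>) \<and>
     (\<forall>D\<in>K. (\<forall>n. n \<noteq> 0 \<longrightarrow> index_writhe (gauss_of D) n = f n) \<and>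
        (\<forall>S. reduced S \<longrightarrow> nesting S (gauss_of D) = g S))"

lemma virtual_equivalence_refl: "D \<in> diagrams \<Longrightarrow> (D, D) \<in> virtual_equivalence"
  using equiv_virtual_equivalence by (auto simp: equiv_def refl_on_def)

lemma profile_closure:
  assumes T: "T \<subseteq> diagrams"
    and m: "\<exists>D\<in>T. \<exists>\<phi>. orientation_reversing_homeo (surface D) (charts D) (surface D) (charts D) \<phi>"
    and J: "\<And>D n. D \<in> T \<Longrightarrow> n \<noteq> 0 \<Longrightarrow> index_writhe (gauss_of D) n = f n"
    and V: "\<And>D S. D \<in> T \<Longrightarrow> reduced S \<Longrightarrow> nesting S (gauss_of D) = g S"
  shows "profile (virtual_equivalence `` T) f g"
  unfolding profile_def
proof (intro conjI ballI allI impI)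
  show "virtual_equivalence `` T \<subseteq> diagrams" by (auto simp: virtual_equivalence_def)
  show "\<exists>D\<in>virtual_equivalence `` T. \<exists>\<phi>. orientation_reversing_homeo (surface D) (charts D) (surface D) (charts D) \<phi>"
    using m T virtual_equivalence_refl by blast
  fix E assume "E \<in> virtual_equivalence `` T"
  then obtain D where D: "D \<in> T" "(D, E) \<in> virtual_equivalence" by blast
  have e: "gauss_equal (gauss_of D) (gauss_of E)" by (rule gauss_virtual_equivalence[OF D(2)])
  show "index_writhe (gauss_of E) n = f n" if "n \<noteq> 0" for n
    using e J[OF D(1) that] that by (simp add: gauss_equal_def)
  show "nesting S (gauss_of E) = g S" if "reduced S" for S
    using e V[OF D(1) that] that by (simp add: gauss_equal_def)
qed

lemma profile_reverse:
  assumes "profile K f g"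
  shows "profile (reverse_knot K) (\<lambda>n. f (- n)) (\<lambda>S. g (reverse_weight S))"
  unfolding reverse_knot_def
proof (rule profile_closure)
  have K: "K \<subseteq> diagrams" using assms by (simp add: profile_def)
  show "reverse_diagram ` K \<subseteq> diagrams" using K reverse_diagram_in_diagrams by blast
  show "\<exists>D\<in>reverse_diagram ` K. \<exists>\<phi>. orientation_reversing_homeo (surface D) (charts D) (surface D) (charts D) \<phi>"
    using assms by (auto simp: profile_def reverse_diagram_def)
  fix E assume "E \<in> reverse_diagram ` K"
  then obtain D where D: "D \<in> K" "E = reverse_diagram D" "D \<in> diagrams" using K by blast
  show "index_writhe (gauss_of E) n = f (- n)" if "n \<noteq> 0" for n
    using gauss_reverse(1)[OF D(3)] D(1,2) assms that by (simp add: profile_def)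
  show "nesting S (gauss_of E) = g (reverse_weight S)" if "reduced S" for S
    using gauss_reverse(2)[OF D(3), of S] D(1,2) assms reduced_weights(1)[OF that] by (simp add: profile_def reverse_weight_def)
qed

lemma profile_vertical:
  assumes "profile K f g"
  shows "profile (vertical_mirror K) (\<lambda>n. - f (- n)) (\<lambda>S. g (reverse_weight S))"
  unfolding vertical_mirror_def
proof (rule profile_closure)
  have K: "K \<subseteq> diagrams" using assms by (simp add: profile_def)
  show "switch_diagram ` K \<subseteq> diagrams" using K switch_diagram_in_diagrams by blast
  show "\<exists>D\<in>switch_diagram ` K. \<exists>\<phi>. orientation_reversing_homeo (surface D) (charts D) (surface D) (charts D) \<phi>"
    using assms by (auto simp: profile_def switch_diagram_def)
  fix E assume "E \<in> switch_diagram ` K"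
  then obtain D where D: "D \<in> K" "E = switch_diagram D" "D \<in> diagrams" using K by blast
  show "index_writhe (gauss_of E) n = - f (- n)" if "n \<noteq> 0" for n
    using gauss_switch(1)[OF D(3)] D(1,2) assms that by (simp add: profile_def)
  show "nesting S (gauss_of E) = g (reverse_weight S)" if "reduced S" for S
    using gauss_switch(2)[OF D(3), of S] D(1,2) assms reduced_weights(1)[OF that] by (simp add: profile_def reverse_weight_def)
qed

lemma profile_horizontal:
  assumes "profile K f g"
  shows "profile (horizontal_mirror K) (\<lambda>n. - f (- n)) (\<lambda>S. g (negate_weight S))"
  unfolding horizontal_mirror_def
proof (rule profile_closure)
  have K: "K \<subseteq> diagrams" using assms by (simp add: profile_def)
  show "{E. \<exists>D\<in>K. mirror_diagram D E} \<subseteq> diagrams" using K mirror_diagram_in_diagrams by blast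
  obtain D \<phi> where D: "D \<in> K" "orientation_reversing_homeo (surface D) (charts D) (surface D) (charts D) \<phi>"
    using assms by (auto simp: profile_def)
  define E where "E = D\<lparr>curve := \<phi> \<circ> curve D\<rparr>"
  have E: "mirror_diagram D E" using D(2) by (auto simp: mirror_diagram_def E_def)
  then have "surface E = surface D" "charts E = charts D" by (simp_all add: mirror_diagram_def)
  then show "\<exists>D\<in>{E. \<exists>D\<in>K. mirror_diagram D E}. \<exists>\<phi>. orientation_reversing_homeo (surface D) (charts D) (surface D) (charts D) \<phi>"
    using D E by (intro bexI[of _ E]) auto
next
  fix E assume "E \<in> {E. \<exists>D\<in>K. mirror_diagram D E}"
  then obtain D where D: "D \<in> K" "mirror_diagram D E" "D \<in> diagrams" using assms by (auto simp: profile_def)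
  note G = gauss_mirror[OF D(3) mirror_diagram_in_diagrams[OF D(3,2)] D(2)]
  show "index_writhe (gauss_of E) n = - f (- n)" if "n \<noteq> 0" for n
    using G(1) D(1) assms that by (simp add: profile_def)
  show "nesting S (gauss_of E) = g (negate_weight S)" if "reduced S" for S
    using G(2)[of S] D(1) assms reduced_weights(2)[OF that] by (simp add: profile_def negate_weight_def)
qed

text \<open>Three of the four nesting numbers are enough: exactly one of the four is 0, so it is
  either among the three or the missing one. The chosen diagram does not matter for classes that
  have a \<open>profile\<close>.\<close>

definition signature :: "nat \<Rightarrow> 'a diagram set \<Rightarrow> int list" where
  "signature N K = (let G = gauss_of (SOME D. D \<in> K) in
     [index_writhe G (int N), nesting (delta (- int N) (int (N - 1))) G, nesting (delta (- int (N - 1)) (int N)) G,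
      nesting (delta (int (N - 1)) (- int N)) G])"

lemma signature_profile:
  assumes "profile K f g" "N \<ge> 2"
  shows "signature N K = [f (int N), g (delta (- int N) (int (N - 1))), g (delta (- int (N - 1)) (int N)),
    g (delta (int (N - 1)) (- int N))]"
proof -
  have "\<exists>D. D \<in> K" using assms(1) by (auto simp: profile_def)
  then have "(SOME D. D \<in> K) \<in> K" by (rule someI_ex)
  moreover have "reduced (delta (- int N) (int (N - 1)))" "reduced (delta (- int (N - 1)) (int N))" "reduced (delta (int (N - 1)) (- int N))"
    using assms(2) by (intro reduced_delta; simp)+
  ultimately show ?thesis using assms by (simp add: signature_def profile_def Let_def)
qed

definition knot_class :: "nat \<Rightarrow> point diagram set" where
  "knot_class N = virtual_equivalence `` {knot_family.knot N}"

lemma profile_knot_class: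
  assumes "N \<ge> 2"
  shows "profile (knot_class N) (index_writhe (knot_gauss N)) (\<lambda>S. nesting S (knot_gauss N))"
  unfolding knot_class_def
proof (rule profile_closure)
  interpret knot_family N by unfold_locales (rule assms)
  show "{knot} \<subseteq> diagrams" using knot_in_diagrams by simp
  show "\<exists>D\<in>{knot}. \<exists>\<phi>. orientation_reversing_homeo (surface D) (charts D) (surface D) (charts D) \<phi>"
    using orientation_reversing_turn_over by (auto simp: knot_def)
  show "index_writhe (gauss_of D) n = index_writhe (knot_gauss N) n" if "D \<in> {knot}" for D n
    using that gauss_iso_index_writhe[OF knot_iso] by simp
  show "nesting S (gauss_of D) = nesting S (knot_gauss N)" if "D \<in> {knot}" for D S
    using that gauss_iso_nesting[OF knot_iso] by simp
qed

text \<open>The 0 appears as the second, third or fourth entry of the signature or not at all, and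
  each of these cases occurs once with index writhe 1 and once with - 1.\<close>

lemma distinct_symmetries:
  assumes N: "N \<ge> 2"
  defines "K \<equiv> knot_class N"
  shows "distinct [K, reverse_knot K, vertical_mirror K, horizontal_mirror K,
      reverse_knot (vertical_mirror K), reverse_knot (horizontal_mirror K),
      horizontal_mirror (vertical_mirror K),
      reverse_knot (horizontal_mirror (vertical_mirror K))]" (is "distinct ?L")
proof -
  note k = profile_knot_class[OF N, folded K_def]
  note v = profile_vertical[OF k] and h = profile_horizontal[OF k]
  note sg = signature_profile[OF _ N]
  have i1: "int (N - 1) = int N - 1" using N by simp
  have J: "index_writhe (knot_gauss N) (int N) = 1" "index_writhe (knot_gauss N) (- int N) = 1"
    using index_writhe_knot_gauss[of N] N by simp_all
  note V = nesting_knot_gauss[OF N]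
  have "distinct (map (signature N) ?L)"
    unfolding list.map sg[OF k] sg[OF profile_reverse[OF k]] sg[OF v] sg[OF h] sg[OF profile_reverse[OF v]]
      sg[OF profile_reverse[OF h]] sg[OF profile_horizontal[OF v]] sg[OF profile_reverse[OF profile_horizontal[OF v]]]
    unfolding weights_delta minus_minus J V by simp
  then show ?thesis by (simp only: distinct_map)
qed

theorem theorem1p3:
  shows "infinite {K \<in> virtual_knots.
    distinct [K, reverse_knot K, vertical_mirror K, horizontal_mirror K,
      reverse_knot (vertical_mirror K), reverse_knot (horizontal_mirror K),
      horizontal_mirror (vertical_mirror K),
      reverse_knot (horizontal_mirror (vertical_mirror K))]}" (is "infinite ?S")
proof -
  have "knot_class N \<in> ?S" if "N \<ge> 2" for N
  proof -
    interpret knot_family N by unfold_locales (rule that)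
    have "knot_class N \<in> virtual_knots"
      unfolding virtual_knots_def knot_class_def by (rule quotientI[OF knot_in_diagrams])
    then show ?thesis using distinct_symmetries[OF that] by simp
  qed
  then have sub: "knot_class ` {2..} \<subseteq> ?S" by (intro image_subsetI) (simp only: atLeast_iff)
  have "inj_on knot_class {2..}"
  proof (rule inj_onI, rule ccontr)
    fix M N :: nat assume MN: "M \<in> {2..}" "N \<in> {2..}" "knot_class M = knot_class N" "M \<noteq> N"
    then have "profile (knot_class N) (index_writhe (knot_gauss M)) (\<lambda>S. nesting S (knot_gauss M))"
      using profile_knot_class[of M] by simp
    from signature_profile[OF this, of N] signature_profile[OF profile_knot_class, of N N]
    \<comment> \<open>The writhe of index N is 1 in the example for N and 0 in the one for M, where
      only the indices M and - M have nonzero writhe.\<close>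
    have "index_writhe (knot_gauss M) (int N) = index_writhe (knot_gauss N) (int N)" using MN by simp
    then show False using index_writhe_knot_gauss[of M "int N"] index_writhe_knot_gauss[of N "int N"] MN by simp
  qed
  then have "infinite (knot_class ` {2..})" using finite_imageD infinite_Ici by blast
  with sub show ?thesis by (rule infinite_super)
qed

end
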